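(* Let $\mathbb{F}_q$ be a finite field with $q$ elements and let $n$ be a positive integer. If there exists a non-exceptional permutation polynomial $f\in\mathbb{F}_q[x]$ of degree $n$ over $\mathbb{F}_q$, then \[ q+1\leqslant (n-2)(n-3)\frac{\lfloor 2\sqrt{q}\rfloor}{2}+2(n-1), \] and in particular \[ q\leqslant\left\lfloor\left(\frac{(n-2)(n-3)+\sqrt{(n-2)^2(n-3)^2+8n-12}}{2}\right)^2\right\rfloor . \]
   Context: A polynomial $f\in\mathbb{F}_q[x]$ is a permutation polynomial (PP) over a field $\mathbb{F}_{q^m}$ if the map $a\mapsto f(a)$ is a bijection of $\mathbb{F}_{q^m}$. A polynomial $f\in\mathbb{F}_q[x]$ is called exceptional over $\mathbb{F}_q$ if it is a PP over $\mathbb{F}_q$ and also a PP over $\mathbb{F}_{q^m}$ for infinitely many positive integers $m$. A non-exceptional PP over $\mathbb{F}_q$ is a PP over $\mathbb{F}_q$ that is not exceptional over $\mathbb{F}_q$. $\lfloor t\rfloor$ denotes the greatest integer $\leqslant t$. *)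

theory Defs
  imports "HOL-Computational_Algebra.Computational_Algebra" "HOL-Library.Cardinality" Complex_Main
begin

text \<open>The field F_q is the finite type 'a. The degree-m extension F_{q^m} is modelled
  concretely as F_q[x]/(g) for a monic irreducible g of degree m over F_q: its elements are
  the residues p with degree p < m (including 0), and evaluating f at the class of p gives the
  class of f(p(x)) mod g.\<close>

definition perm_poly_ext :: "'a::{finite,field} poly \<Rightarrow> nat \<Rightarrow> bool" where
  "perm_poly_ext f m \<longleftrightarrow>
     (\<exists>g::'a poly. irreducible g \<and> lead_coeff g = 1 \<and> degree g = m \<and>
        bij_betw (\<lambda>p. pcompose f p mod g) {p. degree p < m} {p. degree p < m})"

definition perm_poly :: "'a::{finite,field} poly \<Rightarrow> bool" where
  "perm_poly f \<longleftrightarrow> bij (poly f)"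

definition exceptional :: "'a::{finite,field} poly \<Rightarrow> bool" where
  "exceptional f \<longleftrightarrow> perm_poly f \<and> infinite {m. m > 0 \<and> perm_poly_ext f m}"

definition non_exceptional_pp :: "'a::{finite,field} poly \<Rightarrow> bool" where
  "non_exceptional_pp f \<longleftrightarrow> perm_poly f \<and> \<not> exceptional f"

end

(*
  Every irreducible factor of f(X) - f(Y) over the algebraic closure, other than the diagonal, is
  either moved by Frobenius or defined over F_q. If all of them are moved, the off-diagonal zeros of
  f(X) - f(Y) lie on the finitely many common points of conjugate factors, so f is injective on
  F_(q^m) for infinitely many m and f is exceptional. Otherwise some factor h defines an absolutely
  irreducible plane curve of degree d < n, and all its rational points are on the diagonal because f
  permutes F_q; counting with multiplicity, at most d places of degree one lie on the diagonal and at
  most d at infinity. Against this stands the Hasse-Weil-Serre bound q + 1 - g [2 sqrt q] for the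
  number of places of degree one, where g <= (d - 1)(d - 2)/2.

  The bound is proved from scratch: Riemann-Roch for lattices in F x F gives the functional equation
  of the zeta function, Stepanov's method gives N_r = q^r + O(q^(r/2)), and Serre's arithmetic-
  geometric mean argument for the traces of Frobenius yields the integer part.
*)
theory Submission
  imports "HOL-Algebra.Algebraic_Closure_Type" "HOL-Library.Function_Algebras" Defs
begin

section \<open>Ring homomorphisms and polynomials\<close>

hide_const (open) Polynomials.degree Polynomials.lead_coeff up_ring.monom up_ring.coeff

text \<open>The plane curve may be singular, so the coordinate rings of its two charts need not be
  Dedekind domains. Riemann-Roch is therefore proved for arbitrary lattices, starting from the rings
  of the plane model, whose cohomology is counted by monomials. The smooth model appears only as a
  maximal order above them, and enlarging the order can only lower the genus from (d - 1)(d - 2)/2.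
  Maximal orders exist because the Euler characteristic bounds their index, provided that every
  order has no constants beyond F_q; here absolute irreducibility enters, through points over all
  large extensions. The same point estimate supplies a divisor of degree one and confines the zeros
  of the L-polynomial; its constant never reaches the final bound, so it may be left crude. If f has
  zero derivative, it is a p-th power and is replaced by its p-th root; this guarantees a factor h
  with nonzero Y-derivative. Since d <= n - 1, the bound for the curve turns into the stated one,
  and the bound for q comes from the larger root of a quadratic inequality in sqrt q.\<close>

locale crhom =
 fixes h :: "'a::comm_ring_1 => 'b::comm_ring_1"
 assumes h_add: "h (x + y) = h x + h y" and h_mult: "h (x * y) = h x * h y" and h_1 [simp]: "h 1 = 1"
begin

lemma h_0 [simp]: "h 0 = 0"
 using h_add[of 0 0] by simp

lemma h_minus: "h (- x) = - h x"
 using h_add[of x "- x"] by (simp add: eq_neg_iff_add_eq_0 add.commute)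

lemma h_diff: "h (x - y) = h x - h y"
 using h_add[of x "- y"] by (simp add: h_minus)

lemma h_sum: "h (sum f A) = (SUM x:A. h (f x))"
 by (induction A rule: infinite_finite_induct) (simp_all add: h_add)

lemma h_power: "h (x ^ n) = h x ^ n"
 by (induction n) (simp_all add: h_mult)

lemma mp_add: "map_poly h (p + q) = map_poly h p + map_poly h q"
 by (rule poly_eqI) (simp add: coeff_map_poly h_add)

lemma mp_diff: "map_poly h (p - q) = map_poly h p - map_poly h q"
 by (rule poly_eqI) (simp add: coeff_map_poly h_diff)

lemma mp_smult: "map_poly h (smult c p) = smult (h c) (map_poly h p)"
 by (rule poly_eqI) (simp add: coeff_map_poly h_mult)

lemma mp_pCons: "map_poly h (pCons c p) = pCons (h c) (map_poly h p)"
 by (rule poly_eqI) (simp add: coeff_map_poly coeff_pCons split: nat.split)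

lemma mp_1 [simp]: "map_poly h 1 = 1"
 by (rule poly_eqI) (simp add: coeff_map_poly)

lemma mp_mult: "map_poly h (p * q) = map_poly h p * map_poly h q"
 by (induction p) (simp_all add: mp_pCons mp_add mp_smult)

lemma mp_sum: "map_poly h (sum f A) = (SUM x:A. map_poly h (f x))"
 by (induction A rule: infinite_finite_induct) (simp_all add: mp_add)

lemma mp_prod: "map_poly h (prod f A) = (PROD x:A. map_poly h (f x))"
 by (induction A rule: infinite_finite_induct) (simp_all add: mp_mult)

lemma mp_power: "map_poly h (p ^ n) = map_poly h p ^ n"
 by (induction n) (simp_all add: mp_mult)

lemma mp_eval: "poly (map_poly h p) (h x) = h (poly p x)"
 by (induction p) (simp_all add: mp_pCons h_add h_mult)

lemma mp_pcompose: "map_poly h (pcompose p q) = pcompose (map_poly h p) (map_poly h q)"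
 by (induction p) (simp_all add: pcompose_pCons mp_pCons mp_add mp_mult)

lemma crhom_map_poly: "crhom (map_poly h)"
 by unfold_locales (simp_all add: mp_add mp_mult)

lemma crhom_eval: "crhom (%p. poly (map_poly h p) y)"
 by unfold_locales (simp_all add: mp_add mp_mult)

end

lemma map_poly_pderiv:
 fixes h :: "'a::idom => 'b::idom"
 assumes "crhom h" shows "map_poly h (pderiv p) = pderiv (map_poly h p)"
proof (rule poly_eqI)
 interpret crhom h by fact
 fix n have "h (of_nat k) = of_nat k" for k by (induction k) (simp_all add: h_add)
 thus "coeff (map_poly h (pderiv p)) n = coeff (pderiv (map_poly h p)) n"
  by (simp add: coeff_map_poly coeff_pderiv h_mult del: of_nat_Suc)
qed

lemma crhom_comp: "crhom f ==> crhom g ==> crhom (%x. g (f x))"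
 by (simp add: crhom_def)

lemma crhom_of_int: "crhom (of_int :: int => 'a::comm_ring_1)"
 by unfold_locales simp_all

section \<open>Dimensions of quotients over a finite field\<close>

text \<open>The ambient \<open>'e\<close> is only a commutative ring, since it will be a ring of
  pairs of functions and so has zero divisors; \<open>emb\<close> makes it an algebra over the
  finite field.\<close>

locale fq_ring =
 fixes emb :: "'a::{finite,field} => 'e::comm_ring_1" and q :: nat
 assumes q_def: "q = CARD('a)" and emb_add: "emb (a + b) = emb a + emb b"
  and emb_mult: "emb (a * b) = emb a * emb b"
  and emb_1 [simp]: "emb 1 = 1"
begin

lemma q_gt_1: "q > 1"
proof -
 have "card {0, 1 :: 'a} <= q" unfolding q_def by (rule card_mono) auto
 thus ?thesis by simp
qed

lemma emb_0 [simp]: "emb 0 = 0"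
 using emb_add[of 0 0] by simp

lemma emb_minus: "emb (- a) = - emb a"
 using emb_add[of a "- a"] by (simp add: eq_neg_iff_add_eq_0 add.commute)

lemma emb_diff: "emb (a - b) = emb a - emb b"
 using emb_add[of a "- b"] by (simp add: emb_minus)

lemma emb_inv: "c ~= 0 ==> emb (inverse c) * emb c = 1"
 by (metis emb_1 emb_mult left_inverse)

lemma emb_eq_0_iff [simp]: "emb a = 0 \<longleftrightarrow> a = 0"
 by (metis emb_0 emb_inv mult_zero_right zero_neq_one)

lemma emb_eq_iff [simp]: "emb a = emb b \<longleftrightarrow> a = b"
 using emb_eq_0_iff[of "a - b"] by (simp add: emb_diff)

definition subspace :: "'e set => bool" where
 "subspace S \<longleftrightarrow> 0 : S & (ALL x:S. ALL y:S. x + y : S) & (ALL c. ALL x:S. emb c * x : S)"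

lemma subspaceI: "0 : S ==> (!!x y. x : S ==> y : S ==> x + y : S) ==> (!!c x. x : S ==> emb c * x : S) ==> subspace S"
 by (auto simp: subspace_def)

lemma ss_0: "subspace S ==> 0 : S"
 and ss_add: "subspace S ==> x : S ==> y : S ==> x + y : S"
 and ss_scale: "subspace S ==> x : S ==> emb c * x : S"
 by (auto simp: subspace_def)

lemma ss_neg: assumes "subspace S" "x : S" shows "- x : S"
 using ss_scale[OF assms, of "- 1"] by (simp add: emb_minus)

lemma ss_diff: "subspace S ==> x : S ==> y : S ==> x - y : S"
 using ss_add[of S x "- y"] ss_neg[of S y] by simp

lemma ss_sum: "subspace S ==> (!!i. i : I ==> f i : S) ==> sum f I : S"
 by (induction I rule: infinite_finite_induct) (auto simp: ss_0 ss_add)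

lemma ss_Int: "subspace S ==> subspace T ==> subspace (S Int T)"
 by (auto simp: subspace_def)

lemma ss_zero: "subspace {0}"
 by (auto simp: subspace_def)

definition splus :: "'e set => 'e set => 'e set" where
 "splus S T = {s + t |s t. s : S & t : T}"

definition smul :: "'e => 'e set => 'e set" where
 "smul c S = (%x. c * x) ` S"

definition adj :: "'e set => 'e => 'e set" where
 "adj S x = {s + emb c * x |s c. s : S}"

lemma splus_memI: "s : S ==> t : T ==> s + t : splus S T"
 by (auto simp: splus_def)

lemma ss_splus:
 assumes S: "subspace S" and T: "subspace T" shows "subspace (splus S T)"
proof (rule subspaceI)
 show "0 : splus S T" using ss_0[OF S] ss_0[OF T] unfolding splus_def by force
next
 fix x y assume "x : splus S T" "y : splus S T"
 then obtain s t s' t' where "x = s + t" "y = s' + t'" and m: "s : S" "t : T" "s' : S" "t' : T"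
  unfolding splus_def by blast
 hence "x + y = (s + s') + (t + t')" by simp
 thus "x + y : splus S T" using m ss_add[OF S] ss_add[OF T] by (metis splus_memI)
next
 fix c x assume "x : splus S T"
 then obtain s t where "x = s + t" and m: "s : S" "t : T" unfolding splus_def by blast
 hence "emb c * x = emb c * s + emb c * t" by (simp add: distrib_left)
 thus "emb c * x : splus S T" using m ss_scale[OF S] ss_scale[OF T] by (metis splus_memI)
qed

lemma splus_upper1: "subspace T ==> S <= splus S T"
 unfolding splus_def using ss_0 by force

lemma splus_upper2: "subspace S ==> T <= splus S T"
 unfolding splus_def using ss_0 by force

lemma splus_least: "subspace U ==> S <= U ==> T <= U ==> splus S T <= U"
 unfolding splus_def using ss_add by blast

lemma splus_mono: "S <= S' ==> T <= T' ==> splus S T <= splus S' T'"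
 unfolding splus_def by blast

lemma ss_smul: "subspace S ==> subspace (smul c S)"
proof (rule subspaceI)
 assume S: "subspace S"
 show "0 : smul c S" unfolding smul_def using ss_0[OF S] by force
 show "x + y : smul c S" if "x : smul c S" "y : smul c S" for x y
  using that ss_add[OF S] unfolding smul_def by (auto simp: distrib_left[symmetric])
 show "emb a * x : smul c S" if "x : smul c S" for a x
  using that ss_scale[OF S] unfolding smul_def by (auto simp: mult.left_commute)
qed

lemma smul_smul: "smul c (smul d S) = smul (c * d) S"
 by (simp add: smul_def image_image mult.assoc)

lemma smul_one [simp]: "smul 1 S = S"
 by (simp add: smul_def)

lemma smul_mono: "S <= T ==> smul c S <= smul c T"
 by (auto simp: smul_def)

lemma smul_memI: "x : S ==> c * x : smul c S"
 by (auto simp: smul_def)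

lemma adj_eq: "adj S x = splus S (range (%c. emb c * x))"
 by (auto simp: adj_def splus_def)

lemma ss_line: "subspace (range (%c. emb c * x))"
proof (rule subspaceI)
 show "0 : range (%c. emb c * x)" by (rule range_eqI[of _ _ 0]) simp
 show "y + z : range (%c. emb c * x)" if yz: "y : range (%c. emb c * x)" "z : range (%c. emb c * x)" for y z
 proof -
  obtain a b where "y = emb a * x" "z = emb b * x" using yz by blast
  thus ?thesis by (intro range_eqI[of _ _ "a + b"]) (simp add: emb_add distrib_right)
 qed
 show "emb a * y : range (%c. emb c * x)" if y: "y : range (%c. emb c * x)" for a y
 proof -
  obtain b where "y = emb b * x" using y by blast
  thus ?thesis by (intro range_eqI[of _ _ "a * b"]) (simp add: emb_mult mult.assoc)
 qed
qed

lemma ss_adj: "subspace S ==> subspace (adj S x)"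
 unfolding adj_eq by (intro ss_splus ss_line)

lemma adj_upper: "S <= adj S x"
 unfolding adj_def by (force intro: exI[of _ "0::'a"])

lemma adj_self: "subspace S ==> x : adj S x"
 unfolding adj_def using ss_0 by (force intro: exI[of _ "1::'a"])

lemma adj_least: "subspace U ==> S <= U ==> x : U ==> adj S x <= U"
 unfolding adj_def using ss_add ss_scale by blast

section \<open>Cosets, indices and dimensions of quotients\<close>

definition quo :: "'e set => 'e set => 'e set set" where
 "quo A B = (%x. (%b. x + b) ` B) ` A"

definition fin :: "'e set => 'e set => bool" where
 "fin A B \<longleftrightarrow> finite (quo A B)"

definition idx :: "'e set => 'e set => nat" where
 "idx A B = card (quo A B)"

lemma coset_eq_iff:
 assumes "subspace B"
 shows "(%b. x + b) ` B = (%b. y + b) ` B \<longleftrightarrow> x - y : B"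
proof
 assume eq: "(%b. x + b) ` B = (%b. y + b) ` B"
 have "x : (%b. x + b) ` B" using ss_0[OF assms] by force
 then obtain b where "b : B" "x = y + b" unfolding eq by blast
 thus "x - y : B" by simp
next
 have *: "(%b. x + b) ` B <= (%b. y + b) ` B" if "x - y : B" for x y
 proof
  fix z assume "z : (%b. x + b) ` B"
  then obtain b where "b : B" "z = y + ((x - y) + b)" by auto
  thus "z : (%b. y + b) ` B" using ss_add[OF assms that] by blast
 qed
 assume "x - y : B"
 moreover have "y - x : B" using ss_neg[OF assms \<open>x - y \<in> B\<close>] by simp
 ultimately show "(%b. x + b) ` B = (%b. y + b) ` B" using * by blast
qed

text \<open>A map whose fibres on \<open>A\<close> are the cosets of \<open>B\<close> identifies the
  quotient with its image. All indices below are computed by choosing such a map.\<close>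

lemma quo_via:
 assumes "subspace B" and "!!x y. x : A ==> y : A ==> f x = f y \<longleftrightarrow> x - y : B"
 shows "bij_betw (%C. f (SOME x. x : A & (%b. x + b) ` B = C)) (quo A B) (f ` A)"
proof -
 define c where "c x = (%b. x + b) ` B" for x
 define r where "r C = (SOME x. x : A & c x = C)" for C
 have s: "r C : A" "c (r C) = C" if "C : quo A B" for C
 proof -
  have "EX x. x : A & c x = C" using that unfolding quo_def c_def by blast
  from someI_ex[OF this] show "r C : A" "c (r C) = C" unfolding r_def by blast+
 qed
 have k: "f (r (c x)) = f x" if "x : A" for x
 proof -
  have m: "c x : quo A B" using that by (auto simp: quo_def c_def)
  have "r (c x) - x : B" using s(2)[OF m] coset_eq_iff[OF assms(1)] unfolding c_def by blast
  thus ?thesis using assms(2)[OF s(1)[OF m] that] by blast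
 qed
 have "bij_betw (%C. f (r C)) (quo A B) (f ` A)"
 proof (rule bij_betw_imageI)
  show "inj_on (%C. f (r C)) (quo A B)"
  proof (rule inj_onI)
   fix C C' assume C: "C : quo A B" "C' : quo A B" and "f (r C) = f (r C')"
   hence "r C - r C' : B" using assms(2)[OF s(1) s(1)] by blast
   hence "c (r C) = c (r C')" using coset_eq_iff[OF assms(1)] unfolding c_def by blast
   thus "C = C'" using s(2) C by simp
  qed
  have "(%C. f (r C)) ` quo A B = (%x. f (r (c x))) ` A"
   unfolding quo_def image_image c_def by simp
  also have "... = f ` A" using k by (intro image_cong) auto
  finally show "(%C. f (r C)) ` quo A B = f ` A" .
 qed
 thus ?thesis unfolding r_def c_def .
qed

lemma idx_via:
 assumes "subspace B" and "!!x y. x : A ==> y : A ==> f x = f y \<longleftrightarrow> x - y : B"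
 shows "idx A B = card (f ` A)" "fin A B \<longleftrightarrow> finite (f ` A)"
 using bij_betw_same_card[OF quo_via[OF assms]] bij_betw_finite[OF quo_via[OF assms]]
 by (auto simp: idx_def fin_def)

lemma fin_tower:
 assumes "subspace C" "subspace B" "C <= B" "B <= A" "subspace A"
 shows "fin A C \<longleftrightarrow> fin A B & fin B C" "fin A C ==> idx A C = idx A B * idx B C"
proof -
 let ?c = "%B x. (%b. x + b) ` B"
 obtain r where r: "!!x. x : A ==> r x : A & x - r x : B" and r': "!!x y. x : A ==> y : A ==> x - y : B ==> r x = r y"
 proof
  let ?r = "%x. SOME y. y : A & ?c B y = ?c B x"
  have *: "?r x : A & ?c B (?r x) = ?c B x" if "x : A" for x
   by (rule someI_ex[of "%y. y : A & ?c B y = ?c B x"]) (use that in auto)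
  show "?r x : A & x - ?r x : B" if "x : A" for x
   using *[OF that] coset_eq_iff[OF assms(2), of x "?r x"] by auto
  show "?r x = ?r y" if "x : A" "y : A" "x - y : B" for x y
   using that coset_eq_iff[OF assms(2), of x y] by simp
 qed
 \<comment> \<open>Since \<open>r\<close> is constant on cosets of \<open>B\<close>, this pair
   determines \<open>x\<close> exactly modulo \<open>C\<close>, and its image is a full product;
   hence indices multiply.\<close>
 let ?f = "%x. (r x, ?c C (x - r x))"
 have f: "?f x = ?f y \<longleftrightarrow> x - y : C" if xy: "x : A" "y : A" for x y
  using coset_eq_iff assms r' xy by auto
 have g: "r x = r y \<longleftrightarrow> x - y : B" if xy: "x : A" "y : A" for x y
 proof
  assume "r x = r y"
  moreover have "(x - r x) - (y - r y) : B" using r xy ss_diff[OF assms(2)] by blast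
  ultimately show "x - y : B" by simp
 qed (rule r'[OF xy])
 have rr: "r (r x + b) = r x" if "x : A" "b : B" for x b
 proof -
  have "r x + b : A" using that r assms ss_add by blast
  moreover have "(r x + b) - x : B" using ss_diff[OF assms(2) that(2)] r[OF that(1)] by (metis diff_diff_eq2 add.commute)
  ultimately show ?thesis using r' that by blast
 qed
 have im: "?f ` A = r ` A \<times> quo B C"
 proof (intro equalityI subsetI)
  fix z assume "z : ?f ` A" thus "z : r ` A \<times> quo B C" using r by (auto simp: quo_def)
 next
  fix z assume "z : r ` A \<times> quo B C"
  then obtain x b where z: "x : A" "b : B" "z = (r x, ?c C b)" by (auto simp: quo_def)
  have "r x + b : A" using z r assms ss_add by blast
  moreover have "?f (r x + b) = z" using rr[OF z(1,2)] z by simp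
  ultimately show "z : ?f ` A" by force
 qed
 have F: "idx A C = card (r ` A \<times> quo B C)" "fin A C \<longleftrightarrow> finite (r ` A \<times> quo B C)"
  using idx_via[OF assms(1), of A ?f, OF f] unfolding im by blast+
 have G: "idx A B = card (r ` A)" "fin A B \<longleftrightarrow> finite (r ` A)"
  using idx_via[OF assms(2), of A r, OF g] by blast+
 have ne: "r ` A ~= {}" "quo B C ~= {}"
  using ss_0[OF assms(5)] ss_0[OF assms(2)] unfolding quo_def by blast+
 show "fin A C \<longleftrightarrow> fin A B & fin B C"
  using F(2) G(2) ne by (simp only: finite_cartesian_product_iff fin_def[of B C]) blast
 show "idx A C = idx A B * idx B C"
  using F(1) G(1) by (simp only: idx_def[of B C] card_cartesian_product)
qed

lemma fin_self: "subspace A ==> fin A A & idx A A = 1"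
proof -
 assume A: "subspace A"
 have im: "(%_. ()) ` A = {()}" using ss_0[OF A] by auto
 show ?thesis using idx_via[OF A, of A "%_. ()"] ss_diff[OF A] unfolding im by simp
qed

lemma idx_eq_1D:
 assumes "subspace A" "subspace B" "B <= A" "fin A B" "idx A B = 1" shows "A = B"
proof -
 obtain C where C: "quo A B = {C}" using assms(5) by (auto simp: idx_def card_1_singleton_iff)
 have "x : B" if "x : A" for x
 proof -
  have "(%b. x + b) ` B : quo A B" "(%b. 0 + b) ` B : quo A B" using that ss_0[OF assms(1)] unfolding quo_def by blast+
  thus ?thesis using C coset_eq_iff[OF assms(2), of x 0] by auto
 qed
 thus ?thesis using assms by blast
qed

lemma idx_adj:
 assumes S: "subspace S" and x: "x ~: S"
 shows "fin (adj S x) S" "idx (adj S x) S = q"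
proof -
 have u: "c = c'" if "s + emb c * x = s' + emb c' * x + t" "s : S" "s' : S" "t : S" for s s' t c c'
 proof (rule ccontr)
  assume ne: "c ~= c'"
  have "emb (c - c') * x = s' + t - s" using that(1) by (simp add: emb_diff algebra_simps)
  hence "emb (c - c') * x : S" using that S ss_add ss_diff by metis
  hence "emb (inverse (c - c')) * (emb (c - c') * x) : S" by (rule ss_scale[OF S])
  thus False using emb_inv[of "c - c'"] ne x by (simp add: mult.assoc[symmetric])
 qed
 define f where "f z = (SOME c. EX s:S. z = s + emb c * x)" for z
 have fz: "EX s:S. z = s + emb (f z) * x" if "z : adj S x" for z
  unfolding f_def by (rule someI_ex) (use that in \<open>auto simp: adj_def\<close>)
 have f: "f y = f z \<longleftrightarrow> y - z : S" if yz: "y : adj S x" "z : adj S x" for y z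
 proof -
  obtain s t where st: "s : S" "t : S" "y = s + emb (f y) * x" "z = t + emb (f z) * x" using fz yz by blast
  show ?thesis
  proof
   assume "f y = f z"
   hence "y - z = s - t" using st by (metis add_diff_cancel_right)
   thus "y - z : S" using st ss_diff[OF S] by simp
  next
   assume "y - z : S"
   thus "f y = f z" using u[of s "f y" t "f z" "y - z"] st by (metis add_diff_cancel_left' diff_add_cancel)
  qed
 qed
 have im: "f ` adj S x = UNIV"
 proof -
  have "c : f ` adj S x" for c
  proof -
   have m: "emb c * x : adj S x" unfolding adj_def using ss_0[OF S] by force
   obtain s where "s : S" "emb c * x = s + emb (f (emb c * x)) * x" using fz[OF m] by blast
   hence "f (emb c * x) = c" using u[of 0 c s "f (emb c * x)" 0] ss_0[OF S] by simp
   thus ?thesis using m by (metis imageI)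
  qed
  thus ?thesis by blast
 qed
 show "fin (adj S x) S" "idx (adj S x) S = q"
  using idx_via[OF S, of "adj S x" f, OF f] im by (auto simp: q_def)
qed

text \<open>Among the intermediate spaces satisfying \<open>P\<close>, one of least index in
  \<open>A\<close> must be \<open>A\<close> itself: adjoining one more vector would divide that
  index by \<open>q\<close>.\<close>

lemma fin_induct [consumes 4, case_names base step]:
 assumes A: "subspace A" and B: "subspace B" and "B <= A" and fin: "fin A B"
  and base: "P B"
  and step: "!!S x. subspace S ==> B <= S ==> S <= A ==> fin S B ==> x : A ==> x ~: S ==> P S ==> P (adj S x)"
 shows "P A"
proof -
 let ?T = "%S. subspace S & B <= S & S <= A & P S"
 obtain S where S: "?T S" and min: "!!S'. ?T S' ==> idx A S <= idx A S'"
  using ex_has_least_nat[of ?T B "idx A"] assms by auto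
 have "S = A"
 proof (rule ccontr)
  assume "S ~= A"
  then obtain x where x: "x : A" "x ~: S" using S by blast
  let ?S = "adj S x"
  have f: "fin A S" "fin S B" using fin_tower(1)[OF B, of S A] S fin A by auto
  have T: "?T ?S" using S x step[of S x] f ss_adj adj_upper adj_least[OF A] by blast
  have "idx A S = idx A ?S * idx ?S S"
   using fin_tower(2)[of S ?S A] S T f A adj_upper by blast
  hence *: "idx A S = idx A ?S * q" using idx_adj[of S x] S x by simp
  have "fin A ?S" using fin_tower(1)[of S ?S A] S T f A adj_upper by blast
  hence "idx A ?S > 0" unfolding fin_def idx_def quo_def using ss_0[OF A] by (auto simp: card_gt_0_iff)
  hence "idx A ?S < idx A S" using * q_gt_1 by (metis nat_mult_1_right nat_mult_less_cancel_disj)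
  thus False using min[OF T] by simp
 qed
 thus ?thesis using S by simp
qed

lemma idx_power:
 assumes "subspace A" "subspace B" "B <= A" "fin A B"
 shows "EX n. idx A B = q ^ n"
proof -
 have "B <= A & subspace A & fin A B & (EX n. idx A B = q ^ n)"
  using assms
 proof (induction rule: fin_induct)
  case base show ?case using fin_self[OF assms(2)] by (auto intro: exI[of _ 0] simp: assms)
 next
  case (step S x)
  then obtain n where n: "idx S B = q ^ n" by blast
  have s: "subspace (adj S x)" using ss_adj step by blast
  have f: "fin (adj S x) B" using fin_tower(1)[of B S "adj S x"] step s idx_adj[of S x] adj_upper assms by blast
  have "idx (adj S x) B = q * q ^ n"
   using fin_tower(2)[of B S "adj S x"] step s idx_adj[of S x] adj_upper assms f n by simp
  thus ?case using s f step adj_upper[of S x] by (auto intro: exI[of _ "Suc n"])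
 qed
 thus ?thesis by blast
qed

text \<open>The dimension of the quotient as the logarithm of its cardinality, so that no bases are
  needed. It is meaningful only under \<open>fin\<close>: an infinite quotient has
  \<open>idx\<close> 0, which is no power of \<open>q\<close>.\<close>

definition dm :: "'e set => 'e set => nat" where
 "dm A B = (THE n. idx A B = q ^ n)"

lemma dm_eqI: "idx A B = q ^ n ==> dm A B = n"
 unfolding dm_def using q_gt_1 by (intro the_equality) (auto simp: power_inject_exp)

lemma idx_dm: "subspace A ==> subspace B ==> B <= A ==> fin A B ==> idx A B = q ^ dm A B"
 using idx_power dm_eqI by blast

lemma dm_tower:
 assumes "subspace C" "subspace B" "C <= B" "B <= A" "subspace A" "fin A C"
 shows "dm A C = dm A B + dm B C"
proof (rule dm_eqI)
 have "fin A B" "fin B C" using fin_tower(1)[OF assms(1-5)] assms by auto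
 thus "idx A C = q ^ (dm A B + dm B C)"
  using fin_tower(2)[OF assms(1-6)] assms by (simp add: idx_dm power_add)
qed

lemma dm_self: "subspace A ==> dm A A = 0"
 using fin_self by (intro dm_eqI) auto

lemma dm_eq_0D: "subspace A ==> subspace B ==> B <= A ==> fin A B ==> dm A B = 0 ==> A = B"
 using idx_dm[of A B] idx_eq_1D by simp

lemma dm_adj: "subspace S ==> x ~: S ==> dm (adj S x) S = 1"
 using idx_adj by (intro dm_eqI) simp

lemma fin_mono: "fin A C ==> subspace A ==> subspace B ==> subspace C ==> subspace D ==> C <= D ==> D <= B ==> B <= A ==> fin B D"
 using fin_tower(1)[of C B A] fin_tower(1)[of C D B] by blast

text \<open>Stated for a triple, to make the modular law available.\<close>

lemma second_iso:
 assumes "subspace A" "subspace B" "subspace C" "C <= A"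
  and "!!a. a : A ==> a : B ==> a : C" and CB: "C <= B"
 shows "idx (splus A B) B = idx A C" "fin (splus A B) B \<longleftrightarrow> fin A C"
proof -
 let ?c = "%x. (%b. x + b) ` B"
 have im: "quo (splus A B) B = ?c ` A"
 proof (intro equalityI subsetI)
  fix z assume "z : quo (splus A B) B"
  then obtain a b where ab: "a : A" "b : B" "z = ?c (a + b)" by (auto simp: quo_def splus_def)
  moreover have "?c (a + b) = ?c a" using ab by (subst coset_eq_iff[OF assms(2)]) auto
  ultimately show "z : ?c ` A" by auto
 next
  fix z assume "z : ?c ` A" thus "z : quo (splus A B) B"
   unfolding quo_def using splus_upper1[OF assms(2), of A] by blast
 qed
 have "?c x = ?c y \<longleftrightarrow> x - y : C" if "x : A" "y : A" for x y
  using that coset_eq_iff[OF assms(2)] assms(5)[of "x - y"] ss_diff[OF assms(1)] CB by blast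
 from idx_via[OF assms(3), of A ?c, OF this] im
 show "idx (splus A B) B = idx A C" "fin (splus A B) B \<longleftrightarrow> fin A C"
  by (auto simp: idx_def fin_def)
qed

lemma idx_smul:
 assumes "subspace B" and inj: "!!x. x : A ==> c * x = 0 ==> x = 0" and "subspace A" "B <= A"
 shows "idx (smul c A) (smul c B) = idx A B" "fin (smul c A) (smul c B) \<longleftrightarrow> fin A B"
proof -
 let ?f = "%x. (%b. c * x + b) ` smul c B"
 have inj': "x = y" if "x : A" "y : A" "c * x = c * y" for x y
  using inj[of "x - y"] that ss_diff[OF assms(3)] by (simp add: algebra_simps)
 have f: "?f x = ?f y \<longleftrightarrow> x - y : B" if xy: "x : A" "y : A" for x y
 proof -
  have "?f x = ?f y \<longleftrightarrow> c * (x - y) : smul c B"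
   by (subst coset_eq_iff[OF ss_smul[OF assms(1)]]) (simp add: right_diff_distrib)
  also have "... \<longleftrightarrow> x - y : B"
   using inj' xy ss_diff[OF assms(3)] assms(4) unfolding smul_def by (auto simp: image_iff) (metis subsetD)
  finally show ?thesis .
 qed
 have "quo (smul c A) (smul c B) = ?f ` A" by (simp add: quo_def smul_def image_image)
 with idx_via[OF assms(1), of A ?f, OF f]
 show "idx (smul c A) (smul c B) = idx A B" "fin (smul c A) (smul c B) \<longleftrightarrow> fin A B"
  by (auto simp: idx_def fin_def)
qed

lemma dm_zero: "subspace A ==> idx A {0} = card A" "subspace A ==> fin A {0} \<longleftrightarrow> finite A"
 using idx_via[OF ss_zero, of A "%x. x"] by auto

lemma card_dm: "subspace A ==> finite A ==> card A = q ^ dm A {0}"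
 using idx_dm[OF _ ss_zero] dm_zero ss_0 by auto

end

section \<open>Riemann-Roch for lattices\<close>

text \<open>
 Instead of all places of a function field \<open>F\<close>, only two semilocal rings are used, one for the places
 over the affine line and one for the places over infinity. Below, \<open>E\<close> becomes \<open>F \<times> F\<close>, \<open>R\<close> the
 product of the two coordinate rings, \<open>Dl\<close> the diagonal, \<open>Dn\<close> a set of denominators, \<open>tau\<close> a sum of
 residues and \<open>om\<close> a differential. Lattices in \<open>E\<close> play the role of divisors.
\<close>

locale adele = fq_ring emb q
 for emb :: "'a::{finite,field} => 'e::comm_ring_1" and q :: nat +
 fixes E R Dl Dn :: "'e set" and tau :: "'e => 'a" and om :: 'e
 assumes E_ss: "subspace E" and E_1: "1 : E" and E_mult: "x : E ==> y : E ==> x * y : E"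
  and tau_add: "x : E ==> y : E ==> tau (x + y) = tau x + tau y"
  and tau_scale: "x : E ==> tau (emb a * x) = a * tau x"
  and tau_nondeg: "z : E ==> (!!x. x : E ==> tau (z * x) = 0) ==> z = 0"
  and R_ss: "subspace R" and R_E: "R <= E" and R_1: "1 : R" and R_mult: "x : R ==> y : R ==> x * y : R"
  and om_E: "om : E" and om_unit: "EX v:E. om * v = 1"
  and perp_R: "{z : E. ALL x:R. tau (z * x) = 0} = smul om R"
  and Dl_ss: "subspace Dl" and Dl_E: "Dl <= E" and Dl_1: "1 : Dl"
  and Dl_mult: "x : Dl ==> y : Dl ==> x * y : Dl"
  and Dl_inv: "z : Dl ==> z ~= 0 ==> EX w:Dl. z * w = 1" and tau_Dl: "z : Dl ==> tau z = 0"
  and Dn_R: "Dn <= R" and Dn_1: "1 : Dn" and Dn_mult: "x : Dn ==> y : Dn ==> x * y : Dn"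
  and Dn_inv: "c : Dn ==> EX v:E. c * v = 1" and Dn_abs: "e : E ==> EX c:Dn. c * e : R"
  and Dn_fin: "c : Dn ==> fin R (smul c R)"
  and fin_h0_R: "finite (R Int Dl)" and fin_h1_R: "fin E (splus R Dl)"
  and chi_R: "dm (R Int Dl) {0} + dm (smul om R Int Dl) {0} = dm E (splus R Dl) + dm E (splus (smul om R) Dl)"
begin

section \<open>Duality for the pairing given by \<open>tau\<close>\<close>

definition perp :: "'e set => 'e set" where
 "perp S = {z : E. ALL x:S. tau (z * x) = 0}"

lemma tau_0 [simp]: "tau 0 = 0"
 using tau_scale[of 0 0] ss_0[OF E_ss] by simp

lemma tau_diff: "x : E ==> y : E ==> tau (x - y) = tau x - tau y"
 using tau_add[of "x - y" y] ss_diff[OF E_ss, of x y] by simp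

lemma perp_E: "perp S <= E"
 by (auto simp: perp_def)

lemma perp_ss: "S <= E ==> subspace (perp S)"
 using subspaceI ss_0 E_ss ss_add tau_add E_mult ss_scale tau_scale by (fastforce simp: perp_def distrib_right subset_iff mult.assoc)

lemma perp_anti: "S <= T ==> perp T <= perp S"
 by (auto simp: perp_def)

lemma perp_perp: "S <= E ==> S <= perp (perp S)"
 by (auto simp: perp_def mult.commute)

lemma perp_E_zero: "perp E = {0}"
 using tau_nondeg ss_0[OF E_ss] by (auto simp: perp_def)

lemma smul_E: "c : E ==> S <= E ==> smul c S <= E"
 using E_mult by (auto simp: smul_def)

lemma smul_inv: "u * v = 1 ==> smul u (smul v S) = S" "u * v = 1 ==> smul v (smul u S) = S"
 by (simp_all add: smul_smul mult.commute)

lemma smul_le_iff: "u * v = 1 ==> smul u S <= T \<longleftrightarrow> S <= smul v T"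
 using smul_mono[of "smul u S" T v] smul_mono[of S "smul v T" u] by (auto simp: smul_inv)

lemma perp_smul:
 assumes "u : E" "v : E" "u * v = 1" "S <= E"
 shows "perp (smul u S) = smul v (perp S)"
proof (intro equalityI subsetI)
 fix z assume z: "z : perp (smul u S)"
 have "u * z : perp S" using z assms E_mult by (auto simp: perp_def smul_def mult.assoc mult.left_commute)
 hence "v * (u * z) : smul v (perp S)" by (rule smul_memI)
 thus "z : smul v (perp S)" using assms by (metis mult.assoc mult.commute mult_1)
next
 fix z assume "z : smul v (perp S)"
 then obtain y where y: "z = v * y" "y : perp S" by (auto simp: smul_def)
 have "z * (u * x) = y * x" for x
  using assms y by (metis (no_types, opaque_lifting) mult.assoc mult.commute mult_1)
 thus "z : perp (smul u S)" using y assms E_mult by (auto simp: perp_def smul_def)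
qed

text \<open>Biduality can fail for subspaces of the infinite-dimensional \<open>E\<close>. It holds
  for \<open>R\<close> because \<open>perp R\<close> is a multiple of \<open>R\<close> by a unit,
  and it passes to unit multiples and to finite extensions, hence to all lattices.\<close>

definition closed :: "'e set => bool" where
 "closed S \<longleftrightarrow> perp (perp S) = S"

lemma closed_smul:
 assumes "u : E" "v : E" "u * v = 1" "S <= E" "closed S"
 shows "closed (smul u S)"
 using assms perp_smul[of u v S] perp_smul[of v u "perp S"] perp_E unfolding closed_def by (simp add: mult.commute)

lemma closed_R: "closed R"
proof -
 obtain v where v: "v : E" "om * v = 1" using om_unit by blast
 have "perp R = smul om R" using perp_R by (simp add: perp_def)
 thus ?thesis unfolding closed_def using perp_smul[OF om_E v R_E] v by (simp add: smul_inv)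
qed

lemma perp_adj:
 assumes S: "subspace S" "S <= E" and "x : E"
 shows "perp (adj S x) = {z : perp S. tau (z * x) = 0}"
proof (intro equalityI subsetI)
 fix z assume z: "z : perp (adj S x)"
 thus "z : {z : perp S. tau (z * x) = 0}"
  using adj_upper[of S x] adj_self[OF S(1), of x] by (auto simp: perp_def)
next
 fix z assume z: "z : {z : perp S. tau (z * x) = 0}"
 hence zE: "z : E" by (simp add: perp_def)
 have "tau (z * (s + emb c * x)) = 0" if "s : S" for s c
 proof -
  have "z * (s + emb c * x) = z * s + emb c * (z * x)" by (simp add: algebra_simps)
  moreover have "z * s : E" "z * x : E" "emb c * (z * x) : E"
   using zE assms that E_mult ss_scale[OF E_ss] by auto
  ultimately show ?thesis using tau_add[of "z * s" "emb c * (z * x)"] tau_scale[of "z * x" c] z that by (simp add: perp_def)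
 qed
 thus "z : perp (adj S x)" using zE by (auto simp: perp_def adj_def)
qed

text \<open>Adjoining \<open>x\<close> cuts the dual by the single functional sending
  \<open>z\<close> to \<open>tau (z * x)\<close>. So the dual drops by at most one dimension, and by
  exactly one if \<open>S\<close> is closed, because then the functional is not zero on
  \<open>perp S\<close>.\<close>

lemma adj_dual:
 assumes S: "subspace S" "S <= E" and x: "x : E" "x ~: S"
 shows "fin (perp S) (perp (adj S x))" "dm (perp S) (perp (adj S x)) <= 1"
  "closed S ==> dm (perp S) (perp (adj S x)) = 1" "closed S ==> closed (adj S x)"
proof -
 let ?f = "%z. tau (z * x)"
 have sE: "adj S x <= E" using adj_least[OF E_ss] S x by blast
 note ssp = perp_ss[OF S(2)] and ssa = perp_ss[OF sE]
 have f: "?f y = ?f z \<longleftrightarrow> y - z : perp (adj S x)" if "y : perp S" "z : perp S" for y z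
 proof -
  have "y - z : perp S" "y * x : E" "z * x : E" using that ss_diff[OF ssp] E_mult x perp_E by blast+
  thus ?thesis unfolding perp_adj[OF S x(1)] by (auto simp: left_diff_distrib tau_diff)
 qed
 note I = idx_via[OF ssa, of "perp S" ?f, OF f]
 show fin: "fin (perp S) (perp (adj S x))" using I(2) by simp
 have sub: "perp (adj S x) <= perp S" by (rule perp_anti[OF adj_upper])
 have "q ^ dm (perp S) (perp (adj S x)) <= q ^ 1"
  using idx_dm[OF ssp ssa sub fin] I(1) card_mono[of UNIV "?f ` perp S"] by (simp add: q_def)
 thus "dm (perp S) (perp (adj S x)) <= 1" using q_gt_1 power_le_imp_le_exp by blast
 have sc: "?f (emb c * z) = c * ?f z" if "z : perp S" for c z
  using tau_scale[of "z * x" c] that perp_E x E_mult by (simp add: mult.assoc subset_iff)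
 assume cl: "closed S"
 hence "x ~: perp (perp S)" using x by (simp add: closed_def)
 then obtain z0 where z0: "z0 : perp S" "?f z0 ~= 0" using x by (auto simp: perp_def mult.commute)
 have "c : ?f ` perp S" for c
  using sc[OF z0(1), of "c / ?f z0"] z0 ss_scale[OF ssp z0(1)] by (auto simp: image_iff intro!: bexI[of _ "emb (c / ?f z0) * z0"])
 hence "?f ` perp S = UNIV" by blast
 thus "dm (perp S) (perp (adj S x)) = 1" using I(1) by (intro dm_eqI) (simp add: q_def)
 show "closed (adj S x)" unfolding closed_def
 proof (rule equalityI[OF _ perp_perp[OF sE]], rule subsetI)
  fix w assume w: "w : perp (perp (adj S x))"
  hence wE: "w : E" using perp_E by blast
  \<comment> \<open>Every element of \<open>perp S\<close> is a multiple of \<open>z0\<close> plus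
    an element of \<open>perp (adj S x)\<close>. With this \<open>c\<close>, the vector
    \<open>w - emb c * x\<close> is orthogonal to both and falls into
    \<open>perp (perp S) = S\<close>.\<close>
  define c where "c = tau (w * z0) / ?f z0"
  have "w - emb c * x : perp (perp S)" unfolding perp_def[of "perp S"]
  proof (intro CollectI conjI ballI)
   show "w - emb c * x : E" using wE x ss_diff[OF E_ss] ss_scale[OF E_ss] by blast
   fix z assume z: "z : perp S"
   define a where "a = ?f z / ?f z0"
   have zE: "z : E" "z0 : E" using z z0 perp_E by blast+
   have m: "z - emb a * z0 : perp S" using z z0 ss_diff[OF ssp] ss_scale[OF ssp] by blast
   have "?f (z - emb a * z0) = 0"
    using sc[OF z0(1), of a] zE x E_mult ss_scale[OF E_ss] z0(2)
    by (simp add: left_diff_distrib tau_diff a_def)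
   hence "z - emb a * z0 : perp (adj S x)" using m by (simp add: perp_adj[OF S x(1)])
   hence "tau (w * (z - emb a * z0)) = 0" using w by (simp add: perp_def)
   moreover have "w * (z - emb a * z0) = w * z - emb a * (w * z0)" by (simp add: algebra_simps)
   ultimately have "tau (w * z) = a * tau (w * z0)"
    using zE wE E_mult ss_scale[OF E_ss] by (simp add: tau_diff tau_scale)
   moreover have "(w - emb c * x) * z = w * z - emb c * (z * x)" by (simp add: algebra_simps)
   hence "tau ((w - emb c * x) * z) = tau (w * z) - c * ?f z"
    using zE wE x E_mult ss_scale[OF E_ss] by (simp add: tau_diff tau_scale)
   ultimately show "tau ((w - emb c * x) * z) = 0" by (simp add: a_def c_def)
  qed
  hence "w - emb c * x : S" using cl by (simp add: closed_def)
  moreover have "w = (w - emb c * x) + emb c * x" by simp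
  ultimately show "w : adj S x" unfolding adj_def by blast
 qed
qed

lemma dual_fin:
 assumes "subspace A" "subspace B" "B <= A" "A <= E" "fin A B"
 shows "fin (perp B) (perp A)" "dm (perp B) (perp A) <= dm A B"
  "closed B ==> dm (perp B) (perp A) = dm A B" "closed B ==> closed A"
proof -
 have BE: "B <= E" using assms by blast
 have "A <= E & fin (perp B) (perp A) & dm (perp B) (perp A) <= dm A B & (closed B --> dm (perp B) (perp A) = dm A B & closed A)"
  using assms(1,2,3,5)
 proof (induction rule: fin_induct)
  case base
  thus ?case using fin_self[OF perp_ss[OF BE]] dm_self[OF perp_ss[OF BE]] dm_self[OF assms(2)] BE by auto
 next
  case (step S x)
  have SE: "S <= E" and xE: "x : E" using step assms by blast+
  note ad = adj_dual[OF step(1) SE xE step(6)]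
  let ?S = "adj S x"
  have sS: "subspace ?S" "?S <= E" using ss_adj step adj_least[OF E_ss SE xE] by blast+
  have f: "fin (perp B) (perp ?S)"
   using fin_tower(1)[OF perp_ss[OF sS(2)] perp_ss[OF SE] perp_anti[OF adj_upper] perp_anti[OF step(2)] perp_ss[OF BE]] ad step by blast
  have d1: "dm (perp B) (perp ?S) = dm (perp B) (perp S) + dm (perp S) (perp ?S)"
   by (rule dm_tower[OF perp_ss[OF sS(2)] perp_ss[OF SE] perp_anti[OF adj_upper] perp_anti[OF step(2)] perp_ss[OF BE] f])
  have f2: "fin ?S B"
   using fin_tower(1)[OF assms(2) step(1,2) adj_upper sS(1)] idx_adj[OF step(1,6)] step by blast
  have d2: "dm ?S B = dm ?S S + dm S B"
   by (rule dm_tower[OF assms(2) step(1,2) adj_upper sS(1) f2])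
  show ?case using sS f d1 d2 ad step dm_adj[OF step(1,6)] by auto
 qed
 thus "fin (perp B) (perp A)" "dm (perp B) (perp A) <= dm A B"
  "closed B ==> dm (perp B) (perp A) = dm A B" "closed B ==> closed A" by blast+
qed

text \<open>No module structure over \<open>R\<close> is demanded, only commensurability with
  \<open>R\<close> through denominators from \<open>Dn\<close>; that is all the index computations
  use. Modules over the maximal order are singled out later as \<open>fr\<close>.\<close>

definition lattice :: "'e set => bool" where
 "lattice J \<longleftrightarrow> subspace J & J <= E & (EX c:Dn. smul c R <= J & smul c J <= R)"

lemma lat_ss: "lattice J ==> subspace J" and lat_E: "lattice J ==> J <= E"
 by (auto simp: lattice_def)

lemma Dn_E: "c : Dn ==> c : E"
 using Dn_R R_E by blast

lemma smul_R_R: "c : R ==> smul c R <= R"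
 using R_mult by (auto simp: smul_def)

lemma lattice_R: "lattice R"
 unfolding lattice_def using R_ss R_E Dn_1 by (auto intro!: bexI[of _ 1])

lemma smul_mult_le: "c : Dn ==> smul d S <= R ==> smul (c * d) S <= R"
 using smul_mono[of "smul d S" R c] smul_R_R[of c] Dn_R by (auto simp: smul_smul)

lemma smul_mult_ge: "c : Dn ==> smul d R <= S ==> smul (c * d) R <= S"
 using smul_mono[of "smul c R" R d] smul_R_R[of c] Dn_R by (auto simp: smul_smul mult.commute)

lemma lattice_between:
 assumes "lattice J1" "lattice J2" "subspace J" "J1 <= J" "J <= J2"
 shows "lattice J"
proof -
 obtain c d where cd: "c : Dn" "smul c R <= J1" "d : Dn" "smul d J2 <= R"
  using assms unfolding lattice_def by blast
 have "smul (d * c) R <= J" using smul_mult_ge[OF cd(3,2)] assms by blast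
 moreover have "smul (d * c) J <= R"
  using smul_mult_le[OF cd(1), of d J2] cd smul_mono[OF assms(5), of "d * c"] by (auto simp: mult.commute)
 ultimately show ?thesis unfolding lattice_def using assms lat_E[OF assms(2)] Dn_mult cd by blast
qed

lemma lattice_smul:
 assumes "lattice J" "u : E" "v : E" "u * v = 1" shows "lattice (smul u J)"
proof -
 obtain c where c: "c : Dn" "smul c R <= J" "smul c J <= R" using assms unfolding lattice_def by blast
 obtain d where d: "d : Dn" "d * u : R" using Dn_abs assms by blast
 obtain d' where d': "d' : Dn" "d' * v : R" using Dn_abs assms by blast
 let ?e = "(d * d') * c"
 have e: "?e : Dn" using c d d' Dn_mult by blast
 have "smul ?e R <= smul u J"
 proof -
  have "smul (d * (d' * v)) R <= R" using R_mult d d' Dn_R by (intro smul_R_R) blast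
  hence "smul (u * c) (smul (d * (d' * v)) R) <= smul (u * c) R" by (rule smul_mono)
  moreover have "smul (u * c) R <= smul u J" using smul_mono[OF c(2), of u] by (simp add: smul_smul)
  moreover have "u * c * (d * (d' * v)) = (u * v) * ?e" by simp
  ultimately show ?thesis using assms(4) by (simp add: smul_smul)
 qed
 moreover have "smul ?e (smul u J) <= R"
 proof -
  have "smul ?e (smul u J) = smul (d' * (d * u)) (smul c J)" by (simp add: smul_smul mult_ac)
  moreover have "smul (d' * (d * u)) (smul c J) <= smul (d' * (d * u)) R" by (rule smul_mono[OF c(3)])
  moreover have "smul (d' * (d * u)) R <= R" using R_mult d d' Dn_R by (intro smul_R_R) blast
  ultimately show ?thesis by blast
 qed
 ultimately show ?thesis unfolding lattice_def
  using e ss_smul lat_ss[OF assms(1)] smul_E[OF assms(2) lat_E[OF assms(1)]] by blast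
qed

lemma lattice_cR: "c : Dn ==> lattice (smul c R)"
 using Dn_inv[of c] lattice_smul[OF lattice_R Dn_E] by blast

lemma lattice_bounds:
 assumes "lattice J"
 obtains c v where "c : Dn" "v : E" "c * v = 1" "smul c R <= J" "J <= smul v R"
 by (metis assms lattice_def Dn_inv smul_le_iff)

lemma lattice_splus:
 assumes "lattice I" "lattice J" shows "lattice (splus I J)"
proof -
 obtain c v where c: "c : Dn" "v : E" "c * v = 1" "smul c R <= I" "I <= smul v R" using lattice_bounds[OF assms(1)] by blast
 obtain d w where d: "d : Dn" "w : E" "d * w = 1" "smul d R <= J" "J <= smul w R" using lattice_bounds[OF assms(2)] by blast
 have cd: "(c * d) * (v * w) = 1"
 proof -
  have "(c * d) * (v * w) = (c * v) * (d * w)" by simp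
  thus ?thesis using c d by simp
 qed
 have l: "lattice (smul (v * w) R)"
  by (rule lattice_smul[OF lattice_R E_mult[OF c(2) d(2)] E_mult[OF Dn_E[OF c(1)] Dn_E[OF d(1)]]]) (use cd in \<open>simp add: mult.commute\<close>)
 have "smul v R <= smul (v * w) R" if "w * d = 1" "d : Dn" for v w d
  using smul_mono[OF smul_R_R[of d], of "v * w"] that Dn_R by (auto simp: smul_smul mult.assoc)
 from this[of w d v] this[of v c w] have "I <= smul (v * w) R" "J <= smul (v * w) R"
  using c d by (auto simp: mult.commute)
 hence "splus I J <= smul (v * w) R" using splus_least[OF lat_ss[OF l]] by blast
 thus ?thesis using lattice_between[OF assms(1) l] ss_splus lat_ss assms splus_upper1 by blast
qed

lemma lattice_fin:
 assumes "lattice J" "lattice J'" "J <= J'" shows "fin J' J"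
proof -
 obtain c where c: "c : Dn" "smul c R <= J" using assms unfolding lattice_def by blast
 obtain d where d: "d : Dn" "smul d J' <= R" using assms unfolding lattice_def by blast
 obtain v where v: "v : E" "d * v = 1" using Dn_inv d by blast
 have le: "J' <= smul v R" using d smul_le_iff[OF v(2)] by blast
 have "smul v (smul (d * c) R) = smul c R" using smul_inv(2)[OF v(2), of "smul c R"] by (simp add: smul_smul)
 moreover have inj: "x = 0" if "v * x = 0" for x

 proof -
  have "d * v * x = d * (v * x)" by simp
  thus ?thesis using that v by simp
 qed
 have dcR: "smul (d * c) R <= R" using c d Dn_mult Dn_R by (intro smul_R_R) blast
 have "fin (smul v R) (smul v (smul (d * c) R))"
  by (subst idx_smul(2)[OF ss_smul[OF R_ss]]) (use inj R_ss Dn_fin[of "d * c"] dcR c d Dn_mult in blast)+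
 ultimately have "fin (smul v R) (smul c R)" by simp
 thus ?thesis
  using fin_mono[of "smul v R" "smul c R" J' J] ss_smul R_ss lat_ss assms le c by blast
qed

lemma lattice_closed:
 assumes "lattice J" shows "closed J"
 by (metis lattice_bounds assms closed_smul Dn_E R_E closed_R dual_fin lat_ss lat_E lattice_fin lattice_cR)

lemma lattice_perp:
 assumes "lattice J" shows "lattice (perp J)"
proof -
 obtain c v where c: "c : Dn" "v : E" "c * v = 1" "smul c R <= J" "J <= smul v R" using lattice_bounds[OF assms] by blast
 obtain w where w: "w : E" "om * w = 1" using om_unit by blast
 have pR: "perp R = smul om R" using perp_R by (simp add: perp_def)
 have cE: "c : E" using c Dn_E by blast
 have "lattice (smul om R)" by (rule lattice_smul[OF lattice_R om_E w])
 moreover have "perp (smul c R) = smul v (smul om R)" using perp_smul[OF cE c(2,3) R_E] pR by simp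
 moreover have "perp (smul v R) = smul c (smul om R)" using perp_smul[OF c(2) cE _ R_E] pR c by (simp add: mult.commute)
 ultimately have "lattice (perp (smul c R))" "lattice (perp (smul v R))"
  using lattice_smul[of "smul om R" v c] lattice_smul[of "smul om R" c v] c cE by (simp_all add: mult.commute)
 thus ?thesis
  using lattice_between[OF _ _ perp_ss[OF lat_E[OF assms]] perp_anti[OF c(5)] perp_anti[OF c(4)]] by blast
qed

lemma perp_perp_lat: "lattice J ==> perp (perp J) = J"
 using lattice_closed by (simp add: closed_def)

lemma dm_perp: "lattice I ==> lattice J ==> I <= J ==> dm (perp I) (perp J) = dm J I"
 using dual_fin(3)[of J I] lattice_closed lat_ss lat_E lattice_fin by blast

section \<open>Euler characteristic and Riemann-Roch\<close>

definition h0 :: "'e set => nat" where "h0 J = dm (J Int Dl) {0}"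
text \<open>The adelic form of cohomology: \<open>J Int Dl\<close> consists of the global sections
  of \<open>J\<close>, and the quotient of \<open>E\<close> by \<open>J + Dl\<close> is the first
  cohomology.\<close>

definition h1 :: "'e set => nat" where "h1 J = dm E (splus J Dl)"
definition chi :: "'e set => int" where "chi J = int (h0 J) - int (h1 J)"

lemma h_step:
 assumes "lattice I" "lattice J" "I <= J"
 shows "finite (J Int Dl) \<longleftrightarrow> finite (I Int Dl)"
  "fin E (splus I Dl) \<longleftrightarrow> fin E (splus J Dl)"
  "finite (I Int Dl) ==> fin E (splus I Dl) ==> chi J = chi I + int (dm J I)"
proof -
 note ss = lat_ss[OF assms(1)] lat_ss[OF assms(2)] Dl_ss
 let ?I = "I Int Dl" and ?J = "J Int Dl" and ?M = "splus I (J Int Dl)"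
 have sI: "subspace ?I" "subspace ?J" "subspace ?M" using ss ss_Int ss_splus by auto
 have MJ: "?M <= J" "I <= ?M" using splus_least[OF ss(2), of I ?J] assms splus_upper1[OF sI(2)] by auto
 have F: "fin J I" by (rule lattice_fin[OF assms])
 hence F2: "fin J ?M" "fin ?M I" using fin_tower(1)[OF ss(1) sI(3) MJ(2,1) ss(2)] by auto
 have i0: "idx ?M I = idx ?J ?I" "fin ?M I \<longleftrightarrow> fin ?J ?I"
 proof -
  have "splus ?J I = ?M" unfolding splus_def by (metis (no_types, opaque_lifting) add.commute)
  thus "idx ?M I = idx ?J ?I" "fin ?M I \<longleftrightarrow> fin ?J ?I"
   using second_iso[of ?J I ?I] sI ss assms(3) by auto
 qed
 have fin1: "fin ?J {0} \<longleftrightarrow> fin ?I {0}"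
  using fin_tower(1)[OF ss_zero sI(1) _ _ sI(2)] i0 F2 assms(3) ss_0[OF sI(1)] by auto
 thus *: "finite ?J \<longleftrightarrow> finite ?I" using dm_zero sI by blast
 have sD: "subspace (splus I Dl)" "subspace (splus J Dl)" using ss_splus ss by auto
 have le: "splus I Dl <= splus J Dl" "splus J Dl <= E"
  using splus_mono assms(3) splus_least[OF E_ss lat_E[OF assms(2)] Dl_E] by auto
 have i1: "idx (splus J Dl) (splus I Dl) = idx J ?M" "fin (splus J Dl) (splus I Dl) \<longleftrightarrow> fin J ?M"
 proof -
  have "splus J (splus I Dl) = splus J Dl"
  proof (rule equalityI)
   show "splus J (splus I Dl) <= splus J Dl" by (intro splus_least[OF sD(2)] le(1) splus_upper1[OF Dl_ss])
   show "splus J Dl <= splus J (splus I Dl)" by (intro splus_mono order_refl splus_upper2[OF ss(1)])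
  qed
  moreover have "a : ?M" if a: "a : J" "a : splus I Dl" for a
  proof -
   obtain i d where "i : I" "d : Dl" "a = i + d" using a(2) by (auto simp: splus_def)
   moreover have "d : J" using calculation a(1) ss_diff[OF ss(2), of a i] assms(3) by auto
   ultimately show ?thesis by (auto simp: splus_def)
  qed
  moreover have "?M <= splus I Dl" by (intro splus_mono) auto
  ultimately show "idx (splus J Dl) (splus I Dl) = idx J ?M" "fin (splus J Dl) (splus I Dl) \<longleftrightarrow> fin J ?M"
   using second_iso[of J "splus I Dl" ?M] ss sD sI MJ by auto
 qed
 show **: "fin E (splus I Dl) \<longleftrightarrow> fin E (splus J Dl)"
  using fin_tower(1)[OF sD le E_ss] i1 F2 by blast
 assume f: "finite ?I" "fin E (splus I Dl)"
 have "dm ?J {0} = dm ?J ?I + dm ?I {0}"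
  using dm_tower[OF ss_zero sI(1) _ _ sI(2)] f(1) * sI dm_zero assms(3) ss_0[OF sI(1)] by auto
 moreover have "dm E (splus I Dl) = dm E (splus J Dl) + dm (splus J Dl) (splus I Dl)"
  by (rule dm_tower[OF sD le E_ss f(2)])
 moreover have "dm J I = dm J ?M + dm ?M I" by (rule dm_tower[OF ss(1) sI(3) MJ(2,1) ss(2) F])
 ultimately show "chi J = chi I + int (dm J I)"
  using i0(1) i1(1) by (simp add: chi_def h0_def h1_def dm_def)
qed

lemma fin_h:
 assumes "lattice J" shows "finite (J Int Dl)" "fin E (splus J Dl)"
 using h_step[OF lattice_R lattice_splus[OF lattice_R assms] splus_upper1[OF lat_ss[OF assms]]]
  h_step[OF assms lattice_splus[OF lattice_R assms] splus_upper2[OF R_ss]] fin_h0_R fin_h1_R by blast+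

lemma chi_step: "lattice I ==> lattice J ==> I <= J ==> chi J = chi I + int (dm J I)"
 using h_step(3) fin_h by blast

lemma card_h0: "lattice J ==> card (J Int Dl) = q ^ h0 J"
 unfolding h0_def using card_dm[of "J Int Dl"] fin_h ss_Int lat_ss Dl_ss by blast

text \<open>As \<open>tau\<close> vanishes on \<open>Dl\<close>, sections of \<open>perp J\<close>
  annihilate \<open>J + Dl\<close>, whence \<open>h0 (perp J) <= h1 J\<close>, and likewise with the
  roles exchanged. The sum \<open>chi J + chi (perp J)\<close> is unchanged along inclusions of
  lattices, so comparison with \<open>R\<close> through \<open>R + J\<close> makes it zero; both
  inequalities are then equalities.\<close>

theorem riemann_roch:
 assumes "lattice J" shows "chi J = int (h0 J) - int (h0 (perp J))"
proof -
 have le: "h0 (perp J) <= h1 J" if J: "lattice J" for J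
 proof -
  let ?W = "splus J Dl"
  have W: "subspace ?W" "?W <= E" using ss_splus lat_ss Dl_ss J splus_least[OF E_ss lat_E[OF J] Dl_E] by auto
  have "perp J Int Dl <= perp ?W"
  proof
   fix z assume z: "z : perp J Int Dl"
   have "tau (z * (j + d)) = 0" if "j : J" "d : Dl" for j d
   proof -
    have "z * j : E" "z * d : E" using z that lat_E[OF J] Dl_E E_mult by blast+
    thus ?thesis using z that tau_add tau_Dl Dl_mult by (simp add: distrib_left perp_def)
   qed
   thus "z : perp ?W" using z by (auto simp: perp_def splus_def)
  qed
  moreover have f: "fin (perp ?W) {0}" "dm (perp ?W) {0} <= h1 J"
   using dual_fin(1,2)[OF E_ss W subset_refl] fin_h[OF J] perp_E_zero by (auto simp: h1_def)
  moreover have s: "subspace (perp J Int Dl)" "subspace (perp ?W)"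
   using perp_ss lat_E J W Dl_ss ss_Int by auto
  ultimately have "dm (perp ?W) {0} = dm (perp ?W) (perp J Int Dl) + dm (perp J Int Dl) {0}"
   using dm_tower[OF ss_zero s(1)] ss_0[OF s(1)] by auto
  thus ?thesis using f by (simp add: h0_def)
 qed
 have sum: "chi J + chi (perp J) = chi (splus R J) + chi (perp (splus R J))" if J: "lattice J" for J
  using chi_step[OF J lattice_splus[OF lattice_R J] splus_upper2[OF R_ss]]
   chi_step[OF lattice_perp[OF lattice_splus[OF lattice_R J]] lattice_perp[OF J] perp_anti[OF splus_upper2[OF R_ss]]]
   dm_perp[OF J lattice_splus[OF lattice_R J] splus_upper2[OF R_ss]] by simp
 have sum': "chi R + chi (perp R) = chi (splus R J) + chi (perp (splus R J))" if J: "lattice J" for J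
  using chi_step[OF lattice_R lattice_splus[OF lattice_R J] splus_upper1[OF lat_ss[OF J]]]
   chi_step[OF lattice_perp[OF lattice_splus[OF lattice_R J]] lattice_perp[OF lattice_R] perp_anti[OF splus_upper1[OF lat_ss[OF J]]]]
   dm_perp[OF lattice_R lattice_splus[OF lattice_R J] splus_upper1[OF lat_ss[OF J]]] by simp
 have "perp R = smul om R" using perp_R by (simp add: perp_def)
 hence "chi R + chi (perp R) = 0" using chi_R by (simp add: chi_def h0_def h1_def)
 hence "chi J + chi (perp J) = 0" using sum sum' assms by simp
 moreover have "h0 (perp J) <= h1 J" "h0 J <= h1 (perp J)"
  using le[OF assms] le[OF lattice_perp[OF assms]] perp_perp_lat[OF assms] by auto
 ultimately show ?thesis by (simp add: chi_def)
qed

end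

section \<open>Ideals of a maximal order\<close>

context adele
begin

text \<open>The product of ideals. Taking the intersection makes \<open>pr_least\<close> the only
  rule needed, so finite sums of products never have to be written.\<close>

definition pr :: "'e set => 'e set => 'e set" where
 "pr I J = \<Inter>{S. subspace S & (ALL i:I. ALL j:J. i * j : S)}"

lemma pr_ss: "subspace (pr I J)"
 unfolding pr_def by (rule subspaceI) (auto simp: ss_0 ss_add ss_scale)

lemma pr_memI: "i : I ==> j : J ==> i * j : pr I J"
 by (auto simp: pr_def)

lemma pr_least: "subspace S ==> (!!i j. i : I ==> j : J ==> i * j : S) ==> pr I J <= S"
 by (auto simp: pr_def)

lemma pr_mono: "I <= I' ==> J <= J' ==> pr I J <= pr I' J'"
 by (rule pr_least[OF pr_ss]) (auto intro: pr_memI)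

lemma pr_comm: "pr I J = pr J I"
 by (rule equalityI; rule pr_least[OF pr_ss]; metis mult.commute pr_memI)

lemma ss_colon: "subspace S ==> subspace {x. ALL k:K. x * k : S}"
 by (rule subspaceI) (auto simp: ss_0 ss_add ss_scale distrib_right mult.assoc)

lemma pr_assoc_le: "pr (pr I J) K <= pr I (pr J K)"
proof (rule pr_least[OF pr_ss])
 have "pr I J <= {x. ALL k:K. x * k : pr I (pr J K)}"
  by (rule pr_least[OF ss_colon[OF pr_ss]]) (auto simp: mult.assoc intro: pr_memI)
 thus "x * k : pr I (pr J K)" if "x : pr I J" "k : K" for x k using that by blast
qed

lemma pr_assoc: "pr (pr I J) K = pr I (pr J K)"
 by (metis equalityI pr_assoc_le pr_comm)

lemma pr_lc: "pr I (pr J K) = pr J (pr I K)"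
 by (metis pr_assoc pr_comm)

lemma pr_E: "I <= E ==> J <= E ==> pr I J <= E"
 by (rule pr_least[OF E_ss]) (use E_mult in blast)

lemma Dn_mem: "smul c R <= I ==> c : I"
 using smul_memI[OF R_1, of c] by auto

lemma lattice_pr:
 assumes "lattice I" "lattice J" shows "lattice (pr I J)"
proof -
 obtain c where c: "c : Dn" "smul c R <= I" "smul c I <= R" using assms unfolding lattice_def by blast
 obtain d where d: "d : Dn" "smul d R <= J" "smul d J <= R" using assms unfolding lattice_def by blast
 have "c * d * r : pr I J" if "r : R" for r
  using pr_memI[of c I "d * r" J] Dn_mem[OF c(2)] d(2) that by (auto simp: smul_def mult.assoc)
 hence "smul (c * d) R <= pr I J" by (auto simp: smul_def)
 moreover have "pr I J <= {x. ALL k:{c * d}. x * k : R}"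
 proof (rule pr_least[OF ss_colon[OF R_ss]], clarsimp)
  fix i j assume "i : I" "j : J"
  hence "c * i : R" "d * j : R" using c(3) d(3) by (auto simp: smul_def)
  hence "(c * i) * (d * j) : R" by (rule R_mult)
  thus "i * j * (c * d) : R" by (simp only: mult_ac)
 qed
 hence "smul (c * d) (pr I J) <= R" by (auto simp: smul_def mult.commute)
 ultimately show ?thesis unfolding lattice_def
  using pr_ss pr_E lat_E assms Dn_mult[OF c(1) d(1)] by blast
qed

text \<open>Because \<open>tau (z * (i * j)) = tau ((z * i) * j)\<close>, duality exchanges products
  with ideal quotients. Invertibility of ideals is derived from this.\<close>

lemma perp_pr:
 assumes "I <= E" "J <= E" shows "perp (pr I J) = {z : E. ALL i:I. z * i : perp J}"
proof (intro equalityI subsetI)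
 fix z assume "z : perp (pr I J)"
 thus "z : {z : E. ALL i:I. z * i : perp J}"
  using assms E_mult by (auto simp: perp_def mult.assoc pr_memI)
next
 fix z assume z: "z : {z : E. ALL i:I. z * i : perp J}"
 have "subspace {x : E. tau (z * x) = 0}"
  using z ss_0[OF E_ss] ss_add[OF E_ss] ss_scale[OF E_ss] E_mult
  by (intro subspaceI) (auto simp: distrib_left tau_add mult.left_commute[of z] tau_scale)
 hence "pr I J <= {x : E. tau (z * x) = 0}"
  by (rule pr_least) (use z assms E_mult in \<open>auto simp: perp_def mult.assoc\<close>)
 thus "z : perp (pr I J)" using z by (auto simp: perp_def)
qed

definition order :: "'e set => bool" where
 "order S \<longleftrightarrow> lattice S & R <= S & (ALL x:S. ALL y:S. x * y : S)"

definition max_order :: "'e set => bool" where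
 "max_order S \<longleftrightarrow> order S & (ALL S'. order S' --> S <= S' --> S' = S)"

lemma order_R: "order R"
 using lattice_R R_mult by (auto simp: order_def)

text \<open>If an order \<open>S\<close> has only the constants as global sections, then
  \<open>h0 S = 1\<close> and \<open>dm S R = chi S - chi R <= 1 - chi R\<close>. The dimensions
  over \<open>R\<close> are thus bounded, and an order of largest dimension is maximal.\<close>

lemma max_order_exists:
 assumes "!!S. order S ==> S Int Dl = range emb"
 shows "EX S. max_order S"
proof -
 have h0: "h0 S = 1" if "order S" for S
 proof -
  have "card (range emb) = q" using card_image[of emb UNIV] by (auto simp: inj_on_def q_def)
  moreover have "lattice S" using that by (simp add: order_def)
  ultimately have "q ^ h0 S = q ^ 1" using card_h0[of S] assms[OF that] by simp
  thus ?thesis using power_inject_exp[OF q_gt_1] by blast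
 qed
 have "int (dm S R) <= 1 - chi R" if S: "order S" for S
  using chi_step[OF lattice_R, of S] S h0[OF S] by (simp add: order_def chi_def)
 hence bound: "ALL S. order S --> dm S R < Suc (nat (1 - chi R))" by fastforce
 obtain S where S: "order S" and max: "!!S'. order S' ==> dm S' R <= dm S R"
  using ex_has_greatest_nat[of order R "%S. dm S R" "Suc (nat (1 - chi R))", OF order_R bound] by blast
 have "S' = S" if S': "order S'" "S <= S'" for S'
 proof -
  have l: "lattice S" "lattice S'" "R <= S" "R <= S'" using S S' by (auto simp: order_def)
  have "dm S' R = dm S' S + dm S R"
   by (rule dm_tower[OF R_ss lat_ss[OF l(1)] l(3) S'(2) lat_ss[OF l(2)] lattice_fin[OF lattice_R l(2,4)]])
  hence "dm S' S = 0" using max[OF S'(1)] by simp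
  thus ?thesis using dm_eq_0D[OF lat_ss[OF l(2)] lat_ss[OF l(1)] S'(2) lattice_fin[OF l(1,2) S'(2)]] by simp
 qed
 thus ?thesis using S by (auto simp: max_order_def)
qed

end

locale dedekind = adele emb q E R Dl Dn tau om
 for emb :: "'a::{finite,field} => 'e::comm_ring_1" and q E R Dl Dn tau om +
 fixes Om :: "'e set"
 assumes max_Om: "max_order Om"
begin

lemma Om_lat: "lattice Om" and Om_R: "R <= Om" and Om_mult: "x : Om ==> y : Om ==> x * y : Om"
 and Om_max: "order S ==> Om <= S ==> S = Om"
 using max_Om by (auto simp: max_order_def order_def)

lemma Om_1: "1 : Om" using Om_R R_1 by blast

lemmas Om_ss = lat_ss[OF Om_lat] and Om_E = lat_E[OF Om_lat]

section \<open>Fractional ideals and their inverses\<close>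

definition fr :: "'e set => bool" where
 "fr I \<longleftrightarrow> lattice I & (ALL a:Om. ALL i:I. a * i : I)"

lemma fr_lat: "fr I ==> lattice I" and fr_mult: "fr I ==> a : Om ==> i : I ==> a * i : I"
 by (auto simp: fr_def)

lemma fr_ss: "fr I ==> subspace I" and fr_E: "fr I ==> I <= E"
 using fr_lat lat_ss lat_E by blast+

lemma fr_Om: "fr Om"
 using Om_lat Om_mult by (simp add: fr_def)

lemma fr_pr:
 assumes "fr I" "fr J" shows "fr (pr I J)"
proof -
 have *: "pr I J <= {x. ALL k:Om. x * k : pr I J}"
 proof (rule pr_least[OF ss_colon[OF pr_ss]], clarsimp)
  fix i j k assume "i : I" "j : J" "k : Om"
  hence "i * (k * j) : pr I J" using fr_mult[OF assms(2)] by (intro pr_memI) auto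
  thus "i * j * k : pr I J" by (simp only: mult_ac)
 qed
 have "a * i : pr I J" if "a : Om" "i : pr I J" for a i
  using subsetD[OF * that(2)] that(1) by (simp add: mult.commute)
 thus ?thesis unfolding fr_def using lattice_pr fr_lat assms by blast
qed

lemma fr_perp: assumes "fr I" shows "fr (perp I)"
 unfolding fr_def
proof (intro conjI ballI)
 show "lattice (perp I)" using lattice_perp fr_lat assms by blast
 fix a z assume "a : Om" "z : perp I"
 thus "a * z : perp I" using fr_mult[OF assms] Om_E E_mult
  by (auto simp: perp_def mult.assoc mult.left_commute[of a])
qed

lemma fr_splus: "fr I ==> fr J ==> fr (splus I J)"
 unfolding fr_def by (auto simp: lattice_splus) (auto simp: splus_def distrib_left, metis)

lemma fr_smul: "fr J ==> u : E ==> v : E ==> u * v = 1 ==> fr (smul u J)"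
 unfolding fr_def using lattice_smul by (auto simp: smul_def mult.left_commute[of _ u])

lemma pr_Om: assumes "fr I" shows "pr Om I = I" "pr I Om = I"
proof -
 have "pr Om I <= I" by (rule pr_least[OF fr_ss[OF assms]]) (use fr_mult[OF assms] in blast)
 moreover have "I <= pr Om I" using pr_memI[OF Om_1, of _ I] by auto
 ultimately show "pr Om I = I" by blast
 thus "pr I Om = I" by (simp add: pr_comm)
qed

text \<open>The multiplier ring of \<open>I\<close> is again an order, a lattice because it lies in
  a multiple of \<open>I\<close>, and it contains \<open>Om\<close>; maximality leaves no
  room.\<close>

lemma fr_End: assumes "fr I" shows "{z : E. ALL i:I. z * i : I} = Om"
proof (rule Om_max)
 let ?S = "{z : E. ALL i:I. z * i : I}"
 show "Om <= ?S" using fr_mult[OF assms] Om_E by blast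
 have ss: "subspace ?S"
  using ss_Int[OF E_ss ss_colon[OF fr_ss[OF assms], of I]] by (simp add: Int_def)
 obtain c v where c: "c : Dn" "v : E" "c * v = 1" "smul c R <= I" "I <= smul v R"
  using lattice_bounds[OF fr_lat[OF assms]] by blast
 have "z : smul v I" if "z : ?S" for z
 proof -
  have "z * c : I" using that Dn_mem[OF c(4)] by blast
  hence "v * (z * c) : smul v I" by (rule smul_memI)
  moreover have "v * (z * c) = z * (c * v)" by simp
  ultimately show ?thesis using c by simp
 qed
 hence "?S <= smul v I" by blast
 moreover have "lattice (smul v I)"
  using lattice_smul[OF fr_lat[OF assms] c(2) Dn_E[OF c(1)]] c(3) by (simp add: mult.commute)
 ultimately have "lattice ?S" using lattice_between[OF Om_lat _ ss \<open>Om \<subseteq> ?S\<close>] by blast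
 thus "order ?S" unfolding order_def using \<open>Om \<subseteq> ?S\<close> Om_R E_mult by (auto simp: mult.assoc)
qed

text \<open>Biduality of lattices makes every fractional ideal of the maximal order invertible up to the
 single ideal \<open>W = perp Om\<close>; Nakayama's lemma then removes \<open>W\<close>.\<close>

abbreviation "W == perp Om"

lemma fr_W: "fr W" by (rule fr_perp[OF fr_Om])

text \<open>By \<open>perp_pr\<close> and biduality the dual of the product is the multiplier ring
  of \<open>I\<close>, that is \<open>Om\<close>; dualise once more.\<close>

lemma pr_perp: assumes "fr I" shows "pr I (perp I) = W"
proof -
 have "perp (pr I (perp I)) = {z : E. ALL i:I. z * i : I}"
  using perp_pr[OF fr_E[OF assms] perp_E] perp_perp_lat[OF fr_lat[OF assms]] by simp
 hence "perp (pr I (perp I)) = Om" using fr_End[OF assms] by simp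
 thus ?thesis using perp_perp_lat[OF fr_lat[OF fr_pr[OF assms fr_perp[OF assms]]]] by simp
qed

primrec gen :: "'e list => 'e set" where
 "gen [] = {0}"
| "gen (w # ws) = splus (smul w Om) (gen ws)"

lemma gen_ss: "subspace (gen ws)"
 by (induction ws) (auto intro: ss_zero ss_splus ss_smul Om_ss)

lemma gen_mult: "a : Om ==> x : gen ws ==> a * x : gen ws"
proof (induction ws arbitrary: x)
 case (Cons w ws)
 then obtain o1 y where "o1 : Om" "y : gen ws" "x = w * o1 + y" by (auto simp: splus_def smul_def)
 thus ?case using Cons Om_mult[of a o1] splus_memI[OF smul_memI[of "a * o1" Om w] Cons.IH[of y]]
  by (simp add: distrib_left mult_ac)
qed auto

lemma finite_gen:
 assumes "fr I" obtains ws where "I = gen ws"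
proof -
 obtain c v where c: "c : Dn" "v : E" "c * v = 1" "smul c R <= I" "I <= smul v R"
  using lattice_bounds[OF fr_lat[OF assms]] by blast
 have fin: "fin I (smul c R)" by (rule lattice_fin[OF lattice_cR[OF c(1)] fr_lat[OF assms] c(4)])
 have "EX ws. set ws <= I & I <= gen ws"
  using fr_ss[OF assms] ss_smul[OF R_ss] c(4) fin
 proof (induction rule: fin_induct)
  case base
  have "smul c R <= gen [c]" using order_trans[OF smul_mono[OF Om_R, of c] splus_upper1[OF ss_zero]] by simp
  thus ?case using smul_memI[OF R_1, of c] by (intro exI[of _ "[c]"]) auto
 next
  case (step S x)
  then obtain ws where ws: "set ws <= S" "S <= gen ws" by blast
  have "adj S x <= gen (x # ws)"
  proof (rule adj_least[OF gen_ss])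
   show "S <= gen (x # ws)" using ws(2) splus_upper2[OF ss_smul[OF Om_ss]] by auto
   have "x * 1 : smul x Om" by (rule smul_memI[OF Om_1])
   thus "x : gen (x # ws)" using splus_upper1[OF gen_ss] by auto
  qed
  thus ?case using ws(1) adj_upper[of S x] adj_self[OF step(1), of x] by (intro exI[of _ "x # ws"]) auto
 qed
 then obtain ws where ws: "set ws <= I" "I <= gen ws" by blast
 have "gen ws <= I" using ws(1)
 proof (induction ws)
  case (Cons w ws)
  have "smul w Om <= I" using Cons fr_mult[OF assms] by (auto simp: smul_def mult.commute)
  thus ?case using Cons splus_least[OF fr_ss[OF assms]] by auto
 qed (use ss_0 fr_ss assms in auto)
 thus ?thesis using ws that by blast
qed

lemma nakayama:
 assumes Q: "fr Q" "Q <= Om" and V: "fr V" and VQ: "pr Q V = V" shows "Q = Om"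
proof -
 obtain ws where ws: "V = gen ws" by (rule finite_gen[OF V])
 \<comment> \<open>The determinant trick, one generator at a time: an element \<open>u\<close>
   congruent to 1 modulo \<open>Q\<close> carries \<open>V\<close> into the span of the remaining
   generators, and the next \<open>u' = (u - p) * u\<close> disposes of one more.\<close>
 have "EX u:Om. 1 - u : Q & (ALL x:V. u * x = 0)"
  if "EX u:Om. 1 - u : Q & (ALL x:V. u * x : gen ws)" "set ws <= V" for ws
  using that
 proof (induction ws)
  case (Cons w ws)
  then obtain u where u: "u : Om" "1 - u : Q" "!!x. x : V ==> u * x : gen (w # ws)" by blast
  let ?T = "splus (smul w Q) (gen ws)"
  have ssT: "subspace ?T" by (intro ss_splus ss_smul gen_ss fr_ss[OF Q(1)])
  have "pr Q V <= {x. ALL k:{u}. x * k : ?T}"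
  proof (rule pr_least[OF ss_colon[OF ssT]], clarsimp)
   fix p x assume p: "p : Q" and x: "x : V"
   obtain o1 y where y: "o1 : Om" "y : gen ws" "u * x = w * o1 + y"
    using u(3)[OF x] by (auto simp: splus_def smul_def)
   have "p * x * u = w * (o1 * p) + p * y" using y(3) by (metis distrib_left mult.commute mult.left_commute)
   thus "p * x * u : ?T" using splus_memI[OF smul_memI gen_mult] fr_mult[OF Q(1) y(1) p] y(2) p Q(2) by auto
  qed
  moreover have "w : V" using Cons by simp
  ultimately have "w * u : ?T" using VQ by blast
  then obtain p y where p: "p : Q" "y : gen ws" "w * u = w * p + y" by (auto simp: splus_def smul_def)
  define u' where "u' = (u - p) * u"
  have up: "u - p : Om" using u p Q ss_diff[OF Om_ss] by blast
  have wup: "(u - p) * w : gen ws" using p by (simp add: algebra_simps)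
  have "u' * x : gen ws" if x: "x : V" for x
  proof -
   obtain o1 z where z: "o1 : Om" "z : gen ws" "u * x = w * o1 + z"
    using u(3)[OF x] by (auto simp: splus_def smul_def)
   have "u' * x = (u - p) * (u * x)" by (simp add: u'_def)
   also have "... = o1 * ((u - p) * w) + (u - p) * z" unfolding z(3) by (simp add: algebra_simps)
   also have "... : gen ws" using ss_add[OF gen_ss] gen_mult z(1,2) wup up by blast
   finally show ?thesis .
  qed
  moreover have "u' : Om" unfolding u'_def using up u Om_mult by blast
  moreover have e: "1 - u' = (1 - u) + (u * (1 - u) + u * p)" by (simp add: u'_def algebra_simps)
  have "1 - u' : Q" unfolding e by (intro ss_add[OF fr_ss[OF Q(1)]] fr_mult[OF Q(1)] u(1,2) p(1))
  ultimately show ?case using Cons by auto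
 qed auto
 moreover have "set ws <= gen ws" for ws
 proof (induction ws)
  case (Cons w ws)
  have "w * 1 : smul w Om" by (rule smul_memI[OF Om_1])
  thus ?case using Cons splus_upper1[OF gen_ss, of "smul w Om" ws] splus_upper2[OF ss_smul[OF Om_ss], of "gen ws" w] by auto
 qed auto
 ultimately obtain u where u: "u : Om" "1 - u : Q" "!!x. x : V ==> u * x = 0"
  using ws Om_1 ss_0[OF fr_ss[OF Q(1)]] by (metis diff_self mult_1)
 obtain c v where c: "c : Dn" "v : E" "c * v = 1" "smul c R <= V" "V <= smul v R"
  using lattice_bounds[OF fr_lat[OF V]] by blast
 \<comment> \<open>\<open>V\<close> contains the unit \<open>c\<close> of \<open>E\<close>, so an
   element annihilating \<open>V\<close> is zero, and then \<open>1 - u : Q\<close> says that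
   \<open>Q\<close> contains 1.\<close>
 have "u * c = 0" using u(3) Dn_mem[OF c(4)] by blast
 hence "u * (c * v) = 0" by (simp add: mult.assoc[symmetric])
 hence "1 : Q" using u c by simp
 thus ?thesis using fr_mult[OF Q(1), of _ 1] Q(2) by auto
qed

text \<open>The ideal \<open>Xa\<close> is the quotient of \<open>Om\<close> by \<open>W\<close>.
  Applying \<open>pr_perp\<close> to the square of \<open>W\<close> shows that the integral ideal
  \<open>pr W Xa\<close> fixes \<open>W\<close>, so it is \<open>Om\<close> by Nakayama. Any
  \<open>I\<close> is then inverted by \<open>perp I\<close> times \<open>Xa\<close>.\<close>

lemma fr_inverse: assumes "fr I" shows "EX Y. fr Y & pr I Y = Om"
proof -
 define Xa where "Xa = perp (pr W W)"
 have Xa: "fr Xa" unfolding Xa_def by (intro fr_perp fr_pr fr_Om)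
 have "Xa = {z : E. ALL w:W. z * w : Om}"
  unfolding Xa_def using perp_pr[OF perp_E perp_E, of Om Om] perp_perp_lat[OF Om_lat] by simp
 hence "pr W Xa <= Om" by (intro pr_least[OF Om_ss]) (auto simp: mult.commute)
 moreover have "pr (pr W Xa) W = W"
  using pr_perp[OF fr_pr[OF fr_W fr_W]] unfolding Xa_def[symmetric] by (metis pr_assoc pr_comm)
 ultimately have "pr W Xa = Om" using nakayama[of "pr W Xa" W] fr_pr fr_W Xa by blast
 hence "pr I (pr (perp I) Xa) = Om" using pr_perp[OF assms] by (simp add: pr_assoc[symmetric])
 thus ?thesis using fr_pr fr_perp Xa assms by blast
qed

definition iv :: "'e set => 'e set" where "iv I = (SOME Y. fr Y & pr I Y = Om)"

lemma fr_iv: "fr I ==> fr (iv I)" and pr_iv: "fr I ==> pr I (iv I) = Om"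
 unfolding iv_def using someI_ex[OF fr_inverse] by blast+

lemma pr_iv': "fr I ==> pr (iv I) I = Om"
 using pr_iv pr_comm by metis

lemma pr_cancel_le: "fr I ==> fr J ==> fr K ==> pr I J <= pr I K \<longleftrightarrow> J <= K"
proof
 assume f: "fr I" "fr J" "fr K" and le: "pr I J <= pr I K"
 have "pr (iv I) (pr I J) <= pr (iv I) (pr I K)" by (rule pr_mono[OF subset_refl le])
 thus "J <= K" using f by (simp add: pr_assoc[symmetric] pr_iv' pr_Om)
qed (rule pr_mono[OF subset_refl])

lemma pr_cancel: "fr I ==> fr J ==> fr K ==> pr I J = pr I K \<longleftrightarrow> J = K"
 using pr_cancel_le[of I J K] pr_cancel_le[of I K J] by blast

lemma pr_iv_cancel: "fr I ==> fr J ==> pr I (pr J (iv I)) = J"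
 using pr_lc[of I J "iv I"] by (simp add: pr_iv pr_Om)

lemma iv_unique: "fr I ==> fr J ==> pr I J = Om ==> iv I = J"
 using pr_cancel[of I "iv I" J] fr_iv pr_iv by simp

lemma iv_iv: "fr I ==> iv (iv I) = I"
 using iv_unique[of "iv I" I] fr_iv pr_iv' by blast

section \<open>Maximal ideals as places, and the degree of an ideal\<close>

definition maxi :: "'e set => bool" where
 "maxi P \<longleftrightarrow> fr P & P <= Om & P ~= Om & (ALL I. fr I --> P <= I --> I <= Om --> I = P \<or> I = Om)"

lemma maxi_fr: "maxi P ==> fr P" and maxi_Om: "maxi P ==> P <= Om" and maxi_ne: "maxi P ==> P ~= Om"
 and maxi_max: "maxi P ==> fr I ==> P <= I ==> I <= Om ==> I = P \<or> I = Om"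
 by (auto simp: maxi_def)

lemma one_notin: "fr P ==> P <= Om ==> P ~= Om ==> 1 ~: P"
 using fr_mult[of P _ 1] by auto

lemma dm_fr: "fr I ==> fr J ==> fr K ==> I <= J ==> J <= K ==> dm K I = dm K J + dm J I"
 using dm_tower[OF fr_ss fr_ss _ _ fr_ss] lattice_fin[OF fr_lat fr_lat] by (meson order_trans)

lemma dm_fr_0: "fr I ==> fr J ==> I <= J ==> dm J I = 0 ==> I = J"
 using dm_eq_0D[OF fr_ss fr_ss] lattice_fin[OF fr_lat fr_lat] by metis

lemma maxi_exists:
 assumes "fr I" "I <= Om" "I ~= Om" shows "EX P. maxi P & I <= P"
proof -
 let ?T = "%J. fr J & I <= J & J <= Om & J ~= Om"
 obtain P where P: "?T P" and min: "!!J. ?T J ==> dm Om P <= dm Om J"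
  using ex_has_least_nat[of ?T I "dm Om"] assms by auto
 have "J = P \<or> J = Om" if J: "fr J" "P <= J" "J <= Om" for J
 proof (rule ccontr)
  assume n: "~ (J = P \<or> J = Om)"
  hence "?T J" using P J by blast
  hence "dm Om P <= dm Om J" by (rule min)
  hence "dm J P = 0" using dm_fr[of P J Om] P J fr_Om by simp
  thus False using dm_fr_0[of P J] P J n by blast
 qed
 thus ?thesis using P unfolding maxi_def by blast
qed

text \<open>The quotient of \<open>J\<close> by \<open>P J\<close> is one-dimensional over the
  residue field of \<open>P\<close>: multiplication by \<open>iv J\<close> shows that no ideal lies
  strictly between, so any \<open>z\<close> in \<open>J\<close> outside \<open>P J\<close>
  generates, and multiplication by \<open>z\<close> induces an isomorphism from the residue
  field.\<close>

lemma dm_maxi: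
 assumes P: "maxi P" and J: "fr J" shows "dm J (pr P J) = dm Om P"
proof -
 note fP = maxi_fr[OF P]
 have fPJ: "fr (pr P J)" using fr_pr fP J by blast
 have le: "pr P J <= J" using pr_mono[OF maxi_Om[OF P] subset_refl, of J] pr_Om[OF J] by simp
 have "pr P J ~= J" using pr_cancel[of J P Om] J fP fr_Om maxi_ne[OF P] by (simp add: pr_comm pr_Om)
 then obtain z where z: "z : J" "z ~: pr P J" using le by blast
 let ?K = "splus (smul z Om) (pr P J)"
 have ssK: "subspace ?K" by (intro ss_splus ss_smul Om_ss fr_ss[OF fPJ])
 have zJ: "smul z Om <= J" using z fr_mult[OF J] by (auto simp: smul_def mult.commute)
 have K: "pr P J <= ?K" "?K <= J"
  using splus_upper2[OF ss_smul[OF Om_ss]] splus_least[OF fr_ss[OF J] zJ le] by auto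
 have "lattice ?K" using lattice_between[OF fr_lat[OF fPJ] fr_lat[OF J] ssK K] .
 moreover have "a * x : ?K" if ax: "a : Om" "x : ?K" for a x
 proof -
  obtain b y where "b : Om" "y : pr P J" "x = z * b + y" using ax(2) unfolding splus_def smul_def by blast
  moreover from this have "a * x = z * (a * b) + a * y" by (simp add: algebra_simps)
  ultimately show ?thesis using splus_memI[OF smul_memI[OF Om_mult[OF ax(1)]] fr_mult[OF fPJ ax(1)]] by metis
 qed
 ultimately have fK: "fr ?K" by (simp add: fr_def)
 have zK: "z : ?K" using splus_upper1[OF fr_ss[OF fPJ]] smul_memI[OF Om_1, of z] by auto
 have "P <= pr ?K (iv J)"
  using pr_mono[OF K(1) subset_refl, of "iv J"] pr_iv[OF J] pr_Om[OF fP] by (simp add: pr_assoc)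
 moreover have "pr ?K (iv J) <= Om" using pr_mono[OF K(2) subset_refl, of "iv J"] pr_iv[OF J] by simp
 ultimately have "pr ?K (iv J) = P \<or> pr ?K (iv J) = Om" using maxi_max[OF P fr_pr[OF fK fr_iv[OF J]]] by blast
 moreover have KJ: "pr (pr ?K (iv J)) J = ?K" using pr_iv'[OF J] pr_Om[OF fK] by (simp add: pr_assoc)
 ultimately have "?K = pr P J \<or> ?K = J" using pr_Om[OF J] by metis
 hence KJ: "?K = J" using zK z by blast
 let ?c = "%x. (%b. x + b) ` pr P J"
 \<comment> \<open>The kernel of multiplication by \<open>z\<close> into the quotient is an ideal
   containing \<open>P\<close> but not 1, hence equals \<open>P\<close>.\<close>
 let ?P = "{a : Om. z * a : pr P J}"
 have fP': "fr ?P"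
 proof -
  have PP: "P <= ?P" using z maxi_Om[OF P] pr_memI[of _ P z J] by (auto simp: mult.commute)
  have s: "subspace ?P"
  proof (rule subspaceI)
   show "0 : ?P" using ss_0[OF Om_ss] ss_0[OF fr_ss[OF fPJ]] by simp
   show "x + y : ?P" if "x : ?P" "y : ?P" for x y
    using that ss_add[OF Om_ss] ss_add[OF fr_ss[OF fPJ]] by (simp add: distrib_left)
   show "emb c * x : ?P" if "x : ?P" for c x
    using that ss_scale[OF Om_ss, of x c] ss_scale[OF fr_ss[OF fPJ], of "z * x" c] by (simp add: mult.left_commute)
  qed
  have "lattice ?P" by (rule lattice_between[OF fr_lat[OF fP] Om_lat s PP]) auto
  thus ?thesis unfolding fr_def using Om_mult fr_mult[OF fPJ] by (auto simp: mult.left_commute)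
 qed
 have "1 ~: ?P" using z by simp
 moreover have "P <= ?P" using z maxi_Om[OF P] pr_memI[of _ P z J] by (auto simp: mult.commute)
 ultimately have PP: "?P = P" using maxi_max[OF P fP'] Om_1 by blast
 have f: "?c (z * x) = ?c (z * y) \<longleftrightarrow> x - y : P" if "x : Om" "y : Om" for x y
  using that coset_eq_iff[OF fr_ss[OF fPJ], of "z * x" "z * y"] PP ss_diff[OF Om_ss]
  by (auto simp: right_diff_distrib[symmetric])
 have "idx Om P = card ((%x. ?c (z * x)) ` Om)" using idx_via(1)[OF fr_ss[OF fP] f] .
 also have "(%x. ?c (z * x)) ` Om = quo J (pr P J)"
 proof -
  have "quo J (pr P J) = quo ?K (pr P J)" using KJ by simp
  also have "... = (%x. ?c (z * x)) ` Om"
  proof (intro equalityI subsetI)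
   fix C assume "C : quo ?K (pr P J)"
   then obtain a y where a: "a : Om" "y : pr P J" "C = ?c (z * a + y)" by (auto simp: quo_def splus_def smul_def)
   moreover have "?c (z * a + y) = ?c (z * a)" using a coset_eq_iff[OF fr_ss[OF fPJ]] by simp
   ultimately show "C : (%x. ?c (z * x)) ` Om" by blast
  next
   fix C assume "C : (%x. ?c (z * x)) ` Om"
   thus "C : quo ?K (pr P J)" using splus_upper1[OF fr_ss[OF fPJ], of "smul z Om"] unfolding quo_def smul_def by blast
  qed
  finally show ?thesis by simp
 qed
 finally show ?thesis by (simp add: dm_def idx_def)
qed

text \<open>The sign is such that larger ideals have larger degree; an integral ideal has degree
  minus its codimension in \<open>Om\<close>.\<close>

definition dg :: "'e set => int" where "dg I = chi I - chi Om"

lemma dg_Om [simp]: "dg Om = 0" by (simp add: dg_def)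

lemma dg_step: "fr I ==> fr J ==> I <= J ==> dg J = dg I + int (dm J I)"
 using chi_step[OF fr_lat fr_lat, of I J] by (simp add: dg_def)

lemma dg_ideal: "fr I ==> I <= Om ==> dg I = - int (dm Om I)"
 using dg_step[of I Om] fr_Om by simp

lemma dm_maxi_pos: "maxi P ==> dm Om P > 0"
 using dm_fr_0[of P Om] maxi_fr maxi_Om maxi_ne fr_Om by fastforce

lemma dg_maxi: "maxi P ==> fr J ==> dg (pr P J) = dg J - int (dm Om P)"
proof -
 assume P: "maxi P" and J: "fr J"
 have "pr P J <= J" using pr_mono[OF maxi_Om[OF P] subset_refl, of J] pr_Om[OF J] by simp
 thus ?thesis using dg_step[OF fr_pr[OF maxi_fr[OF P] J] J] dm_maxi[OF P J] by simp
qed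

text \<open>Factorisation into maximal ideals in the form of an induction rule: dividing by a
  maximal ideal above \<open>I\<close> lowers the codimension.\<close>

lemma ideal_induct [consumes 2, case_names one mult]:
 assumes "fr I" "I <= Om" and "Pr Om"
  and "!!P I. maxi P ==> fr I ==> I <= Om ==> Pr I ==> Pr (pr P I)"
 shows "Pr I"
 using assms(1,2)
proof (induction "dm Om I" arbitrary: I rule: less_induct)
 case (less I)
 show ?case
 proof (cases "I = Om")
  case False
  then obtain P where P: "maxi P" "I <= P" using maxi_exists less by blast
  note fP = maxi_fr[OF P(1)]
  define I' where "I' = pr I (iv P)"
  have I': "fr I'" "pr P I' = I" unfolding I'_def using pr_iv_cancel[OF fP less(2)] fr_pr less fr_iv fP by auto
  have sub: "I' <= Om" unfolding I'_def using pr_mono[OF P(2) subset_refl, of "iv P"] pr_iv[OF fP] by simp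
  have "dm Om I' < dm Om I"
   using dg_maxi[OF P(1) I'(1)] I'(2) dg_ideal[OF I'(1) sub] dg_ideal[OF less(2,3)] dm_maxi_pos[OF P(1)] by simp
  thus ?thesis using less(1)[OF _ I'(1) sub] assms(4)[OF P(1) I'(1) sub] I' by simp
 qed (use assms in simp)
qed

lemma pr_smul: "u : E ==> fr J ==> pr (smul u I) J = smul u (pr I J)"
proof (rule equalityI)
 assume u: "u : E" and J: "fr J"
 show "pr (smul u I) J <= smul u (pr I J)"
  by (rule pr_least[OF ss_smul[OF pr_ss]]) (auto simp: smul_def mult.assoc intro!: imageI pr_memI)
 have "pr I J <= {x. ALL k:{u}. x * k : pr (smul u I) J}"
  by (rule pr_least[OF ss_colon[OF pr_ss]]) (auto simp: mult.commute[of _ u] mult.assoc[symmetric] intro!: pr_memI smul_memI)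
 thus "smul u (pr I J) <= pr (smul u I) J" by (auto simp: smul_def mult.commute)
qed

lemma dg_pr_ideal:
 assumes "fr I" "I <= Om" "fr J" shows "dg (pr I J) = dg I + dg J"
 using assms(1,2)
proof (induction rule: ideal_induct)
 case one show ?case using assms by (simp add: pr_Om)
next
 case (mult P I)
 thus ?case using dg_maxi[OF mult(1)] fr_pr assms by (simp add: pr_assoc)
qed

lemma Dn_ideal:
 assumes "c : Dn" shows "fr (smul c Om)" "smul c Om <= Om"
 using fr_smul[OF fr_Om Dn_E[OF assms]] Dn_inv[OF assms] Om_mult Dn_R Om_R assms by (auto simp: smul_def)

lemma dg_smul_Dn: "c : Dn ==> fr J ==> dg (smul c J) = dg (smul c Om) + dg J"
 by (metis pr_smul Dn_E pr_Om dg_pr_ideal Dn_ideal)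

lemma Dn_clear: "fr I ==> EX c:Dn. smul c I <= Om & fr (smul c I)"
 using fr_lat[of I] Om_R Dn_inv Dn_E fr_smul[of I] unfolding lattice_def by (meson order_trans)

lemma dg_pr: assumes "fr I" "fr J" shows "dg (pr I J) = dg I + dg J"
proof -
 obtain c where c: "c : Dn" "smul c I <= Om" "fr (smul c I)" using Dn_clear[OF assms(1)] by blast
 have "dg (pr (smul c I) J) = dg (smul c I) + dg J" by (rule dg_pr_ideal[OF c(3,2) assms(2)])
 thus ?thesis using dg_smul_Dn[OF c(1)] assms fr_pr pr_smul[OF Dn_E[OF c(1)] assms(2)] by simp
qed

lemma dg_iv: "fr I ==> dg (iv I) = - dg I"
 using dg_pr[of I "iv I"] fr_iv pr_iv by simp

lemma dg_smul:
 assumes "u : E" "v : E" "u * v = 1" "fr J" shows "dg (smul u J) = dg (smul u Om) + dg J"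
 using dg_pr[OF fr_smul[OF fr_Om assms(1-3)] assms(4)] pr_smul[OF assms(1,4), of Om] pr_Om[OF assms(4)] by simp

text \<open>The product formula: multiplication by a nonzero function maps \<open>Dl\<close> and
  \<open>E\<close> onto themselves, so it leaves both \<open>h0\<close> and \<open>h1\<close>
  unchanged.\<close>

lemma dg_smul_Dl:
 assumes "z : Dl" "w : Dl" "z * w = 1" "fr J" shows "dg (smul z J) = dg J"
proof -
 have E: "z : E" "w : E" using assms Dl_E by auto
 have inj: "x = 0" if "z * x = 0" for x
 proof -
  have "(z * w) * x = w * (z * x)" by simp
  thus ?thesis using that assms by simp
 qed
 have D: "smul z Dl = Dl"
  using smul_mono[of "smul w Dl" Dl z] assms Dl_mult by (auto simp: smul_smul) (auto simp: smul_def)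
 have "smul z (J Int Dl) = smul z J Int smul z Dl"
  unfolding smul_def
 proof (rule image_Int, rule injI)
  fix x y assume "z * x = z * y" thus "x = y" using inj[of "x - y"] by (simp add: right_diff_distrib)
 qed
 hence a: "smul z J Int Dl = smul z (J Int Dl)" using D by simp
 have "smul z {0} = {0}" by (simp add: smul_def)
 moreover have "idx (smul z (J Int Dl)) (smul z {0}) = idx (J Int Dl) {0}"
  using ss_Int[OF fr_ss[OF assms(4)] Dl_ss] by (intro idx_smul(1)[OF ss_zero]) (auto intro: inj dest: ss_0)
 ultimately have h0: "h0 (smul z J) = h0 J" unfolding h0_def a dm_def by simp
 have EE: "smul z E = E" using smul_mono[of "smul w E" E z] assms smul_E E by (auto simp: smul_smul)
 have "smul z (splus J Dl) = splus (smul z J) (smul z Dl)"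
  unfolding smul_def splus_def by (auto simp: distrib_left image_iff) (metis distrib_left)+
 hence b: "splus (smul z J) Dl = smul z (splus J Dl)" using D by simp
 have "idx (smul z E) (smul z (splus J Dl)) = idx E (splus J Dl)"
  using inj by (intro idx_smul(1)) (auto intro: ss_splus fr_ss[OF assms(4)] Dl_ss E_ss intro!: splus_least[OF E_ss fr_E[OF assms(4)] Dl_E, THEN subsetD])
 hence h1: "h1 (smul z J) = h1 J" unfolding h1_def b EE by (simp add: dm_def)
 show ?thesis by (simp add: dg_def chi_def h0 h1)
qed

end

section \<open>The zeta function\<close>

locale zeta = dedekind emb q E R Dl Dn tau om Om
 for emb :: "'a::{finite,field} => 'e::comm_ring_1" and q E R Dl Dn tau om Om +
 assumes const: "Om Int Dl = range emb"
  and fin_ideals: "finite {I. fr I & I <= Om & dm Om I = n}"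
begin

definition ideals :: "nat => 'e set set" where
 "ideals n = {I. fr I & I <= Om & dm Om I = n}"

definition nideals :: "nat => nat" where "nideals n = card (ideals n)"

definition primes_dvd :: "nat => 'e set set" where
 "primes_dvd r = {P. maxi P & dm Om P dvd r}"

text \<open>The number of points over the extension of degree \<open>r\<close>, expressed by places:
  a place whose degree divides \<open>r\<close> contributes as many points as its degree.\<close>

definition npts :: "nat => nat" where
 "npts r = (SUM P:primes_dvd r. dm Om P)"

lemma finite_ideals: "finite (ideals n)"
 unfolding ideals_def by (rule fin_ideals)

lemma maxi_ideals: "maxi P ==> P : ideals (dm Om P)"
 using maxi_fr maxi_Om by (simp add: ideals_def)

lemma finite_primes_le: "finite {P. maxi P & dm Om P <= n}"
 by (rule finite_subset[of _ "UN d:{..n}. ideals d"]) (use finite_ideals maxi_ideals in auto)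

lemma finite_primes_dvd: "r > 0 ==> finite (primes_dvd r)"
 by (rule finite_subset[OF _ finite_primes_le[of r]]) (auto simp: primes_dvd_def dest: dvd_imp_le)

section \<open>Powers of primes and factorisation with multiplicities\<close>

definition pw :: "'e set => nat => 'e set" where "pw P j = (pr P ^^ j) Om"

lemma pw_0 [simp]: "pw P 0 = Om" and pw_Suc: "pw P (Suc j) = pr P (pw P j)"
 by (simp_all add: pw_def)

lemma fr_pw: "fr P ==> fr (pw P j)"
 by (induction j) (auto simp: pw_Suc fr_Om fr_pr)

lemma pw_Om: "fr P ==> P <= Om ==> pw P j <= Om"
proof (induction j)
 case (Suc j)
 have "pr P (pw P j) <= pr Om Om" using Suc by (intro pr_mono) auto
 thus ?case using pr_Om[OF fr_Om] by (simp add: pw_Suc)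
qed simp

lemma dm_pw: assumes "maxi P" shows "dm Om (pw P j) = j * dm Om P"
proof -
 note f = maxi_fr[OF assms] maxi_Om[OF assms]
 have "dg (pw P j) = - int (j * dm Om P)"
  by (induction j) (simp_all add: pw_Suc dg_maxi[OF assms fr_pw[OF f(1)]] algebra_simps)
 thus ?thesis using dg_ideal[OF fr_pw[OF f(1)] pw_Om[OF f], of j] by (simp del: of_nat_mult)
qed

lemma pr_le_right: "fr I ==> fr J ==> I <= Om ==> pr I J <= J"
 using pr_mono[of I Om J J] pr_Om[of J] by simp

lemma comaximal_pw:
 assumes "maxi P" "maxi Q" "P ~= Q"
 shows "EX x:P. EX y:pw Q j. x + y = 1"
proof (induction j)
 case 0 show ?case using ss_0[OF fr_ss[OF maxi_fr[OF assms(1)]]] Om_1 by force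
next
 case (Suc j)
 note P = maxi_fr[OF assms(1)] maxi_Om[OF assms(1)] and Q = maxi_fr[OF assms(2)] maxi_Om[OF assms(2)]
 obtain x y where xy: "x : P" "y : pw Q j" "x + y = 1" using Suc by blast
 have f: "fr (splus P Q)" "P <= splus P Q" "Q <= splus P Q" "splus P Q <= Om"
  by (simp_all add: fr_splus P Q splus_upper1 splus_upper2 fr_ss splus_least[OF Om_ss])
 have "splus P Q = Om"
 proof (rule ccontr)
  assume "splus P Q ~= Om"
  hence "splus P Q = P" using maxi_max[OF assms(1)] f by blast
  hence "P = Q \<or> P = Om" using maxi_max[OF assms(2) P(1) _ P(2)] f by blast
  thus False using assms(3) maxi_ne[OF assms(1)] by blast
 qed
 hence "1 : splus P Q" using Om_1 by simp
 then obtain p s where ps: "p : P" "s : Q" "1 = p + s" unfolding splus_def by blast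
 have "(p + s * x) + s * y = p + s * (x + y)" by (simp add: distrib_left)
 hence "(p + s * x) + s * y = 1" using xy(3) ps(3) by simp
 moreover have "p + s * x : P" using ss_add[OF fr_ss[OF P(1)]] fr_mult[OF P(1)] ps xy Q by blast
 moreover have "s * y : pw Q (Suc j)" using ps xy by (simp add: pw_Suc pr_memI)
 ultimately show ?case by blast
qed

text \<open>The factorisation of \<open>I\<close> as a set: a prime \<open>P\<close> occurs with
  \<open>j\<close> from 1 up to its multiplicity in \<open>I\<close>. Sums over this set replace
  valuations.\<close>

definition pj :: "'e set => ('e set \<times> nat) set" where
 "pj I = {(P, j). maxi P & j > 0 & I <= pw P j}"

definition bump :: "'e set => 'e set \<times> nat => 'e set \<times> nat" where
 "bump P t = (fst t, if fst t = P then Suc (snd t) else snd t)"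

text \<open>Cancelling \<open>P\<close> shifts the exponents at \<open>P\<close> by one, which frees
  the place of \<open>(P, 1)\<close>; at another prime \<open>Q\<close> nothing changes, because
  \<open>P\<close> and the powers of \<open>Q\<close> are comaximal.\<close>

lemma pj_pr:
 assumes P: "maxi P" and I: "fr I" "I <= Om"
 shows "pj (pr P I) = insert (P, 1) (bump P ` pj I)"
proof -
 note fP = maxi_fr[OF P]
 have same: "pr P I <= pw P (Suc j) \<longleftrightarrow> I <= pw P j" for j
  unfolding pw_Suc by (rule pr_cancel_le[OF fP I(1) fr_pw[OF fP]])
 have other: "pr P I <= pw Q j \<longleftrightarrow> I <= pw Q j" if Q: "maxi Q" "Q ~= P" for Q j
 proof
  assume le: "pr P I <= pw Q j"
  obtain x y where xy: "x : P" "y : pw Q j" "x + y = 1" using comaximal_pw[OF P Q(1)] Q(2) by metis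
  show "I <= pw Q j"
  proof
   fix i assume i: "i : I"
   have "x * i : pw Q j" using le pr_memI[OF xy(1) i] by blast
   moreover have "i * y : pw Q j" using fr_mult[OF fr_pw[OF maxi_fr[OF Q(1)]]] i I xy by blast
   moreover have "i = x * i + i * y" using xy(3) by (metis distrib_right mult.commute mult_1)
   ultimately show "i : pw Q j" using ss_add[OF fr_ss[OF fr_pw[OF maxi_fr[OF Q(1)]]]] by metis
  qed
 next
  assume "I <= pw Q j" thus "pr P I <= pw Q j" using pr_le_right[OF fP I(1) maxi_Om[OF P]] by blast
 qed
 have one: "pr P I <= pw P 1" using same[of 0] I by simp
 show ?thesis
 proof (intro equalityI subsetI)
  fix t assume "t : pj (pr P I)"
  then obtain Q j where t: "t = (Q, j)" "maxi Q" "j > 0" "pr P I <= pw Q j" by (auto simp: pj_def)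
  show "t : insert (P, 1) (bump P ` pj I)"
  proof (cases "Q = P")
   case False
   have h: "(Q, j) : pj I" "t = bump P (Q, j)" using False t other by (auto simp: pj_def bump_def)
   show ?thesis unfolding h(2) by (intro insertI2 imageI h(1))
  next
   case True
   obtain i where i: "j = Suc i" using t(3) by (cases j) auto
   show ?thesis
   proof (cases "i = 0")
    case False
    have h: "(P, i) : pj I" "t = bump P (P, i)" using False t same i True by (auto simp: pj_def bump_def)
    show ?thesis unfolding h(2) by (intro insertI2 imageI h(1))
   qed (use i t True in simp)
  qed
 next
  fix t assume "t : insert (P, 1) (bump P ` pj I)"
  then consider "t = (P, 1)" | u where "u : pj I" "t = bump P u" by blast
  thus "t : pj (pr P I)"
  proof cases
   case (2 u)
   obtain Q j where "u = (Q, j)" by (cases u)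
   thus ?thesis using 2 other[of Q j] same[of j] by (cases "Q = P") (auto simp: pj_def bump_def)
  qed (use P one in \<open>simp add: pj_def\<close>)
 qed
qed

lemma sum_pj:
 assumes "fr I" "I <= Om"
 shows "finite (pj I) & (SUM t:pj I. dm Om (fst t)) = dm Om I"
 using assms
proof (induction rule: ideal_induct)
 case one
 have "pj Om = {}"
 proof (rule ccontr)
  assume "pj Om ~= {}"
  then obtain P j where P: "maxi P" "j > 0" "Om <= pw P j" by (auto simp: pj_def)
  hence "pw P j = Om" using pw_Om[OF maxi_fr[OF P(1)] maxi_Om[OF P(1)]] by blast
  hence "j * dm Om P = 0" using dm_pw[OF P(1), of j] dm_self[OF Om_ss] by simp
  thus False using P dm_maxi_pos[OF P(1)] by simp
 qed
 thus ?case using dm_self[OF Om_ss] by simp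
next
 case (mult P I)
 let ?f = "bump P"
 note e = pj_pr[OF mult(1-3)]
 have ni: "(P, 1) ~: ?f ` pj I" by (auto simp: pj_def bump_def)
 have inj: "inj_on ?f (pj I)"
 proof (rule inj_onI)
  fix s t assume e: "bump P s = bump P t"
  have f: "fst s = fst t" using arg_cong[OF e, of fst] by (simp add: bump_def)
  have "snd s = snd t" using arg_cong[OF e, of snd] f by (cases "fst t = P") (simp_all add: bump_def)
  thus "s = t" using f by (rule prod_eqI[rotated])
 qed
 have "(SUM t:pj (pr P I). dm Om (fst t)) = dm Om P + (SUM x:?f ` pj I. dm Om (fst x))"
  unfolding e using ni mult(4) by simp
 also have "(SUM x:?f ` pj I. dm Om (fst x)) = (SUM x:pj I. dm Om (fst x))"
  using inj by (subst sum.reindex) (auto intro!: sum.cong simp: bump_def)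
 also have "... = dm Om I" using mult(4) by simp
 finally have s: "(SUM t:pj (pr P I). dm Om (fst t)) = dm Om P + dm Om I" .
 have le: "pr P I <= Om" by (rule order_trans[OF pr_le_right[OF maxi_fr[OF mult(1)] mult(2) maxi_Om[OF mult(1)]] mult(3)])
 have d1: "dg (pr P I) = dg I - int (dm Om P)" by (rule dg_maxi[OF mult(1,2)])
 have d2: "dg I = - int (dm Om I)" by (rule dg_ideal[OF mult(2,3)])
 have d3: "dg (pr P I) = - int (dm Om (pr P I))" by (rule dg_ideal[OF fr_pr[OF maxi_fr[OF mult(1)] mult(2)] le])
 have "dm Om P + dm Om I = dm Om (pr P I)" using d1 d2 d3 by linarith
 thus ?case using s e mult(4) by simp
qed

lemma card_ideals_le_pw:
 assumes P: "maxi P" and "j * dm Om P <= n"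
 shows "card {I : ideals n. I <= pw P j} = nideals (n - j * dm Om P)"
proof -
 let ?Q = "pw P j"
 have Q: "fr ?Q" "?Q <= Om" using fr_pw pw_Om maxi_fr[OF P] maxi_Om[OF P] by auto
 have dQ: "dg ?Q = - int (j * dm Om P)" using dg_ideal[OF Q] dm_pw[OF P] by simp
 have "bij_betw (pr ?Q) (ideals (n - j * dm Om P)) {I : ideals n. I <= ?Q}"
 proof (rule bij_betw_imageI)
  show "inj_on (pr ?Q) (ideals (n - j * dm Om P))"
   by (rule inj_onI) (use pr_cancel[OF Q(1)] in \<open>auto simp: ideals_def\<close>)
  show "pr ?Q ` ideals (n - j * dm Om P) = {I : ideals n. I <= ?Q}"
  proof (intro equalityI subsetI)
   fix I assume "I : pr ?Q ` ideals (n - j * dm Om P)"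
   then obtain J where J: "fr J" "J <= Om" "dm Om J = n - j * dm Om P" "I = pr ?Q J" by (auto simp: ideals_def)
   have le: "I <= ?Q" using pr_le_right[OF J(1) Q(1) J(2)] J(4) by (simp add: pr_comm)
   have I: "fr I" "I <= Om" using J Q fr_pr le by auto
   have "dg I = dg ?Q + dg J" using dg_pr[OF Q(1) J(1)] J(4) by simp
   hence "dm Om I = n" using dg_ideal[OF I] dg_ideal[OF J(1,2)] dQ J(3) assms(2) by simp
   thus "I : {I : ideals n. I <= ?Q}" using I le by (simp add: ideals_def)
  next
   fix I assume "I : {I : ideals n. I <= ?Q}"
   hence I: "fr I" "I <= Om" "dm Om I = n" "I <= ?Q" by (auto simp: ideals_def)
   let ?J = "pr I (iv ?Q)"
   have J: "fr ?J" "?J <= Om" using fr_pr fr_iv I Q pr_mono[OF I(4) subset_refl, of "iv ?Q"] pr_iv[OF Q(1)] by auto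
   have e: "pr ?Q ?J = I" by (rule pr_iv_cancel[OF Q(1) I(1)])
   have "dg ?J = dg I - dg ?Q" using dg_pr[OF I(1) fr_iv[OF Q(1)]] dg_iv[OF Q(1)] by simp
   hence "int (dm Om ?J) = int n - int (j * dm Om P)" using dg_ideal[OF J] dg_ideal[OF I(1,2)] dQ I(3) by simp
   hence "dm Om ?J = n - j * dm Om P" by (simp only: of_nat_diff[OF assms(2), symmetric])
   thus "I : pr ?Q ` ideals (n - j * dm Om P)" using J e by (force simp: ideals_def)
  qed
 qed
 thus ?thesis unfolding nideals_def by (simp add: bij_betw_same_card)
qed

text \<open>The logarithmic derivative of the zeta function as a recurrence. The codimension
  \<open>n\<close> of each ideal is the sum of \<open>dm Om P\<close> over its pairs
  \<open>(P, j)\<close>. After exchanging the sums, the ideals below the power \<open>pw P j\<close>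
  are counted by dividing by it, and the pairs are grouped by
  \<open>r = j * dm Om P\<close>.\<close>

theorem nideals_rec: "n * nideals n = (SUM r=1..n. npts r * nideals (n - r))"
proof -
 let ?T = "{(P, j). maxi P & j > 0 & j * dm Om P <= n}"
 have le: "j <= n & dm Om P <= n" if "maxi P" "j > 0" "j * dm Om P <= n" for P j
  using that dm_maxi_pos[OF that(1)] by (meson dual_order.trans mult_le_mono nat_mult_1_right
   nat_mult_1 Suc_leI One_nat_def mult_le_mono1 mult_le_mono2 le_trans mult.right_neutral mult.left_neutral less_one leI dvd_triv_left dvd_triv_right dvd_imp_le mult_pos_pos nat_0_less_mult_iff)
 have finT: "finite ?T"
  by (rule finite_subset[of _ "{P. maxi P & dm Om P <= n} \<times> {..n}"]) (use le finite_primes_le in auto)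
 have sub: "pj I = {t:?T. I <= pw (fst t) (snd t)}" if I: "I : ideals n" for I
 proof -
  have "j * dm Om P <= n" if "maxi P" "I <= pw P j" for P j
  proof -
   have "dm Om I = dm Om (pw P j) + dm (pw P j) I"
    using dm_fr[of I "pw P j" Om] I that fr_pw[OF maxi_fr] pw_Om[OF maxi_fr maxi_Om] fr_Om by (simp add: ideals_def)
   thus ?thesis using dm_pw[OF that(1)] I by (simp add: ideals_def)
  qed
  thus ?thesis by (auto simp: pj_def)
 qed
 have "n * nideals n = (SUM I:ideals n. n)" by (simp add: nideals_def)
 also have "... = (SUM I:ideals n. SUM t:pj I. dm Om (fst t))"
  using sum_pj by (intro sum.cong) (auto simp: ideals_def)
 also have "... = (SUM I:ideals n. SUM t:?T. if I <= pw (fst t) (snd t) then dm Om (fst t) else 0)"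
  by (rule sum.cong[OF refl]) (simp only: sub sum.inter_filter[OF finT])
 also have "... = (SUM t:?T. SUM I:ideals n. if I <= pw (fst t) (snd t) then dm Om (fst t) else 0)"
  by (rule sum.swap)
 also have "... = (SUM t:?T. dm Om (fst t) * card {I : ideals n. I <= pw (fst t) (snd t)})"
  using finite_ideals by (intro sum.cong refl) (simp add: sum.inter_filter[symmetric] mult.commute)
 also have "... = (SUM t:?T. dm Om (fst t) * nideals (n - snd t * dm Om (fst t)))"
  using card_ideals_le_pw by (intro sum.cong refl) auto
 also have "... = (SUM r:(%t. snd t * dm Om (fst t)) ` ?T. SUM t:{t:?T. snd t * dm Om (fst t) = r}. dm Om (fst t) * nideals (n - snd t * dm Om (fst t)))"
  by (rule sum.image_gen[OF finT])
 also have "... = (SUM r=1..n. SUM t:{t:?T. snd t * dm Om (fst t) = r}. dm Om (fst t) * nideals (n - snd t * dm Om (fst t)))"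
 proof (rule sum.mono_neutral_left)
  show "(%t. snd t * dm Om (fst t)) ` ?T <= {1..n}"
   using dm_maxi_pos by force
 qed (auto intro!: sum.neutral simp: image_iff)
 also have "... = (SUM r=1..n. npts r * nideals (n - r))"
 proof (rule sum.cong[OF refl])
  fix r assume r: "r : {1..n}"
  have b: "bij_betw fst {t:?T. snd t * dm Om (fst t) = r} (primes_dvd r)"
  proof (rule bij_betw_imageI)
   show "inj_on fst {t:?T. snd t * dm Om (fst t) = r}"
    by (auto simp: inj_on_def dest: dm_maxi_pos)
   have "P : fst ` {t:?T. snd t * dm Om (fst t) = r}" if P: "maxi P" "dm Om P dvd r" for P
   proof -
    obtain j where j: "r = dm Om P * j" using P by (elim dvdE)
    have "j > 0" using r j by (intro Nat.gr0I) auto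
    hence "(P, j) : {t:?T. snd t * dm Om (fst t) = r}" using r P j by (simp add: mult.commute)
    thus ?thesis by (rule image_eqI[rotated]) simp
   qed
   thus "fst ` {t:?T. snd t * dm Om (fst t) = r} = primes_dvd r" by (auto simp: primes_dvd_def)
  qed
  have "(SUM t:{t:?T. snd t * dm Om (fst t) = r}. dm Om (fst t) * nideals (n - snd t * dm Om (fst t)))
    = (SUM t:{t:?T. snd t * dm Om (fst t) = r}. dm Om (fst t) * nideals (n - r))" by (intro sum.cong) auto
  also have "... = (SUM P:primes_dvd r. dm Om P * nideals (n - r))"
   by (rule sum.reindex_bij_betw[OF b])
  finally show "(SUM t:{t:?T. snd t * dm Om (fst t) = r}. dm Om (fst t) * nideals (n - snd t * dm Om (fst t))) = npts r * nideals (n - r)"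
   by (simp add: npts_def sum_distrib_right)
 qed
 finally show ?thesis .
qed

lemma h0_Om: "h0 Om = 1"
proof -
 have "card (range emb) = q" using card_image[of emb UNIV] by (auto simp: inj_on_def q_def)
 hence "q ^ h0 Om = q ^ 1" using card_h0[OF Om_lat] const by simp
 thus ?thesis using power_inject_exp[OF q_gt_1] by blast
qed

abbreviation g :: nat where "g == h1 Om"

lemma chi_Om: "chi Om = 1 - int g"
 by (simp add: chi_def h0_Om)

lemma chi_dg: "chi J = dg J + 1 - int g"
 by (simp add: dg_def chi_Om)

section \<open>Divisor classes and the ideals in a class\<close>

definition cls :: "'e set => 'e set set" where
 "cls J = {smul z J |z. z : Dl & z ~= 0}"

lemma Dl_unit: assumes "z : Dl" "z ~= 0" obtains w where "w : Dl" "w ~= 0" "z * w = 1" "z : E" "w : E"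
 using Dl_inv[OF assms] Dl_E assms by (metis mult_zero_right subsetD zero_neq_one)

lemma Dl_nz: "z : Dl ==> z ~= 0 ==> w : Dl ==> w ~= 0 ==> z * w ~= 0"
 by (metis Dl_inv mult.assoc mult_1_left mult_zero_left)

lemma cls_self: "J : cls J"
 unfolding cls_def using Dl_1 by (auto intro!: exI[of _ 1])

lemma cls_eqI: assumes "J' : cls J" shows "cls J' = cls J"
proof -
 obtain z where z: "z : Dl" "z ~= 0" "J' = smul z J" using assms by (auto simp: cls_def)
 obtain w where w: "w : Dl" "w ~= 0" "z * w = 1" by (rule Dl_unit[OF z(1,2)])
 show ?thesis
 proof (intro equalityI subsetI)
  fix Xa assume "Xa : cls J'"
  then obtain y where y: "y : Dl" "y ~= 0" "Xa = smul (y * z) J" using z(3) by (auto simp: cls_def smul_smul)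
  thus "Xa : cls J" using Dl_mult[OF y(1) z(1)] Dl_nz[OF y(1,2) z(1,2)] unfolding cls_def by blast
 next
  fix Xa assume "Xa : cls J"
  then obtain y where y: "y : Dl" "y ~= 0" "Xa = smul y J" by (auto simp: cls_def)
  have "smul (y * w) J' = smul (y * (z * w)) J" unfolding z(3) smul_smul by (simp only: mult_ac)
  hence "Xa = smul (y * w) J'" using y(3) w(3) by simp
  thus "Xa : cls J'" using Dl_mult[OF y(1) w(1)] Dl_nz[OF y(1,2) w(1,2)] unfolding cls_def by blast
 qed
qed

lemma cls_eq_iff: "cls J' = cls J \<longleftrightarrow> J' : cls J"
 using cls_eqI cls_self by metis

lemma cls_fr: assumes "J' : cls J" "fr J" shows "fr J'" "dg J' = dg J"
proof -
 obtain z where z: "z : Dl" "z ~= 0" "J' = smul z J" using assms by (auto simp: cls_def)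
 obtain w where w: "w : Dl" "w ~= 0" "z * w = 1" "z : E" "w : E" by (rule Dl_unit[OF z(1,2)])
 show "fr J'" "dg J' = dg J" using fr_smul[OF assms(2) w(4,5,3)] dg_smul_Dl[OF z(1) w(1,3) assms(2)] z by auto
qed

lemma smul_perp_cls: assumes "J' : cls J" "fr J" shows "perp J' : cls (perp J)"
proof -
 obtain z where z: "z : Dl" "z ~= 0" "J' = smul z J" using assms by (auto simp: cls_def)
 obtain w where w: "w : Dl" "w ~= 0" "z * w = 1" "z : E" "w : E" by (rule Dl_unit[OF z(1,2)])
 show ?thesis using perp_smul[OF w(4,5,3) fr_E[OF assms(2)]] z w by (auto simp: cls_def)
qed

lemma dg_perp: assumes "fr J" shows "dg (perp J) = 2 * int g - 2 - dg J"
 using riemann_roch[OF fr_lat[OF assms]] riemann_roch[OF lattice_perp[OF fr_lat[OF assms]]]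
  perp_perp_lat[OF fr_lat[OF assms]] chi_dg[of J] chi_dg[of "perp J"] by simp

lemma rr: assumes "fr J" shows "int (h0 J) = int (h0 (perp J)) + dg J + 1 - int g"
 using riemann_roch[OF fr_lat[OF assms]] chi_dg[of J] by simp

lemma h0_cls: assumes "J' : cls J" "fr J" shows "h0 J' = h0 J"
proof -
 obtain z where z: "z : Dl" "z ~= 0" "J' = smul z J" using assms by (auto simp: cls_def)
 obtain w where w: "w : Dl" "w ~= 0" "z * w = 1" "z : E" "w : E" by (rule Dl_unit[OF z(1,2)])
 have "bij_betw ((*) z) (J Int Dl) (J' Int Dl)"
 proof (rule bij_betw_byWitness[of _ "(*) w"])
  show "ALL a:J Int Dl. w * (z * a) = a" "ALL a:J' Int Dl. z * (w * a) = a"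
   using w(3) by (metis mult.assoc mult.commute mult_1)+
  show "(*) z ` (J Int Dl) <= J' Int Dl" using z Dl_mult by (auto simp: smul_def)
  have "w * x : J" if x: "x : J'" for x
  proof -
   obtain j where j: "j : J" "x = z * j" using x z unfolding smul_def by blast
   have "w * x = (z * w) * j" unfolding j(2) by simp
   thus ?thesis using w(3) j(1) by simp
  qed
  thus "(*) w ` (J' Int Dl) <= J Int Dl" using w Dl_mult by auto
 qed
 hence "card (J Int Dl) = card (J' Int Dl)" by (rule bij_betw_same_card)
 hence "q ^ h0 J = q ^ h0 J'" using card_h0 fr_lat cls_fr[OF assms] assms by simp
 thus ?thesis using power_inject_exp[OF q_gt_1] by simp
qed

definition Pic :: "int => 'e set set set" where
 "Pic n = cls ` {J. fr J & dg J = n}"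

definition hc :: "'e set set => nat" where "hc C = h0 (SOME J. J : C)"

lemma hc_cls: assumes "fr J" shows "hc (cls J) = h0 J"
 by (metis someI cls_self hc_def h0_cls assms)

lemma perp_image_cls: assumes "fr J" shows "perp ` cls J = cls (perp J)"
proof (intro equalityI subsetI)
 fix x assume "x : perp ` cls J" thus "x : cls (perp J)" using smul_perp_cls assms by blast
next
 fix x assume x: "x : cls (perp J)"
 hence "perp x : cls J" using smul_perp_cls[OF x fr_perp[OF assms]] perp_perp_lat[OF fr_lat[OF assms]] by simp
 moreover have "perp (perp x) = x" using perp_perp_lat fr_lat cls_fr[OF x fr_perp[OF assms]] by blast
 ultimately show "x : perp ` cls J" by force
qed

lemma bij_Pic_perp: "bij_betw ((`) perp) (Pic n) (Pic (2 * int g - 2 - n))"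
proof (rule bij_betw_byWitness[of _ "(`) perp"])
 have *: "perp ` perp ` C = C" if C: "C : Pic m" for C m
 proof -
  obtain J where "fr J" "C = cls J" using C by (auto simp: Pic_def)
  thus ?thesis using perp_image_cls fr_perp perp_perp_lat fr_lat by metis
 qed
 thus "ALL C:Pic n. perp ` perp ` C = C" "ALL C:Pic (2 * int g - 2 - n). perp ` perp ` C = C" by blast+
 have **: "(`) perp ` Pic m <= Pic (2 * int g - 2 - m)" for m
  using Pic_def perp_image_cls fr_perp dg_perp by auto
 show "(`) perp ` Pic n <= Pic (2 * int g - 2 - n)" by (rule **)
 show "(`) perp ` Pic (2 * int g - 2 - n) <= Pic n" using **[of "2 * int g - 2 - n"] by simp
qed

lemma h0_neg: assumes "fr J" "dg J < 0" shows "h0 J = 0"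
proof (rule ccontr)
 assume "h0 J ~= 0"
 hence "card (J Int Dl) > 1" using card_h0[OF fr_lat[OF assms(1)]] one_less_power[OF q_gt_1] by simp
 hence "~ J Int Dl <= {0}" using card_mono[of "{0}" "J Int Dl"] by fastforce
 then obtain z where z: "z : J" "z : Dl" "z ~= 0" by blast
 obtain w where w: "w : Dl" "w ~= 0" "z * w = 1" "z : E" "w : E" by (rule Dl_unit[OF z(2,3)])
 have "smul z Om <= J" using fr_mult[OF assms(1) _ z(1)] by (auto simp: smul_def mult.commute)
 hence "dg J >= dg (smul z Om)" using dg_step[OF fr_smul[OF fr_Om w(4,5,3)] assms(1)] by simp
 thus False using dg_smul_Dl[OF z(2) w(1,3) fr_Om] assms by simp
qed

text \<open>The effective divisors of a class form a projective space: a nonzero section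
  \<open>z\<close> of \<open>J\<close> yields the integral ideal \<open>smul z (iv J)\<close>, every
  ideal of the class arises so, and \<open>z\<close> is determined up to a nonzero constant.\<close>

lemma class_ideals:
 assumes J: "fr J" "dg J = int n"
 shows "(q - 1) * card {I : ideals n. cls (iv I) = cls J} = q ^ h0 J - 1"
proof -
 let ?Z = "J Int Dl - {0}" and ?K = "iv J" and ?\<phi> = "%z. smul z (iv J)"
 note K = fr_iv[OF J(1)]
 have im: "?\<phi> ` ?Z = {I : ideals n. cls (iv I) = cls J}"
 proof (intro equalityI subsetI)
  fix I assume "I : ?\<phi> ` ?Z"
  then obtain z where z: "z : J" "z : Dl" "z ~= 0" "I = smul z ?K" by blast
  obtain w where w: "w : Dl" "w ~= 0" "z * w = 1" "z : E" "w : E" by (rule Dl_unit[OF z(2,3)])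
  have wz: "w * z = 1" using w by (simp add: mult.commute)
  have I: "fr I" "dg I = - int n" using fr_smul[OF K w(4,5,3)] dg_smul_Dl[OF z(2) w(1,3) K] z dg_iv[OF J(1)] J by auto
  have "smul z Om <= J" using fr_mult[OF J(1) _ z(1)] by (auto simp: smul_def mult.commute)
  hence "pr (smul z Om) ?K <= pr J ?K" by (intro pr_mono) auto
  hence IO: "I <= Om" using pr_smul[OF w(4) K, of Om] pr_Om[OF K] pr_iv[OF J(1)] z by simp
  have "pr I (smul w J) = smul z (pr ?K (smul w J))" using pr_smul[OF w(4) fr_smul[OF J(1) w(5,4) wz], of ?K] z by simp
  also have "... = smul z (smul w Om)" using pr_smul[OF w(5) K, of J] pr_iv[OF J(1)] by (simp add: pr_comm)
  also have "... = Om" using smul_inv[OF w(3)] by simp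
  finally have "iv I = smul w J" by (intro iv_unique[OF I(1) fr_smul[OF J(1) w(5,4) wz]])
  hence "cls (iv I) = cls J" using w by (intro cls_eqI) (auto simp: cls_def)
  thus "I : {I : ideals n. cls (iv I) = cls J}" using I IO dg_ideal[OF I(1) IO] by (simp add: ideals_def)
 next
  fix I assume "I : {I : ideals n. cls (iv I) = cls J}"
  hence I: "fr I" "I <= Om" "iv I : cls J" using cls_eq_iff by (auto simp: ideals_def)
  then obtain z where z: "z : Dl" "z ~= 0" "iv I = smul z J" by (auto simp: cls_def)
  obtain w where w: "w : Dl" "w ~= 0" "z * w = 1" "z : E" "w : E" by (rule Dl_unit[OF z(1,2)])
  have wz: "w * z = 1" using w by (simp add: mult.commute)
  have "pr (smul z J) (smul w ?K) = smul z (pr J (smul w ?K))" using pr_smul[OF w(4) fr_smul[OF K w(5,4) wz], of J] by simp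
  also have "... = smul z (smul w Om)" using pr_smul[OF w(5) J(1), of ?K] pr_iv[OF J(1)] by (simp add: pr_comm)
  also have "... = Om" using smul_inv[OF w(3)] by simp
  finally have "iv (iv I) = smul w ?K" unfolding z(3)
   by (intro iv_unique[OF fr_smul[OF J(1) w(4,5,3)] fr_smul[OF K w(5,4) wz]])
  hence Iw: "I = smul w ?K" using iv_iv[OF I(1)] by simp
  have "pr (smul w ?K) J <= pr Om J" using I(2) Iw by (intro pr_mono) auto
  hence "smul w Om <= J" using pr_smul[OF w(5) J(1), of ?K] pr_iv'[OF J(1)] pr_Om[OF J(1)] by simp
  hence "w : J" using smul_memI[OF Om_1, of w] by auto
  thus "I : ?\<phi> ` ?Z" using w Iw by blast
 qed
 \<comment> \<open>The quotient of two sections with the same ideal stabilises \<open>iv J\<close>.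
   By \<open>fr_End\<close> it lies in \<open>Om\<close>, and being in \<open>Dl\<close> as well it
   is a constant.\<close>
 have fib: "card {x : ?Z. ?\<phi> x = y} = q - 1" if "y : ?\<phi> ` ?Z" for y
 proof -
  obtain z where z: "z : J" "z : Dl" "z ~= 0" "y = ?\<phi> z" using \<open>y \<in> ?\<phi> ` ?Z\<close> by blast
  obtain w where w: "w : Dl" "w ~= 0" "z * w = 1" "z : E" "w : E" by (rule Dl_unit[OF z(2,3)])
  have "{x : ?Z. ?\<phi> x = y} = (%c. emb c * z) ` (UNIV - {0})"
  proof (intro equalityI subsetI)
   fix x assume "x : {x : ?Z. ?\<phi> x = y}"
   hence x: "x : J" "x : Dl" "x ~= 0" "smul x ?K = smul z ?K" using z by auto
   have "smul (x * w) ?K = smul w (smul x ?K)" by (simp add: smul_smul mult.commute)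
   also have "... = ?K" using x(4) smul_inv(2)[OF w(3)] by simp
   finally have "(x * w) * i : ?K" if "i : ?K" for i using smul_memI[OF that, of "x * w"] by simp
   moreover have "x * w : Dl" using x w Dl_mult by blast
   ultimately have "x * w : Om" using fr_End[OF K] Dl_E by blast
   hence "x * w : range emb" using const \<open>x * w \<in> Dl\<close> by blast
   then obtain c where c: "x * w = emb c" by blast
   have "x = x * w * z" using w(3) by (simp add: mult.assoc mult.commute[of w])
   hence "x = emb c * z" using c by simp
   moreover have "c ~= 0" using calculation x by auto
   ultimately show "x : (%c. emb c * z) ` (UNIV - {0})" by blast
  next
   fix x assume "x : (%c. emb c * z) ` (UNIV - {0})"
   then obtain c where c: "c ~= 0" "x = emb c * z" by blast
   have "smul (emb c) ?K = ?K"
   proof (rule equalityI)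
    show "smul (emb c) ?K <= ?K" using ss_scale[OF fr_ss[OF K]] by (auto simp: smul_def)
    have "smul (emb (inverse c)) ?K <= ?K" using ss_scale[OF fr_ss[OF K]] by (auto simp: smul_def)
    thus "?K <= smul (emb c) ?K" using smul_le_iff[OF emb_inv[OF c(1)]] by blast
   qed
   hence "smul z (smul (emb c) ?K) = smul z ?K" by simp
   hence "?\<phi> x = y" using z c by (simp add: smul_smul mult.commute)
   moreover have "x ~= 0" using c w(3) by (metis emb_inv mult.assoc mult_1 mult_zero_left mult_zero_right zero_neq_one)
   ultimately show "x : {x : ?Z. ?\<phi> x = y}" using c z ss_scale[OF fr_ss[OF J(1)]] ss_scale[OF Dl_ss] by auto
  qed
  moreover have "inj_on (%c. emb c * z) (UNIV - {0})"
  proof (rule inj_onI)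
   fix c d assume "emb c * z = emb d * z"
   hence "emb c * (z * w) = emb d * (z * w)" by (simp add: mult.assoc[symmetric])
   thus "c = d" using w(3) by simp
  qed
  ultimately show ?thesis using card_image by (metis card_Diff_singleton UNIV_I q_def)
 qed
 have finZ: "finite ?Z" using fin_h(1)[OF fr_lat[OF J(1)]] by simp
 have "card ?Z = (SUM y:?\<phi> ` ?Z. card {x : ?Z. ?\<phi> x = y})"
  using sum.image_gen[OF finZ, of "%_. 1::nat" ?\<phi>] by simp
 also have "... = (q - 1) * card (?\<phi> ` ?Z)" using fib by simp
 finally have "card ?Z = (q - 1) * card {I : ideals n. cls (iv I) = cls J}" using im by simp
 moreover have "card ?Z = card (J Int Dl) - 1"
  using ss_0[OF fr_ss[OF J(1)]] ss_0[OF Dl_ss] by (subst card_Diff_singleton) auto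
 ultimately show ?thesis using card_h0[OF fr_lat[OF J(1)]] by simp
qed

text \<open>In this range Riemann-Roch gives every class a nonzero section, so each class contains
  an integral ideal of codimension \<open>n\<close>, of which there are finitely many.\<close>

lemma finite_Pic_large: assumes "n >= g" shows "finite (Pic (int n))"
proof (rule finite_subset[OF _ finite_imageI[OF finite_ideals[of n], of "%I. cls (iv I)"]], rule subsetI)
 fix C assume "C : Pic (int n)"
 then obtain J where J: "fr J" "dg J = int n" "C = cls J" by (auto simp: Pic_def)
 have "h0 J >= 1" using rr[OF J(1)] J(2) assms by simp
 hence "q ^ 1 <= q ^ h0 J" using q_gt_1 by (intro power_increasing) auto
 hence "q ^ h0 J - 1 > 0" using q_gt_1 by simp
 hence "card {I : ideals n. cls (iv I) = cls J} ~= 0" using class_ideals[OF J(1,2)] by (metis less_nat_zero_code mult_0_right)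
 hence "{I : ideals n. cls (iv I) = cls J} ~= {}" by (metis card.empty)
 thus "C : (%I. cls (iv I)) ` ideals n" using J by auto
qed

end

section \<open>The functional equation\<close>

context zeta
begin

lemma pr_image_cls: assumes "fr J" "fr D" shows "(%J. pr J D) ` cls J = cls (pr J D)"
proof -
 have "pr (smul z J) D = smul z (pr J D)" if "z : Dl" for z
  using pr_smul[OF _ assms(2)] that Dl_E by blast
 hence "(%J. pr J D) ` cls J = {smul z (pr J D) |z. z : Dl & z ~= 0}"
  unfolding cls_def by auto
 thus ?thesis by (simp add: cls_def)
qed

lemma bij_Pic_pr: assumes D: "fr D" shows "bij_betw (%C. (%J. pr J D) ` C) (Pic n) (Pic (n + dg D))"
proof (rule bij_betw_byWitness[of _ "%C. (%J. pr J (iv D)) ` C"])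
 have c: "pr (pr J D) (iv D) = J" "pr (pr J (iv D)) D = J" if "fr J" for J
  using that D by (simp_all add: pr_assoc pr_iv pr_iv' pr_Om)
 have 1: "(%J. pr J (iv D)) ` (%J. pr J D) ` C = C & (%J. pr J D) ` (%J. pr J (iv D)) ` C = C" if C: "C : Pic m" for C m
 proof -
  obtain J where J: "fr J" "C = cls J" using C by (auto simp: Pic_def)
  have "fr Xa" if "Xa : C" for Xa using cls_fr(1)[OF _ J(1)] J(2) that by blast
  hence "(%Xa. pr (pr Xa D) (iv D)) ` C = (%Xa. Xa) ` C" "(%Xa. pr (pr Xa (iv D)) D) ` C = (%Xa. Xa) ` C"
   using c by auto
  thus ?thesis by (simp add: image_image)
 qed
 show "ALL C:Pic n. (%J. pr J (iv D)) ` (%J. pr J D) ` C = C" using 1 by blast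
 show "ALL C:Pic (n + dg D). (%J. pr J D) ` (%J. pr J (iv D)) ` C = C" using 1 by blast
 have 2: "(%J. pr J D') ` C : Pic (m + dg D')" if C: "C : Pic m" and D': "fr D'" for C m D'
 proof -
  obtain J where J: "fr J" "dg J = m" "C = cls J" using C by (auto simp: Pic_def)
  hence "(%J. pr J D') ` C = cls (pr J D')" "fr (pr J D')" "dg (pr J D') = m + dg D'"
   using pr_image_cls[OF J(1) D'] fr_pr[OF J(1) D'] dg_pr[OF J(1) D'] by auto
  thus ?thesis unfolding Pic_def by blast
 qed
 show "(%C. (%J. pr J D) ` C) ` Pic n <= Pic (n + dg D)" using 2[OF _ D] by blast
 show "(%C. (%J. pr J (iv D)) ` C) ` Pic (n + dg D) <= Pic n"
  using 2[OF _ fr_iv[OF D], of _ "n + dg D"] dg_iv[OF D] by auto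
qed

lemma fr_powers:
 assumes "fr D" shows "EX D'. fr D' & dg D' = k * dg D"
proof -
 have "EX D'. fr D' & dg D' = int m * dg D" for m
 proof (induction m)
  case 0 show ?case using fr_Om by (intro exI[of _ Om]) simp
 next
  case (Suc m)
  then obtain D' where "fr D'" "dg D' = int m * dg D" by blast
  thus ?case using fr_pr[OF assms] dg_pr[OF assms] by (intro exI[of _ "pr D D'"]) (simp add: algebra_simps)
 qed
 from this[of "nat k"] this[of "nat (- k)"] obtain D1 D2 where
  "fr D1" "dg D1 = int (nat k) * dg D" "fr D2" "dg D2 = int (nat (- k)) * dg D" by blast
 thus ?thesis using fr_iv[of D2] dg_iv[of D2]
  by (cases "k >= 0") (auto intro: exI[of _ D1] exI[of _ "iv D2"])
qed

lemma nideals_0: "nideals 0 = 1"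
proof -
 have "ideals 0 = {Om}" using dm_fr_0[of _ Om] fr_Om dm_self[OF Om_ss] by (auto simp: ideals_def)
 thus ?thesis by (simp add: nideals_def)
qed

text \<open>A place whose degree divides \<open>m\<close> yields an ideal of degree
  \<open>m\<close>; a quotient of two such ideals for consecutive values of \<open>m\<close> has
  degree one.\<close>

lemma degree_one:
 assumes "npts r > 0" "npts (Suc r) > 0" "r > 0" shows "EX D. fr D & dg D = 1"
proof -
 have *: "EX D. fr D & dg D = int m" if m: "npts m > 0" for m
 proof -
  have "primes_dvd m ~= {}" using m by (auto simp: npts_def)
  then obtain P where P: "maxi P" "dm Om P dvd m" by (auto simp: primes_dvd_def)
  then obtain k where k: "m = dm Om P * k" by blast
  obtain D where "fr D" "dg D = - int k * dg P" using fr_powers[OF maxi_fr[OF P(1)]] by blast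
  thus ?thesis using dg_ideal[OF maxi_fr maxi_Om] P(1) k by auto
 qed
 obtain D1 where D1: "fr D1" "dg D1 = int r" using *[OF assms(1)] by blast
 obtain D2 where D2: "fr D2" "dg D2 = int (Suc r)" using *[OF assms(2)] by blast
 show ?thesis using fr_pr[OF D2(1) fr_iv[OF D1(1)]] dg_pr[OF D2(1) fr_iv[OF D1(1)]] dg_iv[OF D1(1)] D1 D2
  by (intro exI[of _ "pr D2 (iv D1)"]) simp
qed

definition bsum :: "int => nat" where "bsum n = (SUM C:Pic n. q ^ hc C)"

text \<open>Riemann-Roch summed over classes: \<open>perp\<close> maps the classes of degree
  \<open>n\<close> bijectively to those of the complementary degree and changes \<open>h0\<close> by
  \<open>n + 1 - g\<close>. The bound on \<open>n\<close> makes that exponent a natural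
  number.\<close>

lemma bsum_sym: assumes "n >= int g - 1"
 shows "bsum n = q ^ nat (n + 1 - int g) * bsum (2 * int g - 2 - n)"
proof -
 have "bsum (2 * int g - 2 - n) = (SUM C:Pic n. q ^ hc (perp ` C))"
  unfolding bsum_def by (rule sum.reindex_bij_betw[OF bij_Pic_perp, symmetric])
 moreover have "q ^ hc C = q ^ nat (n + 1 - int g) * q ^ hc (perp ` C)" if C: "C : Pic n" for C
 proof -
  obtain J where J: "fr J" "dg J = n" "C = cls J" using C by (auto simp: Pic_def)
  have "hc C = h0 J" "hc (perp ` C) = h0 (perp J)"
   using J hc_cls[OF J(1)] hc_cls[OF fr_perp[OF J(1)]] perp_image_cls[OF J(1)] by auto
  hence "hc C = nat (n + 1 - int g) + hc (perp ` C)" using rr[OF J(1)] J(2) assms by simp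
  thus ?thesis by (simp add: power_add)
 qed
 hence "bsum n = (SUM C:Pic n. q ^ nat (n + 1 - int g) * q ^ hc (perp ` C))"
  unfolding bsum_def by (rule sum.cong[OF refl])
 ultimately show ?thesis by (simp only: sum_distrib_left)
qed

definition la :: "int => int" where
 "la n = (if n < 0 then 0 else int (nideals (nat n)))"

text \<open>The coefficient of T^n in the L-polynomial (1 - T)(1 - q T) Z(T), where Z is the zeta
  function with coefficients \<open>la\<close>.\<close>

definition lc :: "int => int" where
 "lc n = la n - (int q + 1) * la (n - 1) + int q * la (n - 2)"

text \<open>A divisor of degree one makes all degrees have the same number \<open>H\<close> of
  classes. Then (q - 1) \<open>la m\<close> is \<open>bsum m - H\<close> for every integer
  \<open>m\<close>; for negative \<open>m\<close> each class contributes 1 and both sides vanish. In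
  \<open>lc\<close> the constant \<open>H\<close> cancels since 1 - (q + 1) + q = 0, so the symmetry
  of \<open>bsum\<close> carries over.\<close>

lemma lc_sym:
 assumes "EX D. fr D & dg D = 1" "n <= int g"
 shows "lc (2 * int g - n) = int q ^ nat (int g - n) * lc n"
proof -
 define H where "H = card (Pic 0)"
 have cardPic: "card (Pic m) = H" and finPic: "finite (Pic m)" for m
 proof -
  obtain D1 where "fr D1" "dg D1 = 1" using assms by blast
  then obtain D where "fr D" "dg D = m" using fr_powers[of D1 m] by auto
  thus "card (Pic m) = H" using bij_betw_same_card[OF bij_Pic_pr[of D 0]] by (simp add: H_def)
  obtain D' where D': "fr D'" "dg D' = int g + \<bar>m\<bar> - m"
   using fr_powers[OF \<open>fr D1\<close>, of "int g + \<bar>m\<bar> - m"] \<open>dg D1 = 1\<close> by auto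
  have "finite (Pic (m + dg D'))" using finite_Pic_large[of "g + nat \<bar>m\<bar>"] D'(2) by simp
  thus "finite (Pic m)" using bij_betw_finite[OF bij_Pic_pr[OF D'(1), of m]] by simp
 qed
 have la: "int (q - 1) * la m = int (bsum m) - int H" for m
 proof (cases "m < 0")
  case True
  have "hc C = 0" if C: "C : Pic m" for C
  proof -
   obtain J where J: "fr J" "dg J = m" "C = cls J" using C by (auto simp: Pic_def)
   thus ?thesis using hc_cls[OF J(1)] h0_neg True by simp
  qed
  thus ?thesis using True cardPic by (simp add: la_def bsum_def)
 next
  case False
  define k where "k = nat m"
  have k: "m = int k" using False by (simp add: k_def)
  have sub: "(%I. cls (iv I)) ` ideals k <= Pic m"
  proof
   fix Xa assume "Xa : (%I. cls (iv I)) ` ideals k"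
   then obtain I where I: "fr I" "I <= Om" "dm Om I = k" "Xa = cls (iv I)" by (auto simp: ideals_def)
   thus "Xa : Pic m" using fr_iv[OF I(1)] dg_iv[OF I(1)] dg_ideal[OF I(1,2)] k by (auto simp: Pic_def)
  qed
  have "nideals k = (SUM C:(%I. cls (iv I)) ` ideals k. card {I : ideals k. cls (iv I) = C})"
   using sum.image_gen[OF finite_ideals[of k], of "%_. 1::nat" "%I. cls (iv I)"] by (simp add: nideals_def)
  also have "... = (SUM C:Pic m. card {I : ideals k. cls (iv I) = C})"
  proof (rule sum.mono_neutral_left[OF finPic sub], rule ballI)
   fix C assume "C : Pic m - (%I. cls (iv I)) ` ideals k"
   hence "{I : ideals k. cls (iv I) = C} = {}" by blast
   thus "card {I : ideals k. cls (iv I) = C} = 0" by (simp only: card.empty)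
  qed
  finally have "int ((q - 1) * nideals k) = (SUM C:Pic m. int ((q - 1) * card {I : ideals k. cls (iv I) = C}))"
   by (simp add: sum_distrib_left)
  also have "... = (SUM C:Pic m. int (q ^ hc C) - 1)"
  proof (rule sum.cong[OF refl])
   fix C assume "C : Pic m"
   then obtain J where J: "fr J" "dg J = m" "C = cls J" by (auto simp: Pic_def)
   have "q ^ h0 J >= 1" using q_gt_1 by simp
   thus "int ((q - 1) * card {I : ideals k. cls (iv I) = C}) = int (q ^ hc C) - 1"
    using class_ideals[OF J(1), of k] J k hc_cls[OF J(1)] by simp
  qed
  also have "... = int (bsum m) - int H" by (simp add: sum_subtractf bsum_def cardPic)
  finally show ?thesis using False by (simp add: la_def k_def)
 qed
 have lcb: "int (q - 1) * lc m = int (bsum m) - (int q + 1) * int (bsum (m - 1)) + int q * int (bsum (m - 2))" for m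
 proof -
  have "int (q - 1) * lc m = int (q - 1) * la m - (int q + 1) * (int (q - 1) * la (m - 1)) + int q * (int (q - 1) * la (m - 2))"
   by (simp add: lc_def algebra_simps)
  also have "... = (int (bsum m) - int H) - (int q + 1) * (int (bsum (m - 1)) - int H) + int q * (int (bsum (m - 2)) - int H)"
   by (simp only: la)
  finally show ?thesis by (simp add: algebra_simps)
 qed
 show ?thesis
 proof (cases "n = int g")
  case False
  hence lt: "n < int g" using assms by simp
  define k where "k = nat (int g - n - 1)"
  have k: "n = int g - int k - 1" using lt by (simp add: k_def)
  have e1: "bsum (2 * int g - n) = q ^ (k + 2) * bsum (n - 2)"
   using bsum_sym[of "2 * int g - n"] by (simp add: k nat_add_distrib algebra_simps)
  have e2: "bsum (2 * int g - n - 1) = q ^ (k + 1) * bsum (n - 1)"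
   using bsum_sym[of "2 * int g - n - 1"] by (simp add: k nat_add_distrib algebra_simps)
  have e3: "bsum (2 * int g - n - 2) = q ^ k * bsum n"
   using bsum_sym[of "2 * int g - n - 2"] by (simp add: k algebra_simps)
  have "int (q - 1) * lc (2 * int g - n) = int q ^ (k + 1) * (int (q - 1) * lc n)"
   unfolding lcb e1 e2 e3 by (simp add: algebra_simps)
  moreover have "int (q - 1) ~= 0" using q_gt_1 by simp
  ultimately have "lc (2 * int g - n) = int q ^ (k + 1) * lc n" by (metis (no_types, lifting) mult.left_commute mult_cancel_left)
  moreover have "nat (int g - n) = k + 1" using lt by (simp add: k_def)
  ultimately show ?thesis by simp
 qed simp
qed

end

section \<open>Serre's refinement of the Weil bound\<close>

text \<open>Dickson polynomials, which express z^n + (q/z)^n through z + q/z. They turn the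
  self-reciprocal L-polynomial into an integer polynomial in the traces.\<close>

fun dickson :: "int => nat => int poly" where
 "dickson q 0 = [:2:]"
| "dickson q (Suc 0) = [:0, 1:]"
| "dickson q (Suc (Suc n)) = [:0, 1:] * dickson q (Suc n) - smult q (dickson q n)"

lemma coeff_dickson:
 "(ALL m>n. coeff (dickson q n) m = 0) & (n > 0 --> coeff (dickson q n) n = 1 & coeff (dickson q n) (n - 1) = 0)"
proof (induction q n rule: dickson.induct)
 case (3 q n)
 have c: "coeff (dickson q (Suc (Suc n))) m = (case m of 0 => 0 | Suc k => coeff (dickson q (Suc n)) k) - q * coeff (dickson q n) m" for m
  by (simp add: coeff_pCons)
 show ?case using 3 by (auto simp: coeff_pCons split: nat.split)
qed (auto simp: coeff_pCons split: nat.split)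

interpretation of_int_hom: crhom "of_int :: int => complex"
 by (rule crhom_of_int)

abbreviation cpoly :: "int poly => complex poly" where "cpoly == map_poly of_int"

lemma poly_dickson:
 fixes z :: complex assumes "z ~= 0"
 shows "poly (cpoly (dickson q n)) (z + of_int q / z) = z ^ n + (of_int q / z) ^ n"
proof (induction q n rule: dickson.induct)
 case (3 q n)
 have "poly (cpoly (dickson q (Suc (Suc n)))) (z + of_int q / z) =
  (z + of_int q / z) * (z ^ Suc n + (of_int q / z) ^ Suc n) - of_int q * (z ^ n + (of_int q / z) ^ n)"
  by (simp add: of_int_hom.mp_diff of_int_hom.mp_smult of_int_hom.mp_pCons 3)
 also have "... = z ^ Suc (Suc n) + (of_int q / z) ^ Suc (Suc n)"
 proof -
  define u where "u = of_int q / z"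
  have "of_int q = z * u" using assms by (simp add: u_def)
  thus ?thesis by (simp add: algebra_simps)
 qed
 finally show ?case .
qed (auto simp: of_int_hom.mp_pCons)

text \<open>The inequality of arithmetic and geometric means in the only case required, obtained by
  summing ln x <= x - 1.\<close>

lemma sum_mset_ge_size:
 fixes A :: "real multiset"
 assumes "\<forall>x\<in>#A. x > 0" "prod_mset A >= 1" shows "sum_mset A >= real (size A)"
proof -
 have "prod_mset A > 0 & ln (prod_mset A) <= sum_mset A - real (size A)" using assms(1)
 proof (induction A)
  case (add x A)
  hence "ln (x * prod_mset A) = ln x + ln (prod_mset A)" by (intro ln_mult_pos) auto
  moreover have "ln x <= x - 1" using add by (intro ln_le_minus_one) simp
  ultimately show ?case using add by simp
 qed simp
 moreover have "ln (prod_mset A) >= 0" using assms(2) by simp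
 ultimately show ?thesis by linarith
qed

lemma coeff_prod_linear:
 fixes A :: "'a::idom multiset"
 shows "coeff (\<Prod>x\<in>#A. [:-x, 1:]) (size A) = 1 & (ALL n>size A. coeff (\<Prod>x\<in>#A. [:-x, 1:]) n = 0) &
  (A ~= {#} --> coeff (\<Prod>x\<in>#A. [:-x, 1:]) (size A - 1) = - sum_mset A)"
proof (induction A)
 case (add y A)
 let ?P = "\<Prod>x\<in>#A. [:-x, 1:]"
 have c: "coeff ([:-y, 1:] * ?P) m = - y * coeff ?P m + (case m of 0 => 0 | Suc k => coeff ?P k)" for m
  by (simp add: coeff_pCons)
 have "(case size A of 0 => 0 | Suc k => coeff ?P k) = - sum_mset A"
  using add by (cases "A = {#}") (auto split: nat.split)
 thus ?case using add by (auto simp: coeff_pCons split: nat.split)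
qed (auto simp: coeff_1)

text \<open>If \<open>t P'(t) = - S(t) P(t)\<close> near a nonzero root of \<open>P\<close> with \<open>S\<close> bounded, the order of vanishing of
 the two sides would differ.\<close>

lemma log_deriv_no_root:
 fixes P :: "complex poly"
 assumes P: "P ~= 0" "poly P t0 = 0" and t0: "t0 ~= 0" "norm t0 < \<rho>"
  and S: "!!t. norm t < \<rho> ==> norm (S t) <= B" "!!t. norm t < \<rho> ==> t * poly (pderiv P) t = - S t * poly P t"
 shows False
proof -
 define m where "m = order t0 P"
 have m: "m ~= 0" using P by (simp add: m_def order_root)
 obtain M where M: "P = [:-t0, 1:] ^ m * M" "poly M t0 ~= 0"
  unfolding m_def using order_decomp[OF P(1), of t0] poly_eq_0_iff_dvd by blast
 obtain k where k: "m = Suc k" using m by (cases m) auto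
 let ?f = "%t. t * (of_nat m * poly M t + (t - t0) * poly (pderiv M) t)"
 have eq: "?f t = - S t * (t - t0) * poly M t" if t: "norm t < \<rho>" "t ~= t0" for t
 proof -
  have "poly (pderiv P) t = (t - t0) ^ k * (of_nat m * poly M t + (t - t0) * poly (pderiv M) t)"
  proof -
   have "pderiv P = smult (of_nat m) ([:-t0, 1:] ^ k) * M + [:-t0, 1:] ^ Suc k * pderiv M"
    unfolding M(1) k pderiv_mult pderiv_power_Suc by (simp add: pderiv_pCons mult.commute)
   thus ?thesis by (simp only: poly_add poly_mult poly_smult poly_power) (simp add: algebra_simps)
  qed
  moreover have "poly P t = (t - t0) ^ k * ((t - t0) * poly M t)" unfolding M(1) k by (simp add: algebra_simps)
  ultimately have "(t - t0) ^ k * ?f t = (t - t0) ^ k * (- S t * (t - t0) * poly M t)"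
   using S(2)[OF t(1)] by (simp add: mult_ac)
  moreover have "(t - t0) ^ k ~= 0" using t(2) by simp
  ultimately show ?thesis by (metis mult_left_cancel)
 qed
 have t1: "((%t. norm (?f t)) \<longlongrightarrow> norm (?f t0)) (at t0)"
  by (intro tendsto_intros)
 have t2: "((%t. B * (norm (t - t0) * norm (poly M t))) \<longlongrightarrow> B * (norm (t0 - t0) * norm (poly M t0))) (at t0)"
  by (intro tendsto_intros)
 have ev: "eventually (%t. norm (?f t) <= B * (norm (t - t0) * norm (poly M t))) (at t0)"
 proof -
  have "eventually (%t. norm t < \<rho>) (at t0)"
   using order_tendstoD(2)[OF tendsto_norm[OF tendsto_ident_at] t0(2)] .
  moreover have "eventually (%t. t ~= t0) (at t0)" by (simp add: eventually_at_filter)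
  ultimately show ?thesis
  proof eventually_elim
   case (elim t)
   from eq[OF elim] S(1)[OF elim(1)] show ?case
    by (simp add: norm_mult mult.assoc mult_right_mono)
  qed
 qed
 have "norm (?f t0) <= B * (norm (t0 - t0) * norm (poly M t0))"
  by (rule tendsto_le[OF at_neq_bot t2 t1 ev])
 thus False using t0(1) M(2) m by simp
qed

text \<open>The traces x_i are the roots of a monic integer polynomial \<open>W\<close> of degree
  \<open>g\<close>, and all are real with absolute value at most 2 sqrt q. With m the integer part
  of 2 sqrt q, the numbers m + 1 - x_i are positive and their product \<open>poly W (m + 1)\<close>
  is an integer, so at least 1; hence their sum is at least \<open>g\<close>. The sum of the traces
  is read off from \<open>L 1\<close>.\<close>

theorem serre_bound:
 fixes a N :: "nat => nat" and q g :: nat and C :: real and L :: "nat => int"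
 assumes q: "q >= 2" and a0: "a 0 = 1" and rec: "!!n. n * a n = (SUM r=1..n. N r * a (n - r))"
  and L: "!!n. L n = int (a n) - (int q + 1) * (if n >= 1 then int (a (n - 1)) else 0) + int q * (if n >= 2 then int (a (n - 2)) else 0)"
  and L0: "!!n. n > 2 * g ==> L n = 0" and Lsym: "!!n. n <= g ==> L (2 * g - n) = int q ^ (g - n) * L n"
  and bound: "!!r. r >= 1 ==> \<bar>real (N r) - real q ^ r\<bar> <= C * sqrt (real q) ^ r"
 shows "real q + 1 - real g * of_int \<lfloor>2 * sqrt (real q)\<rfloor> <= real (N 1)"
proof -
 \<comment> \<open>The power sums of the Frobenius eigenvalues. The value 0 at \<open>r = 0\<close>
   makes the generating series minus T times the logarithmic derivative of the L-polynomial.\<close>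
 define s where "s r = (if r = 0 then 0 else real q ^ r + 1 - real (N r))" for r
 have LL0: "L 0 = 1" by (simp add: L a0)
 have L1: "L 1 = int (N 1) - (int q + 1)" using rec[of 1] by (simp add: L a0)
 \<comment> \<open>Newton's identities, from T L' = - S L as formal power series; \<open>G1\<close>
   and \<open>Gq\<close> are the contributions of the factors 1 - T and 1 - q T.\<close>
 have newton: "real n * of_int (L n) = - (SUM i<=n. s i * of_int (L (n - i)))" for n
 proof -
  define A NN G1 Gq LL where "A = Abs_fps (%n. real (a n))" and "NN = Abs_fps (%r. if r = 0 then 0 else real (N r))"
   and "G1 = Abs_fps (%r. if r = 0 then 0 else 1 :: real)" and "Gq = Abs_fps (%r. if r = 0 then 0 else real q ^ r)"
   and "LL = A * (1 - fps_X) * (1 - fps_const (real q) * fps_X)"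
  have A': "fps_X * fps_deriv A = NN * A"
  proof (rule fps_ext)
   fix n
   have "(NN * A) $ n = (SUM i=0..n. (if i = 0 then 0 else real (N i)) * real (a (n - i)))"
    by (simp add: fps_mult_nth NN_def A_def)
   also have "... = (SUM i=1..n. real (N i) * real (a (n - i)))"
    by (rule sum.mono_neutral_cong_right) auto
   also have "... = real (n * a n)" unfolding rec by simp
   also have "... = (fps_X * fps_deriv A) $ n" by (cases n) (simp_all add: A_def algebra_simps)
   finally show "(fps_X * fps_deriv A) $ n = (NN * A) $ n" by simp
  qed
  have g1: "(1 - fps_X) * G1 = fps_X"
  proof (rule fps_ext)
   fix n show "((1 - fps_X) * G1) $ n = fps_X $ n"
    by (cases n; cases "n - 1") (simp_all add: G1_def left_diff_distrib)
  qed
  have gq: "(1 - fps_const (real q) * fps_X) * Gq = fps_const (real q) * fps_X"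
  proof (rule fps_ext)
   fix n show "((1 - fps_const (real q) * fps_X) * Gq) $ n = (fps_const (real q) * fps_X) $ n"
    by (cases n; cases "n - 1") (simp_all add: Gq_def left_diff_distrib mult.assoc)
  qed
  have "fps_X * fps_deriv LL = (fps_X * fps_deriv A) * (1 - fps_X) * (1 - fps_const (real q) * fps_X)
   - fps_X * A * (1 - fps_const (real q) * fps_X) - (fps_const (real q) * fps_X) * A * (1 - fps_X)"
   unfolding LL_def by (simp add: algebra_simps)
  also have "... = NN * LL - ((1 - fps_X) * G1) * A * (1 - fps_const (real q) * fps_X)
   - ((1 - fps_const (real q) * fps_X) * Gq) * A * (1 - fps_X)"
   unfolding A' g1 gq by (simp add: LL_def)
  also have "... = - ((G1 + Gq - NN) * LL)" unfolding LL_def by (simp add: algebra_simps)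
  finally have "(fps_X * fps_deriv LL) $ n = - ((G1 + Gq - NN) * LL) $ n" by simp
  moreover have LLn: "LL $ n = of_int (L n)" for n
  proof -
   have e: "LL = A - fps_const (real q + 1) * (fps_X * A) + fps_const (real q) * (fps_X * (fps_X * A))"
    unfolding LL_def by (simp add: algebra_simps flip: fps_const_add)
   show ?thesis unfolding e
    by (cases n; cases "n - 1") (simp_all add: A_def L Suc_le_eq numeral_2_eq_2)
  qed
  moreover have "(fps_X * fps_deriv LL) $ n = real n * LL $ n" by (cases n) simp_all
  moreover have "(G1 + Gq - NN) $ i = s i" for i by (simp add: G1_def Gq_def NN_def s_def)
  ultimately show ?thesis by (simp add: fps_mult_nth atLeast0AtMost)
 qed
 define P where "P = (SUM n<=2 * g. monom (of_int (L n)) n :: complex poly)"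
 have cP: "coeff P n = of_int (L n)" for n
  using L0[of n] by (auto simp: P_def coeff_sum)
 have pP: "poly P t = (SUM n<=2*g. of_int (L n) * t ^ n)" for t
  by (simp add: P_def poly_sum poly_monom)
 have P0: "P ~= 0" using cP[of 0] LL0 by auto
 \<comment> \<open>By the estimate for \<open>N\<close> the series of the \<open>s r\<close>
   converges for |t| < 1 / sqrt q and is bounded on each smaller disc, so \<open>P\<close> has no
   zero there. The functional equation will give the opposite inequality.\<close>
 have rh: "norm t >= 1 / sqrt q" if t: "poly P t = 0" for t
 proof (rule ccontr)
  assume "~ norm t >= 1 / sqrt q"
  hence lt: "norm t < 1 / sqrt q" by simp
  then obtain \<rho> where \<rho>: "norm t < \<rho>" "\<rho> < 1 / sqrt q" using dense by blast
  define \<theta> where "\<theta> = sqrt q * \<rho>"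
  have "0 <= \<rho>" using \<rho>(1) norm_ge_zero[of t] by linarith
  hence \<theta>: "0 <= \<theta>" "\<theta> < 1" using \<rho>(2) q by (auto simp: \<theta>_def field_simps)
  have C: "\<bar>s r\<bar> <= (\<bar>C\<bar> + 1) * sqrt q ^ r" for r
  proof (cases "r = 0")
   case False
   have "\<bar>s r\<bar> <= 1 + \<bar>real (N r) - real q ^ r\<bar>" using False by (simp add: s_def)
   also have "... <= 1 + C * sqrt q ^ r" using bound[of r] False by simp
   also have "... <= sqrt q ^ r + \<bar>C\<bar> * sqrt q ^ r"
    using q by (intro add_mono mult_right_mono) (auto intro: one_le_power)
   finally show ?thesis by (simp add: algebra_simps)
  qed (simp add: s_def)
  have nb: "norm (of_real (s r) * u ^ r) <= (\<bar>C\<bar> + 1) * \<theta> ^ r" if u: "norm u < \<rho>" for u :: complex and r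
  proof -
   have "norm (of_real (s r) * u ^ r) = \<bar>s r\<bar> * norm u ^ r" by (simp add: norm_mult norm_power)
   also have "... <= ((\<bar>C\<bar> + 1) * sqrt q ^ r) * \<rho> ^ r"
    using C u by (intro mult_mono power_mono) auto
   finally show ?thesis by (simp add: \<theta>_def power_mult_distrib)
  qed
  have gsum: "summable (%r. (\<bar>C\<bar> + 1) * \<theta> ^ r)" using \<theta> by (intro summable_mult summable_geometric) auto
  define S where "S u = (\<Sum>r. of_real (s r) * u ^ r)" for u :: complex
  show False
  proof (rule log_deriv_no_root[OF P0 t, of \<rho> S "\<Sum>r. (\<bar>C\<bar> + 1) * \<theta> ^ r"])
   show "t ~= 0" using t cP[of 0] LL0 by (auto simp: poly_0_coeff_0)
   show "norm t < \<rho>" by fact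
   fix u :: complex assume u: "norm u < \<rho>"
   show "norm (S u) <= (\<Sum>r. (\<bar>C\<bar> + 1) * \<theta> ^ r)"
    unfolding S_def by (rule norm_suminf_le[OF nb[OF u] gsum])
   have s1: "summable (%r. norm (of_real (s r) * u ^ r))"
    using nb[OF u] by (intro summable_comparison_test'[OF gsum, of 0]) auto
   have s2: "summable (%n. norm (of_int (L n) * u ^ n))"
    using L0 by (intro summable_finite[of "{..2*g}"]) (auto simp: not_le)
   have "(%k. SUM i<=k. (of_real (s i) * u ^ i) * (of_int (L (k - i)) * u ^ (k - i))) sums (S u * (\<Sum>n. of_int (L n) * u ^ n))"
    unfolding S_def by (rule Cauchy_product_sums[OF s1 s2])
   also have "(%k. SUM i<=k. (of_real (s i) * u ^ i) * (of_int (L (k - i)) * u ^ (k - i))) = (%k. - (of_nat k * of_int (L k) * u ^ k))"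
   proof
    fix k
    have "(SUM i<=k. (of_real (s i) * u ^ i) * (of_int (L (k - i)) * u ^ (k - i))) = (SUM i<=k. of_real (s i * of_int (L (k - i))) * u ^ k)"
     by (intro sum.cong) (auto simp: mult_ac simp flip: power_add)
    also have "... = of_real (- (real k * of_int (L k))) * u ^ k"
     unfolding newton by (simp add: sum_distrib_right)
    finally show "(SUM i<=k. (of_real (s i) * u ^ i) * (of_int (L (k - i)) * u ^ (k - i))) = - (of_nat k * of_int (L k) * u ^ k)"
     by simp
   qed
   also have "(\<Sum>n. of_int (L n) * u ^ n) = poly P u"
    unfolding pP by (rule suminf_finite) (use L0 in auto)
   finally have 1: "(%k. - (of_nat k * of_int (L k) * u ^ k)) sums (S u * poly P u)" .
   have "(%k. - (of_nat k * of_int (L k) * u ^ k)) sums (SUM k<=2*g. - (of_nat k * of_int (L k) * u ^ k))"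
    by (rule sums_finite) (use L0 in auto)
   with 1 have "S u * poly P u = (SUM k<=2*g. - (of_nat k * of_int (L k) * u ^ k))" by (rule sums_unique2)
   moreover have "u * poly (pderiv P) u = (SUM k<=2*g. of_nat k * of_int (L k) * u ^ k)"
   proof -
    have "pderiv P = (SUM n<=2 * g. pderiv (monom (of_int (L n)) n))"
     unfolding P_def using higher_pderiv_sum[of 1 "%n. monom (of_int (L n)) n" "{..2*g}"] by simp
    hence "u * poly (pderiv P) u = (SUM n<=2 * g. u * poly (pderiv (monom (of_int (L n)) n)) u)"
     by (simp add: poly_sum sum_distrib_left)
    also have "... = (SUM k<=2*g. of_nat k * of_int (L k) * u ^ k)"
     by (intro sum.cong refl) (simp add: pderiv_monom poly_monom power_eq_if)
    finally show ?thesis .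
   qed
   ultimately show "u * poly (pderiv P) u = - S u * poly P u" by (simp add: sum_negf)
  qed
 qed
 show ?thesis
 proof (cases "g = 0")
  case True
  hence "L 1 = 0" using L0 by simp
  hence "int (N 1) = int q + 1" using L1 by simp
  hence "real (N 1) = real q + 1" by linarith
  thus ?thesis by simp
 next
  case False
  \<comment> \<open>The functional equation pairs the coefficients of index n and 2 g - n; in the
    variable z + q/z each pair becomes one Dickson polynomial. The exact relation to
    \<open>P\<close> is \<open>WP\<close>.\<close>
  define W where "W = [:L g:] + (SUM n<g. smult (L n) (dickson q (g - n)))"
  have cW: "coeff W k = (if k = 0 then L g else 0) + (SUM n<g. L n * coeff (dickson q (g - n)) k)" for k
   by (simp add: W_def coeff_sum coeff_pCons split: nat.split)
  have Wg: "coeff W g = 1"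
  proof -
   have "(SUM n<g. L n * coeff (dickson q (g - n)) g) = (SUM n:{0}. L n * coeff (dickson q (g - n)) g)"
    using False coeff_dickson by (intro sum.mono_neutral_right) auto
   thus ?thesis using False coeff_dickson[of g q] by (simp add: cW LL0)
  qed
  have Wgt: "coeff W k = 0" if "k > g" for k
   using that coeff_dickson by (auto simp: cW)
  have Wg1: "coeff W (g - 1) = L 1"
  proof (cases "g = 1")
   case True
   thus ?thesis by (simp add: cW)
  next
   case F: False
   have "(SUM n<g. L n * coeff (dickson q (g - n)) (g - 1)) = (SUM n:{0, 1}. L n * coeff (dickson q (g - n)) (g - 1))"
    using False F coeff_dickson by (intro sum.mono_neutral_right) auto
   thus ?thesis using False F coeff_dickson[of g q] coeff_dickson[of "g - 1" q] by (simp add: cW)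
  qed
  have degW: "degree W = g" using Wg Wgt by (intro antisym degree_le le_degree) auto
  let ?W = "cpoly W :: complex poly"
  have cW': "coeff ?W k = of_int (coeff W k)" for k by (simp add: coeff_map_poly)
  have degW': "degree ?W = g" using Wg Wgt cW' by (intro antisym degree_le le_degree) auto
  hence lW': "lead_coeff ?W = 1" using Wg cW' by simp
  have WP: "poly P (1 / z) * z ^ (2 * g) = z ^ g * poly ?W (z + of_nat q / z)" if z: "z ~= 0" for z
  proof -
   have "poly ?W (z + of_nat q / z) = of_int (L g) + (SUM n<g. of_int (L n) * (z ^ (g - n) + (of_nat q / z) ^ (g - n)))"
    using poly_dickson[OF z, of "int q"]
    by (simp add: W_def of_int_hom.mp_add of_int_hom.mp_sum poly_sum of_int_hom.mp_smult of_int_hom.mp_pCons)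
   moreover have "z ^ g * z ^ (g - n) = z ^ (2 * g - n)" if "n < g" for n
    using that by (simp flip: power_add add: mult_2)
   ultimately have "z ^ g * poly ?W (z + of_nat q / z) = of_int (L g) * z ^ g + (SUM n<g. of_int (L n) * z ^ (2 * g - n))
     + (SUM n<g. of_int (L n) * (z ^ g * (of_nat q / z) ^ (g - n)))"
    by (simp add: distrib_left sum_distrib_left sum.distrib mult.left_commute[of "z ^ g"])
   also have "(SUM n<g. of_int (L n) * (z ^ g * (of_nat q / z) ^ (g - n))) = (SUM n<g. of_int (L (2 * g - n)) * z ^ n)"
   proof (rule sum.cong[OF refl])
    fix n assume "n : {..<g}"
    hence n: "n < g" by simp
    have "z ^ g = z ^ n * z ^ (g - n)" using n by (simp flip: power_add)
    thus "of_int (L n) * (z ^ g * (of_nat q / z) ^ (g - n)) = of_int (L (2 * g - n)) * z ^ n"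
     using n z Lsym[of n] by (simp add: power_divide)
   qed
   also have "(SUM n<g. of_int (L (2 * g - n)) * z ^ n) = (SUM n:{g<..2*g}. of_int (L n) * z ^ (2 * g - n))"
    by (rule sum.reindex_bij_witness[of _ "%n. 2 * g - n" "%n. 2 * g - n"]) auto
   also have "of_int (L g) * z ^ g + (SUM n<g. of_int (L n) * z ^ (2 * g - n)) = (SUM n<=g. of_int (L n) * z ^ (2 * g - n))"
    by (simp add: lessThan_Suc_atMost[symmetric])
   also have "... + (SUM n:{g<..2*g}. of_int (L n) * z ^ (2 * g - n)) = (SUM n<=2*g. of_int (L n) * z ^ (2 * g - n))"
    by (subst sum.union_disjoint[symmetric]) (auto intro!: sum.cong)
   also have "... = poly P (1 / z) * z ^ (2 * g)"
    unfolding pP sum_distrib_right using z by (intro sum.cong) (auto simp: power_diff field_simps)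
   finally show ?thesis by simp
  qed
  have root: "x : \<real> & \<bar>Re x\<bar> <= 2 * sqrt q" if x: "poly ?W x = 0" for x
  proof -
   \<comment> \<open>A root of z^2 - x z + q, chosen so that x = z + q/z.\<close>
   define z where "z = (x + csqrt (x\<^sup>2 - 4 * of_nat q)) / 2"
   have z2: "z\<^sup>2 - x * z + of_nat q = 0"
   proof -
    define s where "s = csqrt (x\<^sup>2 - 4 * of_nat q)"
    have "4 * (z\<^sup>2 - x * z + of_nat q) = s\<^sup>2 - (x\<^sup>2 - 4 * of_nat q)"
     unfolding z_def s_def[symmetric] by (simp add: field_simps power2_eq_square)
    hence "4 * (z\<^sup>2 - x * z + of_nat q) = 0" unfolding s_def by simp
    thus ?thesis by (metis mult_eq_0_iff zero_neq_numeral)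
   qed
   hence z: "z ~= 0" using q by auto
   have xz: "x = z + of_nat q / z" using z2 z by (simp add: field_simps power2_eq_square)
   \<comment> \<open>This applies to z and to q/z, whose product is q. Both therefore have absolute
     value sqrt q, so q/z is the conjugate of z and x is real.\<close>
   have le: "norm u <= sqrt q" if u: "u ~= 0" "x = u + of_nat q / u" for u
   proof -
    have "poly P (1 / u) = 0" using WP[OF u(1)] x u by simp
    hence "norm (1 / u) >= 1 / sqrt q" by (rule rh)
    thus ?thesis using u(1) q by (simp add: norm_divide field_simps)
   qed
   have "norm z <= sqrt q" using le[OF z xz] .
   moreover have "norm (of_nat q / z) <= sqrt q" using le[of "of_nat q / z"] xz z q by simp
   hence "sqrt q * sqrt q <= sqrt q * norm z" using z by (simp add: norm_divide field_simps)
   hence "sqrt q <= norm z" by (rule mult_left_le_imp_le) (use q in simp)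
   ultimately have nz: "norm z = sqrt q" by simp
   have "z * cnj z = of_nat q" using complex_norm_square[of z] nz by simp
   hence "of_nat q / z = cnj z" using z by (simp add: field_simps)
   hence "x = of_real (2 * Re z)" using xz by (simp add: complex_add_cnj)
   thus ?thesis using abs_Re_le_cmod[of z] nz by simp
  qed
  obtain A where A: "size A = degree ?W" "?W = smult (lead_coeff ?W) (\<Prod>x\<in>#A. [:-x, 1:])"
   using alg_closed_imp_factorization[of ?W] degW' False by (metis degree_0)
  hence W: "?W = (\<Prod>x\<in>#A. [:-x, 1:])" "size A = g" using degW' lW' by auto
  have rA: "x : \<real> & \<bar>Re x\<bar> <= 2 * sqrt q" if x: "x \<in># A" for x
  proof (rule root)
   obtain B where "A = add_mset x B" using x by (metis insert_DiffM)
   thus "poly ?W x = 0" unfolding W by simp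
  qed
  define m where "m = \<lfloor>2 * sqrt (real q)\<rfloor>"
  have pos: "of_int m + 1 - Re x > 0" if "x \<in># A" for x
   using rA[OF that] unfolding m_def by linarith
  have "complex_of_int (poly W (m + 1)) = poly ?W (of_int (m + 1))" by (simp only: of_int_hom.mp_eval)
  also have "... = (\<Prod>x\<in>#A. of_int (m + 1) - x)" unfolding W by (simp add: poly_prod_mset)
  also have "... = (\<Prod>x\<in>#A. of_real (of_int m + 1 - Re x))"
  proof (intro arg_cong[of _ _ prod_mset] image_mset_cong)
   fix x assume "x \<in># A"
   hence "x = of_real (Re x)" using rA by auto
   thus "of_int (m + 1) - x = complex_of_real (of_int m + 1 - Re x)" by (metis of_int_1 of_int_add of_real_diff of_real_of_int_eq)
  qed
  also have "... = of_real (\<Prod>x\<in>#A. of_int m + 1 - Re x)" by (induction A) simp_all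
  finally have ev: "real_of_int (poly W (m + 1)) = (\<Prod>x\<in>#A. of_int m + 1 - Re x)"
   by (metis of_real_eq_iff of_real_of_int_eq)
  have "(\<Prod>x\<in>#A. of_int m + 1 - Re x) > 0" using pos by (induction A) simp_all
  \<comment> \<open>Integrality enters here: a positive integer is at least 1. This is what allows 2
    sqrt q to be replaced by its integer part.\<close>
  hence "poly W (m + 1) >= 1" using ev by (metis of_int_0_less_iff int_one_le_iff_zero_less)
  hence ge1: "(\<Prod>x\<in>#A. of_int m + 1 - Re x) >= 1" using ev by (metis of_int_1_le_iff)
  have "real (size (image_mset (%x. of_int m + 1 - Re x) A)) <= (\<Sum>x\<in>#A. of_int m + 1 - Re x)"
   using pos ge1 by (intro sum_mset_ge_size) auto
  also have "(\<Sum>x\<in>#A. of_int m + 1 - Re x) = real (size A) * (of_int m + 1) - Re (sum_mset A)"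
   by (induction A) (simp_all add: algebra_simps)
  finally have "real g <= real g * (of_int m + 1) - Re (sum_mset A)" using W(2) by simp
  moreover have "of_int (L 1) = - sum_mset A"
   using coeff_prod_linear[of A] W False Wg1 cW'[of "g - 1"] by auto
  hence "Re (sum_mset A) = - of_int (L 1)" by (metis Re_complex_of_real add.inverse_inverse of_real_of_int_eq uminus_complex.sel(1))
  ultimately have "- of_int (L 1) <= real g * of_int m" by (simp add: algebra_simps)
  thus ?thesis using L1 by (simp add: m_def)
 qed
qed

context zeta
begin

text \<open>The point estimate is used twice: besides feeding \<open>serre_bound\<close>, it makes
  \<open>npts\<close> positive for two consecutive large arguments, which provides the divisor of
  degree one behind the functional equation.\<close>

theorem hasse_weil_serre:
 assumes bound: "!!r. r >= 1 ==> \<bar>real (npts r) - real q ^ r\<bar> <= C * sqrt (real q) ^ r"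
 shows "real q + 1 - real g * of_int \<lfloor>2 * sqrt (real q)\<rfloor> <= real (npts 1)"
proof -
 have q1: "real q > 1" using q_gt_1 by simp
 have pos: "npts r > 0" if r: "r >= 1" "C < sqrt (real q) ^ r" for r
 proof (rule ccontr)
  assume "~ npts r > 0"
  hence "real q ^ r <= C * sqrt (real q) ^ r" using bound[OF r(1)] by simp
  also have "... < sqrt (real q) ^ r * sqrt (real q) ^ r" using r(2) q1 by (intro mult_strict_right_mono) auto
  also have "... = real q ^ r" by (simp flip: power_mult_distrib)
  finally show False by simp
 qed
 have "sqrt (real q) > 1" using q1 by simp
 then obtain r0 where r0: "C < sqrt (real q) ^ r0" using real_arch_pow by blast
 have Cr: "C < sqrt (real q) ^ r" if "r >= r0" for r
  using r0 power_increasing[OF that, of "sqrt (real q)"] \<open>sqrt (real q) > 1\<close> by linarith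
 hence "npts (Suc r0) > 0" "npts (Suc (Suc r0)) > 0" using pos Cr[of "Suc r0"] Cr[of "Suc (Suc r0)"] by simp_all
 hence d1: "EX D. fr D & dg D = 1" using degree_one[of "Suc r0"] by blast
 define L where "L n = lc (int n)" for n
 have lcneg: "lc m = 0" if "m < 0" for m using that by (simp add: lc_def la_def)
 show ?thesis
 proof (rule serre_bound[of q nideals npts L g C, OF _ nideals_0 nideals_rec _ _ _ bound])
  show "2 <= q" using q_gt_1 by simp
  show "L n = int (nideals n) - (int q + 1) * (if 1 <= n then int (nideals (n - 1)) else 0) + int q * (if 2 <= n then int (nideals (n - 2)) else 0)" for n
   by (simp add: L_def lc_def la_def nat_diff_distrib)
  show "L n = 0" if "n > 2 * g" for n
   using lc_sym[OF d1, of "2 * int g - int n"] lcneg[of "2 * int g - int n"] that by (simp add: L_def)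
  show "L (2 * g - n) = int q ^ (g - n) * L n" if "n <= g" for n
  proof -
   have "nat (int g - int n) = g - n" by arith
   thus ?thesis using lc_sym[OF d1, of "int n"] that by (simp add: L_def)
  qed
 qed
qed

end

section \<open>Finite fields inside an algebraic closure\<close>

lemma finite_field_card_gt_1: "CARD('a::{finite,field}) > 1"
proof -
 have "card {0, 1 :: 'a} <= CARD('a)" by (rule card_mono) auto
 thus ?thesis by simp
qed

lemma finite_field_power_card: "(x::'a::{finite,field}) ^ CARD('a) = x"
proof (cases "x = 0")
 case False
 let ?U = "UNIV - {0::'a}"
 have "bij_betw (%y. x * y) ?U ?U"
  by (rule bij_betw_byWitness[of _ "%y. y / x"]) (use False in auto)
 hence "(PROD y:?U. x * y) = (PROD y:?U. y)" by (rule prod.reindex_bij_betw)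
 hence e: "x ^ card ?U * (PROD y:?U. y) = 1 * (PROD y:?U. y)" by (simp add: prod.distrib)
 have nz: "(PROD y:?U. y) ~= 0" by simp
 have "x ^ card ?U = 1" by (rule mult_right_cancel[OF nz, THEN iffD1, OF e])
 moreover have "CARD('a) = Suc (card ?U)" using card_Suc_Diff1[of "UNIV :: 'a set" 0] by (simp only: finite UNIV_I)
 ultimately show ?thesis by (simp only: power_Suc mult_1_right)
qed (use finite_field_card_gt_1[where 'a = 'a] in simp)

lemma finite_field_power_card_power: "(x::'a::{finite,field}) ^ (CARD('a) ^ m) = x"
 by (induction m) (simp_all add: power_mult finite_field_power_card)

text \<open>The polynomial (X + 1)^q - X^q - 1 has degree below q and vanishes at all q elements of
  the field, so all its coefficients are zero.\<close>

lemma finite_field_binomial_0: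
 assumes "0 < i" "i < CARD('a::{finite,field})" shows "of_nat (CARD('a) choose i) = (0::'a)"
proof -
 let ?q = "CARD('a)"
 define G where "G = [:1, 1::'a:] ^ ?q - monom 1 ?q - 1"
 have cG: "coeff G k = (if k <= ?q then of_nat (?q choose k) else 0) - (if k = ?q then 1 else 0) - (if k = 0 then 1 else 0)" for k
  using coeff_linear_poly_power[of k ?q 1 "1::'a"] degree_power_le[of "[:1, 1::'a:]" ?q] by (auto simp: G_def intro: coeff_eq_0)
 have "poly G a = 0" for a
  by (simp add: G_def poly_monom finite_field_power_card)
 hence "{a. poly G a = 0} = UNIV" by auto
 moreover have "degree G < ?q"
  using finite_field_card_gt_1[where 'a = 'a] by (intro degree_lessI) (auto simp: cG)
 ultimately have "G = 0" using card_poly_roots_bound[of G] by fastforce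
 thus ?thesis using cG[of i] assms by simp
qed

lemma frob_add:
 fixes h :: "'a::{finite,field} => 'r::comm_ring_1"
 assumes "crhom h" shows "((x::'r) + y) ^ CARD('a) = x ^ CARD('a) + y ^ CARD('a)"
proof -
 interpret crhom h by fact
 let ?q = "CARD('a)"
 have "of_nat k = h (of_nat k)" for k by (induction k) (simp_all add: h_add)
 hence z: "of_nat (?q choose i) = (0::'r)" if "0 < i" "i < ?q" for i
  using finite_field_binomial_0[OF that] by simp
 have "(x + y) ^ ?q = (SUM i<=?q. of_nat (?q choose i) * x ^ i * y ^ (?q - i))" by (rule binomial_ring)
 also have "... = (SUM i:{0, ?q}. of_nat (?q choose i) * x ^ i * y ^ (?q - i))"
  using z by (intro sum.mono_neutral_right) auto
 finally show ?thesis by simp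
qed

lemma crhom_frob:
 fixes h :: "'a::{finite,field} => 'r::comm_ring_1"
 assumes "crhom h" shows "crhom (%x::'r. x ^ (CARD('a) ^ m))"
proof (induction m)
 case (Suc m)
 have "crhom (%x::'r. x ^ CARD('a))"
  by unfold_locales (simp_all add: frob_add[OF assms] power_mult_distrib)
 from crhom_comp[OF Suc this] show ?case by (simp add: mult.commute flip: power_mult)
qed (simp add: crhom_def)

lemma crhom_to_ac: "crhom (to_ac :: 'a::field => _)"
 by unfold_locales simp_all

interpretation to_ac: crhom "to_ac :: 'a::field => 'a alg_closure"
 by (rule crhom_to_ac)

interpretation frob: crhom "%x::'a::{finite,field} alg_closure. x ^ (CARD('a) ^ m)" for m
 by (rule crhom_frob[OF crhom_to_ac])

lemma frob_inj: "(x::'a::{finite,field} alg_closure) ^ (CARD('a) ^ m) = y ^ (CARD('a) ^ m) \<longleftrightarrow> x = y"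
 using frob.h_diff[of x y m] by auto

text \<open>The field with \<open>q^m\<close> elements, as a subset of the algebraic closure of the field with \<open>q\<close> elements.\<close>

definition kf :: "nat => 'a::{finite,field} alg_closure set" where
 "kf m = {x. x ^ (CARD('a) ^ m) = x}"

lemma kf_0 [simp]: "0 : kf m" "1 : kf m"
 by (auto simp: kf_def)

lemma to_ac_kf [simp]: "to_ac a : kf m"
 by (simp add: kf_def flip: to_ac_power) (simp add: finite_field_power_card_power)

lemma kf_1: "kf 1 = range (to_ac :: 'a::{finite,field} => _)"
proof -
 let ?q = "CARD('a)"
 let ?P = "monom 1 ?q - [:0, 1:] :: 'a alg_closure poly"
 have P: "?P ~= 0"
 proof -
  have "coeff ?P ?q = 1" using finite_field_card_gt_1[where 'a = 'a] by (simp add: coeff_pCons split: nat.split)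
  thus ?thesis by (metis coeff_0 zero_neq_one)
 qed
 have "degree ?P <= ?q" using finite_field_card_gt_1[where 'a = 'a] by (intro degree_diff_le degree_monom_le) auto
 have roots: "{x. poly ?P x = 0} = kf 1" by (auto simp: kf_def poly_monom)
 have "card (kf 1 :: 'a alg_closure set) <= ?q" using card_poly_roots_bound[OF P] \<open>degree ?P \<le> ?q\<close> roots by simp
 moreover have "range to_ac <= (kf 1 :: 'a alg_closure set)" by auto
 moreover have "card (range (to_ac :: 'a => _)) = ?q" by (rule card_image[OF inj_to_ac])
 moreover have "finite (kf 1 :: 'a alg_closure set)" using poly_roots_finite[OF P] roots by simp
 ultimately show ?thesis by (metis card_seteq)
qed

lemma alg_closed_card_roots:
 fixes P :: "'b::alg_closed_field poly"
 assumes "P ~= 0" "!!x. poly P x = 0 ==> poly (pderiv P) x ~= 0"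
 shows "card {x. poly P x = 0} = degree P"
proof -
 obtain A where A: "size A = degree P" "P = smult (lead_coeff P) (\<Prod>x\<in>#A. [:-x, 1:])"
  using alg_closed_imp_factorization[OF assms(1)] by blast
 have c1: "count A x <= 1" for x
 proof (rule ccontr)
  assume "~ count A x <= 1"
  hence "{#x, x#} <=# A" by (simp add: subseteq_mset_def)
  then obtain B where B: "A = add_mset x (add_mset x B)" by (metis mset_subset_eq_exists_conv union_mset_add_mset_left)
  have "P = [:-x, 1:] * ([:-x, 1:] * smult (lead_coeff P) (\<Prod>y\<in>#B. [:-y, 1:]))"
   by (subst A(2)) (simp add: B mult_ac)
  then obtain Q where Q: "P = [:-x, 1:] * ([:-x, 1:] * Q)" by blast
  have "poly P x = 0" "poly (pderiv P) x = 0" unfolding Q by (simp_all add: pderiv_mult del: mult_pCons_left)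
  thus False using assms(2) by blast
 qed
 have "poly P x = 0 \<longleftrightarrow> x \<in># A" for x
 proof -
  have "poly P x = lead_coeff P * (\<Prod>y\<in>#A. x - y)" by (subst A(2)) (simp add: poly_prod_mset image_mset.compositionality o_def)
  also have "... = 0 \<longleftrightarrow> x \<in># A" using assms(1) by auto
  finally show ?thesis .
 qed
 hence "{x. poly P x = 0} = set_mset A" by auto
 moreover have "card (set_mset A) = size A"
 proof -
  have "size A = (SUM x:set_mset A. count A x)" by (simp add: size_multiset_overloaded_eq)
  also have "... = (SUM x:set_mset A. 1)"
   using c1 by (intro sum.cong) (auto simp: le_antisym Suc_le_eq)
  finally show ?thesis by simp
 qed
 ultimately show ?thesis using A(1) by simp
qed

lemma alg_closed_exists_root:
 fixes P :: "'b::alg_closed_field poly"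
 assumes "degree P > 0" shows "EX x. poly P x = 0"
 using alg_closed_imp_poly_has_root assms by blast

lemma of_nat_card_power_0:
 fixes dummy :: "'a::{finite,field} alg_closure"
 assumes "m > 0" shows "of_nat (CARD('a) ^ m) = (0 :: 'a alg_closure)"
proof -
 have "of_nat CARD('a) = (0::'a)"
  using finite_field_binomial_0[of 1, where 'a = 'a] finite_field_card_gt_1[where 'a = 'a] by simp
 hence "of_nat CARD('a) = (0 :: 'a alg_closure)" by (metis to_ac_0 to_ac_of_nat)
 thus ?thesis using assms by simp
qed

lemma card_kf:
 assumes "m > 0" shows "card (kf m :: 'a::{finite,field} alg_closure set) = CARD('a) ^ m" "finite (kf m :: 'a alg_closure set)"
proof -
 let ?Q = "CARD('a) ^ m"
 have Q: "?Q > 1" using finite_field_card_gt_1[where 'a = 'a] assms by (rule one_less_power)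
 let ?P = "monom 1 ?Q - [:0, 1:] :: 'a alg_closure poly"
 have dP: "degree ?P = ?Q"
  using Q assms by (intro antisym degree_diff_le degree_monom_le le_degree) (auto simp: coeff_pCons simp del: One_nat_def split: nat.split)
 hence P: "?P ~= 0" by auto
 have "pderiv ?P = - 1" using of_nat_card_power_0[OF assms, where 'a = 'a]
  by (simp add: pderiv_diff pderiv_monom pderiv_pCons one_pCons del: of_nat_power)
 hence "card {x. poly ?P x = 0} = degree ?P" by (intro alg_closed_card_roots[OF P]) simp
 moreover have roots: "{x. poly ?P x = 0} = kf m" by (auto simp: kf_def poly_monom)
 ultimately show "card (kf m :: 'a alg_closure set) = ?Q" using dP by simp
 show "finite (kf m :: 'a alg_closure set)" using poly_roots_finite[OF P] roots by simp
qed

lemma kf_mult: "x : kf m ==> x : kf (m * k)"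
proof (induction k)
 case (Suc k)
 thus ?case by (simp add: kf_def power_add power_mult)
qed (simp add: kf_def)

lemma kf_add_iff: "x : kf m ==> x : kf (m + k) \<longleftrightarrow> x : kf k"
 by (simp add: kf_def power_add power_mult)

lemma frob_lift: "map_poly (%x. x ^ (CARD('a) ^ m)) (map_poly to_ac p) = map_poly to_ac (p :: 'a::{finite,field} poly)"
 by (subst map_poly_map_poly) (auto intro!: map_poly_cong simp: finite_field_power_card_power simp flip: to_ac_power)

lemma frob_cycle:
 fixes x :: "'a::{finite,field} alg_closure"
 assumes "i < j" "x ^ (CARD('a) ^ i) = x ^ (CARD('a) ^ j)" shows "x : kf (j - i)"
proof -
 have "CARD('a) ^ j = CARD('a) ^ (j - i) * CARD('a) ^ i" using assms(1) by (simp flip: power_add)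
 hence "x ^ (CARD('a) ^ i) = (x ^ (CARD('a) ^ (j - i))) ^ (CARD('a) ^ i)" using assms(2) by (simp add: power_mult)
 hence "x = x ^ (CARD('a) ^ (j - i))" by (simp only: frob_inj)
 thus ?thesis by (simp add: kf_def)
qed

lemma frob_orbit_inj:
 fixes x :: "'a::{finite,field} alg_closure"
 assumes "!!j. 0 < j ==> j < m ==> x ~: kf j" shows "inj_on (%i. x ^ (CARD('a) ^ i)) {..<m}"
proof (rule linorder_inj_onI)
 fix i j assume "i < j" "i : {..<m}" "j : {..<m}"
 thus "x ^ (CARD('a) ^ i) ~= x ^ (CARD('a) ^ j)" using frob_cycle[of i j x] assms[of "j - i"] by auto
qed auto

lemma finite_degree_le: "finite {p :: 'a::{finite,field} poly. degree p <= n}"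
proof (rule finite_subset)
 show "{p :: 'a poly. degree p <= n} <= (%c. SUM i<=n. monom (c i) i) ` ({..n} \<rightarrow>\<^sub>E UNIV)"
 proof
  fix p :: "'a poly" assume "p : {p. degree p <= n}"
  hence "p = (SUM i<=n. monom (restrict (coeff p) {..n} i) i)" using poly_as_sum_of_monoms'[of p n] by simp
  thus "p : (%c. SUM i<=n. monom (c i) i) ` ({..n} \<rightarrow>\<^sub>E UNIV)"
   by (rule image_eqI[where x = "restrict (coeff p) {..n}"]) simp
 qed
 show "finite ((%c. SUM i<=n. monom (c i) i) ` ({..n} \<rightarrow>\<^sub>E (UNIV :: 'a set)))" by (intro finite_imageI finite_PiE) auto
qed

lemma kf_exists: "EX m>0. (x::'a::{finite,field} alg_closure) : kf m"
proof -
 let ?q = "CARD('a)"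
 obtain p :: "'a poly" where p: "p ~= 0" "poly (map_poly to_ac p) x = 0" by (rule alg_closure_algebraic)
 let ?S = "{y. poly (map_poly to_ac p) y = 0}"
 have p0: "map_poly to_ac p ~= 0" using p(1) by (subst map_poly_eq_0_iff) auto
 have "poly (map_poly to_ac p) (x ^ (?q ^ m)) = (poly (map_poly to_ac p) x) ^ (?q ^ m)" for m
  using frob.mp_eval[of m "map_poly to_ac p" x] by (simp add: frob_lift)
 hence "range (%m. x ^ (?q ^ m)) <= ?S" using p(2) by auto
 hence "finite (range (%m. x ^ (?q ^ m)))" using poly_roots_finite[OF p0] finite_subset by blast
 hence "~ inj (%m. x ^ (?q ^ m))" using finite_imageD[of "%m. x ^ (?q ^ m)" UNIV] by auto
 then obtain i j where ij: "i < j" "x ^ (?q ^ i) = x ^ (?q ^ j)" by (auto simp: inj_on_def) (metis linorder_neqE_nat)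
 thus ?thesis using frob_cycle[OF ij] by (intro exI[of _ "j - i"]) simp
qed

lemma kf_common:
 assumes "finite (S :: 'a::{finite,field} alg_closure set)" shows "EX m>0. S <= kf m"
 using assms
proof (induction S)
 case (insert x S)
 then obtain m where m: "m > 0" "S <= kf m" by blast
 obtain k where k: "k > 0" "x : kf k" using kf_exists by blast
 have "insert x S <= kf (m * k)" using m k kf_mult[of _ m k] kf_mult[of x k m] by (auto simp: mult.commute)
 thus ?case using m k by (intro exI[of _ "m * k"]) auto
qed auto

text \<open>By counting: the proper subfields do not fill the field with \<open>q^m\<close> elements.\<close>

lemma kf_generator:
 assumes "m > 0" shows "EX x. (x::'a::{finite,field} alg_closure) : kf m & (ALL j. 0 < j --> j < m --> x ~: kf j)"
proof (rule ccontr)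
 let ?q = "CARD('a)"
 assume "~ ?thesis"
 hence sub: "(kf m :: 'a alg_closure set) <= (UN j:{1..<m}. kf j)" by force
 have s: "(SUM j:{1..<m}. ?q ^ j) < ?q ^ m" for m
 proof (induction m)
  case (Suc m)
  show ?case
  proof (cases "m = 0")
   case False
   have "(SUM j:{1..<Suc m}. ?q ^ j) = (SUM j:{1..<m}. ?q ^ j) + ?q ^ m" using False by simp
   also have "... < 2 * ?q ^ m" using Suc by simp
   also have "... <= ?q ^ Suc m" using finite_field_card_gt_1[where 'a = 'a] by simp
   finally show ?thesis .
  qed simp
 qed simp
 have "?q ^ m <= card (UN j:{1..<m}. kf j :: 'a alg_closure set)"
  using card_mono[OF _ sub] card_kf[where 'a = 'a] assms by simp
 also have "... <= (SUM j:{1..<m}. card (kf j :: 'a alg_closure set))" by (rule card_UN_le) simp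
 also have "... = (SUM j:{1..<m}. ?q ^ j)" using card_kf[where 'a = 'a] by (intro sum.cong) auto
 finally show False using s[of m] by simp
qed

lemma frob_fixed_poly:
 fixes P :: "'a::{finite,field} alg_closure poly"
 assumes "map_poly (%x. x ^ CARD('a)) P = P" shows "EX p. P = map_poly to_ac p"
proof
 have "to_ac (of_ac (coeff P n)) = coeff P n" for n
 proof -
  have "coeff P n ^ CARD('a) = coeff P n"
   using arg_cong[OF assms, of "%P. coeff P n"] by (simp add: coeff_map_poly)
  hence "coeff P n : kf 1" by (simp add: kf_def)
  thus ?thesis using kf_1 to_ac_of_ac by blast
 qed
 thus "P = map_poly to_ac (map_poly of_ac P)"
  by (intro poly_eqI) (simp add: coeff_map_poly)
qed

text \<open>Frobenius permutes the m conjugates of \<open>x\<close> cyclically, so the product of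
  the corresponding linear factors has coefficients fixed by Frobenius.\<close>

lemma min_poly_exists:
 fixes x :: "'a::{finite,field} alg_closure"
 assumes m: "m > 0" "x : kf m" "!!j. 0 < j ==> j < m ==> x ~: kf j"
 shows "EX p::'a poly. degree p = m & lead_coeff p = 1 & map_poly to_ac p = (PROD i<m. [:- (x ^ (CARD('a) ^ i)), 1:])
   & inj_on (%i. x ^ (CARD('a) ^ i)) {..<m}"
proof -
 let ?q = "CARD('a)"
 let ?P = "PROD i<m. [:- (x ^ (?q ^ i)), 1:]"
 have "map_poly (%x. x ^ (?q ^ 1)) ?P = (PROD i<m. [:- (x ^ (?q ^ Suc i)), 1:])"
 proof -
  have "map_poly (%x. x ^ (?q ^ 1)) [:- (x ^ (?q ^ i)), 1:] = [:- (x ^ (?q ^ Suc i)), 1:]" for i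
  proof -
   have "(- (x ^ (?q ^ i))) ^ (?q ^ 1) = - ((x ^ (?q ^ i)) ^ (?q ^ 1))" by (rule frob.h_minus)
   moreover have "(x ^ (?q ^ i)) ^ (?q ^ 1) = x ^ (?q ^ Suc i)" by (simp flip: power_mult add: mult.commute)
   ultimately show ?thesis by (simp only: frob.mp_pCons map_poly_0 power_one)
  qed
  thus ?thesis by (simp only: frob.mp_prod)
 qed
 also have "... = ?P"
 proof -
  obtain k where k: "m = Suc k" using m(1) by (cases m) auto
  have "(PROD i<m. [:- (x ^ (?q ^ Suc i)), 1:]) = (PROD i<k. [:- (x ^ (?q ^ Suc i)), 1:]) * [:- x, 1:]"
   using m(2) by (simp add: k kf_def)
  also have "... = ?P" unfolding k prod.lessThan_Suc_shift by simp
  finally show ?thesis .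
 qed
 finally have fixP: "map_poly (%x. x ^ ?q) ?P = ?P" by simp
 obtain p where p: "?P = map_poly to_ac p" using frob_fixed_poly[OF fixP] by blast
 have d: "degree ?P = m" by (subst degree_prod_eq_sum_degree) auto
 have l: "lead_coeff ?P = 1" by (simp add: lead_coeff_prod)
 have dp: "degree p = m" using d unfolding p by (subst (asm) degree_map_poly) auto
 moreover have "to_ac (lead_coeff p) = 1" using l d unfolding p by (simp add: coeff_map_poly dp)
 hence "lead_coeff p = 1" by (metis to_ac_1 to_ac_eq_iff)
 moreover have "inj_on (%i. x ^ (?q ^ i)) {..<m}" by (rule frob_orbit_inj[OF m(3)])
 ultimately show ?thesis using p by metis
qed

lemma min_poly_dvd:
 fixes x :: "'a::{finite,field} alg_closure"
 assumes x: "!!j. 0 < j ==> j < m ==> x ~: kf j"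
  and p: "p ~= (0::'a poly)" "poly (map_poly to_ac p) x = 0"
 shows "m <= degree p"
proof -
 let ?q = "CARD('a)"
 have inv: "poly (map_poly to_ac p) (x ^ (?q ^ i)) = 0" for i
  using frob.mp_eval[of i "map_poly to_ac p" x] p(2) by (simp add: frob_lift)
 have inj: "inj_on (%i. x ^ (?q ^ i)) {..<m}" by (rule frob_orbit_inj[OF x])
 have p0: "map_poly to_ac p ~= 0" using p(1) by (subst map_poly_eq_0_iff) auto
 have "m = card ((%i. x ^ (?q ^ i)) ` {..<m})" using card_image[OF inj] by simp
 also have "... <= card {y. poly (map_poly to_ac p) y = 0}"
  using inv by (intro card_mono poly_roots_finite[OF p0]) auto
 also have "... <= degree (map_poly to_ac p)" by (rule card_poly_roots_bound[OF p0])
 also have "... = degree p" by (rule degree_map_poly) simp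
 finally show ?thesis .
qed

section \<open>Polynomials in two variables\<close>

text \<open>Polynomials in two variables are polynomials in \<open>Y\<close> with coefficients in \<open>k[X]\<close>;
 \<open>tdle g s\<close> says that the total degree is at most \<open>s\<close>.\<close>

definition tdle :: "'b::comm_ring_1 poly poly => nat => bool" where
 "tdle g s \<longleftrightarrow> (ALL a b. s < a + b --> coeff (coeff g b) a = 0)"

lemma tdleD: "tdle g s ==> s < a + b ==> coeff (coeff g b) a = 0"
 by (auto simp: tdle_def)

lemma tdle_mono: "tdle g s ==> s <= t ==> tdle g t"
 by (auto simp: tdle_def)

lemma tdle_0 [simp]: "tdle 0 s"
 by (simp add: tdle_def)

lemma tdle_add: "tdle g s ==> tdle f s ==> tdle (g + f) s"
 by (simp add: tdle_def)

lemma tdle_diff: "tdle g s ==> tdle f s ==> tdle (g - f) s"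
 by (simp add: tdle_def)

lemma tdle_sum: "(!!i. i : I ==> tdle (f i) s) ==> tdle (sum f I) s"
 by (induction I rule: infinite_finite_induct) (auto intro: tdle_add)

lemma tdle_smult: "tdle g s ==> tdle (smult [:c:] g) s"
 by (simp add: tdle_def)

lemma tdle_mult: assumes "tdle g s" "tdle f t" shows "tdle (g * f) (s + t)"
 unfolding tdle_def
proof (intro allI impI)
 fix a b assume ab: "s + t < a + b"
 have "coeff (coeff (g * f) b) a = (SUM i<=b. SUM j<=a. coeff (coeff g i) j * coeff (coeff f (b - i)) (a - j))"
  by (simp add: coeff_mult coeff_sum)
 also have "... = 0"
 proof (intro sum.neutral ballI)
  fix i j assume "i : {..b}" "j : {..a}"
  hence "s < j + i \<or> t < (a - j) + (b - i)" using ab by auto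
  thus "coeff (coeff g i) j * coeff (coeff f (b - i)) (a - j) = 0"
   using tdleD[OF assms(1)] tdleD[OF assms(2)] by auto
 qed
 finally show "coeff (coeff (g * f) b) a = 0" .
qed

lemma tdle_exists: "EX s. tdle g s"
proof -
 let ?s = "degree g + (SUM b<=degree g. degree (coeff g b))"
 have "coeff (coeff g b) a = 0" if "?s < a + b" for a b
 proof (cases "b <= degree g")
  case True
  have "degree (coeff g b) <= (SUM b<=degree g. degree (coeff g b))"
   using True by (intro member_le_sum) auto
  thus ?thesis using that True by (intro coeff_eq_0) simp
 qed (simp add: coeff_eq_0)
 thus ?thesis by (auto simp: tdle_def)
qed

definition mono2 :: "nat => nat => 'b::comm_ring_1 poly poly" where
 "mono2 i j = monom (monom 1 i) j"

lemma coeff_mono2: "coeff (coeff (mono2 i j) b) a = (if a = i & b = j then 1 else 0)"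
 by (simp add: mono2_def)

lemma tdle_mono2: "i + j <= s ==> tdle (mono2 i j) s"
 by (auto simp: tdle_def coeff_mono2)

text \<open>Division by \<open>h\<close>, monic in Y. As the total degree of \<open>h\<close> equals
  its Y-degree, every multiple subtracted on the way has total degree at most
  \<open>s\<close>.\<close>

lemma red_exists:
 fixes h :: "'b::comm_ring_1 poly poly"
 assumes h: "degree h = d" "lead_coeff h = 1" "tdle h d" and g: "tdle g s"
 shows "EX r. tdle r s & (ALL b>=d. coeff r b = 0) & h dvd (g - r)"
proof -
 have "ALL b>=n. coeff g b = 0 ==> ?thesis" for n using g
 proof (induction n arbitrary: g)
  case 0
  hence "g = 0" by (simp add: poly_eq_iff)
  thus ?case by (intro exI[of _ 0]) simp
 next
  case (Suc n)
  show ?case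
  proof (cases "n < d \<or> coeff g n = 0")
   case True
   thus ?thesis
   proof
    assume "coeff g n = 0"
    hence "ALL b>=n. coeff g b = 0" using Suc.prems(1) by (metis le_antisym not_less_eq_eq)
    thus ?thesis using Suc by blast
   next
    assume "n < d"
    thus ?thesis using Suc.prems by (intro exI[of _ g]) auto
   qed
  next
   case False
   define c where "c = coeff g n"
   have nd: "d <= n" and c: "c ~= 0" using False by (auto simp: c_def)
   obtain a where a: "coeff c a ~= 0" using c by (metis leading_coeff_0_iff)
   have ns: "n <= s" using tdleD[OF Suc.prems(2), of a n] a by (force simp: c_def)
   let ?m = "monom c (n - d)"
   have "tdle ?m (s - d)" unfolding tdle_def using nd tdleD Suc.prems c_def by fastforce
   hence "tdle (?m * h) s" using tdle_mult[OF _ h(3), of ?m "s - d"] nd ns by simp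
   hence t: "tdle (g - ?m * h) s" using Suc.prems(2) by (rule tdle_diff[rotated])
   have cm: "coeff (?m * h) b = (if b < n - d then 0 else c * coeff h (b - (n - d)))" for b
    by (simp add: coeff_monom_mult)
   have "coeff (g - ?m * h) b = 0" if "b >= n" for b
   proof (cases "b = n")
    case True
    have "coeff (?m * h) n = c" using h nd by (simp add: cm)
    thus ?thesis using True by (simp add: c_def)
   next
    case False
    hence "b - (n - d) > degree h" using that nd h by simp
    hence "coeff h (b - (n - d)) = 0" by (rule coeff_eq_0)
    thus ?thesis using Suc.prems(1) False that by (simp add: cm)
   qed
   then obtain r where r: "tdle r s" "ALL b>=d. coeff r b = 0" "h dvd (g - ?m * h - r)" using Suc.IH[OF _ t] by blast
   have "g - r = (g - ?m * h - r) + ?m * h" by simp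
   hence "h dvd (g - r)" using r(3) by (metis dvd_add dvd_triv_right)
   thus ?thesis using r by blast
  qed
 qed
 from this[of "Suc (degree g)"] show ?thesis by (simp add: coeff_eq_0)
qed

lemma monic_dvd_small:
 fixes h :: "'b::idom poly poly"
 assumes "degree h = d" "h ~= 0" "ALL b>=d. coeff r b = 0" "h dvd r" shows "r = 0"
proof (rule ccontr)
 assume "r ~= 0"
 hence "degree h <= degree r" using assms(4) by (rule dvd_imp_degree_le[rotated])
 hence "lead_coeff r = 0" using assms by simp
 thus False using \<open>r \<noteq> 0\<close> by simp
qed

text \<open>Euclid's algorithm over k(X) without fractions. A nonzero combination \<open>w\<close>
  of least Y-degree divides \<open>h\<close> and \<open>g\<close> up to nonzero factors from k[X],
  by pseudo-division; if it still involved Y, primality of \<open>h\<close> would force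
  \<open>h\<close> to divide \<open>g\<close>.\<close>

lemma bezout_prime:
 fixes h :: "'b::field poly poly"
 assumes h: "prime_elem h" "degree h > 0" and g: "~ h dvd g"
 shows "EX u v r. r ~= 0 & u * h + v * g = [:r:]"
proof -
 let ?I = "%w. w ~= 0 & (EX u v. w = u * h + v * g)"
 have h0: "h ~= 0" using h by auto
 have "?I h" using h0 by (metis add.right_neutral mult_1 mult_zero_left)
 then obtain w where w: "?I w" and min: "!!w'. ?I w' ==> degree w <= degree w'"
  using ex_has_least_nat[of ?I h degree] by blast
 obtain u v where uv: "w = u * h + v * g" using w by blast
 have div: "EX c s. c ~= 0 & smult c f = w * s" if f: "f = h \<or> f = g" for f
 proof -
  obtain c s where cs: "c ~= 0" "smult c f = w * s + pseudo_mod f w" using pseudo_mod(1)[of w f] w by auto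
  have "pseudo_mod f w = 0"
  proof (rule ccontr)
   assume n0: "pseudo_mod f w ~= 0"
   have "pseudo_mod f w = smult c f - w * s" using cs by simp
   hence "EX u v. pseudo_mod f w = u * h + v * g"
   proof -
    have "smult c f = [:c:] * f" by simp
    hence "smult c h - w * s = ([:c:] - s * u) * h + (- s * v) * g" if "f = h"
     using uv by (simp add: algebra_simps)
    moreover have "smult c g - w * s = (- s * u) * h + ([:c:] - s * v) * g"
     using uv by (simp add: algebra_simps)
    ultimately show ?thesis using f \<open>pseudo_mod f w = smult c f - w * s\<close> by metis
   qed
   hence "degree w <= degree (pseudo_mod f w)" using min n0 by blast
   thus False using pseudo_mod(2)[of w f] w n0 by auto
  qed
  thus ?thesis using cs by auto
 qed
 have ndvd: "~ h dvd [:c:]" if "c ~= 0" for c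
  using dvd_imp_degree_le[of h "[:c:]"] that h by auto
 have "degree w = 0"
 proof (rule ccontr)
  assume dw: "degree w ~= 0"
  obtain c s where cs: "c ~= 0" "smult c h = w * s" using div[of h] by blast
  have "h dvd w * s" using cs(2) by (metis dvd_smult dvd_refl)
  hence "h dvd w \<or> h dvd s" using h(1) by (simp add: prime_elem_dvd_mult_iff)
  thus False
  proof
   assume "h dvd s"
   then obtain s' where "s = h * s'" by blast
   hence "h * [:c:] = h * (w * s')" using cs(2) by simp
   hence c: "[:c:] = w * s'" using h0 by (metis mult_left_cancel)
   hence "s' ~= 0" "w ~= 0" using cs(1) by auto
   hence "degree [:c:] = degree w + degree s'" unfolding c by (rule degree_mult_eq[rotated])
   thus False using dw by simp
  next
   assume hw: "h dvd w"
   obtain c' s' where c': "c' ~= 0" "smult c' g = w * s'" using div[of g] by blast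
   hence "h dvd [:c':] * g" using hw by simp
   hence "h dvd [:c':] \<or> h dvd g" using h(1) by (simp add: prime_elem_dvd_mult_iff del: mult_pCons_left)
   thus False using g ndvd c' by blast
  qed
 qed
 then obtain r where r: "w = [:r:]" by (metis degree_eq_zeroE)
 hence "r ~= 0" using w by auto
 thus ?thesis using r uv by (intro exI[of _ u] exI[of _ v] exI[of _ r]) simp
qed

section \<open>Linear algebra and a weak Bezout theorem\<close>

lemma homogeneous_system:
 fixes A :: "'j => 'i => 'b::field"
 assumes "finite J" "finite I" "card J < card I"
 shows "EX x. (EX i:I. x i ~= 0) & (ALL j:J. (SUM i:I. A j i * x i) = 0)"
 using assms
proof (induction J arbitrary: A I rule: finite_induct)
 case empty
 then obtain i where "i : I" by fastforce
 thus ?case by (intro exI[of _ "%_. 1"]) auto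
next
 case (insert j J)
 show ?case
 proof (cases "ALL i:I. A j i = 0")
  case True
  have "card J < card I" using insert by simp
  from insert.IH[OF insert.prems(1) this, of A]
  obtain x where "EX i:I. x i ~= 0" "ALL j:J. (SUM i:I. A j i * x i) = 0" by blast
  hence ?thesis if "ALL i:I. A j i = 0"
   using that by (intro exI[of _ x]) auto
  thus ?thesis using True by blast
 next
  case False
  then obtain i0 where i0: "i0 : I" "A j i0 ~= 0" by blast
  let ?I = "I - {i0}"
  have "card J < card ?I" "finite ?I" using insert i0 by simp_all
  from insert.IH[OF this(2,1), of "%j' i. A j' i - A j' i0 * A j i / A j i0"]
  obtain x where x: "EX i:?I. x i ~= 0" "ALL j':J. (SUM i:?I. (A j' i - A j' i0 * A j i / A j i0) * x i) = 0" by blast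
  define S where "S = (SUM i:?I. A j i * x i)"
  define y where "y = x(i0 := - S / A j i0)"
  have split: "(SUM i:I. A j' i * y i) = (SUM i:?I. A j' i * x i) - A j' i0 * S / A j i0" for j'
   using i0 insert y_def by (simp add: sum.remove)
  have "(SUM i:I. A j' i * y i) = 0" if "j' : insert j J" for j'
  proof (cases "j' = j")
   case True thus ?thesis using split[of j] i0 by (simp add: S_def)
  next
   case F: False
   hence "(SUM i:?I. (A j' i - A j' i0 * A j i / A j i0) * x i) = 0" using that x by blast
   moreover have "(SUM i:?I. (A j' i - A j' i0 * A j i / A j i0) * x i) = (SUM i:?I. A j' i * x i) - A j' i0 * S / A j i0"
    by (simp add: S_def right_diff_distrib sum_subtractf sum_distrib_left sum_divide_distrib mult_ac)
   ultimately show ?thesis using split[of j'] by simp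
  qed
  moreover have "EX i:I. y i ~= 0" using x(1) by (auto simp: y_def)
  ultimately show ?thesis by blast
 qed
qed

text \<open>The exponents, Y first, of the possible monomials of a remainder modulo \<open>h\<close>
  of total degree at most \<open>s\<close>.\<close>

definition box :: "nat => nat => (nat \<times> nat) set" where
 "box d s = (SIGMA b:{..<d}. {a. a + b <= s})"

lemma card_box: "d <= Suc s ==> finite (box d s) & card (box d (s + k)) = card (box d s) + d * k"
proof -
 assume d: "d <= Suc s"
 have f: "{a. a + b <= s} = {..<Suc s - b}" for s b :: nat by auto
 have c: "card (box d s) = (SUM b<d. Suc s - b)" for s by (simp add: box_def f)
 have "(SUM b<d. Suc (s + k) - b) = (SUM b<d. (Suc s - b) + k)" using d by (intro sum.cong) auto
 thus ?thesis by (simp add: sum.distrib box_def f)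
qed

lemma finite_box: "finite (box d s)"
proof -
 have "{a. a + b <= s} = {..<Suc s - b}" for s b :: nat by auto
 thus ?thesis by (simp add: box_def)
qed

text \<open>A weak form of Bezout's theorem: the quotient by \<open>(u, h)\<close> has dimension at most \<open>d s\<close>.\<close>

lemma colength_bound:
 fixes h u :: "'b::field poly poly" and Lf :: "nat => 'b poly poly"
 assumes h: "prime_elem h" "degree h = d" "lead_coeff h = 1" "tdle h d" and u: "~ h dvd u" "tdle u s"
  and ind: "!!v w. h dvd (u * v + (SUM i<N. smult [:w i:] (Lf i))) ==> ALL i<N. w i = 0"
 shows "N <= d * s"
proof (rule ccontr)
 assume "~ N <= d * s"
 have "EX T0. ALL i<N. tdle (Lf i) T0"
 proof (induction N)
  case (Suc n)
  then obtain T0 where "ALL i<n. tdle (Lf i) T0" by blast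
  moreover obtain T1 where "tdle (Lf n) T1" using tdle_exists by blast
  ultimately show ?case by (intro exI[of _ "T0 + T1"]) (auto simp: less_Suc_eq intro: tdle_mono)
 qed simp
 then obtain T0 where T0: "ALL i<N. tdle (Lf i) T0" by blast
 \<comment> \<open>Large enough to bound all \<open>Lf i\<close>, and at least \<open>d\<close>, so
   that raising the degree bound adds exactly \<open>d\<close> monomials per step to the
   box.\<close>
 define T where "T = T0 + d"
 define I where "I = Inl ` box d T Un Inr ` {..<N}"
 define J where "J = box d (T + s)"
 define el where "el i = (case i of Inl (b, a) => u * mono2 a b | Inr n => Lf n)" for i
 have el: "tdle (el i) (T + s)" if "i : I" for i
 proof -
  have "tdle (u * mono2 a b) (T + s)" if "a + b <= T" for a b
   using tdle_mult[OF u(2) tdle_mono2[OF that]] by (simp add: add.commute)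
  moreover have "tdle (Lf i) (T + s)" if "i < N" for i using T0 that tdle_mono[of "Lf i" T0] by (simp add: T_def)
  ultimately show ?thesis using that by (auto simp: I_def el_def box_def)
 qed
 have "ALL i:I. EX r. tdle r (T + s) & (ALL b>=d. coeff r b = 0) & h dvd (el i - r)"
  using red_exists[OF h(2,3,4)] el by blast
 then obtain rd where rd: "!!i. i : I ==> tdle (rd i) (T + s)" "!!i b. i : I ==> b >= d ==> coeff (rd i) b = 0"
  "!!i. i : I ==> h dvd (el i - rd i)" by metis
 have fin: "finite I" "finite J" by (simp_all add: I_def J_def finite_box)
 \<comment> \<open>The multiples of \<open>u\<close> by the monomials of a box, together with the
   \<open>Lf i\<close>, outnumber the remainders modulo \<open>h\<close> of degree
   \<open>T + s\<close> as soon as N > d s. A linear relation follows; \<open>ind\<close> removes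
   the \<open>Lf i\<close> from it, and then \<open>h\<close> divides u v, which forces v =
   0.\<close>
 have "card I = card (box d T) + N"
  unfolding I_def by (subst card_Un_disjoint) (auto simp: finite_box card_image)
 moreover have "card J = card (box d T) + d * s" unfolding J_def using card_box[of d T s] by (simp add: T_def)
 ultimately have "card J < card I" using \<open>\<not> N \<le> d * s\<close> by simp
 from homogeneous_system[OF fin(2,1) this, of "%j i. coeff (coeff (rd i) (fst j)) (snd j)"]
 obtain x where x: "EX i:I. x i ~= 0" "ALL j:J. (SUM i:I. coeff (coeff (rd i) (fst j)) (snd j) * x i) = 0" by blast
 have "(SUM i:I. smult [:x i:] (rd i)) = 0"
 proof (rule poly_eqI, rule poly_eqI)
  fix b a
  have e: "coeff (coeff (SUM i:I. smult [:x i:] (rd i)) b) a = (SUM i:I. coeff (coeff (rd i) b) a * x i)"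
   by (simp add: coeff_sum mult.commute)
  have "... = 0"
  proof (cases "(b, a) : J")
   case True thus ?thesis using x(2) by fastforce
  next
   case False
   hence "coeff (coeff (rd i) b) a = 0" if "i : I" for i
    using rd(2)[OF that, of b] tdleD[OF rd(1)[OF that], of a b] by (auto simp: J_def box_def)
   thus ?thesis by simp
  qed
  thus "coeff (coeff (SUM i:I. smult [:x i:] (rd i)) b) a = coeff (coeff 0 b) a" using e by simp
 qed
 moreover have "h dvd (SUM i:I. smult [:x i:] (el i - rd i))"
  using rd(3) by (intro dvd_sum dvd_smult) auto
 ultimately have dv: "h dvd (SUM i:I. smult [:x i:] (el i))"
  by (simp add: smult_diff_right sum_subtractf)
 define v where "v = (SUM p:box d T. smult [:x (Inl p):] (mono2 (snd p) (fst p)))"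
 have "(SUM i:I. smult [:x i:] (el i)) = u * v + (SUM i<N. smult [:x (Inr i):] (Lf i))"
  unfolding I_def v_def
  by (subst sum.union_disjoint) (auto simp: finite_box sum.reindex el_def case_prod_beta sum_distrib_left)
 hence dv': "h dvd (u * v + (SUM i<N. smult [:x (Inr i):] (Lf i)))" using dv by simp
 hence w0: "ALL i<N. x (Inr i) = 0" by (rule ind)
 hence "h dvd u * v" using dv' by simp
 hence "h dvd v" using h(1) u(1) by (simp add: prime_elem_dvd_mult_iff)
 moreover have cv: "coeff (coeff v b) a = (if (b, a) : box d T then x (Inl (b, a)) else 0)" for a b
 proof -
  have "coeff (coeff v b) a = (SUM p:box d T. if p = (b, a) then x (Inl p) else 0)"
   unfolding v_def coeff_sum by (intro sum.cong) (auto simp: coeff_mono2)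
  thus ?thesis by (simp add: finite_box)
 qed
 moreover have "ALL b>=d. coeff v b = 0" using cv by (auto simp: poly_eq_iff box_def)
 ultimately have "v = 0" using monic_dvd_small[OF h(2)] h(1) by (metis not_prime_elem_zero)
 hence "x (Inl p) = 0" if "p : box d T" for p using cv[of "fst p" "snd p"] that by simp
 thus False using x(1) w0 by (auto simp: I_def)
qed

section \<open>Evaluation at points and common zeros\<close>

definition ev2 :: "'b::comm_ring_1 poly poly => 'b => 'b => 'b" where
 "ev2 g x y = poly (map_poly (%c. poly c x) g) y"

lemma crhom_poly: "crhom (%c. poly c x)"
 by unfold_locales simp_all

lemma crhom_ev2: "crhom (%g. ev2 g x y)"
 unfolding ev2_def using crhom.crhom_eval[OF crhom_poly] .

lemma ev2_simps [simp]:
 "ev2 (f + g) x y = ev2 f x y + ev2 g x y" "ev2 (f - g) x y = ev2 f x y - ev2 g x y"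
 "ev2 (f * g) x y = ev2 f x y * ev2 g x y" "ev2 (sum F A) x y = (SUM i:A. ev2 (F i) x y)" "ev2 (f ^ n) x y = ev2 f x y ^ n"
 "ev2 1 x y = 1" "ev2 0 x y = 0"
proof -
 interpret crhom "%g. ev2 g x y" by (rule crhom_ev2)
 show "ev2 (f + g) x y = ev2 f x y + ev2 g x y" "ev2 (f - g) x y = ev2 f x y - ev2 g x y"
 "ev2 (f * g) x y = ev2 f x y * ev2 g x y" "ev2 (sum F A) x y = (SUM i:A. ev2 (F i) x y)" "ev2 (f ^ n) x y = ev2 f x y ^ n"
 "ev2 1 x y = 1" "ev2 0 x y = 0" by (simp_all add: h_add h_diff h_mult h_sum h_power)
qed

lemma ev2_pCons [simp]: "ev2 (pCons c g) x y = poly c x + y * ev2 g x y"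
 by (simp add: ev2_def map_poly_pCons)

lemma ev2_smult [simp]: "ev2 (smult c g) x y = poly c x * ev2 g x y"
 unfolding ev2_def by (simp add: crhom.mp_smult[OF crhom_poly])

lemma ev2_monom [simp]: "ev2 (monom c n) x y = poly c x * y ^ n"
 by (simp add: ev2_def map_poly_monom poly_monom)

lemma ev2_mono2 [simp]: "ev2 (mono2 i j) x y = x ^ i * y ^ j"
 by (simp add: mono2_def poly_monom)

lemma ev2_prod [simp]: "ev2 (prod F A) x y = (PROD i:A. ev2 (F i) x y)"
 by (induction A rule: infinite_finite_induct) simp_all

lemma ev2_dvd: "h dvd g ==> ev2 h x y = 0 ==> ev2 g x y = 0"
 by auto

text \<open>A linear factor that vanishes at \<open>z'\<close> but not at \<open>z\<close>: in X if
  the first coordinates differ, otherwise in Y. Products of these serve as Lagrange interpolation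
  polynomials.\<close>

definition sep :: "'b::field \<times> 'b => 'b \<times> 'b => 'b poly poly" where
 "sep z z' = (if fst z ~= fst z' then [:[:- fst z', 1:]:] else [:[:- snd z':], 1:])"

lemma sep: "ev2 (sep z z') (fst z') (snd z') = 0" "z ~= z' ==> ev2 (sep z z') (fst z) (snd z) ~= 0"
 by (auto simp: sep_def prod_eq_iff)

text \<open>Evaluation at the common zeros shows that their Lagrange polynomials are independent
  modulo \<open>u\<close> and \<open>h\<close>, so \<open>colength_bound\<close> limits their
  number.\<close>

lemma card_common_zeros:
 fixes h u :: "'b::field poly poly"
 assumes h: "prime_elem h" "degree h = d" "lead_coeff h = 1" "tdle h d" and u: "~ h dvd u" "tdle u s"
  and Z: "finite Z" "!!z. z : Z ==> ev2 h (fst z) (snd z) = 0 & ev2 u (fst z) (snd z) = 0"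
 shows "card Z <= d * s"
proof -
 obtain zs where zs: "Z = set zs" "distinct zs" using finite_distinct_list[OF Z(1)] by blast
 define N where "N = length zs"
 define Lf where "Lf i = (PROD j:{..<N} - {i}. sep (zs ! i) (zs ! j))" for i
 have card: "card Z = N" using zs by (simp add: N_def distinct_card)
 have ev: "ev2 (Lf i) (fst (zs ! j)) (snd (zs ! j)) = 0" if "i < N" "j < N" "i ~= j" for i j
  unfolding Lf_def ev2_prod using that by (intro prod_zero) (auto intro: bexI[of _ j] simp: sep)
 have ev': "ev2 (Lf i) (fst (zs ! i)) (snd (zs ! i)) ~= 0" if "i < N" for i
 proof -
  have "ev2 (sep (zs ! i) (zs ! j)) (fst (zs ! i)) (snd (zs ! i)) ~= 0" if "j < N" "j ~= i" for j
   using that \<open>i < N\<close> zs(2) by (intro sep(2)) (auto simp: N_def nth_eq_iff_index_eq)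
  thus ?thesis unfolding Lf_def by auto
 qed
 have "N <= d * s"
 proof (rule colength_bound[OF h u])
  fix v w assume dv: "h dvd (u * v + (SUM i<N. smult [:w i:] (Lf i)))"
  show "ALL i<N. w i = 0"
  proof (intro allI impI)
   fix j assume j: "j < N"
   let ?x = "fst (zs ! j)" and ?y = "snd (zs ! j)"
   have z: "ev2 h ?x ?y = 0" "ev2 u ?x ?y = 0" using Z(2)[of "zs ! j"] j zs(1) by (auto simp: N_def)
   have "0 = (SUM i<N. w i * ev2 (Lf i) ?x ?y)" using ev2_dvd[OF dv z(1)] z(2) by simp
   also have "... = (SUM i:{j}. w i * ev2 (Lf i) ?x ?y)"
    using j ev by (intro sum.mono_neutral_right) auto
   finally show "w j = 0" using ev'[OF j] by simp
  qed
 qed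
 thus ?thesis using card by simp
qed

text \<open>Eliminating Y leaves finitely many x, and \<open>h\<close>, being monic in Y, has
  finitely many zeros above each.\<close>

lemma finite_common_zeros:
 fixes h u :: "'b::field poly poly"
 assumes h: "prime_elem h" "degree h > 0" "lead_coeff h = 1" and u: "~ h dvd u"
 shows "finite {(x, y). ev2 h x y = 0 & ev2 u x y = 0}"
proof -
 obtain a b r where r: "r ~= 0" "a * h + b * u = [:r:]" using bezout_prime[OF h(1,2) u] by blast
 have sub: "{(x, y). ev2 h x y = 0 & ev2 u x y = 0} <= (SIGMA x:{x. poly r x = 0}. {y. ev2 h x y = 0})"
 proof clarify
  fix x y assume "ev2 h x y = 0" "ev2 u x y = 0"
  hence "ev2 (a * h + b * u) x y = 0" by simp
  hence "poly r x = 0" unfolding r(2) by simp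
  thus "x : {x. poly r x = 0} & y : {y. ev2 h x y = 0}" using \<open>ev2 h x y = 0\<close> by simp
 qed
 have "finite {y. ev2 h x y = 0}" for x
 proof -
  have "coeff (map_poly (%c. poly c x) h) (degree h) = 1" using h(3) by (simp add: coeff_map_poly)
  hence "map_poly (%c. poly c x) h ~= 0" by auto
  thus ?thesis unfolding ev2_def by (rule poly_roots_finite)
 qed
 hence "finite (SIGMA x:{x. poly r x = 0}. {y. ev2 h x y = 0})" using poly_roots_finite[OF r(1)] by auto
 thus ?thesis using sub finite_subset by blast
qed

lemma poly_taylor2:
 fixes p :: "'b::idom poly"
 shows "EX w. poly p (a + b) = poly p a + b * poly (pderiv p) a + b\<^sup>2 * w"
proof (induction p)
 case (pCons c p)
 then obtain w where "poly p (a + b) = poly p a + b * poly (pderiv p) a + b\<^sup>2 * w" by blast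
 thus ?case by (intro exI[of _ "poly (pderiv p) a + (a + b) * w"])
  (simp add: pderiv_pCons algebra_simps power2_eq_square)
qed simp

lemma poly_diff_dvd: "(a - b :: 'b::comm_ring_1) dvd (poly p a - poly p b)"
proof (induction p)
 case (pCons c p)
 have "poly (pCons c p) a - poly (pCons c p) b = a * (poly p a - poly p b) + (a - b) * poly p b" by (simp add: algebra_simps)
 thus ?case using pCons by (metis dvd_add dvd_mult dvd_triv_left)
qed simp

text \<open>The derivative keeps the constant term \<open>D\<close> during the iteration, so a
  multiple of the next power of the variable always cancels the next coefficient; the diagonal of
  the iterates is the root.\<close>

lemma fps_hensel:
 fixes H :: "'b::field fps poly"
 assumes "fps_nth (poly H (fps_const y0)) 0 = 0" "fps_nth (poly (pderiv H) (fps_const y0)) 0 ~= 0"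
 shows "\<exists>\<eta>. poly H \<eta> = 0 & fps_nth \<eta> 0 = y0"
proof -
 define D where "D = fps_nth (poly (pderiv H) (fps_const y0)) 0"
 define e where "e = rec_nat (fps_const y0) (%n f. f - fps_const (fps_nth (poly H f) (Suc n) / D) * fps_X ^ Suc n)"
 have e0: "e 0 = fps_const y0" by (simp add: e_def)
 have eS: "e (Suc n) = e n - fps_const (fps_nth (poly H (e n)) (Suc n) / D) * fps_X ^ Suc n" for n
  by (simp add: e_def)
 have e00: "fps_nth (e n) 0 = y0" for n by (induction n) (simp_all add: e0 eS)
 have D: "fps_nth (poly (pderiv H) (e n)) 0 = D" for n
 proof -
  have "(e n - fps_const y0) dvd (poly (pderiv H) (e n) - poly (pderiv H) (fps_const y0))" by (rule poly_diff_dvd)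
  then obtain w where "poly (pderiv H) (e n) - poly (pderiv H) (fps_const y0) = (e n - fps_const y0) * w" by blast
  hence "fps_nth (poly (pderiv H) (e n) - poly (pderiv H) (fps_const y0)) 0 = 0" by (simp add: e00)
  thus ?thesis by (simp add: D_def)
 qed
 have inv: "ALL i<=n. fps_nth (poly H (e n)) i = 0" for n
 proof (induction n)
  case 0 thus ?case using assms e0 by simp
 next
  case (Suc n)
  define c where "c = - (fps_nth (poly H (e n)) (Suc n) / D)"
  define b where "b = fps_const c * fps_X ^ Suc n"
  have b: "e (Suc n) = e n + b" by (simp add: eS b_def c_def)
  obtain w where w: "poly H (e n + b) = poly H (e n) + b * poly (pderiv H) (e n) + b\<^sup>2 * w" using poly_taylor2 by blast
  have b2: "b\<^sup>2 * w = fps_X ^ Suc (Suc n) * (fps_const (c\<^sup>2) * fps_X ^ n * w)"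
   by (simp add: b_def power2_eq_square)
  have "fps_nth (poly H (e (Suc n))) i = 0" if i: "i <= Suc n" for i
  proof -
   have "fps_nth (b\<^sup>2 * w) i = 0" unfolding b2 fps_X_power_mult_nth using i by simp
   moreover have "fps_nth (b * poly (pderiv H) (e n)) i = (if i = Suc n then c * D else 0)"
   proof -
    have e: "b * poly (pderiv H) (e n) = fps_X ^ Suc n * (fps_const c * poly (pderiv H) (e n))" by (simp only: b_def mult_ac)
    show ?thesis unfolding e using i by (simp add: fps_X_power_mult_nth D del: power_Suc)
   qed
   moreover have "fps_nth (poly H (e n)) (Suc n) + c * D = 0" using assms(2) by (simp add: c_def D_def)
   ultimately show ?thesis using Suc i unfolding b w by auto
  qed
  thus ?case by blast
 qed
 define \<eta> where "\<eta> = Abs_fps (%n. fps_nth (e n) n)"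
 have stab: "fps_nth (e (n + k)) i = fps_nth (e n) i" if "i <= n" for n k i
  using that by (induction k) (simp_all add: eS fps_X_power_mult_right_nth del: power_Suc)
 have "fps_nth (poly H \<eta>) n = 0" for n
 proof -
  have "fps_nth (\<eta> - e n) i = 0" if "i <= n" for i
   using stab[of i i "n - i"] that by (simp add: \<eta>_def)
  moreover obtain w where w: "poly H \<eta> - poly H (e n) = (\<eta> - e n) * w" using poly_diff_dvd by blast
  ultimately have "fps_nth (poly H \<eta> - poly H (e n)) n = 0" unfolding w fps_mult_nth by (intro sum.neutral) auto
  thus ?thesis using inv[of n] by simp
 qed
 hence "poly H \<eta> = 0" by (simp add: fps_eq_iff)
 moreover have "fps_nth \<eta> 0 = y0" by (simp add: \<eta>_def e00)
 ultimately show ?thesis by blast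
qed

section \<open>Counting points on a plane curve by Stepanov's method\<close>

lemma crhom_map_to_ac: "crhom (map_poly (to_ac :: 'a::field => _))"
 by (rule to_ac.crhom_map_poly)

interpretation mac: crhom "map_poly (to_ac :: 'a::field => 'a alg_closure)"
 by (rule crhom_map_to_ac)

abbreviation lift :: "'a::field poly poly => 'a alg_closure poly poly" where
 "lift == map_poly (map_poly to_ac)"

lemma coeff_lift: "coeff (coeff (lift g) b) a = to_ac (coeff (coeff g b) a)"
 by (simp add: coeff_map_poly)

lemma lift_eq_iff: "lift f = lift g \<longleftrightarrow> f = g"
 by (simp add: poly_eq_iff coeff_lift)

lemma lift_0_iff: "lift g = 0 \<longleftrightarrow> g = 0"
 using lift_eq_iff[of g 0] by simp

lemma tdle_lift: "tdle (lift g) s \<longleftrightarrow> tdle g s"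
 by (simp add: tdle_def coeff_lift)

lemma degree_lift: "degree (lift g) = degree g"
 by (intro degree_map_poly) (simp add: poly_eq_iff coeff_map_poly)

lemma lift_mono2: "lift (mono2 i j) = mono2 i j"
 by (simp add: mono2_def map_poly_monom)

lemma lift_smult_const: "lift (smult [:c:] g) = smult [:to_ac c:] (lift g)"
 by (simp add: mac.mp_smult map_poly_pCons)

lemma lift_pderiv: "lift (pderiv g) = pderiv (lift g)"
 by (rule map_poly_pderiv[OF crhom_map_to_ac])

lemma ev2_lift_frob:
 fixes g :: "'a::{finite,field} poly poly"
 shows "ev2 (lift g) (x ^ (CARD('a) ^ m)) (y ^ (CARD('a) ^ m)) = (ev2 (lift g) x y) ^ (CARD('a) ^ m)"
proof -
 let ?Q = "CARD('a) ^ m"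
 note c = frob_lift[where 'a = 'a and m = m]
 have "(ev2 (lift g) x y) ^ ?Q = poly (map_poly (%z. z ^ ?Q) (map_poly (%c. poly c x) (lift g))) (y ^ ?Q)"
  unfolding ev2_def by (rule frob.mp_eval[symmetric])
 also have "map_poly (%z. z ^ ?Q) (map_poly (%c. poly c x) (lift g)) = map_poly (%c. (poly (map_poly to_ac c) x) ^ ?Q) g"
  by (simp add: map_poly_map_poly o_def)
 also have "(%c. (poly (map_poly to_ac c) x) ^ ?Q) = (%c. poly (map_poly to_ac c) (x ^ ?Q))"
 proof
  fix c show "(poly (map_poly to_ac c) x) ^ ?Q = poly (map_poly to_ac c) (x ^ ?Q)"
   using frob.mp_eval[where m = m and p = "map_poly to_ac c" and x = x] c[of c] by simp
 qed
 also have "map_poly (%c. poly (map_poly to_ac c) (x ^ ?Q)) g = map_poly (%c. poly c (x ^ ?Q)) (lift g)"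
  by (simp add: map_poly_map_poly o_def)
 finally show ?thesis by (simp add: ev2_def)
qed

lemma infinite_alg_closure: "infinite (UNIV :: 'a::{finite,field} alg_closure set)"
proof
 assume f: "finite (UNIV :: 'a alg_closure set)"
 let ?n = "card (UNIV :: 'a alg_closure set)"
 have "CARD('a) ^ Suc ?n <= ?n" using card_kf(1)[of "Suc ?n", where 'a = 'a] card_mono[OF f, of "kf (Suc ?n)"] by simp
 moreover have "?n < CARD('a) ^ Suc ?n"
 proof -
  have "?n < 2 ^ ?n" by (rule less_exp)
  also have "(2::nat) ^ ?n <= CARD('a) ^ ?n" using finite_field_card_gt_1[where 'a = 'a] by (intro power_mono) auto
  also have "... <= CARD('a) ^ Suc ?n" using finite_field_card_gt_1[where 'a = 'a] by (intro power_increasing) auto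
  finally show ?thesis .
 qed
 ultimately show False by simp
qed

text \<open>Primality of \<open>lift h\<close> is absolute irreducibility. Monicity together with
  the bound on the total degree makes y integral over k[x] and y/x integral at infinity. The last
  condition makes y separable over k(x).\<close>

locale plane_curve =
 fixes h :: "'a::{finite,field} poly poly" and d :: nat
 assumes d_pos: "d > 0" and deg_h: "degree h = d" and monic_h: "lead_coeff h = 1" and td_h: "tdle h d"
  and prime_h: "prime_elem (lift h)" and sep_h: "pderiv h ~= 0"
begin

abbreviation "H == lift h"

lemma H: "degree H = d" "lead_coeff H = 1" "tdle H d" "H ~= 0"
 using deg_h monic_h td_h prime_h by (auto simp: degree_lift tdle_lift coeff_map_poly)

lemma not_dvd_small:
 assumes "g ~= 0" "ALL b>=d. coeff g b = 0" shows "~ H dvd g"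
 using monic_dvd_small[OF H(1,4) assms(2)] assms(1) by blast

lemma not_dvd_pderiv: "~ H dvd pderiv H"
proof (rule not_dvd_small)
 show "pderiv H ~= 0" using sep_h lift_0_iff[of "pderiv h"] by (simp add: lift_pderiv)
 show "ALL b>=d. coeff (pderiv H) b = 0" using H(1) by (auto simp: coeff_pderiv coeff_eq_0)
qed

lemma bezout_H: "~ H dvd g ==> EX u v r. r ~= 0 & u * H + v * g = [:r:]"
 using bezout_prime[OF prime_h] H(1) d_pos by simp

text \<open>Here \<open>r\<close> plays the role of the discriminant of \<open>H\<close> in Y; it
  comes from a Bezout relation between \<open>H\<close> and its derivative.\<close>

lemma disc_exists: "EX r. r ~= 0 & (ALL x y. poly r x ~= 0 --> ev2 H x y = 0 --> ev2 (pderiv H) x y ~= 0)"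
proof -
 obtain u v r where r: "r ~= 0" "u * H + v * pderiv H = [:r:]"
  using bezout_H[OF not_dvd_pderiv] by blast
 have "ev2 (pderiv H) x y ~= 0" if "poly r x ~= 0" "ev2 H x y = 0" for x y
 proof
  assume "ev2 (pderiv H) x y = 0"
  hence "ev2 (u * H + v * pderiv H) x y = 0" using that by simp
  thus False using that unfolding r(2) by simp
 qed
 thus ?thesis using r by blast
qed

lemma sect:
 shows "degree (map_poly (%c. poly c x) H) = d" "map_poly (%c. poly c x) H ~= 0"
  "ev2 (pderiv H) x y = poly (pderiv (map_poly (%c. poly c x) H)) y"
proof -
 have l: "coeff (map_poly (%c. poly c x) H) d = 1" using H by (simp add: coeff_map_poly)
 thus "map_poly (%c. poly c x) H ~= 0" by auto
 have "degree (map_poly (%c. poly c x) H) <= d" using H(1) by (intro degree_le) (auto simp: coeff_map_poly coeff_eq_0)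
 thus "degree (map_poly (%c. poly c x) H) = d" using l le_degree[of "map_poly (%c. poly c x) H" d] by simp
 show "ev2 (pderiv H) x y = poly (pderiv (map_poly (%c. poly c x) H)) y"
  unfolding ev2_def by (simp add: map_poly_pderiv[OF crhom_poly])
qed

lemma fiber_finite: "finite {y. ev2 H x y = 0}" and fiber_card_le: "card {y. ev2 H x y = 0} <= d"
 using poly_roots_finite[OF sect(2)] card_poly_roots_bound[OF sect(2)] sect(1) by (auto simp: ev2_def)

lemma fiber_card: "(!!y. ev2 H x y = 0 ==> ev2 (pderiv H) x y ~= 0) ==> card {y. ev2 H x y = 0} = d"
 using alg_closed_card_roots[OF sect(2), of x] sect(1,3) by (auto simp: ev2_def)

lemma smooth_point: "EX x0 y0. ev2 H x0 y0 = 0 & ev2 (pderiv H) x0 y0 ~= 0"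
proof -
 obtain r where r: "r ~= 0" "ALL x y. poly r x ~= 0 --> ev2 H x y = 0 --> ev2 (pderiv H) x y ~= 0" using disc_exists by blast
 obtain x0 where x0: "poly r x0 ~= 0" using poly_roots_finite[OF r(1)] infinite_alg_closure[where 'a = 'a] by (metis (mono_tags, lifting) UNIV_eq_I mem_Collect_eq)
 obtain y0 where "poly (map_poly (%c. poly c x0) H) y0 = 0" using alg_closed_exists_root[of "map_poly (%c. poly c x0) H"] sect(1) d_pos by auto
 thus ?thesis using r(2) x0 unfolding ev2_def by blast
qed

definition "P0 = (SOME p. ev2 H (fst p) (snd p) = 0 & ev2 (pderiv H) (fst p) (snd p) ~= 0)"
definition "x0 = fst P0"
definition "y0 = snd P0"

lemma P0: "ev2 H x0 y0 = 0" "ev2 (pderiv H) x0 y0 ~= 0"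
proof -
 have "EX p. ev2 H (fst p) (snd p) = 0 & ev2 (pderiv H) (fst p) (snd p) ~= 0" using smooth_point by auto
 from someI_ex[OF this] show "ev2 H x0 y0 = 0" "ev2 (pderiv H) x0 y0 ~= 0" by (simp_all add: P0_def x0_def y0_def)
qed

text \<open>Expansion at the smooth point \<open>(x0, y0)\<close> in the local parameter \<open>x - x0\<close>.\<close>

definition loc :: "'a alg_closure poly => 'a alg_closure fps" where
 "loc c = fps_of_poly (pcompose c [:x0, 1:])"

lemma crhom_loc: "crhom loc"
 by unfold_locales (simp_all add: loc_def pcompose_add pcompose_mult fps_of_poly_add fps_of_poly_mult pcompose_1)

interpretation loc: crhom loc by (rule crhom_loc)

lemma loc_0_iff: "loc c = 0 \<longleftrightarrow> c = 0"
 by (auto simp: loc_def pcompose_eq_0_iff)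

lemma loc_nth_0: "fps_nth (loc c) 0 = poly c x0"
 by (simp add: loc_def fps_of_poly_nth flip: poly_0_coeff_0) (simp add: poly_pcompose)

lemma crhom_nth_0: "crhom (%f :: 'a alg_closure fps. fps_nth f 0)"
 by unfold_locales simp_all

lemma eta_exists: "\<exists>\<eta>. poly (map_poly loc H) \<eta> = 0 & fps_nth \<eta> 0 = y0"
proof (rule fps_hensel)
 have *: "fps_nth (poly (map_poly loc g) (fps_const y0)) 0 = ev2 g x0 y0" for g
 proof -
  have "fps_nth (poly (map_poly loc g) (fps_const y0)) 0 = poly (map_poly (%f. fps_nth f 0) (map_poly loc g)) (fps_nth (fps_const y0) 0)"
   by (rule crhom.mp_eval[OF crhom_nth_0, symmetric])
  thus ?thesis by (simp add: map_poly_map_poly o_def loc_nth_0 ev2_def)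
 qed
 show "fps_nth (poly (map_poly loc H) (fps_const y0)) 0 = 0" using * P0 by simp
 show "fps_nth (poly (pderiv (map_poly loc H)) (fps_const y0)) 0 ~= 0"
  using *[of "pderiv H"] P0 by (simp add: map_poly_pderiv[OF crhom_loc])
qed

definition "eta = (SOME \<eta>. poly (map_poly loc H) \<eta> = 0 & fps_nth \<eta> 0 = y0)"

definition expand :: "'a alg_closure poly poly => 'a alg_closure fps" where
 "expand g = poly (map_poly loc g) eta"

lemma expand_H: "expand H = 0"
 unfolding expand_def eta_def using someI_ex[OF eta_exists] by simp

lemma crhom_expand: "crhom expand"
 unfolding expand_def by (rule loc.crhom_eval)

interpretation expand: crhom expand by (rule crhom_expand)

lemma expand_const: "expand [:c:] = loc c"
 by (simp add: expand_def loc.mp_pCons)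

lemma expand_smult: "expand (smult [:c:] g) = fps_const c * expand g"
proof -
 have "expand (smult [:c:] g) = expand [:[:c:]:] * expand g" by (simp flip: expand.h_mult)
 thus ?thesis by (simp add: expand_const loc_def)
qed

lemma expand_eq_0_iff: "expand g = 0 \<longleftrightarrow> H dvd g"
proof
 assume e: "expand g = 0"
 show "H dvd g"
 proof (rule ccontr)
  assume "~ H dvd g"
  then obtain u v r where r: "r ~= 0" "u * H + v * g = [:r:]" using bezout_H by blast
  have "expand (u * H + v * g) = 0" using e expand_H by (simp add: expand.h_add expand.h_mult)
  thus False using r by (simp add: expand_const loc_0_iff)
 qed
qed (auto elim!: dvdE simp: expand.h_mult expand_H)

text \<open>The case of \<open>colength_bound\<close> for the powers of X - x0. They expand to the
  powers of the local parameter, and below the order of vanishing of \<open>u\<close> these are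
  independent modulo all multiples of the expansion of \<open>u\<close>.\<close>

lemma order_bound:
 assumes "~ H dvd u" "tdle u s" "ALL i<N. fps_nth (expand u) i = 0" shows "N <= d * s"
proof (rule colength_bound[OF prime_h H(1-3) assms(1,2)])
 fix v w assume "H dvd (u * v + (SUM i<N. smult [:w i:] [:[:- x0, 1:] ^ i:]))"
 hence "expand (u * v + (SUM i<N. smult [:w i:] [:[:- x0, 1:] ^ i:])) = 0" by (simp only: expand_eq_0_iff)
 moreover have "expand [:[:- x0, 1:] ^ i:] = fps_X ^ i" for i
 proof -
  have "loc ([:- x0, 1:] ^ i) = (loc [:- x0, 1:]) ^ i" by (rule loc.h_power)
  also have "loc [:- x0, 1:] = fps_X" by (simp add: loc_def pcompose_pCons)
  finally show ?thesis by (simp add: expand_const)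
 qed
 ultimately have e: "expand u * expand v + (SUM i<N. fps_const (w i) * fps_X ^ i) = 0"
  by (simp only: expand.h_add expand.h_mult expand.h_sum expand_smult)
 show "ALL i<N. w i = 0"
 proof (intro allI impI)
  fix j assume j: "j < N"
  have "fps_nth (expand u * expand v) j = 0" unfolding fps_mult_nth using assms(3) j by (intro sum.neutral) auto
  moreover have "fps_nth (SUM i<N. fps_const (w i) * fps_X ^ i) j = (SUM i<N. if i = j then w i else 0)"
   unfolding fps_sum_nth by (intro sum.cong) auto
  ultimately have "fps_nth (expand u * expand v + (SUM i<N. fps_const (w i) * fps_X ^ i)) j = w j" using j by simp
  thus "w j = 0" unfolding e by simp
 qed
qed

end

section \<open>The auxiliary function in Stepanov's method\<close>

context plane_curve
begin

interpretation loc: crhom loc by (rule crhom_loc)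
interpretation expand: crhom expand by (rule crhom_expand)

lemma fps_frob_add: "crhom (%f :: 'a alg_closure fps. f ^ (CARD('a) ^ m))"
proof (rule crhom_frob)
 show "crhom (%c::'a. fps_const (to_ac c))" by unfold_locales (simp_all flip: fps_const_add fps_const_mult)
qed

text \<open>Linear independence over \<open>M'\<close>-th powers: the functions \<open>X^i Y^j\<close> of small degree have orders of
 vanishing below \<open>M'\<close> at the smooth point, and so has every combination of them.\<close>

lemma power_independent:
 assumes M': "M' = CARD('a) ^ m" "d * (B + d) < M'"
  and w: "EX i<=B. EX j<d. w i j ~= 0"
 shows "(SUM i<=B. SUM j<d. expand (mono2 i j) * w i j ^ M') ~= 0"
proof
 assume z: "(SUM i<=B. SUM j<d. expand (mono2 i j) * w i j ^ M') = 0"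
 interpret F: crhom "%f :: 'a alg_closure fps. f ^ M'" unfolding M'(1) by (rule fps_frob_add)
 \<comment> \<open>The common power of the variable is divided out, which leaves at least one
   \<open>w' i j\<close> with nonzero constant term.\<close>
 obtain i0 j0 where 0: "i0 <= B" "j0 < d" "w i0 j0 ~= 0"
  and min: "!!i j. i <= B ==> j < d ==> w i j ~= 0 ==> subdegree (w i0 j0) <= subdegree (w i j)"
 proof -
  let ?P = "%p. fst p <= B & snd p < d & w (fst p) (snd p) ~= 0"
  obtain i j where "i <= B" "j < d" "w i j ~= 0" using w by blast
  hence "?P (i, j)" by simp
  then obtain p where "?P p" "!!p'. ?P p' ==> subdegree (w (fst p) (snd p)) <= subdegree (w (fst p') (snd p'))"
   using ex_has_least_nat[of ?P "(i, j)" "%p. subdegree (w (fst p) (snd p))"] by blast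
  thus ?thesis using that[of "fst p" "snd p"] by force
 qed
 define \<mu> where "\<mu> = subdegree (w i0 j0)"
 define w' where "w' i j = fps_shift \<mu> (w i j)" for i j
 define c where "c i j = fps_nth (w' i j) 0" for i j
 have ww: "w i j = fps_X ^ \<mu> * w' i j" if "i <= B" "j < d" for i j
 proof (cases "w i j = 0")
  case False
  hence "\<mu> <= subdegree (w i j)" using min that by (simp add: \<mu>_def)
  thus ?thesis using fps_shift_times_fps_X_power[of \<mu> "w i j"] by (simp add: w'_def mult.commute)
 qed (simp add: w'_def)
 have c0: "c i0 j0 ~= 0" using 0 by (simp add: c_def w'_def \<mu>_def)
 have "(fps_X ^ \<mu>) ^ M' * (SUM i<=B. SUM j<d. expand (mono2 i j) * w' i j ^ M') = (SUM i<=B. SUM j<d. expand (mono2 i j) * w i j ^ M')"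
  unfolding sum_distrib_left by (intro sum.cong refl) (simp add: ww power_mult_distrib mult.left_commute)
 hence z': "(SUM i<=B. SUM j<d. expand (mono2 i j) * w' i j ^ M') = 0" using z by simp
 \<comment> \<open>Raising to the power \<open>M'\<close> is additive, so modulo the
   \<open>M'\<close>-th power of the variable each \<open>w'\<close> may be replaced by its constant
   term. Thus \<open>U\<close>, a nonzero polynomial of degree at most B + d, would vanish to order
   \<open>M'\<close>, against \<open>order_bound\<close>.\<close>
 define U where "U = (SUM i<=B. SUM j<d. smult [:c i j ^ M':] (mono2 i j))"
 have cU: "coeff (coeff U b) a = (if a <= B & b < d then c a b ^ M' else 0)" for a b
 proof -
  have "coeff (coeff U b) a = (SUM i<=B. SUM j<d. if a = i & b = j then c i j ^ M' else 0)"
   unfolding U_def coeff_sum by (intro sum.cong refl) (simp add: coeff_mono2)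
  also have "... = (SUM i<=B. if a = i then (if b < d then c i b ^ M' else 0) else 0)"
   by (intro sum.cong refl) auto
  finally show ?thesis by auto
 qed
 have "w' i j ^ M' = fps_const (c i j ^ M') + fps_X ^ M' * (fps_shift 1 (w' i j)) ^ M'" for i j
 proof -
  have "w' i j = fps_const (c i j) + fps_X * fps_shift 1 (w' i j)"
  proof (rule fps_ext)
   fix n show "fps_nth (w' i j) n = fps_nth (fps_const (c i j) + fps_X * fps_shift 1 (w' i j)) n"
    by (cases n) (simp_all add: c_def)
  qed
  hence "w' i j ^ M' = (fps_const (c i j) + fps_X * fps_shift 1 (w' i j)) ^ M'" by simp
  thus ?thesis by (simp add: F.h_add power_mult_distrib)
 qed
 hence "(SUM i<=B. SUM j<d. expand (mono2 i j) * w' i j ^ M')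
  = (SUM i<=B. SUM j<d. expand (smult [:c i j ^ M':] (mono2 i j)) + fps_X ^ M' * (expand (mono2 i j) * (fps_shift 1 (w' i j)) ^ M'))"
  by (simp add: expand_smult algebra_simps)
 also have "... = expand U + fps_X ^ M' * (SUM i<=B. SUM j<d. expand (mono2 i j) * (fps_shift 1 (w' i j)) ^ M')"
  by (simp add: U_def expand.h_sum sum.distrib sum_distrib_left)
 finally have e: "expand U = - (fps_X ^ M' * (SUM i<=B. SUM j<d. expand (mono2 i j) * (fps_shift 1 (w' i j)) ^ M'))"
  using z' by (simp add: eq_neg_iff_add_eq_0)
 have "fps_nth (expand U) i = 0" if "i < M'" for i
  unfolding e using that by (simp add: fps_X_power_mult_nth)
 moreover have "~ H dvd U"
 proof (rule not_dvd_small)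
  show "U ~= 0" using cU[of j0 i0] 0 c0 by auto
  show "ALL b>=d. coeff U b = 0" using cU by (auto simp: poly_eq_iff)
 qed
 moreover have "tdle U (B + d)" using cU by (auto simp: tdle_def)
 ultimately have "M' <= d * (B + d)" by (intro order_bound) auto
 thus False using M'(2) by simp
qed

lemma card_remainders:
 "finite {r :: 'a poly poly. tdle r s & (ALL b>=d. coeff r b = 0)}"
 "card {r :: 'a poly poly. tdle r s & (ALL b>=d. coeff r b = 0)} <= CARD('a) ^ (d * (s + 1))"
proof -
 let ?R = "{r :: 'a poly poly. tdle r s & (ALL b>=d. coeff r b = 0)}"
 let ?I = "{..<d} \<times> {..s}"
 let ?f = "%r :: 'a poly poly. restrict (%p. coeff (coeff r (fst p)) (snd p)) ?I"
 have inj: "inj_on ?f ?R"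
 proof (rule inj_onI)
  fix r r' assume r: "r : ?R" "r' : ?R" and eq: "?f r = ?f r'"
  show "r = r'"
  proof (rule poly_eqI, rule poly_eqI)
   fix b a
   show "coeff (coeff r b) a = coeff (coeff r' b) a"
   proof (cases "(b, a) : ?I")
    case True thus ?thesis using fun_cong[OF eq, of "(b, a)"] by simp
   next
    case False
    thus ?thesis using r tdleD[of r s a b] tdleD[of r' s a b] by (cases "b < d") auto
   qed
  qed
 qed
 have sub: "?f ` ?R <= ?I \<rightarrow>\<^sub>E UNIV"
  by (rule image_subsetI, unfold PiE_iff) (intro conjI restrict_extensional ballI UNIV_I)
 have fin: "finite (?I \<rightarrow>\<^sub>E (UNIV :: 'a set))" by (intro finite_PiE) auto
 show "finite ?R" using inj_on_finite[OF inj sub fin] .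
 have "card ?R <= card (?I \<rightarrow>\<^sub>E (UNIV :: 'a set))" by (rule card_inj_on_le[OF inj sub fin])
 also have "... = CARD('a) ^ (d * (s + 1))" by (simp add: card_PiE)
 finally show "card ?R <= CARD('a) ^ (d * (s + 1))" .
qed

text \<open>What remains of the M-th power of the auxiliary function as the coefficient of the l-th
  power of y^(M M'), once x^(M M') has been replaced by x.\<close>

definition powsum :: "nat => nat => nat => (nat \<times> nat \<times> nat \<times> nat => 'a) => nat => 'a poly poly" where
 "powsum B K M \<beta> l = (SUM i<=B. SUM j<d. SUM k<K. smult [:\<beta> (i, j, k, l):] (mono2 (i * M + k) (j * M)))"

text \<open>\<open>Cf\<close> lists \<open>e\<close> additive conditions on the polynomials
  \<open>A l\<close> which force the sum of A l (y^(M M'))^l to vanish on \<open>S\<close>. There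
  are more coefficient families \<beta> than values of the remainders of these conditions modulo
  \<open>h\<close>, so two families agree, and their difference satisfies all conditions on the
  curve. The resulting function \<open>G\<close> is not zero on the curve, but its M-th power
  vanishes on \<open>S\<close>; passing to this power does the work of a high multiplicity, and the
  weak Bezout bound finishes.\<close>

theorem stepanov:
 fixes Cf :: "(nat => 'a poly poly) => nat => 'a poly poly"
 assumes M: "M = CARD('a) ^ ma" "M' = CARD('a) ^ mb" and small: "d * (B + d) < M'"
  and many: "e * (d * (B * M + K + d * M + d + 1)) < (B + 1) * d * K * d"
  and Cdiff: "!!A A' i. Cf (%l. A l - A' l) i = Cf A i - Cf A' i"
  and Ctd: "!!A s i. (!!l. l < d ==> tdle (A l) s) ==> i < e ==> tdle (Cf A i) (s + d)"
  and Cpt: "!!A x y. (x, y) : S ==> (!!i. i < e ==> ev2 (lift (Cf A i)) x y = 0) ==>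
    (SUM l<d. ev2 (lift (A l)) x y * (y ^ (M * M')) ^ l) = 0"
  and S: "finite S" "!!x y. (x, y) : S ==> ev2 H x y = 0 & x ^ (M * M') = x"
 shows "card S <= d * (B + d + M' * (K + d))"
proof -
 let ?s = "B * M + K + d * M"
 let ?I = "{..B} \<times> {..<d} \<times> {..<K} \<times> {..<d}"
 let ?R = "{r :: 'a poly poly. tdle r (?s + d) & (ALL b>=d. coeff r b = 0)}"
 have tdA: "tdle (powsum B K M \<beta> l) ?s" for \<beta> l
  unfolding powsum_def
 proof (intro tdle_sum tdle_smult tdle_mono2)
  fix i j k assume "i : {..B}" "j : {..<d}" "k : {..<K}"
  hence "i * M <= B * M" "j * M <= d * M" "k <= K" by auto
  thus "i * M + k + j * M <= ?s" by linarith
 qed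
 have "EX r. r : ?R & h dvd (Cf (powsum B K M \<beta>) i - r)" if "i < e" for \<beta> i
  using red_exists[OF deg_h monic_h td_h Ctd[of "powsum B K M \<beta>", OF tdA that]] by blast
 hence ex: "EX r. i < e --> r : ?R & h dvd (Cf (powsum B K M \<beta>) i - r)" for \<beta> i by blast
 define rd where "rd \<beta> i = (SOME r. i < e --> r : ?R & h dvd (Cf (powsum B K M \<beta>) i - r))" for \<beta> i
 have rd: "rd \<beta> i : ?R" "h dvd (Cf (powsum B K M \<beta>) i - rd \<beta> i)" if "i < e" for \<beta> i
  using someI_ex[OF ex, of i \<beta>] that unfolding rd_def[symmetric] by blast+
 let ?f = "%\<beta>. restrict (rd \<beta>) {..<e}"
 have "?f ` (?I \<rightarrow>\<^sub>E UNIV) <= {..<e} \<rightarrow>\<^sub>E ?R"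
 proof (rule image_subsetI)
  fix \<beta> show "?f \<beta> : {..<e} \<rightarrow>\<^sub>E ?R"
   unfolding PiE_iff using rd(1) by (intro conjI restrict_extensional ballI) (simp only: restrict_apply lessThan_iff if_True)
 qed
 hence "card (?f ` (?I \<rightarrow>\<^sub>E UNIV)) <= card ({..<e} \<rightarrow>\<^sub>E ?R)"
  by (intro card_mono finite_PiE card_remainders(1)) auto
 also have "... = card ?R ^ e" by (simp add: card_PiE)
 also have "... <= (CARD('a) ^ (d * (?s + d + 1))) ^ e" by (intro power_mono card_remainders(2)) simp
 also have "... = CARD('a) ^ (e * (d * (?s + d + 1)))" by (simp add: mult.commute flip: power_mult)
 also have "... < CARD('a) ^ card ?I"
  using many finite_field_card_gt_1[where 'a = 'a] by (intro power_strict_increasing) (auto simp: mult_ac)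
 also have "... = card (?I \<rightarrow>\<^sub>E (UNIV :: 'a set))" by (simp add: card_PiE)
 finally have "~ inj_on ?f (?I \<rightarrow>\<^sub>E UNIV)" by (rule pigeonhole)
 then obtain \<beta>1 \<beta>2 where b12: "\<beta>1 : ?I \<rightarrow>\<^sub>E UNIV" "\<beta>2 : ?I \<rightarrow>\<^sub>E UNIV" "\<beta>1 ~= \<beta>2" "?f \<beta>1 = ?f \<beta>2"
  unfolding inj_on_def by blast
 define \<beta> where "\<beta> t = \<beta>1 t - \<beta>2 t" for t
 obtain i1 j1 k1 l1 where nz: "i1 <= B" "j1 < d" "k1 < K" "l1 < d" "\<beta> (i1, j1, k1, l1) ~= 0"
 proof -
  obtain t where t: "\<beta>1 t ~= \<beta>2 t" using b12(3) by blast
  hence "t : ?I" using PiE_arb[OF b12(1), of t] PiE_arb[OF b12(2), of t] by metis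
  moreover have "\<beta> t ~= 0" using t by (simp add: \<beta>_def)
  ultimately show ?thesis using that by (cases t) auto
 qed
 have ps: "powsum B K M \<beta> = (%l. powsum B K M \<beta>1 l - powsum B K M \<beta>2 l)"
 proof
  fix l show "powsum B K M \<beta> l = powsum B K M \<beta>1 l - powsum B K M \<beta>2 l"
   unfolding powsum_def sum_subtractf[symmetric] \<beta>_def
   by (intro sum.cong refl) (simp flip: smult_diff_left)
 qed
 have dv: "h dvd Cf (powsum B K M \<beta>) i" if i: "i < e" for i
 proof -
  have "rd \<beta>1 i = rd \<beta>2 i" using fun_cong[OF b12(4), of i] i by simp
  hence "Cf (powsum B K M \<beta>) i = (Cf (powsum B K M \<beta>1) i - rd \<beta>1 i) - (Cf (powsum B K M \<beta>2) i - rd \<beta>2 i)"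
   unfolding ps Cdiff by simp
  thus ?thesis using rd(2)[OF i] by simp
 qed
 \<comment> \<open>The exponents are read in two ways. Grouped by i and j, \<open>G\<close> is a
   combination of small monomials with \<open>M'\<close>-th powers as coefficients, hence nonzero;
   raised to the power \<open>M\<close>, it acquires the exponents M M' k and M M' l, which can be
   reduced on \<open>S\<close>.\<close>
 define G where "G = (SUM i<=B. SUM j<d. SUM k<K. SUM l<d. smult [:\<beta> (i, j, k, l):] (mono2 (i + M' * k) (j + M' * l)))"
 have tdG: "tdle G (B + d + M' * (K + d))"
  unfolding G_def
 proof (intro tdle_sum tdle_smult tdle_mono2)
  fix i j k l assume "i : {..B}" "j : {..<d}" "k : {..<K}" "l : {..<d}"
  hence "i <= B" "j <= d" "k <= K" "l <= d" by auto
  from this(1,2) mult_le_mono2[OF this(3), of M'] mult_le_mono2[OF this(4), of M']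
  show "i + M' * k + (j + M' * l) <= B + d + M' * (K + d)" unfolding distrib_left by linarith
 qed
 have liftG: "lift G = (SUM i<=B. SUM j<d. SUM k<K. SUM l<d. smult [:to_ac (\<beta> (i, j, k, l)):] (mono2 (i + M' * k) (j + M' * l)))"
  unfolding G_def by (simp add: mac.mp_sum lift_smult_const lift_mono2)
 have "~ H dvd lift G"
 proof -
  define v where "v i j = (SUM k<K. SUM l<d. smult [:\<beta> (i, j, k, l):] (mono2 k l))" for i j
  have cv: "coeff (coeff (v i j) b) a = (if a < K & b < d then \<beta> (i, j, a, b) else 0)" for i j a b
  proof -
   have "coeff (coeff (v i j) b) a = (SUM k<K. SUM l<d. if a = k & b = l then \<beta> (i, j, k, l) else 0)"
    unfolding v_def coeff_sum by (intro sum.cong refl) (simp add: coeff_mono2)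
   also have "... = (SUM k<K. if a = k then (if b < d then \<beta> (i, j, k, b) else 0) else 0)"
    by (intro sum.cong refl) auto
   finally show ?thesis by auto
  qed
  have mono2_mult: "mono2 a b * mono2 a' b' = (mono2 (a + a') (b + b') :: 'a alg_closure poly poly)" for a b a' b'
   by (simp add: mono2_def mult_monom)
  have mono2_pow: "mono2 a b ^ n = (mono2 (n * a) (n * b) :: 'a alg_closure poly poly)" for a b n
   by (simp add: mono2_def monom_power mult.commute)
  interpret F: crhom "%f :: 'a alg_closure fps. f ^ M'" unfolding M by (rule fps_frob_add)
  have "expand (lift G) = (SUM i<=B. SUM j<d. expand (mono2 i j) * (expand (lift (v i j))) ^ M')"
  proof -
   have bM: "to_ac b ^ M' = to_ac b" for b :: 'a by (simp add: M finite_field_power_card_power flip: to_ac_power)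
   have "(expand (lift (v i j))) ^ M' = (SUM k<K. SUM l<d. fps_const (to_ac (\<beta> (i, j, k, l))) * expand (mono2 (M' * k) (M' * l)))" for i j
    unfolding v_def
    by (simp add: mac.mp_sum lift_smult_const lift_mono2 expand.h_sum F.h_sum expand_smult power_mult_distrib bM mono2_pow flip: expand.h_power)
   moreover have "expand (mono2 (i + M' * k) (j + M' * l)) = expand (mono2 i j) * expand (mono2 (M' * k) (M' * l))" for i j k l
    by (simp add: mono2_mult flip: expand.h_mult)
   ultimately show ?thesis unfolding liftG
    by (simp add: expand.h_sum expand_smult sum_distrib_left mult.left_commute)
  qed
  moreover have "(SUM i<=B. SUM j<d. expand (mono2 i j) * (expand (lift (v i j))) ^ M') ~= 0"
  proof (rule power_independent[OF M(2) small])
   have "v i1 j1 ~= 0" using cv[of i1 j1 l1 k1] nz by auto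
   moreover have "ALL b>=d. coeff (v i1 j1) b = 0" using cv by (auto simp: poly_eq_iff)
   ultimately have "~ H dvd lift (v i1 j1)"
    by (intro not_dvd_small) (auto simp: lift_0_iff coeff_map_poly)
   thus "EX i<=B. EX j<d. expand (lift (v i j)) ~= 0" using nz expand_eq_0_iff by blast
  qed
  ultimately show ?thesis using expand_eq_0_iff by metis
 qed
 moreover have "ev2 (lift G) x y = 0" if xy: "(x, y) : S" for x y
 proof -
  have bM: "to_ac b ^ M = to_ac b" for b :: 'a by (simp add: M finite_field_power_card_power flip: to_ac_power)
  have "ev2 (lift (Cf (powsum B K M \<beta>) i)) x y = 0" if "i < e" for i
  proof -
   have "H dvd lift (Cf (powsum B K M \<beta>) i)" using dv[OF that] by (auto simp: mac.mp_mult)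
   thus ?thesis using ev2_dvd S(2)[OF xy] by blast
  qed
  hence 0: "(SUM l<d. ev2 (lift (powsum B K M \<beta> l)) x y * (y ^ (M * M')) ^ l) = 0" by (rule Cpt[OF xy])
  have "(ev2 (lift G) x y) ^ M = (SUM i<=B. SUM j<d. SUM k<K. SUM l<d. to_ac (\<beta> (i, j, k, l)) * (x ^ (i + M' * k) * y ^ (j + M' * l)) ^ M)"
   unfolding liftG M(1) by (simp add: frob.h_sum power_mult_distrib bM[unfolded M(1)])
  also have "... = (SUM i<=B. SUM j<d. SUM k<K. SUM l<d. to_ac (\<beta> (i, j, k, l)) * (x ^ (i * M + k) * y ^ (j * M)) * (y ^ (M * M')) ^ l)"
  proof (intro sum.cong refl)
   fix i j k l
   have "(x ^ (i + M' * k)) ^ M = x ^ (i * M) * (x ^ (M * M')) ^ k"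
    by (simp add: algebra_simps flip: power_mult power_add)
   moreover have "(y ^ (j + M' * l)) ^ M = y ^ (j * M) * (y ^ (M * M')) ^ l"
    by (simp add: algebra_simps flip: power_mult power_add)
   ultimately show "to_ac (\<beta> (i, j, k, l)) * (x ^ (i + M' * k) * y ^ (j + M' * l)) ^ M
     = to_ac (\<beta> (i, j, k, l)) * (x ^ (i * M + k) * y ^ (j * M)) * (y ^ (M * M')) ^ l"
    using S(2)[OF xy] by (simp add: power_mult_distrib power_add)
  qed
  also have "... = (SUM l<d. SUM i<=B. SUM j<d. SUM k<K. to_ac (\<beta> (i, j, k, l)) * (x ^ (i * M + k) * y ^ (j * M)) * (y ^ (M * M')) ^ l)"
  proof -
   have "(SUM i<=B. SUM j<d. SUM k<K. SUM l<d. F i j k l) = (SUM l<d. SUM i<=B. SUM j<d. SUM k<K. F i j k l)" for F :: "nat => nat => nat => nat => 'a alg_closure"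
   proof -
    have "(SUM i<=B. SUM j<d. SUM k<K. SUM l<d. F i j k l) = (SUM i<=B. SUM j<d. SUM l<d. SUM k<K. F i j k l)" by (intro sum.cong refl sum.swap)
    also have "... = (SUM i<=B. SUM l<d. SUM j<d. SUM k<K. F i j k l)" by (intro sum.cong refl sum.swap)
    also have "... = (SUM l<d. SUM i<=B. SUM j<d. SUM k<K. F i j k l)" by (rule sum.swap)
    finally show ?thesis .
   qed
   thus ?thesis .
  qed
  also have "... = (SUM l<d. ev2 (lift (powsum B K M \<beta> l)) x y * (y ^ (M * M')) ^ l)"
   unfolding powsum_def by (simp add: mac.mp_sum lift_smult_const lift_mono2 sum_distrib_right)
  finally have "(ev2 (lift G) x y) ^ M = 0" using 0 by simp
  thus ?thesis by simp
 qed
 ultimately show ?thesis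
  using card_common_zeros[OF prime_h H(1-3) _ _ S(1), of "lift G" "B + d + M' * (K + d)"] tdG S(2)
  by (auto simp: tdle_lift)
qed

end

text \<open>\<open>B\<close>, about M' / (2 d), is as large as independence permits.
  \<open>K\<close>, about e M / d, balances unknowns against conditions, and the excess \<kappa>
  covers the lower order terms. The term d K M' then gives the leading e M M', and everything else
  is O(M').\<close>

lemma stepanov_parameters:
 fixes d e M M' :: nat
 defines "\<kappa> == 4 * d * (2 * d + 1) + 1"
 assumes d: "d > 0" "e <= d" "M >= 1" "M <= M'" "4 * d * d + 4 * d <= M'"
 shows "EX B K. d * (B + d) < M' & e * (d * (B * M + K + d * M + d + 1)) < (B + 1) * d * K * d
  & d * (B + d + M' * (K + d)) <= e * (M * M') + M' * (d * \<kappa> + d * d + 2)"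
proof (intro exI conjI)
 define B where "B = M' div (2 * d)"
 define N where "N = (e * M) div d"
 let ?K = "N + \<kappa>"
 have B1: "2 * (d * B) <= M'" using div_times_less_eq_dividend[of M' "2 * d"] by (simp add: B_def mult_ac)
 have B2: "M' < 2 * (d * B) + 2 * d" using dividend_less_div_times[of "2 * d" M'] d by (simp add: B_def mult_ac)
 have N1: "d * N <= e * M" by (simp add: N_def)
 have N2: "e * M < d * N + d" using dividend_less_div_times[of d "e * M"] d by (simp add: N_def mult_ac)
 have dd: "d <= d * d" by simp
 show "d * (B + d) < M'"
 proof -
  have "2 * (d * (B + d)) <= M' + 2 * (d * d)" using B1 by (simp add: distrib_left)
  also have "... < 2 * M'" using d by simp
  finally show ?thesis by simp
 qed
 show "d * (B + d + M' * (?K + d)) <= e * (M * M') + M' * (d * \<kappa> + d * d + 2)"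
 proof -
  have "d * (B + d + M' * (?K + d)) = d * B + d * d + M' * (d * N) + M' * (d * \<kappa>) + M' * (d * d)"
   by (simp add: algebra_simps)
  also have "... <= M' + M' + M' * (e * M) + M' * (d * \<kappa>) + M' * (d * d)"
   using B1 d N1 by (intro add_mono mult_le_mono2) auto
  finally show ?thesis by (simp add: algebra_simps)
 qed
 show "e * (d * (B * M + ?K + d * M + d + 1)) < (B + 1) * d * ?K * d"
 proof -
  have "e * (d * M + d + 1) <= d * (d * M + d + 1)" using d by (intro mult_le_mono1)
  also have "... <= d * (2 * d * M + M)"
  proof (rule mult_le_mono2)
   have "d <= d * M" using d by simp
   thus "d * M + d + 1 <= 2 * d * M + M" using d(3) by linarith
  qed
  also have "... = M * (d * (2 * d + 1))" by (simp add: algebra_simps)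
  also have "... < (4 * (d * B)) * (d * (2 * d + 1))"
  proof (rule mult_strict_right_mono)
   show "M < 4 * (d * B)" using B2 d by linarith
  qed (use d in simp)
  also have "... = B * d * (4 * d * (2 * d + 1))" by simp
  finally have 1: "e * (d * M + d + 1) < B * d * (4 * d * (2 * d + 1))" .
  have 2: "e * ?K <= d * ?K" using d by (intro mult_le_mono1)
  have 3: "B * (e * M) <= B * (d * N) + B * d" using mult_le_mono2[OF less_imp_le[OF N2], of B] by (simp add: distrib_left)
  have "e * (B * M + ?K + d * M + d + 1) = B * (e * M) + e * ?K + e * (d * M + d + 1)" by (simp add: algebra_simps)
  also have "... < B * (d * N) + B * d + d * ?K + B * d * (4 * d * (2 * d + 1))" using 1 2 3 by linarith
  also have "... = (B + 1) * d * ?K" by (simp add: \<kappa>_def algebra_simps)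
  finally have "(e * (B * M + ?K + d * M + d + 1)) * d < ((B + 1) * d * ?K) * d" using d by (intro mult_strict_right_mono) auto
  thus ?thesis by (simp only: mult_ac)
 qed
qed

section \<open>Upper and lower estimates for the number of points\<close>

context plane_curve
begin

text \<open>The coefficient of the l-th power of y' in the divided difference (h(x, y') - h(x, y)) /
  (y' - y).\<close>

definition h2 :: "nat => 'a poly poly" where
 "h2 l = (SUM m:{l<..d}. smult (coeff h m) (monom 1 (m - Suc l)))"

lemma h2_top: "h2 (d - 1) = 1"
proof -
 have "{d - 1<..d} = {d}" using d_pos by auto
 thus ?thesis using monic_h deg_h by (simp add: h2_def)
qed

lemma tdle_h2: "tdle (h2 l) d"
 unfolding h2_def
proof (rule tdle_sum)
 fix m assume "m : {l<..d}"
 thus "tdle (smult (coeff h m) (monom 1 (m - Suc l))) d"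
  using tdleD[OF td_h] by (auto simp: tdle_def)
qed

lemma ev2_H_sum: "ev2 H x y = (SUM m<=d. poly (map_poly to_ac (coeff h m)) x * y ^ m)"
proof -
 have "h = (SUM m<=d. monom (coeff h m) m)" using deg_h by (metis poly_as_sum_of_monoms)
 hence "H = lift (SUM m<=d. monom (coeff h m) m)" by (rule arg_cong)
 also have "... = (SUM m<=d. monom (map_poly to_ac (coeff h m)) m)" by (simp add: mac.mp_sum map_poly_monom)
 finally show ?thesis by simp
qed

lemma h2_factor: "ev2 H x y' - ev2 H x y = (y' - y) * (SUM l<d. ev2 (lift (h2 l)) x y * y' ^ l)"
proof -
 let ?c = "%m. poly (map_poly to_ac (coeff h m)) x"
 have l2: "ev2 (lift (h2 l)) x y = (SUM m:{l<..d}. ?c m * y ^ (m - Suc l))" for l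
  by (simp add: h2_def mac.mp_sum mac.mp_smult map_poly_monom)
 have "ev2 H x y' - ev2 H x y = (SUM m<=d. ?c m * (y' ^ m - y ^ m))"
  by (simp add: ev2_H_sum right_diff_distrib sum_subtractf)
 also have "... = (SUM m<=d. SUM l<m. (y' - y) * (?c m * y ^ (m - Suc l) * y' ^ l))"
  by (simp add: power_diff_sumr2 sum_distrib_left mult_ac)
 also have "... = (SUM l<d. SUM m:{l<..d}. (y' - y) * (?c m * y ^ (m - Suc l) * y' ^ l))"
  unfolding sum.Sigma[OF finite_atMost ballI[OF finite_lessThan]] sum.Sigma[OF finite_lessThan ballI[OF finite_greaterThanAtMost]]
  by (rule sum.reindex_bij_witness[of _ "%(l, m). (m, l)" "%(m, l). (l, m)"]) auto
 finally show ?thesis by (simp add: l2 sum_distrib_left sum_distrib_right)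
qed

definition pts :: "nat => ('a alg_closure \<times> 'a alg_closure) set" where
 "pts r = {(x, y). x : kf r & y : kf r & ev2 H x y = 0}"

text \<open>Stepanov's method yields only upper bounds. The lower bound for \<open>pts\<close> comes
  from an upper bound for these complementary points, since together they fill almost all
  fibres.\<close>

definition npts' :: "nat => ('a alg_closure \<times> 'a alg_closure) set" where
 "npts' r = {(x, y). x : kf r & y ~: kf r & ev2 H x y = 0}"

lemma finite_pts: "r > 0 ==> finite (pts r)" "r > 0 ==> finite (npts' r)"
proof -
 assume r: "r > 0"
 have f: "finite (SIGMA x:kf r. {y. ev2 H x y = 0})" using card_kf(2)[OF r] fiber_finite by auto
 show "finite (pts r)" "finite (npts' r)" by (rule finite_subset[OF _ f], auto simp: pts_def npts'_def)+
qed

lemma card_pts_total: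
 "EX b. ALL r>0. d * CARD('a) ^ r <= card (pts r) + card (npts' r) + b & card (pts r) + card (npts' r) <= d * CARD('a) ^ r"
proof -
 obtain R where R: "R ~= 0" "ALL x y. poly R x ~= 0 --> ev2 H x y = 0 --> ev2 (pderiv H) x y ~= 0" using disc_exists by blast
 let ?Z = "{x. poly R x = 0}"
 have fZ: "finite ?Z" by (rule poly_roots_finite[OF R(1)])
 show ?thesis
 proof (intro exI[of _ "d * card ?Z"] allI impI)
  fix r :: nat assume r: "r > 0"
  note k = card_kf[OF r, where 'a = 'a]
  let ?A = "SIGMA x:kf r. {y. ev2 H x y = 0}"
  have A: "?A = pts r Un npts' r" "pts r Int npts' r = {}" by (auto simp: pts_def npts'_def)
  have "card (pts r) + card (npts' r) = card ?A" unfolding A(1) using A(2) finite_pts[OF r] by (simp add: card_Un_disjoint)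
  also have "card ?A = (SUM x:kf r. card {y. ev2 H x y = 0})" using k fiber_finite by (intro card_SigmaI) auto
  finally have e: "card (pts r) + card (npts' r) = (SUM x:kf r. card {y. ev2 H x y = 0})" .
  have "(SUM x:kf r. card {y. ev2 H x y = 0}) <= (SUM x:(kf r :: 'a alg_closure set). d)" by (intro sum_mono fiber_card_le)
  moreover have "d * card (kf r - ?Z) = (SUM x:kf r - ?Z. card {y. ev2 H x y = 0})"
   using fiber_card R(2) by simp
  moreover have "... <= (SUM x:kf r. card {y. ev2 H x y = 0})" using k by (intro sum_mono2) auto
  moreover have "card (kf r :: 'a alg_closure set) <= card (kf r - ?Z) + card ?Z"
   using diff_card_le_card_Diff[OF fZ, of "kf r"] by simp
  hence "d * card (kf r :: 'a alg_closure set) <= d * card (kf r - ?Z) + d * card ?Z" by (metis distrib_left mult_le_mono2)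
  ultimately show "d * CARD('a) ^ r <= card (pts r) + card (npts' r) + d * card ?Z & card (pts r) + card (npts' r) <= d * CARD('a) ^ r"
   using e k by (simp add: mult.commute)
 qed
qed

text \<open>On \<open>pts\<close> the Frobenius power of y is y itself, so a single condition
  suffices. On \<open>npts'\<close> it is a different root y' in the same fibre and satisfies the
  divided difference equation, whose coefficient at degree d - 1 is 1; making the \<open>A l\<close>
  proportional to the \<open>h2 l\<close> costs d - 1 conditions.\<close>

lemma card_pts_le:
 defines "\<kappa> == d * (4 * d * (2 * d + 1) + 1) + d * d + 2"
 assumes r: "r > 0" and M: "M = CARD('a) ^ ma" "M' = CARD('a) ^ mb" "ma + mb = r" "M <= M'" "4 * d * d + 4 * d <= M'"
 shows "card (pts r) <= CARD('a) ^ r + M' * \<kappa>" "card (npts' r) <= (d - 1) * CARD('a) ^ r + M' * \<kappa>"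
proof -
 have MM: "M * M' = CARD('a) ^ r" using M by (simp flip: power_add)
 have M1: "M >= 1" using M by simp
 show "card (pts r) <= CARD('a) ^ r + M' * \<kappa>"
 proof -
  obtain B K where BK: "d * (B + d) < M'" "1 * (d * (B * M + K + d * M + d + 1)) < (B + 1) * d * K * d"
   "d * (B + d + M' * (K + d)) <= 1 * (M * M') + M' * \<kappa>"
   using stepanov_parameters[of d 1 M M'] d_pos M unfolding \<kappa>_def by auto
  have "card (pts r) <= d * (B + d + M' * (K + d))"
  proof (rule stepanov[OF M(1,2) BK(1,2), where Cf = "%A i. SUM l<d. A l * mono2 0 l"])
   show "(SUM l<d. (A l - A' l) * mono2 0 l) = (SUM l<d. A l * mono2 0 l) - (SUM l<d. A' l * mono2 0 l)" for A A' :: "nat => 'a poly poly"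
    by (simp add: left_diff_distrib sum_subtractf)
   show "tdle (SUM l<d. A l * mono2 0 l) (s + d)" if "!!l. l < d ==> tdle (A l) s" for A :: "nat => 'a poly poly" and s
    using that by (intro tdle_sum tdle_mult tdle_mono2) auto
   show "(SUM l<d. ev2 (lift (A l)) x y * (y ^ (M * M')) ^ l) = 0"
    if "(x, y) : pts r" "!!i::nat. i < 1 ==> ev2 (lift (SUM l<d. A l * mono2 0 l)) x y = 0" for A :: "nat => 'a poly poly" and x y
    using that(1) that(2)[of 0] by (simp add: pts_def kf_def MM mac.mp_sum mac.mp_mult lift_mono2)
   show "finite (pts r)" by (rule finite_pts(1)[OF r])
   show "ev2 H x y = 0 & x ^ (M * M') = x" if "(x, y) : pts r" for x y
    using that by (simp add: pts_def kf_def MM)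
  qed
  thus ?thesis using BK(3) MM by simp
 qed
 show "card (npts' r) <= (d - 1) * CARD('a) ^ r + M' * \<kappa>"
 proof -
  obtain B K where BK: "d * (B + d) < M'" "(d - 1) * (d * (B * M + K + d * M + d + 1)) < (B + 1) * d * K * d"
   "d * (B + d + M' * (K + d)) <= (d - 1) * (M * M') + M' * \<kappa>"
   using stepanov_parameters[of d "d - 1" M M'] d_pos M unfolding \<kappa>_def by auto
  have "card (npts' r) <= d * (B + d + M' * (K + d))"
  proof (rule stepanov[OF M(1,2) BK(1,2), where Cf = "%A i. A i - A (d - 1) * h2 i"])
   show "A i - A' i - (A (d - 1) - A' (d - 1)) * h2 i = (A i - A (d - 1) * h2 i) - (A' i - A' (d - 1) * h2 i)" for A A' :: "nat => 'a poly poly" and i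
    by (simp add: algebra_simps)
   show "tdle (A i - A (d - 1) * h2 i) (s + d)" if "!!l. l < d ==> tdle (A l) s" "i < d - 1" for A :: "nat => 'a poly poly" and s i
    using that(2) tdle_h2 d_pos by (intro tdle_diff tdle_mult tdle_mono[OF that(1)]) auto
   show "finite (npts' r)" by (rule finite_pts(2)[OF r])
   show "ev2 H x y = 0 & x ^ (M * M') = x" if "(x, y) : npts' r" for x y
    using that by (simp add: npts'_def kf_def MM)
   fix A :: "nat => 'a poly poly" and x y
   assume xy: "(x, y) : npts' r" and c: "!!i. i < d - 1 ==> ev2 (lift (A i - A (d - 1) * h2 i)) x y = 0"
   define y' where "y' = y ^ (M * M')"
   have y': "y' ~= y" using xy by (simp add: y'_def MM npts'_def kf_def)
   have "ev2 H (x ^ (M * M')) y' = (ev2 H x y) ^ (M * M')" unfolding y'_def MM by (rule ev2_lift_frob)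
   hence "ev2 H x y' = 0" "ev2 H x y = 0" using xy by (simp_all add: npts'_def kf_def MM)
   hence s0: "(SUM l<d. ev2 (lift (h2 l)) x y * y' ^ l) = 0" using h2_factor[of x y' y] y' by simp
   have e: "ev2 (lift (A l)) x y = ev2 (lift (A (d - 1))) x y * ev2 (lift (h2 l)) x y" if "l < d" for l
   proof (cases "l = d - 1")
    case True thus ?thesis using h2_top by simp
   next
    case False thus ?thesis using c[of l] that by (simp add: mac.mp_diff mac.mp_mult)
   qed
   have "(SUM l<d. ev2 (lift (A l)) x y * y' ^ l) = (SUM l<d. ev2 (lift (A (d - 1))) x y * (ev2 (lift (h2 l)) x y * y' ^ l))"
   proof (intro sum.cong refl)
    fix l assume l: "l : {..<d}"
    show "ev2 (lift (A l)) x y * y' ^ l = ev2 (lift (A (d - 1))) x y * (ev2 (lift (h2 l)) x y * y' ^ l)"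
     by (subst e[OF l[unfolded lessThan_iff]]) (rule mult.assoc)
   qed
   also have "... = 0" unfolding sum_distrib_left[symmetric] s0 by simp
   finally show "(SUM l<d. ev2 (lift (A l)) x y * (y ^ (M * M')) ^ l) = 0" by (simp add: y'_def)
  qed
  thus ?thesis using BK(3) MM by simp
 qed
qed

theorem card_pts_estimate: "EX C. ALL r>=1. \<bar>real (card (pts r)) - real CARD('a) ^ r\<bar> <= C * sqrt (real CARD('a)) ^ r"
proof -
 let ?q = "CARD('a)"
 have q1: "real ?q > 1" using finite_field_card_gt_1[where 'a = 'a] by simp
 define \<kappa> where "\<kappa> = d * (4 * d * (2 * d + 1) + 1) + d * d + 2"
 define T where "T = 4 * d * d + 4 * d"
 obtain b where b: "!!r. r > 0 ==> d * ?q ^ r <= card (pts r) + card (npts' r) + b & card (pts r) + card (npts' r) <= d * ?q ^ r"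
  using card_pts_total by blast
 define C where "C = real (d + 1) * real (T ^ 2) + real b + sqrt ?q * real \<kappa>"
 have sq: "sqrt (real ?q) ^ r >= 1" for r using q1 by (intro one_le_power) simp
 have "\<bar>real (card (pts r)) - real ?q ^ r\<bar> <= C * sqrt (real ?q) ^ r" if r: "r >= 1" for r
 proof -
  \<comment> \<open>The exponent is split in halves, the larger one going to \<open>M'\<close>, so
    that the error O(M') is O(q^(r/2)).\<close>
  define mb where "mb = r - r div 2"
  define M' where "M' = ?q ^ mb"
  have "real ?q ^ mb = (sqrt ?q ^ 2) ^ mb" by simp
  also have "... = sqrt ?q ^ (2 * mb)" by (simp only: power_mult)
  finally have M'sq: "real M' = sqrt ?q ^ (2 * mb)" by (simp add: M'_def)
  also have "... <= sqrt ?q ^ Suc r" using q1 by (intro power_increasing) (auto simp: mb_def)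
  finally have M'le: "real M' <= sqrt ?q * sqrt ?q ^ r" by simp
  have tot: "d * ?q ^ r <= card (pts r) + card (npts' r) + b" "card (pts r) + card (npts' r) <= d * ?q ^ r" using b r by auto
  show ?thesis
  \<comment> \<open>Below the threshold required by the choice of parameters, q^r is at most the
    square of \<open>T\<close>, and the whole deviation is absorbed into \<open>C\<close>.\<close>
  proof (cases "T <= M'")
   case True
   have "?q ^ (r div 2) <= M'" unfolding M'_def mb_def using q1 by (intro power_increasing) auto
   hence up: "card (pts r) <= ?q ^ r + M' * \<kappa>" "card (npts' r) <= (d - 1) * ?q ^ r + M' * \<kappa>"
    using card_pts_le[OF _ refl M'_def, of r "r div 2"] r True unfolding \<kappa>_def T_def by (auto simp: mb_def)
   have "d * ?q ^ r = (d - 1) * ?q ^ r + ?q ^ r" using d_pos by (cases d) auto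
   hence lo: "?q ^ r <= card (pts r) + M' * \<kappa> + b" using tot up by linarith
   have "real (card (pts r)) <= real (?q ^ r + M' * \<kappa>)" using up(1) by (simp only: of_nat_le_iff)
   moreover have "real (?q ^ r) <= real (card (pts r) + M' * \<kappa> + b)" using lo by (simp only: of_nat_le_iff)
   ultimately have "\<bar>real (card (pts r)) - real ?q ^ r\<bar> <= real M' * real \<kappa> + real b" by simp
   also have "... <= (sqrt ?q * sqrt ?q ^ r) * real \<kappa> + real b * sqrt ?q ^ r"
    using M'le sq[of r] by (intro add_mono mult_right_mono) (simp_all add: mult_le_cancel_left1)
   also have "... <= (sqrt ?q * sqrt ?q ^ r) * real \<kappa> + real b * sqrt ?q ^ r + real (d + 1) * real (T ^ 2) * sqrt ?q ^ r"
    by simp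
   also have "... = C * sqrt ?q ^ r" by (simp add: C_def algebra_simps)
   finally show ?thesis .
  next
   case False
   have "?q ^ r <= ?q ^ (2 * mb)" using q1 by (intro power_increasing) (auto simp: mb_def)
   also have "... = M' ^ 2" by (simp add: M'_def mult.commute flip: power_mult)
   also have "... <= T ^ 2" using False by (intro power_mono) auto
   finally have qT: "?q ^ r <= T ^ 2" .
   have "\<bar>real (card (pts r)) - real ?q ^ r\<bar> <= real (card (pts r)) + real (?q ^ r)" by (simp add: abs_le_iff)
   also have "... = real (card (pts r) + ?q ^ r)" by simp
   also have "... <= real ((d + 1) * ?q ^ r)" using tot by (simp only: of_nat_le_iff) simp
   also have "... <= real ((d + 1) * T ^ 2)" using qT by (simp only: of_nat_le_iff mult_le_mono2)
   also have "... = real (d + 1) * real (T ^ 2)" by (simp only: of_nat_mult)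
   also have "... <= real (d + 1) * real (T ^ 2) * sqrt ?q ^ r" using mult_left_mono[OF sq[of r], of "real (d + 1) * real (T ^ 2)"] by simp
   also have "... <= C * sqrt ?q ^ r" unfolding C_def using q1 by (intro mult_right_mono) auto
   finally show ?thesis .
  qed
 qed
 thus ?thesis by blast
qed

end

section \<open>The function field of a plane curve\<close>

text \<open>Rational functions of \<open>x\<close> are expanded at infinity: \<open>x\<close> is the inverse of the variable of the Laurent series.\<close>

definition px :: "'b::field poly => 'b fls" where
 "px p = poly (map_poly fls_const p) fls_X_inv"

lemma crhom_fls_const: "crhom (fls_const :: 'b::field => _)"
 by unfold_locales (simp_all add: fls_const_mult_const fls_plus_const)

interpretation px: crhom px
 unfolding px_def by (rule crhom.crhom_eval[OF crhom_fls_const])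

lemma px_pCons: "px (pCons a p) = fls_const a + fls_shift 1 (px p)"
 by (simp add: px_def fls_X_inv_times_conv_shift map_poly_pCons)

lemma px_nth: "fls_nth (px p) n = (if n <= 0 then coeff p (nat (- n)) else 0)"
proof (induction p arbitrary: n)
 case 0 thus ?case by simp
next
 case (pCons a p)
 have "nat (- n) = Suc (nat (- (n + 1)))" if "n < 0" using that by simp
 thus ?case using pCons.IH[of "n + 1"] by (auto simp: px_pCons)
qed

lemma px_eq_iff: "px p = px s \<longleftrightarrow> p = s"
proof
 assume e: "px p = px s"
 show "p = s"
 proof (rule poly_eqI)
  fix i show "coeff p i = coeff s i" using px_nth[of p "- int i"] px_nth[of s "- int i"] e by simp
 qed
qed simp

lemma px_0_iff: "px p = 0 \<longleftrightarrow> p = 0"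
 using px_eq_iff[of p 0] by simp

lemma px_const: "px [:a:] = fls_const a"
 by (simp add: px_pCons)

lemma px_X: "px [:0, 1:] = fls_X_inv"
 by (simp add: px_pCons flip: fls_X_inv_conv_shift_1)

lemma range_px: "range px = {f. ALL n>0. fls_nth f n = 0}"
proof (intro equalityI subsetI)
 fix f :: "'b::field fls" assume f: "f : {f. ALL n>0. fls_nth f n = 0}"
 define N where "N = nat (- fls_subdegree f)"
 define p where "p = (SUM i<=N. monom (fls_nth f (- int i)) i)"
 have cp: "coeff p i = fls_nth f (- int i)" for i
 proof (cases "i <= N")
  case True thus ?thesis by (simp add: p_def coeff_sum)
 next
  case False
  hence "- int i < fls_subdegree f" by (simp add: N_def)
  thus ?thesis by (simp add: p_def coeff_sum)
 qed
 have "f = px p"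
 proof (rule fls_eqI)
  fix n show "fls_nth f n = fls_nth (px p) n" using f by (simp add: px_nth cp)
 qed
 thus "f : range px" by blast
qed (auto simp: px_nth)

section \<open>Rational functions inside Laurent series at infinity\<close>

definition subr :: "'b::comm_ring_1 set => bool" where
 "subr S \<longleftrightarrow> 1 : S & (ALL a:S. ALL b:S. a - b : S & a * b : S)"

lemma subr_simps:
 assumes "subr S"
 shows "1 : S" "0 : S" "a : S ==> b : S ==> a - b : S" "a : S ==> b : S ==> a * b : S"
  "a : S ==> - a : S" "a : S ==> b : S ==> a + b : S"
  "(!!i. i : I ==> f i : S) ==> sum f I : S" "a : S ==> a ^ n : S"
proof -
 have d: "!!a b. a : S ==> b : S ==> a - b : S" and one: "1 : S" and m: "!!a b. a : S ==> b : S ==> a * b : S"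
  using assms by (auto simp: subr_def)
 have z: "0 : S" using d[OF one one] by simp
 have n: "- a : S" if "a : S" for a using d[OF z that] by simp
 have p: "a + b : S" if "a : S" "b : S" for a b using d[OF that(1) n[OF that(2)]] by simp
 show "1 : S" "0 : S" "a : S ==> b : S ==> a - b : S" "a : S ==> b : S ==> a * b : S"
  "a : S ==> - a : S" "a : S ==> b : S ==> a + b : S" by (rule one z d m n p; assumption)+
 show "(!!i. i : I ==> f i : S) ==> sum f I : S" by (induction I rule: infinite_finite_induct) (auto intro: z p)
 show "a : S ==> a ^ n : S" by (induction n) (auto intro: one m)
qed

text \<open>The field k(x) inside the Laurent series in 1/x. Coefficients at infinity, and with them
  residues, are thus available directly.\<close>

definition ratf :: "'b::field fls set" where
 "ratf = {f. EX p s. s ~= 0 & f * px s = px p}"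

lemma ratf_px [simp]: "px p : ratf"
 unfolding ratf_def by (rule CollectI, rule exI[of _ p], rule exI[of _ 1]) simp

lemma range_px_ratf: "a : range px ==> a : ratf"
 by auto

lemma subr_ratf: "subr ratf"
 unfolding subr_def
proof (intro conjI ballI)
 show "1 : ratf" using ratf_px[of 1] by simp
 fix a b :: "'b::field fls" assume "a : ratf" "b : ratf"
 then obtain p s p' s' where ps: "s ~= 0" "s' ~= 0" "a * px s = px p" "b * px s' = px p'" by (auto simp: ratf_def)
 have "(a - b) * px (s * s') = (a * px s) * px s' - (b * px s') * px s" by (simp add: px.h_mult algebra_simps)
 also have "... = px (p * s' - p' * s)" unfolding ps by (simp add: px.h_mult px.h_diff)
 finally show "a - b : ratf" unfolding ratf_def by (intro CollectI exI[of _ "p * s' - p' * s"] exI[of _ "s * s'"] conjI) (use ps in auto)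
 have "(a * b) * px (s * s') = (a * px s) * (b * px s')" by (simp add: px.h_mult)
 also have "... = px (p * p')" unfolding ps by (simp add: px.h_mult)
 finally show "a * b : ratf" unfolding ratf_def by (intro CollectI exI[of _ "p * p'"] exI[of _ "s * s'"] conjI) (use ps in auto)
qed

lemmas ratf_simps = subr_simps[OF subr_ratf]

lemma ratf_inverse: "a : ratf ==> inverse a : ratf"
proof (cases "a = 0")
 case False
 assume "a : ratf"
 then obtain p s where ps: "s ~= 0" "a * px s = px p" by (auto simp: ratf_def)
 have "px p ~= 0" using ps False by (metis mult_eq_0_iff px_0_iff)
 moreover have "inverse a * px p = px s" unfolding ps(2)[symmetric] using False by simp
 ultimately show ?thesis unfolding ratf_def using px_0_iff by blast
qed (use ratf_simps(2) in simp)

lemma ratf_clear: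
 assumes "finite A" "A <= ratf" shows "EX s. s ~= 0 & (ALL a:A. a * px s : range px)"
 using assms
proof (induction A rule: finite_induct)
 case empty show ?case by (intro exI[of _ 1]) simp
next
 case (insert a A)
 then obtain s where s: "s ~= 0" "ALL a:A. a * px s : range px" by blast
 obtain p t where t: "t ~= 0" "a * px t = px p" using insert by (auto simp: ratf_def)
 have "b * px (s * t) : range px" if b: "b : insert a A" for b
 proof (cases "b = a")
  case True
  have "b * px (s * t) = (a * px t) * px s" by (simp add: True px.h_mult)
  thus ?thesis unfolding t(2) by (metis px.h_mult rangeI)
 next
  case False
  then obtain p' where "b * px s = px p'" using s b by blast
  hence "b * px (s * t) = px (p' * t)" by (simp add: px.h_mult)
  thus ?thesis by simp
 qed
 thus ?case using s t by (intro exI[of _ "s * t"]) auto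
qed

text \<open>This is x^(-n), since 1/x is the variable of the series.\<close>

definition Tn :: "int => 'b::field fls" where "Tn n = fls_X_intpow n"

lemma Tn_nth: "fls_nth (Tn n * f) i = fls_nth f (i - n)" "fls_nth (f * Tn n) i = fls_nth f (i - n)"
 by (simp_all add: Tn_def fls_X_intpow_times_conv_shift)

lemma Tn_nth1: "fls_nth (Tn n) i = (if i = n then 1 else 0)"
 using Tn_nth(1)[of n 1 i] by simp

lemma Tn_add: "Tn (m + n) = (Tn m * Tn n :: 'b::field fls)"
 by (rule fls_eqI) (auto simp: Tn_nth Tn_nth1)

lemma Tn_0 [simp]: "Tn 0 = 1"
 by (rule fls_eqI) (simp add: Tn_nth1)

lemma Tn_cancel [simp]: "Tn n * Tn (- n) = (1 :: 'b::field fls)"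
 using Tn_add[of n "-n"] by simp

lemma Tn_power: "Tn 1 ^ n = (Tn (int n) :: 'b::field fls)"
proof (induction n)
 case (Suc n)
 have "Tn (int (Suc n)) = (Tn 1 * Tn (int n) :: 'b fls)" using Tn_add[of 1 "int n"] by simp
 thus ?case using Suc by simp
qed simp

lemma Tn_neg: "Tn (- int n) = px (monom 1 n)"
 by (rule fls_eqI) (auto simp: px_nth Tn_nth1)

lemma Tn_ratf [simp]: "Tn n : (ratf :: 'b::field fls set)"
proof (cases "n <= 0")
 case True
 hence "Tn n = (px (monom 1 (nat (- n))) :: 'b fls)" using Tn_neg[of "nat (-n)"] by simp
 thus ?thesis by simp
next
 case False
 have "Tn n = inverse (Tn (- n) :: 'b fls)" by (metis Tn_cancel inverse_unique mult.commute)
 moreover have "Tn (- n) = (px (monom 1 (nat n)) :: 'b fls)" using Tn_neg[of "nat n"] False by simp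
 ultimately show ?thesis using ratf_inverse[OF ratf_px] by metis
qed

lemma Tn_nonzero [simp]: "Tn n ~= (0 :: 'b::field fls)"
 by (metis Tn_cancel mult_zero_left zero_neq_one)

definition inft :: "'b::field fls set" where
 "inft = {f : ratf. ALL i<0. fls_nth f i = 0}"

lemma fls_mult_nth_0: "(ALL i<0. fls_nth f i = 0) ==> (ALL i<0. fls_nth g i = 0) ==> i < 0 ==> fls_nth (f * g) i = (0 :: 'b::field)"
proof -
 assume f: "ALL i<0. fls_nth f i = 0" and g: "ALL i<0. fls_nth g i = 0" and i: "i < 0"
 have "fls_subdegree f >= 0" "fls_subdegree g >= 0" using f g by (cases "f = 0"; cases "g = 0"; auto intro: fls_subdegree_geI)+
 thus ?thesis using i by (intro fls_times_nth_eq0) simp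
qed

lemma subr_inft: "subr inft"
 unfolding subr_def
proof (intro conjI ballI)
 show "1 : inft" using ratf_simps(1) by (auto simp: inft_def)
 fix a b :: "'b::field fls" assume "a : inft" "b : inft"
 thus "a - b : inft" "a * b : inft" using ratf_simps fls_mult_nth_0[of a b] by (auto simp: inft_def)
qed

lemma subr_range_px: "subr (range px)"
 unfolding subr_def by (auto intro: px.h_diff[symmetric] px.h_mult[symmetric] range_eqI[of _ _ 1])

lemma ratf_Tn_inft: assumes "a : ratf" shows "EX n. ALL m>=n. Tn (int m) * a : inft"
proof (intro exI allI impI)
 fix m assume "m >= nat (- fls_subdegree a)"
 thus "Tn (int m) * a : inft" using ratf_simps(4)[OF Tn_ratf assms] by (auto simp: inft_def Tn_nth)
qed

lemma inft_unit:
 assumes "a : inft" "fls_nth a 0 ~= 0" shows "inverse a : inft"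
proof -
 have "fls_subdegree a = 0" using assms by (intro fls_subdegree_eqI) (auto simp: inft_def)
 hence "fls_subdegree (inverse a) = 0" by simp
 thus ?thesis using ratf_inverse[of a] assms by (auto simp: inft_def)
qed

lemma px_inft: "Tn (int n) * px p : inft" if "degree p <= n"
 using that ratf_simps(4)[OF Tn_ratf ratf_px] by (auto simp: inft_def Tn_nth px_nth coeff_eq_0)

section \<open>The function field in coordinates\<close>

context plane_curve
begin

text \<open>Division by the monic \<open>h\<close> commutes with \<open>lift\<close> and small
  remainders are unique, so divisibility by \<open>lift h\<close> descends to
  \<open>h\<close>.\<close>

lemma prime_elem_h: "prime_elem h"
proof (rule prime_elemI)
 show "h ~= 0" using monic_h by auto
 show "~ is_unit h" using deg_h d_pos by (auto simp: is_unit_poly_iff)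
 have dvd: "h dvd f" if "H dvd lift f" for f
 proof -
  obtain s where "tdle f s" using tdle_exists by blast
  then obtain r where r: "ALL b>=d. coeff r b = 0" "h dvd (f - r)" using red_exists[OF deg_h monic_h td_h] by blast
  obtain k where "f - r = h * k" using r(2) by auto
  hence "f = h * k + r" by (simp add: algebra_simps)
  hence "lift f = H * lift k + lift r" by (simp add: mac.mp_add mac.mp_mult)
  hence "H dvd lift r" using that by (metis dvd_add_right_iff dvd_triv_left)
  moreover have "ALL b>=d. coeff (lift r) b = 0" using r(1) by (simp add: coeff_map_poly)
  ultimately have "lift r = 0" using not_dvd_small by blast
  thus ?thesis using r(2) by (simp add: lift_0_iff)
 qed
 fix a b assume "h dvd a * b"
 then obtain k where "a * b = h * k" by auto
 hence "lift a * lift b = H * lift k" by (metis mac.mp_mult)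
 hence "H dvd lift a * lift b" by simp
 thus "h dvd a \<or> h dvd b" using prime_elem_dvd_multD[OF prime_h] dvd by blast
qed

text \<open>A root of \<open>h\<close> over the Laurent series. The function field is realised
  inside the algebraic closure of the Laurent series field, from which it inherits its
  arithmetic.\<close>

definition yy :: "'a fls alg_closure" where
 "yy = (SOME y. poly (map_poly to_ac (map_poly px h)) y = 0)"

definition ply :: "'a fls poly => 'a fls alg_closure" where
 "ply p = poly (map_poly to_ac p) yy"

lemma crhom_to_ac_fls: "crhom (to_ac :: 'a fls => _)"
 by (rule crhom_to_ac)

lemma crhom_ply: "crhom ply"
 unfolding ply_def by (rule crhom.crhom_eval[OF crhom_to_ac_fls])

interpretation ply: crhom ply by (rule crhom_ply)
interpretation mpx: crhom "map_poly px :: 'a poly poly => _" by (rule px.crhom_map_poly)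

lemma ply_pCons: "ply (pCons a p) = to_ac a + yy * ply p"
 by (simp add: ply_def to_ac.mp_pCons)

lemma ply_const: "ply [:a:] = to_ac a"
 by (simp add: ply_pCons)

lemma ply_smult: "ply (smult a p) = to_ac a * ply p"
 by (simp add: ply_def to_ac.mp_smult)

lemma ply_monom: "ply (monom a n) = to_ac a * yy ^ n"
 by (simp add: ply_def map_poly_monom poly_monom)

lemma degree_mpx: "degree (map_poly px g) = degree g" for g :: "'a poly poly"
 by (rule degree_map_poly) (simp add: px_0_iff)

lemma ply_h: "ply (map_poly px h) = 0"
proof -
 have "degree (map_poly to_ac (map_poly px h)) > 0"
  using deg_h d_pos by (subst degree_map_poly) (simp_all add: degree_mpx)
 from alg_closed_exists_root[OF this] show ?thesis unfolding ply_def yy_def by (rule someI_ex)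
qed

definition rho :: "'a poly poly => 'a fls alg_closure" where
 "rho g = ply (map_poly px g)"

lemma crhom_rho: "crhom rho"
 unfolding rho_def by (rule crhom_comp[OF px.crhom_map_poly crhom_ply])

interpretation rho: crhom rho by (rule crhom_rho)

lemma rho_const: "rho [:p:] = to_ac (px p)"
 by (simp add: rho_def px.mp_pCons ply_const)

lemma rho_dvd: "h dvd g ==> rho g = 0"
 using ply_h by (auto simp: rho.h_mult rho_def[of h])

lemma bezout_h: "~ h dvd g ==> EX u v r. r ~= 0 & u * h + v * g = [:r:]"
 using bezout_prime[OF prime_elem_h] deg_h d_pos by simp

lemma rho_bezout:
 assumes "~ h dvd g" shows "EX v r. r ~= 0 & rho v * rho g = to_ac (px r)"
proof -
 obtain u v r where r: "r ~= 0" "u * h + v * g = [:r:]" using bezout_h[OF assms] by blast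
 have "rho (u * h + v * g) = rho v * rho g" using rho_dvd[of h] by (simp add: rho.h_add rho.h_mult)
 thus ?thesis using r by (metis rho_const)
qed

lemma to_ac_px_0_iff: "to_ac (px r) = (0 :: 'a fls alg_closure) \<longleftrightarrow> r = 0"
 using px_0_iff[of r] by simp

lemma rho_0_iff: "rho g = 0 \<longleftrightarrow> h dvd g"
 using rho_dvd rho_bezout[of g] to_ac_px_0_iff by (metis mult_zero_right)

definition pol :: "'a fls poly set" where
 "pol = {p. degree p < d & (ALL i. coeff p i : ratf)}"

lemma pol_clear:
 assumes "p : pol" shows "EX s g. s ~= 0 & smult (px s) p = map_poly px g & (ALL b>=d. coeff g b = 0)"
proof -
 obtain s where s: "s ~= 0" "ALL a:coeff p ` {..<d}. a * px s : range px"
  using ratf_clear[of "coeff p ` {..<d}"] assms by (auto simp: pol_def)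
 have "EX c. ALL i<d. coeff p i * px s = px (c i)" using s(2) by (intro choice_iff'[THEN iffD1]) (auto simp: image_iff)
 then obtain c where c: "!!i. i < d ==> coeff p i * px s = px (c i)" by blast
 define g where "g = (SUM i<d. monom (c i) i)"
 have cg: "coeff g i = (if i < d then c i else 0)" for i
  by (simp add: g_def coeff_sum)
 have "smult (px s) p = map_poly px g"
 proof (rule poly_eqI)
  fix i show "coeff (smult (px s) p) i = coeff (map_poly px g) i"
  proof (cases "i < d")
   case True thus ?thesis using c[of i] by (simp add: coeff_map_poly cg mult.commute)
  next
   case False
   hence "coeff p i = 0" using assms by (intro coeff_eq_0) (auto simp: pol_def)
   thus ?thesis using False by (simp add: coeff_map_poly cg)
  qed
 qed
 thus ?thesis using s cg by (intro exI[of _ s] exI[of _ g]) auto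
qed

text \<open>This says that \<open>yy\<close> has degree \<open>d\<close> over k(x): after clearing
  denominators, \<open>h\<close> would divide a polynomial of smaller Y-degree.\<close>

lemma pol_ply_0: assumes "p : pol" "ply p = 0" shows "p = 0"
proof -
 obtain s g where s: "s ~= 0" "smult (px s) p = map_poly px g" "ALL b>=d. coeff g b = 0" using pol_clear[OF assms(1)] by blast
 have "rho g = 0" using assms(2) by (simp add: rho_def ply_smult flip: s(2))
 hence "h dvd g" by (simp add: rho_0_iff)
 hence "g = 0" using monic_dvd_small[OF deg_h _ s(3)] by fastforce
 hence "smult (px s) p = 0" using s(2) by simp
 thus ?thesis using s(1) px_0_iff[of s] by simp
qed

lemma pol_add: "p : pol ==> p' : pol ==> p + p' : pol" and pol_diff: "p : pol ==> p' : pol ==> p - p' : pol"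
 by (auto simp: pol_def intro: degree_add_less degree_diff_less ratf_simps(3,6))

lemma pol_smult: "a : ratf ==> p : pol ==> smult a p : pol"
 using ratf_simps(4) by (auto simp: pol_def)

lemma pol_0 [simp]: "0 : pol"
 using d_pos ratf_simps(2) by (auto simp: pol_def)

lemma pol_monom: "a : ratf ==> j < d ==> monom a j : pol"
 using ratf_simps(2) by (auto simp: pol_def intro: le_less_trans[OF degree_monom_le])

lemma pol_sum: "(!!i. i : I ==> f i : pol) ==> sum f I : pol"
 by (induction I rule: infinite_finite_induct) (auto intro: pol_add)

definition FF :: "'a fls alg_closure set" where "FF = ply ` pol"

definition co :: "'a fls alg_closure => 'a fls poly" where "co u = (THE p. p : pol & ply p = u)"

lemma co_ply: assumes "p : pol" shows "co (ply p) = p"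
 unfolding co_def
proof (rule the_equality)
 fix p' assume "p' : pol & ply p' = ply p"
 thus "p' = p" using pol_ply_0[OF pol_diff[of p' p]] assms by (simp add: ply.h_diff)
qed (use assms in simp)

lemma co_pol: "u : FF ==> co u : pol" and ply_co: "u : FF ==> ply (co u) = u"
 by (auto simp: FF_def co_ply)

lemma co_eqI: "p : pol ==> ply p = u ==> co u = p"
 using co_ply by auto

lemma FF_ply: "p : pol ==> ply p : FF"
 by (simp add: FF_def)

lemma co_add: "u : FF ==> v : FF ==> co (u + v) = co u + co v"
 and co_diff: "u : FF ==> v : FF ==> co (u - v) = co u - co v"
 and co_scale: "a : ratf ==> u : FF ==> co (to_ac a * u) = smult a (co u)"
 by (rule co_eqI; simp add: pol_add pol_diff pol_smult co_pol ply.h_add ply.h_diff ply_smult ply_co)+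

lemma co_0 [simp]: "co 0 = 0"
 by (rule co_eqI) simp_all

lemma FF_add: "u : FF ==> v : FF ==> u + v : FF" and FF_diff: "u : FF ==> v : FF ==> u - v : FF"
 and FF_scale: "a : ratf ==> u : FF ==> to_ac a * u : FF"
 unfolding FF_def by (auto simp flip: ply.h_add ply.h_diff ply_smult intro!: pol_add pol_diff pol_smult)

lemma co_coeff: "u : FF ==> coeff (co u) j : ratf" and co_coeff_0: "u : FF ==> d <= j ==> coeff (co u) j = 0"
 using co_pol[of u] by (auto simp: pol_def intro!: coeff_eq_0)

text \<open>
 Both affine charts of the curve are handled at once: for a ring \<open>S\<close> of rational functions and a
 scaling factor \<open>t\<close>, the elements whose \<open>j\<close>-th coordinate lies in \<open>t ^ j S\<close> form the ring \<open>S[t y]\<close>.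
\<close>

definition adm :: "'a fls set => 'a fls => bool" where
 "adm S t \<longleftrightarrow> subr S & S <= ratf & t : ratf & t ~= 0 & (ALL j<=d. t ^ (d - j) * px (coeff h j) : S)"

definition tS :: "'a fls set => 'a fls => nat => 'a fls set" where
 "tS S t j = (%s. t ^ j * s) ` S"

definition gr :: "'a fls set => 'a fls => 'a fls poly => bool" where
 "gr S t p \<longleftrightarrow> (ALL j. coeff p j : tS S t j)"

definition AA :: "'a fls set => 'a fls => 'a fls alg_closure set" where
 "AA S t = {u : FF. gr S t (co u)}"

context
 fixes S t assumes adm: "adm S t"
begin

lemmas S_simps = subr_simps[OF adm[unfolded adm_def, THEN conjunct1]]

lemma tS_add: "a : tS S t j ==> b : tS S t j ==> a + b : tS S t j"
 and tS_diff: "a : tS S t j ==> b : tS S t j ==> a - b : tS S t j"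
 and tS_0: "0 : tS S t j"
 and tS_mult: "a : tS S t i ==> b : tS S t j ==> a * b : tS S t (i + j)"
 and tS_ratf: "a : tS S t j ==> a : ratf"
proof -
 show "a : tS S t j ==> b : tS S t j ==> a + b : tS S t j" "a : tS S t j ==> b : tS S t j ==> a - b : tS S t j"
  using S_simps(3,6) unfolding tS_def by (auto simp flip: distrib_left right_diff_distrib)
 show "0 : tS S t j" unfolding tS_def using S_simps(2) by auto
 show "a : tS S t j ==> a : ratf" using adm ratf_simps(4,8) unfolding tS_def adm_def by blast
 assume "a : tS S t i" "b : tS S t j"
 then obtain s s' where "a = t ^ i * s" "b = t ^ j * s'" "s : S" "s' : S" by (auto simp: tS_def)
 thus "a * b : tS S t (i + j)" unfolding tS_def using S_simps(4)[of s s'] by (intro image_eqI[of _ _ "s * s'"]) (auto simp: power_add)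
qed

lemma tS_sum: "(!!i. i : I ==> f i : tS S t j) ==> sum f I : tS S t j"
 by (induction I rule: infinite_finite_induct) (auto intro: tS_add tS_0)

lemma gr_add: "gr S t p ==> gr S t p' ==> gr S t (p + p')" and gr_diff: "gr S t p ==> gr S t p' ==> gr S t (p - p')"
 by (simp_all add: gr_def tS_add tS_diff)

lemma gr_mult: "gr S t p ==> gr S t p' ==> gr S t (p * p')"
 unfolding gr_def coeff_mult
proof (intro allI tS_sum)
 fix j i :: nat assume p: "ALL j. coeff p j : tS S t j" "ALL j. coeff p' j : tS S t j" and i: "i : {..j}"
 show "coeff p i * coeff p' (j - i) : tS S t j" using tS_mult[of _ i _ "j - i"] p i by simp
qed

lemma gr_monom: "a : tS S t n ==> gr S t (monom a n)"
 by (auto simp: gr_def tS_0)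

text \<open>Division by \<open>h\<close> respects the grading because \<open>adm\<close> puts
  \<open>t ^ (d - j)\<close> times the j-th coefficient of \<open>h\<close> into
  \<open>S\<close>.\<close>

lemma gr_reduce:
 assumes "gr S t p" shows "EX r. gr S t r & degree r < d & ply r = ply p"
 using assms
proof (induction "degree p" arbitrary: p rule: less_induct)
 case less
 show ?case
 proof (cases "degree p < d")
  case False
  let ?n = "degree p"
  let ?m = "monom (lead_coeff p) (?n - d) * map_poly px h"
  have n: "d <= ?n" using False by simp
  have cm: "coeff ?m b = (if b < ?n - d then 0 else lead_coeff p * px (coeff h (b - (?n - d))))" for b
   by (simp add: coeff_monom_mult coeff_map_poly)
  have "gr S t ?m" unfolding gr_def
  proof
   fix b
   show "coeff ?m b : tS S t b"
   proof (cases "b < ?n - d \<or> b > ?n")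
    case True
    hence "coeff ?m b = 0" using n deg_h by (auto simp: cm coeff_eq_0)
    thus ?thesis using tS_0 by simp
   next
    case F: False
    define j where "j = b - (?n - d)"
    have j: "b = ?n - d + j" "j <= d" using F by (auto simp: j_def)
    obtain s where s: "s : S" "lead_coeff p = t ^ ?n * s" using less.prems by (auto simp: gr_def tS_def)
    have "coeff ?m b = t ^ ?n * s * px (coeff h j)" using F by (simp add: cm j_def s(2)[symmetric])
    also have "t ^ ?n = t ^ b * t ^ (d - j)" using j n by (simp flip: power_add)
    finally have "coeff ?m b = t ^ b * (s * (t ^ (d - j) * px (coeff h j)))" by simp
    moreover have "s * (t ^ (d - j) * px (coeff h j)) : S" using S_simps(4) s(1) adm j by (auto simp: adm_def)
    ultimately show ?thesis unfolding tS_def by blast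
   qed
  qed
  hence g: "gr S t (p - ?m)" using less.prems gr_diff by blast
  have e: "ply (p - ?m) = ply p" using ply_h by (simp add: ply.h_diff ply.h_mult)
  show ?thesis
  proof (cases "degree (p - ?m) < ?n")
   case True
   thus ?thesis using less.hyps[OF True g] e by simp
  next
   case F: False
   have z: "coeff (p - ?m) b = 0" if "b >= ?n" for b
   proof (cases "b = ?n")
    case True
    thus ?thesis using n deg_h monic_h by (simp add: cm)
   next
    case False
    thus ?thesis using that n deg_h by (simp add: cm coeff_eq_0)
   qed
   hence "p - ?m = 0" using F by (metis leading_coeff_0_iff not_less)
   hence "ply p = 0" using e by simp
   thus ?thesis using d_pos tS_0 by (intro exI[of _ 0]) (simp add: gr_def)
  qed
 qed (use less in blast)
qed

lemma gr_AA: assumes "gr S t p" shows "ply p : AA S t"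
proof -
 obtain r where r: "gr S t r" "degree r < d" "ply r = ply p" using gr_reduce[OF assms] by blast
 hence "r : pol" using tS_ratf by (auto simp: pol_def gr_def)
 thus ?thesis using r co_ply[of r] FF_ply[of r] by (simp add: AA_def)
qed

lemma AA_iff: "u : AA S t \<longleftrightarrow> u : FF & (ALL j<d. coeff (co u) j : tS S t j)"
 unfolding AA_def gr_def using co_coeff_0 tS_0 by (auto simp: not_less) (metis not_less)

lemma AA_closed:
 shows "u : AA S t ==> v : AA S t ==> u + v : AA S t" "u : AA S t ==> v : AA S t ==> u - v : AA S t"
  "u : AA S t ==> v : AA S t ==> u * v : AA S t" "s : S ==> to_ac s : AA S t" "1 : AA S t"
proof -
 show "u : AA S t ==> v : AA S t ==> u + v : AA S t" "u : AA S t ==> v : AA S t ==> u - v : AA S t"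
  by (simp_all add: AA_def FF_add FF_diff co_add co_diff gr_add gr_diff)
 show "u : AA S t ==> v : AA S t ==> u * v : AA S t"
  using gr_AA[OF gr_mult[of "co u" "co v"]] by (simp add: AA_def ply.h_mult ply_co)
 show s: "s : S ==> to_ac s : AA S t" for s
  using gr_AA[OF gr_monom[of s 0]] by (simp add: ply_monom tS_def)
 show "1 : AA S t" using s[OF S_simps(1)] by simp
qed

text \<open>Testing against w = (t y)^k brings the coordinate of index d - 1 - k to the top position
  d - 1. Proceeding from the highest coordinate downwards, the part \<open>top\<close> already known
  to be integral is split off, so that its reduction modulo \<open>h\<close> does no harm.\<close>

lemma AA_dual:
 assumes u: "u : FF" and w: "!!w. w : AA S t ==> coeff (co (u * w)) (d - 1) : tS S t (d - 1)"
 shows "u : AA S t"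
proof -
 have "coeff (co u) (d - 1 - k) : tS S t (d - 1 - k)" for k
 proof (induction k rule: less_induct)
  case (less k)
  show ?case
  proof (cases "k < d")
   case False
   thus ?thesis using less[of "d - 1"] d_pos by (cases "k = d - 1") auto
  next
   case k: True
   define j where "j = d - 1 - k"
   define top where "top = (SUM i:{j<..<d}. monom (coeff (co u) i) i)"
   have jd: "j < d" using d_pos by (simp add: j_def)
   have ih: "coeff (co u) i : tS S t i" if "i : {j<..<d}" for i
    using less[of "d - 1 - i"] that by (auto simp: j_def)
   have ct: "coeff top i = (if i : {j<..<d} then coeff (co u) i else 0)" for i
    by (simp add: top_def coeff_sum)
   have gt: "gr S t top" unfolding gr_def using ih tS_0 by (simp add: ct)
   have ptop: "top : pol" unfolding top_def using co_coeff[OF u] by (intro pol_sum pol_monom) auto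
   define p where "p = co u - top"
   have pp: "p : pol" unfolding p_def using ptop co_pol[OF u] by (rule pol_diff[rotated])
   have cp: "coeff p i = (if i <= j then coeff (co u) i else 0)" for i
    using co_coeff_0[OF u, of i] by (auto simp: p_def ct)
   define w where "w = to_ac (t ^ k) * yy ^ k"
   have wA: "w : AA S t"
    using gr_AA[OF gr_monom[of "t ^ k" k]] S_simps(1) by (force simp: w_def ply_monom tS_def)
   have tk: "t ^ k : ratf" using adm by (auto simp: adm_def intro: ratf_simps(8))
   have dg: "degree (monom (t ^ k) k * p) < d"
   proof -
    have "degree p <= j" by (rule degree_le) (simp add: cp)
    moreover have "degree (monom (t ^ k) k) <= k" by (rule degree_monom_le)
    ultimately have "degree (monom (t ^ k) k * p) <= k + j" using degree_mult_le[of "monom (t ^ k) k" p] by linarith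
    thus ?thesis using k by (simp add: j_def)
   qed
   have pw: "monom (t ^ k) k * p : pol" unfolding pol_def
   proof (intro CollectI conjI allI dg)
    fix i show "coeff (monom (t ^ k) k * p) i : ratf"
     using ratf_simps(2) ratf_simps(4)[OF tk] pp by (auto simp: coeff_monom_mult pol_def)
   qed
   have "ply (monom (t ^ k) k * p) = u * w - ply top * w"
    by (simp add: ply.h_mult ply_monom w_def p_def ply.h_diff ply_co[OF u] algebra_simps)
   moreover have "coeff (co (ply (monom (t ^ k) k * p))) (d - 1) = t ^ k * coeff p j"
    unfolding co_ply[OF pw] using k by (simp add: coeff_monom_mult j_def)
   moreover have "ply top * w : AA S t" using gr_AA[OF gt] wA AA_closed(3) by blast
   moreover have uw: "u * w : FF"
   proof -
    have "u * w = ply (monom (t ^ k) k * p) + ply top * w" using calculation(1) by simp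
    thus ?thesis using FF_ply[OF pw] calculation(3) FF_add by (simp add: AA_def)
   qed
   ultimately have e: "t ^ k * coeff (co u) j = coeff (co (u * w)) (d - 1) - coeff (co (ply top * w)) (d - 1)"
    by (simp add: cp co_diff AA_def)
   have "coeff (co (ply top * w)) (d - 1) : tS S t (d - 1)"
    using \<open>ply top * w \<in> AA S t\<close> by (simp add: AA_def gr_def)
   hence "t ^ k * coeff (co u) j : tS S t (d - 1)" unfolding e using w[OF wA] tS_diff by blast
   then obtain s where s: "s : S" "t ^ k * coeff (co u) j = t ^ (d - 1) * s" by (auto simp: tS_def)
   have "t ^ (d - 1) = t ^ k * t ^ j" using k by (simp add: j_def flip: power_add)
   hence "coeff (co u) j = t ^ j * s" using s(2) adm by (simp add: adm_def)
   thus ?thesis using s(1) unfolding j_def tS_def by blast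
  qed
 qed
 from this[of "d - 1 - _"] have "coeff (co u) j : tS S t j" if "j < d" for j
  using that by (metis Suc_diff_1 d_pos diff_diff_cancel less_Suc_eq_le)
 thus ?thesis using u by (simp add: AA_iff)
qed

end

lemma adm_ratf: "adm ratf 1"
 by (simp add: adm_def subr_ratf ratf_simps(1))

lemma adm_px: "adm (range px) 1"
 by (auto simp: adm_def subr_range_px ratf_simps(1))

lemma adm_inft: "adm inft (Tn 1)"
proof -
 have "Tn 1 ^ (d - j) * px (coeff h j) : inft" if "j <= d" for j
 proof -
  have "degree (coeff h j) <= d - j"
   by (rule degree_le) (use tdleD[OF td_h] that in auto)
  from px_inft[OF this] show ?thesis by (simp only: Tn_power)
 qed
 thus ?thesis unfolding adm_def using subr_inft by (auto simp: inft_def)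
qed

lemma FF_AA: "FF = AA ratf 1"
 using co_coeff by (auto simp: AA_iff[OF adm_ratf] tS_def)

lemma FF_mult: "u : FF ==> v : FF ==> u * v : FF" and FF_1: "1 : FF" and FF_ratf: "a : ratf ==> to_ac a : FF"
 using AA_closed[OF adm_ratf] by (simp_all add: FF_AA)

lemma rho_FF: "rho g : FF"
 unfolding rho_def FF_AA using gr_AA[OF adm_ratf, of "map_poly px g"] by (simp add: gr_def tS_def coeff_map_poly)

lemma range_rho: "AA (range px) 1 = range rho"
proof (intro equalityI subsetI)
 fix u assume u: "u : AA (range px) 1"
 have "ALL j. EX c. coeff (co u) j = px c" using u by (auto simp: AA_def gr_def tS_def)
 then obtain c where c: "!!j. coeff (co u) j = px (c j)" by metis
 have "co u = map_poly px (SUM j<d. monom (c j) j)"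
 proof (rule poly_eqI)
  fix j show "coeff (co u) j = coeff (map_poly px (SUM j<d. monom (c j) j)) j"
   using c[of j] co_coeff_0[of u j] u by (auto simp: coeff_map_poly coeff_sum AA_def)
 qed
 thus "u : range rho" using u ply_co[of u] by (auto simp: rho_def AA_def)
next
 fix u assume "u : range rho"
 thus "u : AA (range px) 1"
  using gr_AA[OF adm_px] by (auto simp: rho_def gr_def tS_def coeff_map_poly)
qed

lemma FF_inverse: assumes "u : FF" shows "inverse u : FF"
proof (cases "u = 0")
 case False
 obtain s g where s: "s ~= 0" "smult (px s) (co u) = map_poly px g" using pol_clear[OF co_pol[OF assms]] by blast
 have e: "rho g = to_ac (px s) * u" by (simp add: rho_def ply_smult ply_co assms flip: s(2))
 hence "rho g ~= 0" using False s(1) to_ac_px_0_iff by simp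
 then obtain v r where r: "r ~= 0" "rho v * rho g = to_ac (px r)" using rho_bezout rho_0_iff by blast
 have "(to_ac (inverse (px r) * px s) * rho v) * u = to_ac (inverse (px r)) * (rho v * rho g)" by (simp add: e)
 also have "... = 1" unfolding r(2) using r(1) px_0_iff[of r] by simp
 finally have "inverse u = to_ac (inverse (px r) * px s) * rho v" by (metis inverse_unique mult.commute)
 thus ?thesis using FF_scale[OF ratf_simps(4)[OF ratf_inverse[OF ratf_px] ratf_px] rho_FF] by simp
qed (use assms in simp)

end

section \<open>Dimensions from coordinates\<close>

context fq_ring
begin

lemma dm_coords_le:
 assumes "subspace A" "subspace B" "B <= A" "finite I" and f: "!!x y. x : A ==> y : A ==> (ALL i:I. f x i = (f y i :: 'a)) \<longleftrightarrow> x - y : B"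
 shows "fin A B" "dm A B <= card I"
proof -
 let ?f = "%x. restrict (f x) I"
 have f': "?f x = ?f y \<longleftrightarrow> x - y : B" if "x : A" "y : A" for x y
  using f[OF that] by (metis (mono_tags, lifting) restrict_apply' restrict_ext)
 have sub: "?f ` A <= (I \<rightarrow>\<^sub>E UNIV)" by auto
 have finP: "finite (I \<rightarrow>\<^sub>E (UNIV :: 'a set))" using assms(4) by (intro finite_PiE) auto
 have cardP: "card (I \<rightarrow>\<^sub>E (UNIV :: 'a set)) = q ^ card I" using assms(4) by (simp add: card_PiE q_def)
 show fin: "fin A B" using idx_via(2)[OF assms(2) f'] finite_subset[OF sub finP] by blast
 have "q ^ dm A B = card (?f ` A)" using idx_via(1)[OF assms(2) f'] idx_dm[OF assms(1-3) fin] by simp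
 also have "... <= q ^ card I" using card_mono[OF finP sub] cardP by simp
 finally show "dm A B <= card I" using q_gt_1 by simp
qed

lemma dm_coords:
 assumes "subspace A" "subspace B" "B <= A" "finite I" and f: "!!x y. x : A ==> y : A ==> (ALL i:I. f x i = (f y i :: 'a)) \<longleftrightarrow> x - y : B"
  and surj: "!!c. EX x:A. ALL i:I. f x i = c i"
 shows "fin A B" "dm A B = card I"
proof -
 show "fin A B" by (rule dm_coords_le(1)[OF assms(1-4) f])
 let ?f = "%x. restrict (f x) I"
 have f': "?f x = ?f y \<longleftrightarrow> x - y : B" if "x : A" "y : A" for x y
  using f[OF that] by (metis (mono_tags, lifting) restrict_apply' restrict_ext)
 have im: "?f ` A = (I \<rightarrow>\<^sub>E UNIV)"
 proof (intro equalityI subsetI)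
  fix c :: "_ => 'a" assume c: "c : I \<rightarrow>\<^sub>E UNIV"
  obtain x where x: "x : A" "ALL i:I. f x i = c i" using surj by blast
  have "?f x = c" using x(2) c by (auto simp: fun_eq_iff extensional_def)
  thus "c : ?f ` A" using x(1) by blast
 qed auto
 have "idx A B = card (I \<rightarrow>\<^sub>E (UNIV :: 'a set))" using idx_via(1)[OF assms(2) f'] im by simp
 also have "... = q ^ card I" using assms(4) by (simp add: card_PiE q_def)
 finally show "dm A B = card I" by (rule dm_eqI)
qed

end

section \<open>Two charts, their twists and the cohomology by monomials\<close>

context plane_curve
begin

interpretation ply: crhom ply by (rule crhom_ply)

text \<open>The coefficient of y^j x^(-i).\<close>

definition cf :: "'a fls alg_closure => nat => int => 'a" where
 "cf u j i = fls_nth (coeff (co u) j) i"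

lemma cf_simps:
 assumes "u : FF"
 shows "v : FF ==> cf (u + v) j i = cf u j i + cf v j i" "v : FF ==> cf (u - v) j i = cf u j i - cf v j i"
  "cf (to_ac (fls_const c) * u) j i = c * cf u j i" "cf (to_ac (Tn n) * u) j i = cf u j (i - n)"
proof -
 have c: "fls_const c : ratf" using ratf_px[of "[:c:]"] by (simp add: px_const)
 show "cf (to_ac (fls_const c) * u) j i = c * cf u j i" using co_scale[OF c assms] by (simp add: cf_def)
 show "cf (to_ac (Tn n) * u) j i = cf u j (i - n)" using co_scale[OF Tn_ratf assms] by (simp add: cf_def Tn_nth)
qed (use assms in \<open>simp_all add: cf_def co_add co_diff\<close>)

lemma cf_0 [simp]: "cf 0 j i = 0"
 by (simp add: cf_def)

lemma cf_eq_0: assumes "u : FF" "!!j i. j < d ==> cf u j i = 0" shows "u = 0"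
proof -
 have "coeff (co u) j = 0" for j
  using assms(2)[of j] co_coeff_0[OF assms(1), of j] by (cases "j < d") (auto simp: cf_def intro: fls_eqI)
 hence "co u = 0" by (simp add: poly_eq_iff)
 thus ?thesis using ply_co[OF assms(1)] by simp
qed

lemma cf_exists:
 assumes "!!j. j < d ==> a j : ratf" shows "EX u:FF. ALL j<d. coeff (co u) j = a j"
proof -
 let ?p = "SUM j<d. monom (a j) j"
 have p: "?p : pol" using assms by (intro pol_sum pol_monom) auto
 show ?thesis
  by (rule bexI[of _ "ply ?p"]) (auto simp: co_ply[OF p] FF_ply[OF p] coeff_sum if_distrib sum.delta' cong: if_cong)
qed

lemma cf_exists_finite:
 assumes "finite I" shows "EX u:FF. ALL j<d. ALL i. cf u j i = (if (j, i) : I then c (j, i) else 0)"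
proof -
 let ?a = "%j. SUM (j', i):I. if j' = j then fls_const (c (j', i)) * Tn i else 0"
 have r: "fls_const c : ratf" for c :: 'a using ratf_px[of "[:c:]"] by (simp add: px_const)
 have ra: "?a j : ratf" for j
 proof (rule ratf_simps(7))
  fix t assume "t : I"
  show "(case t of (j', i) => if j' = j then fls_const (c (j', i)) * Tn i else 0) : ratf"
   using ratf_simps(4)[OF r Tn_ratf] ratf_simps(2) by (auto split: prod.split)
 qed
 obtain u where u: "u : FF" "!!j. j < d ==> coeff (co u) j = ?a j" using cf_exists[of ?a] ra by blast
 have "cf u j i = (if (j, i) : I then c (j, i) else 0)" if "j < d" for j i
 proof -
  have "cf u j i = (SUM t:I. if t = (j, i) then c t else 0)"
   unfolding cf_def u(2)[OF that] fls_nth_sum by (intro sum.cong) (auto simp: Tn_nth1 split: prod.splits)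
  thus ?thesis using assms by simp
 qed
 thus ?thesis using u(1) by blast
qed

text \<open>The affine coordinate ring k[x, y]; its companion \<open>Ri\<close> is generated by y/x
  over the rational functions regular at x = infinity.\<close>

definition R0 where "R0 = AA (range px) 1"
definition Ri where "Ri = AA inft (Tn 1)"

lemma R0_iff: "u : R0 \<longleftrightarrow> u : FF & (ALL j<d. ALL i>0. cf u j i = 0)"
 by (simp add: R0_def AA_iff[OF adm_px] tS_def cf_def) (simp add: range_px)

lemma tS_inft: "a : tS inft (Tn 1) j \<longleftrightarrow> a : ratf & (ALL i<int j. fls_nth a i = 0)"
proof
 assume "a : tS inft (Tn 1) j"
 then obtain s where s: "s : inft" "a = Tn (int j) * s" by (auto simp: tS_def Tn_power)
 show "a : ratf & (ALL i<int j. fls_nth a i = 0)"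
  unfolding s(2) using s(1) ratf_simps(4)[OF Tn_ratf, of s] by (simp add: Tn_nth inft_def)
next
 assume a: "a : ratf & (ALL i<int j. fls_nth a i = 0)"
 have "a = (Tn (int j) * Tn (- int j)) * a" by simp
 hence "a = Tn 1 ^ j * (Tn (- int j) * a)" unfolding Tn_power mult.assoc[symmetric] .
 moreover have "Tn (- int j) * a : inft" using a ratf_simps(4)[OF Tn_ratf, of a] by (simp add: Tn_nth inft_def)
 ultimately show "a : tS inft (Tn 1) j" unfolding tS_def by blast
qed

lemma Ri_iff: "u : Ri \<longleftrightarrow> u : FF & (ALL j<d. ALL i<int j. cf u j i = 0)"
 using co_coeff by (auto simp: Ri_def AA_iff[OF adm_inft] tS_inft cf_def)

lemmas R0_closed = AA_closed[OF adm_px, folded R0_def] and Ri_closed = AA_closed[OF adm_inft, folded Ri_def]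

lemma R0_FF: "u : R0 ==> u : FF" and Ri_FF: "u : Ri ==> u : FF"
 by (simp_all add: R0_iff Ri_iff)

text \<open>In a pair, the first component belongs to the affine chart and the second one to infinity.\<close>

definition pair :: "'b => 'b => bool => 'b" where "pair u v = (%b. if b then u else v)"

lemma pair_apply [simp]: "pair u v b = (if b then u else v)"
 by (simp add: pair_def)

definition emb :: "'a => bool => 'a fls alg_closure" where "emb c = (%_. to_ac (fls_const c))"
definition EE where "EE = {e :: bool => _. e True : FF & e False : FF}"
text \<open>The second component may be x^N times an element of \<open>Ri\<close>: this is the
  lattice of the line bundle O(N) on the plane curve.\<close>

definition RN where "RN N = {e :: bool => _. e True : R0 & e False : FF & to_ac (Tn N) * e False : Ri}"
definition RR where "RR = {e :: bool => _. e True : R0 & e False : Ri}"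
definition Dl where "Dl = {e :: bool => _. e True : FF & e True = e False}"
definition cc :: "'a poly => nat => bool => 'a fls alg_closure" where
 "cc p n = pair (to_ac (px p)) (to_ac (Tn (int n)))"
definition Dn where "Dn = {cc p n |p n. p ~= 0}"
text \<open>By Euler's formula for the traces of y^j / h_Y this is, up to sign, the residue at x =
  infinity of the trace of u dx / h_Y, with h_Y the Y-derivative of \<open>h\<close>.\<close>

definition lam where "lam u = cf u (d - 1) 1"
definition tau :: "(bool => 'a fls alg_closure) => 'a" where "tau e = lam (e True) - lam (e False)"
text \<open>The second component is x^(d - 3): the canonical class of a plane curve of degree d is d
  - 3 times a line section.\<close>

definition om :: "bool => 'a fls alg_closure" where "om = pair 1 (to_ac (Tn (3 - int d)))"

lemma fls_const_ratf [simp]: "fls_const c : ratf"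
 using ratf_px[of "[:c:]"] by (simp add: px_const)

lemma const_R0: "to_ac (fls_const c) : R0" and const_Ri: "to_ac (fls_const c) : Ri"
 using R0_closed(4)[of "fls_const c"] Ri_closed(4)[of "fls_const c"] by (auto simp: range_px inft_def)

lemma Tn_Ri: "to_ac (Tn (int n)) : Ri"
 by (rule Ri_closed(4)) (simp add: inft_def Tn_nth1)

lemma px_R0: "to_ac (px p) : R0"
 by (rule R0_closed(4)) simp

sublocale ad: fq_ring emb "CARD('a)"
proof
 show "emb 1 = 1" by (simp add: emb_def fun_eq_iff)
qed (simp_all add: emb_def fun_eq_iff flip: fls_plus_const fls_const_mult_const to_ac_add to_ac_mult)

lemma EE_ss: "ad.subspace EE" and RR_ss: "ad.subspace RR" and RN_ss: "ad.subspace (RN N)" and Dl_ss: "ad.subspace Dl"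
proof -
 note r = FF_add FF_scale[OF fls_const_ratf] R0_closed(1) R0_closed(3)[OF const_R0] Ri_closed(1) Ri_closed(3)[OF const_Ri]
 have z: "0 : FF" "0 : R0" "0 : Ri" using FF_diff[OF FF_1 FF_1] by (simp_all add: R0_iff Ri_iff)
 show "ad.subspace EE" "ad.subspace RR" by (rule ad.subspaceI; simp add: EE_def RR_def emb_def z r)+
 show "ad.subspace Dl" by (rule ad.subspaceI; auto simp: Dl_def emb_def z intro: r)
 show "ad.subspace (RN N)"
  by (rule ad.subspaceI; simp add: RN_def emb_def z r distrib_left mult.left_commute[of "to_ac (fls_const _)"])
    (metis Ri_closed(3) const_Ri mult.left_commute)
qed

lemma RN_0: "RN 0 = RR"
 using Ri_FF by (auto simp: RN_def RR_def)

lemma RN_iff: "e : RN N \<longleftrightarrow> e : EE & (ALL j<d. ALL i>0. cf (e True) j i = 0) & (ALL j<d. ALL i<int j - N. cf (e False) j i = 0)"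
proof -
 have "(ALL i<int j. cf u j (i - N) = 0) \<longleftrightarrow> (ALL i<int j - N. cf u j i = 0)" for j u
 proof (intro iffI allI impI)
  fix i assume "ALL i<int j. cf u j (i - N) = 0" "i < int j - N"
  thus "cf u j i = 0" by (metis add_diff_cancel less_diff_eq)
 qed auto
 thus ?thesis using FF_scale[OF Tn_ratf, of _ N]
  by (auto simp: RN_def EE_def R0_iff Ri_iff cf_simps)
qed

lemma smul_pair:
 assumes "a ~= 0" "b ~= 0"
 shows "e : ad.smul (pair a b) {e. e True : A & e False : B} \<longleftrightarrow> e True / a : A & e False / b : B"
proof
 assume "e True / a : A & e False / b : B"
 moreover have "e = pair a b * pair (e True / a) (e False / b)" using assms by auto
 ultimately show "e : ad.smul (pair a b) {e. e True : A & e False : B}" unfolding ad.smul_def by (intro image_eqI) auto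
qed (use assms in \<open>auto simp: ad.smul_def\<close>)

lemma to_ac_Tn_neg: "to_ac (Tn (- n)) = inverse (to_ac (Tn n) :: 'a fls alg_closure)"
proof -
 have "to_ac (Tn n) * to_ac (Tn (- n)) = (1 :: 'a fls alg_closure)" by (metis Tn_cancel to_ac_1 to_ac_mult)
 thus ?thesis by (metis inverse_unique)
qed

lemma smul_om_R: "ad.smul om RR = RN (int d - 3)"
proof -
 have "to_ac (Tn (int d - 3)) = inverse (to_ac (Tn (3 - int d)) :: 'a fls alg_closure)" using to_ac_Tn_neg[of "3 - int d"] by simp
 hence "u / to_ac (Tn (3 - int d)) = to_ac (Tn (int d - 3)) * u" for u :: "'a fls alg_closure" by (simp add: field_simps)
 moreover have "to_ac (Tn (int d - 3)) * u : Ri ==> u : FF" for u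
 proof -
  assume "to_ac (Tn (int d - 3)) * u : Ri"
  hence "to_ac (Tn (3 - int d)) * (to_ac (Tn (int d - 3)) * u) : FF" using FF_scale[OF Tn_ratf] Ri_FF by blast
  moreover have "Tn (3 - int d) * Tn (int d - 3) = (1 :: 'a fls)" by (metis Tn_cancel minus_diff_eq)
  hence "to_ac (Tn (3 - int d)) * (to_ac (Tn (int d - 3)) * u) = u" by (metis mult.assoc mult_1 to_ac_1 to_ac_mult)
  ultimately show "u : FF" by simp
 qed
 ultimately show ?thesis unfolding om_def RR_def RN_def
  using smul_pair[of 1 "to_ac (Tn (3 - int d))" _ R0 Ri] by auto
qed

definition II :: "int => (nat \<times> int) set" where "II N = {(j, i). j < d & 1 <= i & i < int j - N}"
definition I0 :: "int => (nat \<times> int) set" where "I0 N = {(j, i). j < d & i <= 0 & int j - N <= i}"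

lemma finite_II: "finite (II N)" and finite_I0: "finite (I0 N)"
proof -
 have "II N <= {..<d} \<times> {1..int d - N}" "I0 N <= {..<d} \<times> {- N..0}" by (auto simp: II_def I0_def)
 thus "finite (II N)" "finite (I0 N)" by (auto intro: finite_subset)
qed

text \<open>Serre duality for the plane model at the level of monomials, realised by a reflection of
  the exponents.\<close>

lemma card_I0_II: "N + N' = int d - 3 ==> card (I0 N') = card (II N)"
 by (rule bij_betw_same_card[of "%(j, i). (d - 1 - j, 1 - i)"],
   rule bij_betw_byWitness[where f' = "%(j, i). (d - 1 - j, 1 - i)"]) (auto simp: I0_def II_def)

lemma sections_RN: "finite (RN N Int Dl)" "ad.dm (RN N Int Dl) {0} = card (I0 N)"
proof -
 have ss: "ad.subspace (RN N Int Dl)" using RN_ss Dl_ss by (rule ad.ss_Int)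
 have s: "{0} <= RN N Int Dl" using ad.ss_0[OF ss] by simp
 have f: "(ALL t:I0 N. cf (x True) (fst t) (snd t) = cf (y True) (fst t) (snd t)) \<longleftrightarrow> x - y : {0}"
  if x: "x : RN N Int Dl" and y: "y : RN N Int Dl" for x y
 proof
  assume e: "ALL t:I0 N. cf (x True) (fst t) (snd t) = cf (y True) (fst t) (snd t)"
  have m: "x - y : RN N Int Dl" using ss x y by (rule ad.ss_diff)
  have F: "x True : FF" "y True : FF" "(x - y) True : FF" using x y m by (auto simp: Dl_def)
  have "cf ((x - y) True) j i = 0" if j: "j < d" for j i
  proof (cases "(j, i) : I0 N")
   case True thus ?thesis using e F by (force simp: cf_simps)
  next
   case False
   hence "i > 0 \<or> i < int j - N" using j by (auto simp: I0_def)
   moreover have "cf ((x - y) True) j i = cf ((x - y) False) j i" using m by (simp add: Dl_def)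
   ultimately show ?thesis using m j unfolding Int_iff RN_iff by metis
  qed
  hence "(x - y) True = 0" by (rule cf_eq_0[OF F(3)])
  thus "x - y : {0}" using m by (auto simp: Dl_def fun_eq_iff) (metis (full_types))
 qed auto
 have surj: "EX x:RN N Int Dl. ALL t:I0 N. cf (x True) (fst t) (snd t) = c t" for c
 proof -
  obtain u where u: "u : FF" "!!j i. j < d ==> cf u j i = (if (j, i) : I0 N then c (j, i) else 0)"
   using cf_exists_finite[OF finite_I0] by blast
  have "(%_. u) : RN N Int Dl" unfolding Int_iff RN_iff using u by (auto simp: EE_def Dl_def I0_def)
  thus ?thesis by (rule bexI[rotated]) (use u in \<open>auto simp: I0_def\<close>)
 qed
 show "ad.dm (RN N Int Dl) {0} = card (I0 N)"
  by (rule ad.dm_coords(2)[OF ss ad.ss_zero s finite_I0 f surj])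
 show "finite (RN N Int Dl)"
  using ad.dm_coords(1)[OF ss ad.ss_zero s finite_I0 f surj] ad.dm_zero(2)[OF ss] by blast
qed

lemma splus_RN_Dl:
 assumes e: "e : EE"
 shows "e : ad.splus (RN N) Dl \<longleftrightarrow> (ALL t:II N. cf (e True - e False) (fst t) (snd t) = 0)"
proof
 assume "e : ad.splus (RN N) Dl"
 then obtain r w where rw: "r : RN N" "w : Dl" "e = r + w" by (auto simp: ad.splus_def)
 have "e True - e False = r True - r False" using rw by (simp add: Dl_def)
 thus "ALL t:II N. cf (e True - e False) (fst t) (snd t) = 0"
  using rw(1) unfolding RN_iff by (auto simp: cf_simps EE_def II_def)
next
 assume z: "ALL t:II N. cf (e True - e False) (fst t) (snd t) = 0"
 let ?v = "e True - e False"
 have v: "?v : FF" using e FF_diff by (simp add: EE_def)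
 \<comment> \<open>The polynomial part in x. The regular part of the Laurent series includes the
   constant term, which has to be restored.\<close>
 let ?b = "%j. coeff (co ?v) j - fps_to_fls (fls_regpart (coeff (co ?v) j)) + fls_const (fls_nth (coeff (co ?v) j) 0)"
 have "?b j : range px" for j unfolding range_px by simp
 hence "?b j : ratf" for j by (rule range_px_ratf)
 then obtain r where r: "r : FF" "!!j. j < d ==> coeff (co r) j = ?b j" using cf_exists[of ?b] by blast
 have cr: "cf r j i = (if i <= 0 then cf ?v j i else 0)" if "j < d" for j i
  using r(2)[OF that] by (simp add: cf_def)
 have "pair r (r - ?v) : RN N" unfolding RN_iff
 proof (intro conjI allI impI)
  show "pair r (r - ?v) : EE" using r v FF_diff by (simp add: EE_def)
  show "cf (pair r (r - ?v) True) j i = 0" if "j < d" "i > 0" for j i using that by (simp add: cr)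
  show "cf (pair r (r - ?v) False) j i = 0" if "j < d" "i < int j - N" for j i
  proof (cases "i >= 1")
   case True
   hence "(j, i) : II N" using that by (simp add: II_def)
   thus ?thesis using z cr[OF that(1)] cf_simps(2)[OF r(1) v] by force
  qed (use that cr v r(1) in \<open>simp add: cf_simps\<close>)
 qed
 moreover have "(%_. e True - r) : Dl" using e r FF_diff by (simp add: Dl_def EE_def)
 moreover have "e = pair r (r - ?v) + (%_. e True - r)" by auto
 ultimately show "e : ad.splus (RN N) Dl" unfolding ad.splus_def by blast
qed

lemma Dl_EE: "Dl <= EE" and RN_EE: "RN N <= EE" and RR_EE: "RR <= EE"
 using R0_FF Ri_FF by (auto simp: Dl_def EE_def RN_def RR_def)

lemma cosections_RN: "ad.fin EE (ad.splus (RN N) Dl)" "ad.dm EE (ad.splus (RN N) Dl) = card (II N)"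
proof -
 have ss: "ad.subspace (ad.splus (RN N) Dl)" using RN_ss Dl_ss by (rule ad.ss_splus)
 have s: "ad.splus (RN N) Dl <= EE" using EE_ss RN_EE Dl_EE by (rule ad.splus_least)
 have f: "(ALL t:II N. cf (x True - x False) (fst t) (snd t) = cf (y True - y False) (fst t) (snd t)) \<longleftrightarrow> x - y : ad.splus (RN N) Dl"
  if x: "x : EE" and y: "y : EE" for x y
 proof -
  have "(x - y) True - (x - y) False = (x True - x False) - (y True - y False)" by simp
  moreover have "x True - x False : FF" "y True - y False : FF" using x y FF_diff by (auto simp: EE_def)
  hence "cf ((x - y) True - (x - y) False) j i = 0 \<longleftrightarrow> cf (x True - x False) j i = cf (y True - y False) j i" for j i
   using calculation by (simp only: cf_simps right_minus_eq)
  thus ?thesis using splus_RN_Dl[OF ad.ss_diff[OF EE_ss x y], of N] by simp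
 qed
 have surj: "EX x:EE. ALL t:II N. cf (x True - x False) (fst t) (snd t) = c t" for c
 proof -
  obtain u where u: "u : FF" "!!j i. j < d ==> cf u j i = (if (j, i) : II N then c (j, i) else 0)"
   using cf_exists_finite[OF finite_II] by blast
  have "pair u 0 : EE" using u FF_diff[OF FF_1 FF_1] by (simp add: EE_def)
  thus ?thesis by (rule bexI[rotated]) (use u in \<open>auto simp: II_def\<close>)
 qed
 show "ad.fin EE (ad.splus (RN N) Dl)" "ad.dm EE (ad.splus (RN N) Dl) = card (II N)"
  by (rule ad.dm_coords[OF EE_ss ss s finite_II f surj]; assumption)+
qed

text \<open>Twice the arithmetic genus of a plane curve of degree d, found by counting
  monomials.\<close>

lemma card_II_0: "2 * card (II 0) = (d - 1) * (d - 2)"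
proof -
 have "II 0 = (SIGMA j:{..<d}. {1..<int j})" by (auto simp: II_def)
 hence c: "card (II 0) = (SUM j<d. j - 1)" by (simp add: nat_diff_distrib')
 have "2 * (SUM j<n. j - 1) = (n - 1) * (n - 2)" for n :: nat
 proof (induction n)
  case (Suc n)
  show ?case
  proof (cases n)
   case (Suc m)
   thus ?thesis using Suc.IH by (cases m) (auto simp: algebra_simps)
  qed simp
 qed simp
 thus ?thesis unfolding c .
qed

end

section \<open>Duality between the two charts\<close>

context plane_curve
begin

lemma FF_0: "0 : FF"
 using FF_diff[OF FF_1 FF_1] by simp

text \<open>Multiplying the test function by x^n moves the coefficient of exponent n + 1 to the one
  read by \<open>lam\<close>. So orthogonality makes the top coordinates polynomial, and
  \<open>AA_dual\<close> does the rest.\<close>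

lemma dual_R0:
 assumes "z : FF" shows "z : R0 \<longleftrightarrow> (ALL w:R0. lam (z * w) = 0)"
proof
 assume "z : R0"
 thus "ALL w:R0. lam (z * w) = 0" using R0_closed(3)[of z] d_pos by (auto simp: R0_iff lam_def)
next
 assume z: "ALL w:R0. lam (z * w) = 0"
 show "z : R0" unfolding R0_def
 proof (rule AA_dual[OF adm_px assms], fold R0_def)
  fix w assume w: "w : R0"
  have zw: "z * w : FF" using assms R0_FF[OF w] by (rule FF_mult)
  have "cf (z * w) (d - 1) (1 + int n) = 0" for n
  proof -
   have "to_ac (Tn (- int n)) * w : R0" unfolding Tn_neg using px_R0 w by (rule R0_closed(3))
   hence "lam (z * (to_ac (Tn (- int n)) * w)) = 0" using z by blast
   hence "lam (to_ac (Tn (- int n)) * (z * w)) = 0" by (simp add: mult.left_commute)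
   thus ?thesis by (simp add: lam_def cf_simps(4)[OF zw])
  qed
  from this[of "nat (i - 1)" for i] have "cf (z * w) (d - 1) i = 0" if "i > 0" for i using that by (metis add.commute diff_add_cancel int_nat_eq zle_diff1_eq)
  thus "coeff (co (z * w)) (d - 1) : tS (range px) 1 (d - 1)" by (simp add: tS_def cf_def) (simp add: range_px)
 qed
qed

text \<open>The origin of the twist: in \<open>Ri\<close> the coordinate at y^(d - 1) must vanish up
  to exponent d - 2, whereas \<open>lam\<close> reads exponent 1; the difference is d - 3.\<close>

lemma dual_Ri:
 assumes "z : FF" shows "to_ac (Tn (int d - 3)) * z : Ri \<longleftrightarrow> (ALL w:Ri. lam (z * w) = 0)"
proof -
 let ?z = "to_ac (Tn (int d - 3)) * z"
 have zF: "?z : FF" by (rule FF_scale[OF Tn_ratf assms])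
 have e: "cf (?z * w) j i = cf (z * w) j (i - (int d - 3))" if "w : FF" for w j i
  using cf_simps(4)[OF FF_mult[OF assms that], of "int d - 3"] by (simp add: mult.assoc)
 show ?thesis
 proof
  assume "?z : Ri"
  hence "cf (?z * w) (d - 1) (int d - 2) = 0" if "w : Ri" for w using Ri_closed(3)[of ?z w] that d_pos by (auto simp: Ri_iff)
  thus "ALL w:Ri. lam (z * w) = 0" using e Ri_FF by (auto simp: lam_def)
 next
  assume z: "ALL w:Ri. lam (z * w) = 0"
  show "?z : Ri" unfolding Ri_def
  proof (rule AA_dual[OF adm_inft zF], fold Ri_def)
   fix w assume w: "w : Ri"
   have zw: "z * w : FF" using assms Ri_FF[OF w] by (rule FF_mult)
   have *: "cf (z * w) (d - 1) (1 - int n) = 0" for n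
   proof -
    have "to_ac (Tn (int n)) * w : Ri" using Tn_Ri w by (rule Ri_closed(3))
    hence "lam (z * (to_ac (Tn (int n)) * w)) = 0" using z by blast
    hence "lam (to_ac (Tn (int n)) * (z * w)) = 0" by (simp add: mult.left_commute)
    thus ?thesis by (simp add: lam_def cf_simps(4)[OF zw])
   qed
   have "cf (?z * w) (d - 1) i = 0" if "i < int (d - 1)" for i
   proof -
    have "i - (int d - 3) = 1 - int (nat (int d - 2 - i))" using that d_pos by simp
    thus ?thesis unfolding e[OF Ri_FF[OF w]] using * by metis
   qed
   thus "coeff (co (?z * w)) (d - 1) : tS inft (Tn 1) (d - 1)" using co_coeff[OF FF_mult[OF zF Ri_FF[OF w]]]
    by (simp add: tS_inft cf_def)
  qed
 qed
qed

lemma perp_RR: "{z : EE. ALL x:RR. tau (z * x) = 0} = ad.smul om RR"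
proof -
 have z0: "0 : R0" "0 : Ri" using FF_0 by (simp_all add: R0_iff Ri_iff)
 have lam0: "lam 0 = 0" by (simp add: lam_def)
 have iff: "(ALL x:RR. tau (z * x) = 0) \<longleftrightarrow> (ALL w:R0. lam (z True * w) = 0) & (ALL w:Ri. lam (z False * w) = 0)" for z
 proof
  assume a: "ALL x:RR. tau (z * x) = 0"
  show "(ALL w:R0. lam (z True * w) = 0) & (ALL w:Ri. lam (z False * w) = 0)"
  proof (intro conjI ballI)
   fix w assume "w : R0"
   hence "pair w 0 : RR" using z0 by (simp add: RR_def)
   hence "tau (z * pair w 0) = 0" using a by blast
   thus "lam (z True * w) = 0" by (simp add: tau_def lam0)
  next
   fix w assume "w : Ri"
   hence "pair 0 w : RR" using z0 by (simp add: RR_def)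
   hence "tau (z * pair 0 w) = 0" using a by blast
   thus "lam (z False * w) = 0" by (simp add: tau_def lam0)
  qed
 qed (auto simp: tau_def RR_def)
 have "(ALL x:RR. tau (z * x) = 0) \<longleftrightarrow> z True : R0 & to_ac (Tn (int d - 3)) * z False : Ri" if "z : EE" for z
  using iff[of z] dual_R0[of "z True"] dual_Ri[of "z False"] that unfolding EE_def by blast
 thus ?thesis unfolding smul_om_R using R0_FF by (auto simp: RN_def EE_def)
qed

lemma cc_mult: "cc p n * cc p' n' = cc (p * p') (n + n')"
 by (simp add: cc_def fun_eq_iff px.h_mult Tn_add)

lemma cc_RR: "cc p n : RR"
 using px_R0 Tn_Ri by (simp add: cc_def RR_def)

lemma cc_inverse:
 assumes "p ~= 0" shows "pair (inverse (to_ac (px p))) (inverse (to_ac (Tn (int n)))) : EE"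
  "cc p n * pair (inverse (to_ac (px p))) (inverse (to_ac (Tn (int n)))) = 1"
 using assms FF_inverse[OF FF_ratf[OF ratf_px]] FF_inverse[OF FF_ratf[OF Tn_ratf]] px_0_iff[of p] by (auto simp: EE_def cc_def)

text \<open>Coordinates of the quotient: for each of the d powers of y, the residue modulo
  \<open>p\<close> in the affine chart and the first \<open>n\<close> admissible coefficients at
  infinity.\<close>

lemma dm_cc: assumes p: "p ~= 0" shows "ad.fin RR (ad.smul (cc p n) RR)" "ad.dm RR (ad.smul (cc p n) RR) <= d * (degree p + n)"
proof -
 define un where "un = (%a. SOME s. px s = (a :: 'a fls))"
 have un: "px (un a) = a" if "a : range px" for a unfolding un_def by (rule someI_ex) (use that in auto)
 have un_diff: "un (a - b) = un a - un b" if "a : range px" "b : range px" for a b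
  using that un[of a] un[of b] un[of "a - b"] subr_simps(3)[OF subr_range_px that] by (simp flip: px_eq_iff add: px.h_diff)
 define J where "J = {..<d} \<times> {..<degree p}"
 define J' where "J' = {..<d} \<times> {..<n}"
 define f where "f = (%e t. case t of Inl (j, i) => coeff (un (coeff (co (e True)) j) mod p) i | Inr (j, i) => cf (e False) j (int j + int i))"
 have fin: "finite (J <+> J')" by (simp add: J_def J'_def)
 have ss: "ad.subspace (ad.smul (cc p n) RR)" by (rule ad.ss_smul[OF RR_ss])
 have nz: "to_ac (px p) ~= (0 :: 'a fls alg_closure)" "to_ac (Tn (int n)) ~= (0 :: 'a fls alg_closure)" using p to_ac_px_0_iff[of p] by auto
 have mem: "e : ad.smul (cc p n) RR \<longleftrightarrow> to_ac (inverse (px p)) * e True : R0 & to_ac (Tn (- int n)) * e False : Ri" for e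
  unfolding cc_def RR_def smul_pair[OF nz] by (simp add: divide_inverse mult.commute to_ac_Tn_neg)
 have sub: "ad.smul (cc p n) RR <= RR"
 proof
  fix e assume e: "e : ad.smul (cc p n) RR"
  then obtain r where r: "r : RR" "e = cc p n * r" by (auto simp: ad.smul_def)
  thus "e : RR" using cc_RR[of p n] R0_closed(3) Ri_closed(3) by (simp add: RR_def)
 qed
 have crit: "e : ad.smul (cc p n) RR \<longleftrightarrow> (ALL j<d. p dvd un (coeff (co (e True)) j)) & (ALL j<d. ALL i<n. cf (e False) j (int j + int i) = 0)" if e: "e : RR" for e
 proof -
  have eF: "e True : FF" "e False : FF" using e R0_FF Ri_FF by (auto simp: RR_def)
  have eR: "coeff (co (e True)) j : range px" if "j < d" for j
   using e that by (simp add: RR_def R0_iff range_px cf_def)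
  have ip: "inverse (px p) : ratf" by (rule ratf_inverse[OF ratf_px])
  have 1: "inverse (px p) * coeff (co (e True)) j : range px \<longleftrightarrow> p dvd un (coeff (co (e True)) j)" if "j < d" for j
  proof -
   have "inverse (px p) * coeff (co (e True)) j : range px \<longleftrightarrow> (EX s. inverse (px p) * px (un (coeff (co (e True)) j)) = px s)"
    unfolding un[OF eR[OF that]] by blast
   also have "... \<longleftrightarrow> (EX s. px (un (coeff (co (e True)) j)) = px p * px s)" using p px_0_iff[of p] by (auto simp: field_simps)
   also have "... \<longleftrightarrow> p dvd un (coeff (co (e True)) j)" by (simp add: px_eq_iff dvd_def flip: px.h_mult)
   finally show ?thesis .
  qed
  have "to_ac (inverse (px p)) * e True : R0 \<longleftrightarrow> (ALL j<d. inverse (px p) * coeff (co (e True)) j : range px)"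
   unfolding R0_def AA_iff[OF adm_px] using FF_scale[OF ip eF(1)] by (simp add: tS_def co_scale[OF ip eF(1)] del: to_ac_inverse)
  also have "... \<longleftrightarrow> (ALL j<d. p dvd un (coeff (co (e True)) j))" using 1 by blast
  finally have a: "to_ac (inverse (px p)) * e True : R0 \<longleftrightarrow> (ALL j<d. p dvd un (coeff (co (e True)) j))" .
  have "to_ac (Tn (- int n)) * e False : Ri \<longleftrightarrow> (ALL j<d. ALL i<int j. cf (e False) j (i + int n) = 0)"
   unfolding Ri_iff using FF_scale[OF Tn_ratf eF(2)] by (simp add: cf_simps(4)[OF eF(2)])
  also have "... \<longleftrightarrow> (ALL j<d. ALL i<n. cf (e False) j (int j + int i) = 0)"
  proof (intro iffI allI impI)
   fix j i assume a: "ALL j<d. ALL i<int j. cf (e False) j (i + int n) = 0" "j < d" "i < n"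
   show "cf (e False) j (int j + int i) = 0" using a(1)[rule_format, OF a(2), of "int j + int i - int n"] a(3) by simp
  next
   fix j i assume a: "ALL j<d. ALL i<n. cf (e False) j (int j + int i) = 0" "j < d" "i < int j"
   show "cf (e False) j (i + int n) = 0"
   proof (cases "i + int n < int j")
    case True thus ?thesis using e a(2) by (simp add: RR_def Ri_iff)
   next
    case False
    hence "i + int n = int j + int (nat (i + int n - int j))" "nat (i + int n - int j) < n" using a(3) by auto
    thus ?thesis using a(1,2) by metis
   qed
  qed
  finally show ?thesis unfolding mem using a by blast
 qed
 have f: "(ALL t:J <+> J'. f x t = f y t) \<longleftrightarrow> x - y : ad.smul (cc p n) RR" if x: "x : RR" and y: "y : RR" for x y
 proof -
  have m: "x - y : RR" by (rule ad.ss_diff[OF RR_ss x y])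
  have F: "x True : FF" "y True : FF" "x False : FF" "y False : FF" using x y R0_FF Ri_FF by (auto simp: RR_def)
  have R: "coeff (co (x True)) j : range px" "coeff (co (y True)) j : range px" if "j < d" for j
   using x y that by (simp_all add: RR_def R0_iff range_px cf_def)
  have d1: "(ALL i<degree p. coeff (a mod p) i = coeff (b mod p) i) \<longleftrightarrow> p dvd a - b" for a b
  proof
   assume h: "ALL i<degree p. coeff (a mod p) i = coeff (b mod p) i"
   have "coeff (a mod p) i = coeff (b mod p) i" for i
   proof (cases "i < degree p")
    case False
    hence "coeff (a mod p) i = 0 & coeff (b mod p) i = 0"
     using degree_mod_less[OF p, of a] degree_mod_less[OF p, of b] by (auto intro: coeff_eq_0)
    thus ?thesis by simp
   qed (use h in blast)
   thus "p dvd a - b" using mod_eq_dvd_iff poly_eqI by blast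
  qed (auto simp: mod_eq_dvd_iff[symmetric])
  have "(ALL t:J <+> J'. f x t = f y t) \<longleftrightarrow> (ALL j<d. ALL i<degree p. coeff (un (coeff (co (x True)) j) mod p) i = coeff (un (coeff (co (y True)) j) mod p) i)
    & (ALL j<d. ALL i<n. cf (x False) j (int j + int i) = cf (y False) j (int j + int i))"
   unfolding J_def J'_def Plus_def f_def by (simp add: ball_Un) blast
  also have "... \<longleftrightarrow> (ALL j<d. p dvd un (coeff (co ((x - y) True)) j)) & (ALL j<d. ALL i<n. cf ((x - y) False) j (int j + int i) = 0)"
   using R by (simp add: d1 cf_simps F co_diff un_diff)
  finally show ?thesis unfolding crit[OF m] .
 qed
 show "ad.fin RR (ad.smul (cc p n) RR)" by (rule ad.dm_coords_le(1)[OF RR_ss ss sub fin f])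
 have "ad.dm RR (ad.smul (cc p n) RR) <= card (J <+> J')" by (rule ad.dm_coords_le(2)[OF RR_ss ss sub fin f])
 also have "... = d * (degree p + n)" by (simp add: J_def J'_def card_Plus distrib_left)
 finally show "ad.dm RR (ad.smul (cc p n) RR) <= d * (degree p + n)" .
qed

lemma FF_cc: assumes "u : FF" shows "EX p. p ~= 0 & to_ac (px p) * u : R0"
proof -
 obtain s g where s: "s ~= 0" "smult (px s) (co u) = map_poly px g" using pol_clear[OF co_pol[OF assms]] by blast
 have "rho g = to_ac (px s) * u" by (simp add: rho_def ply_smult ply_co assms flip: s(2))
 moreover have "rho g : R0" unfolding R0_def range_rho by simp
 ultimately show ?thesis using s(1) by metis
qed

lemma FF_Tn: assumes "u : FF" shows "EX n. to_ac (Tn (int n)) * u : Ri"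
proof -
 have "EX n. ALL m>=n. Tn (int m) * coeff (co u) j : inft" for j
  by (rule ratf_Tn_inft[OF co_coeff[OF assms]])
 then obtain n where n: "!!j m. m >= n j ==> Tn (int m) * coeff (co u) j : inft" by metis
 define N where "N = (SUM j<d. n j) + d"
 have "cf (to_ac (Tn (int N)) * u) j i = 0" if "j < d" "i < int j" for j i
 proof -
  have "n j <= (SUM j<d. n j)" using that by (intro member_le_sum) auto
  hence "N - d >= n j" by (simp add: N_def)
  from n[OF this] have "fls_nth (coeff (co u) j) (i - int (N - d)) = 0" if "i < 0" for i using that by (auto simp: inft_def Tn_nth)
  from this[of "i - int d"] have "fls_nth (coeff (co u) j) (i - int N) = 0" using that by (simp add: N_def algebra_simps)
  thus ?thesis by (simp add: cf_simps(4)[OF assms]) (simp add: cf_def)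
 qed
 thus ?thesis using FF_scale[OF Tn_ratf assms] by (auto simp: Ri_iff)
qed

sublocale ad: adele emb "CARD('a)" EE RR Dl Dn tau om
proof
 show "ad.subspace EE" "ad.subspace RR" "ad.subspace Dl" by (rule EE_ss RR_ss Dl_ss)+
 show "1 : EE" "1 : RR" "1 : Dl" using FF_1 R0_closed(5) Ri_closed(5) by (simp_all add: EE_def RR_def Dl_def)
 show "RR <= EE" "Dl <= EE" by (rule RR_EE Dl_EE)+
 show "x * y : EE" if "x : EE" "y : EE" for x y using that FF_mult by (simp add: EE_def)
 show "x * y : RR" if "x : RR" "y : RR" for x y using that R0_closed(3) Ri_closed(3) by (simp add: RR_def)
 show "x * y : Dl" if "x : Dl" "y : Dl" for x y using that FF_mult[of "x True" "y True"] by (auto simp: Dl_def)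
 show "tau (x + y) = tau x + tau y" if "x : EE" "y : EE" for x y using that by (simp add: EE_def tau_def lam_def cf_simps)
 show "tau (emb a * x) = a * tau x" if "x : EE" for x a using that by (simp add: EE_def tau_def lam_def emb_def cf_simps right_diff_distrib)
 show "{z : EE. ALL x:RR. tau (z * x) = 0} = ad.smul om RR" by (rule perp_RR)
 show "om : EE" using FF_1 FF_ratf[OF Tn_ratf] by (simp add: om_def EE_def)
 show "EX v:EE. om * v = 1"
 proof (rule bexI)
  show "om * pair 1 (to_ac (Tn (- (3 - int d)))) = 1" by (simp add: om_def fun_eq_iff flip: to_ac_mult del: minus_diff_eq)
  show "pair 1 (to_ac (Tn (- (3 - int d)))) : EE" using FF_1 FF_ratf[OF Tn_ratf] by (simp add: EE_def)
 qed
 show "EX w:Dl. z * w = 1" if z: "z : Dl" "z ~= 0" for z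
 proof (rule bexI)
  have nz: "z True ~= 0" "z False = z True" using z by (auto simp: Dl_def fun_eq_iff) (metis (full_types))
  show "z * (%_. inverse (z True)) = 1"
  proof
   fix b show "(z * (%_. inverse (z True))) b = 1 b" using nz by (cases b) simp_all
  qed
  show "(%_. inverse (z True)) : Dl" using z FF_inverse[of "z True"] by (auto simp: Dl_def)
 qed
 show "tau z = 0" if "z : Dl" for z using that by (simp add: Dl_def tau_def)
 show "Dn <= RR" using cc_RR by (auto simp: Dn_def)
 have "(1 :: bool => 'a fls alg_closure) = cc 1 0" by (simp add: cc_def fun_eq_iff)
 thus "1 : Dn" unfolding Dn_def by (metis (mono_tags, lifting) mem_Collect_eq zero_neq_one)
 show "x * y : Dn" if xy: "x : Dn" "y : Dn" for x y
 proof -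
  obtain p n p' n' where "x = cc p n" "y = cc p' n'" "p ~= 0" "p' ~= 0" using xy by (auto simp: Dn_def)
  thus ?thesis unfolding Dn_def by (intro CollectI exI[of _ "p * p'"] exI[of _ "n + n'"]) (simp add: cc_mult)
 qed
 show "EX v:EE. c * v = 1" if c: "c : Dn" for c
 proof -
  obtain p n where "p ~= 0" "c = cc p n" using c by (auto simp: Dn_def)
  thus ?thesis using cc_inverse by blast
 qed
 show "EX c:Dn. c * e : RR" if e: "e : EE" for e
 proof -
  obtain p n where "p ~= 0" "to_ac (px p) * e True : R0" "to_ac (Tn (int n)) * e False : Ri" using FF_cc[of "e True"] FF_Tn[of "e False"] e unfolding EE_def by blast
  thus ?thesis by (intro bexI[of _ "cc p n"]) (auto simp: cc_def RR_def Dn_def)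
 qed
 show "ad.fin RR (ad.smul c RR)" if "c : Dn" for c using that dm_cc(1) by (auto simp: Dn_def)
 show "finite (RR Int Dl)" "ad.fin EE (ad.splus RR Dl)" using sections_RN(1)[of 0] cosections_RN(1)[of 0] by (simp_all add: RN_0)
 show "ad.dm (RR Int Dl) {0} + ad.dm (ad.smul om RR Int Dl) {0} = ad.dm EE (ad.splus RR Dl) + ad.dm EE (ad.splus (ad.smul om RR) Dl)"
  unfolding smul_om_R using sections_RN(2)[of 0] cosections_RN(2)[of 0] sections_RN(2)[of "int d - 3"] cosections_RN(2)[of "int d - 3"]
   card_I0_II[of 0 "int d - 3"] card_I0_II[of "int d - 3" 0] by (simp add: RN_0)
 show "z = 0" if z: "z : EE" "!!x. x : EE ==> tau (z * x) = 0" for z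
 proof -
  obtain w where w: "w : FF" "lam w = 1"
   using cf_exists_finite[of "{(d - 1, 1)}" "%_. 1"] d_pos by (auto simp: lam_def)
  have l0: "lam 0 = 0" by (simp add: lam_def)
  have "z True = 0"
  proof (rule ccontr)
   assume n: "z True ~= 0"
   have "pair (inverse (z True) * w) 0 : EE" using z(1) w(1) FF_inverse FF_mult FF_0 by (simp add: EE_def)
   hence "tau (z * pair (inverse (z True) * w) 0) = 0" by (rule z(2))
   thus False using n w(2) by (simp add: tau_def l0 flip: mult.assoc)
  qed
  moreover have "z False = 0"
  proof (rule ccontr)
   assume n: "z False ~= 0"
   have "pair 0 (inverse (z False) * w) : EE" using z(1) w(1) FF_inverse FF_mult FF_0 by (simp add: EE_def)
   hence "tau (z * pair 0 (inverse (z False) * w)) = 0" by (rule z(2))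
   thus False using n w(2) by (simp add: tau_def l0 flip: mult.assoc)
  qed
  ultimately have "z b = 0 b" for b by (cases b) simp_all
  thus ?thesis by (rule ext)
 qed
qed

end

section \<open>Points and primes\<close>

lemma finite_mult_closed_power:
 fixes A :: "'b::field set"
 assumes "finite A" "!!a b. a : A ==> b : A ==> a * b : A" "w : A" "w ~= 0"
 shows "EX m>0. w ^ m = 1"
proof -
 have "w ^ Suc n : A" for n by (induction n) (use assms in auto)
 hence "finite (range (%n. w ^ Suc n))" using assms(1) by (auto intro: finite_subset)
 hence "~ inj (%n. w ^ Suc n)" using finite_imageD by blast
 then obtain i j where "i < j" "w ^ Suc i = w ^ Suc j" by (auto simp: inj_def) (metis linorder_neqE_nat)
 moreover have "w ^ Suc j = w ^ Suc i * w ^ (j - i)" using \<open>i < j\<close> by (simp flip: power_add)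
 ultimately have "w ^ (j - i) = 1" using assms(4) by simp
 thus ?thesis using \<open>i < j\<close> by (intro exI[of _ "j - i"]) simp
qed

section \<open>Values of functions at points, and the field of constants\<close>

context plane_curve
begin

interpretation rho: crhom rho by (rule crhom_rho)

abbreviation acp :: "'a poly => 'a alg_closure => 'a alg_closure" where "acp p x == poly (map_poly to_ac p) x"

definition evR :: "'a alg_closure \<times> 'a alg_closure => 'a fls alg_closure => 'a alg_closure" where
 "evR z w = ev2 (lift (SOME g. rho g = w)) (fst z) (snd z)"

text \<open>The value at \<open>z\<close> of a function that multiplication by \<open>p\<close>
  turns into a polynomial in x and y. The choice hidden in \<open>evR\<close> is harmless for points
  of the curve by \<open>evR_rho\<close>.\<close>

definition psi :: "'a poly => 'a alg_closure \<times> 'a alg_closure => 'a fls alg_closure => 'a alg_closure" where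
 "psi p z u = evR z (to_ac (px p) * u) / acp p (fst z)"

definition dom :: "'a poly => 'a fls alg_closure set" where
 "dom p = {u. to_ac (px p) * u : R0}"

definition cpts :: "'a poly => ('a alg_closure \<times> 'a alg_closure) set" where
 "cpts p = {(x, y). ev2 H x y = 0 & acp p x ~= 0}"

lemma evR_rho: assumes "ev2 H (fst z) (snd z) = 0" shows "evR z (rho g) = ev2 (lift g) (fst z) (snd z)"
proof -
 define g' where "g' = (SOME g'. rho g' = rho g)"
 have "rho g' = rho g" unfolding g'_def by (rule someI_ex) blast
 hence "h dvd g' - g" by (simp add: rho.h_diff flip: rho_0_iff)
 then obtain k where "g' - g = h * k" by auto
 hence "lift g' - lift g = H * lift k" by (metis mac.mp_diff mac.mp_mult)
 hence "ev2 (lift g' - lift g) (fst z) (snd z) = 0" using assms by simp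
 thus ?thesis by (simp add: evR_def g'_def)
qed

lemma R0_rho: "w : R0 \<longleftrightarrow> (EX g. w = rho g)"
 unfolding R0_def range_rho by blast

lemma evR_hom:
 assumes "ev2 H (fst z) (snd z) = 0" "v : R0" "w : R0"
 shows "evR z (v + w) = evR z v + evR z w" "evR z (v * w) = evR z v * evR z w"
proof -
 obtain g g' where "v = rho g" "w = rho g'" using assms R0_rho by auto
 thus "evR z (v + w) = evR z v + evR z w" "evR z (v * w) = evR z v * evR z w"
  using assms(1) by (simp_all add: evR_rho mac.mp_add mac.mp_mult flip: rho.h_add rho.h_mult)
qed

lemma evR_px: assumes "ev2 H (fst z) (snd z) = 0" shows "evR z (to_ac (px p)) = acp p (fst z)"
 using evR_rho[OF assms, of "[:p:]"] by (simp add: rho_const mac.mp_pCons)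

lemma psi_simps:
 assumes z: "z : cpts p" and u: "u : dom p"
 shows "v : dom p ==> psi p z (u + v) = psi p z u + psi p z v"
  "v : dom p ==> u * v : dom p ==> psi p z (u * v) = psi p z u * psi p z v"
  "w : R0 ==> psi p z w = evR z w"
proof -
 have H: "ev2 H (fst z) (snd z) = 0" and nz: "acp p (fst z) ~= 0" using z by (auto simp: cpts_def)
 show "v : dom p ==> psi p z (u + v) = psi p z u + psi p z v"
  using evR_hom(1)[OF H] u by (simp add: psi_def dom_def distrib_left add_divide_distrib)
 show "w : R0 ==> psi p z w = evR z w"
  using evR_hom(2)[OF H px_R0] evR_px[OF H] nz by (simp add: psi_def)
 assume v: "v : dom p" "u * v : dom p"
 have "acp p (fst z) * evR z (to_ac (px p) * (u * v)) = evR z (to_ac (px p) * (to_ac (px p) * (u * v)))"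
  using evR_hom(2)[OF H px_R0, of "to_ac (px p) * (u * v)" p] evR_px[OF H] v by (simp add: dom_def)
 also have "... = evR z ((to_ac (px p) * u) * (to_ac (px p) * v))" by (simp add: mult_ac)
 also have "... = evR z (to_ac (px p) * u) * evR z (to_ac (px p) * v)" using evR_hom(2)[OF H] u v by (simp add: dom_def)
 finally show "psi p z (u * v) = psi p z u * psi p z v" using nz by (simp add: psi_def field_simps)
qed

lemma R0_dom: "w : R0 ==> w : dom p"
 unfolding dom_def using R0_closed(3)[OF px_R0] by blast

lemma psi_R0: "z : cpts p ==> w : R0 ==> psi p z w = evR z w"
 using psi_simps(3) R0_dom by blast

lemma psi_rho: "z : cpts p ==> psi p z (rho g) = ev2 (lift g) (fst z) (snd z)"
 using R0_rho psi_R0 evR_rho by (fastforce simp: cpts_def)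

lemma psi_1: "z : cpts p ==> psi p z 1 = 1"
 using psi_rho[of z p 1] by simp

lemma to_ac_const_rho: "to_ac (fls_const c) = rho [:[:c:]:]"
 by (simp add: rho_const px_const)

lemma psi_const: "z : cpts p ==> psi p z (to_ac (fls_const c)) = to_ac c"
 using psi_rho[of z p "[:[:c:]:]"] by (simp add: to_ac_const_rho mac.mp_pCons to_ac.mp_pCons)

definition frobpt :: "nat => 'a alg_closure \<times> 'a alg_closure => 'a alg_closure \<times> 'a alg_closure" where
 "frobpt i z = (fst z ^ (CARD('a) ^ i), snd z ^ (CARD('a) ^ i))"

lemma frobpt_cpts: "z : cpts p ==> frobpt i z : cpts p"
 using ev2_lift_frob[of h "fst z" i "snd z"] ev2_lift_frob[of "[:p:]" "fst z" i "snd z"]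
 by (auto simp: cpts_def frobpt_def mac.mp_pCons)

lemma psi_frobpt: assumes "z : cpts p" "u : dom p" shows "psi p (frobpt i z) u = psi p z u ^ (CARD('a) ^ i)"
proof -
 obtain g where g: "to_ac (px p) * u = rho g" using assms R0_rho by (auto simp: dom_def)
 have H: "ev2 H (fst z) (snd z) = 0" "ev2 H (fst (frobpt i z)) (snd (frobpt i z)) = 0" using assms frobpt_cpts[OF assms(1)] by (auto simp: cpts_def case_prod_unfold)
 have "acp p (fst (frobpt i z)) = acp p (fst z) ^ (CARD('a) ^ i)"
  using ev2_lift_frob[of "[:p:]" "fst z" i "snd z"] by (simp add: frobpt_def mac.mp_pCons)
 thus ?thesis unfolding psi_def g evR_rho[OF H(1)] evR_rho[OF H(2)]
  using ev2_lift_frob[of g "fst z" i "snd z"] by (simp add: frobpt_def power_divide)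
qed

lemma frobpt_pts: "z : pts r ==> frobpt r z = z"
 by (auto simp: pts_def kf_def frobpt_def)

lemma psi_kf: "z : cpts p ==> z : pts r ==> u : dom p ==> psi p z u : kf r"
 using psi_frobpt[of z p u r] by (simp add: frobpt_pts kf_def)

lemma finite_bad_pts:
 assumes "p ~= 0" shows "finite {(x, y). ev2 H x y = 0 & acp p x = 0}"
proof -
 have "map_poly to_ac p ~= 0" using assms by (simp add: map_poly_eq_0_iff)
 hence "finite (SIGMA x:{x. acp p x = 0}. {y. ev2 H x y = 0})" using poly_roots_finite fiber_finite by (intro finite_SigmaI) auto
 thus ?thesis by (rule finite_subset[rotated]) auto
qed

lemma points_avoiding:
 assumes "p ~= 0" shows "EX r0. ALL r>=r0. EX z:pts r. z : cpts p"
proof -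
 obtain C where C: "!!r. r >= 1 ==> \<bar>real (card (pts r)) - real CARD('a) ^ r\<bar> <= C * sqrt (real CARD('a)) ^ r" using card_pts_estimate by blast
 let ?B = "{(x, y). ev2 H x y = 0 & acp p x = 0}"
 let ?s = "sqrt (real CARD('a))"
 have s1: "?s > 1" using finite_field_card_gt_1[where 'a = 'a] by simp
 obtain r0 where r0: "\<bar>C\<bar> + card ?B + 1 < ?s ^ r0" using real_arch_pow[OF s1] by blast
 show ?thesis
 proof (intro exI[of _ "Suc r0"] allI impI)
  fix r assume r: "Suc r0 <= r"
  have "?s ^ r0 <= ?s ^ r" using s1 r by (intro power_increasing) auto
  hence sr: "\<bar>C\<bar> + card ?B + 1 < ?s ^ r" using r0 by linarith
  have "real CARD('a) ^ r = (?s ^ 2) ^ r" by simp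
  also have "... = ?s ^ r * ?s ^ r" by (simp only: power_mult[symmetric] mult_2 power_add)
  finally have q: "real CARD('a) ^ r = ?s ^ r * ?s ^ r" .
  have "(real (card ?B) + 1) * 1 <= (?s ^ r - C) * ?s ^ r" using sr s1 by (intro mult_mono one_le_power) auto
  hence "real (card ?B) < ?s ^ r * ?s ^ r - C * ?s ^ r" by (simp add: left_diff_distrib)
  also have "... <= real (card (pts r))" using C[of r] r q by simp
  finally have "card ?B < card (pts r)" by simp
  hence "~ pts r <= ?B" using card_mono[OF finite_bad_pts[OF assms]] by (meson not_less)
  thus "EX z:pts r. z : cpts p" by (auto simp: cpts_def pts_def)
 qed
qed

text \<open>The constants of an order form a finite ring \<open>A\<close>. Let r be large and
  evaluate at a point over \<open>kf r\<close> that avoids the denominators: u^(q^r) - u takes the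
  value 0, whereas a nonzero element of \<open>A\<close> has a power equal to 1. So u^(q^r) = u for
  all large r, and two consecutive r give u^q = u.\<close>

lemma constants:
 assumes S: "ad.order S" shows "S Int Dl = range emb"
proof (intro equalityI subsetI)
 fix e assume e: "e : S Int Dl"
 note lat = S[unfolded ad.order_def, THEN conjunct1]
 have Sm: "!!x y. x : S ==> y : S ==> x * y : S" using S by (auto simp: ad.order_def)
 define A where "A = (%e. e True) ` (S Int Dl)"
 have finA: "finite A" unfolding A_def using ad.fin_h(1)[OF lat] by simp
 have ss: "ad.subspace (S Int Dl)" by (rule ad.ss_Int[OF ad.lat_ss[OF lat] Dl_ss])
 have A_mult: "a * b : A" if ab: "a : A" "b : A" for a b
 proof -
  obtain e f where "e : S Int Dl" "f : S Int Dl" "a = e True" "b = f True" using ab by (auto simp: A_def)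
  thus ?thesis unfolding A_def using Sm ad.Dl_mult by (intro image_eqI[of _ _ "e * f"]) auto
 qed
 have A_diff: "a - b : A" if ab: "a : A" "b : A" for a b
 proof -
  obtain e f where "e : S Int Dl" "f : S Int Dl" "a = e True" "b = f True" using ab by (auto simp: A_def)
  thus ?thesis unfolding A_def using ad.ss_diff[OF ss, of e f] by (intro image_eqI[of _ _ "e - f"]) auto
 qed
 have A_power: "a ^ Suc n : A" if "a : A" for a n
 proof (induction n)
  case (Suc n)
  thus ?case using A_mult[OF that] by simp
 qed (use that in simp)
 obtain c where c: "c : Dn" "ad.smul c S <= RR" using lat unfolding ad.lattice_def by blast
 obtain p n where "p ~= 0" "c = cc p n" using c(1) unfolding Dn_def by blast
 hence p: "p ~= 0" "ad.smul (cc p n) S <= RR" using c(2) by simp_all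
 have Adom: "a : dom p" if "a : A" for a
 proof -
  obtain f where f: "f : S" "a = f True" using \<open>a \<in> A\<close> unfolding A_def by blast
  have "cc p n * f : RR" using p(2) ad.smul_memI[OF f(1)] by blast
  thus ?thesis by (simp add: RR_def cc_def dom_def f(2))
 qed
 obtain r0 where r0: "!!r. r >= r0 ==> EX z:pts r. z : cpts p" using points_avoiding[OF p(1)] by blast
 let ?u = "e True"
 have uA: "?u : A" using e by (simp add: A_def)
 have fix_r: "?u ^ (CARD('a) ^ r) = ?u" if r: "r >= r0" for r
 proof (rule ccontr)
  assume ne: "?u ^ (CARD('a) ^ r) ~= ?u"
  obtain z where z: "z : pts r" "z : cpts p" using r0[OF r] by blast
  have pm: "psi p z (a * b) = psi p z a * psi p z b" if "a : A" "b : A" for a b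
   using psi_simps(2)[OF z(2) Adom Adom Adom] A_mult that by blast
  have pp: "psi p z (a ^ Suc n) = psi p z a ^ Suc n" if "a : A" for a n
   by (induction n) (use pm A_power that in auto)
  let ?w = "?u ^ (CARD('a) ^ r) - ?u"
  have cp: "CARD('a) ^ r > 0" by simp
  have uq: "?u ^ (CARD('a) ^ r) : A" using A_power[OF uA, of "CARD('a) ^ r - 1"] by simp
  have wA: "?w : A" using A_diff uq uA by blast
  have "psi p z (?u ^ (CARD('a) ^ r)) = psi p z ?u ^ (CARD('a) ^ r)" using pp[OF uA, of "CARD('a) ^ r - 1"] by simp
  also have "... = psi p z ?u" using psi_kf[OF z(2,1) Adom[OF uA]] by (simp add: kf_def)
  finally have "psi p z ?w = 0" using psi_simps(1)[OF z(2) Adom[OF wA] Adom[OF uA]] by simp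
  moreover obtain m where m: "m > 0" "?w ^ m = 1" using finite_mult_closed_power[OF finA A_mult wA] ne by auto
  ultimately have "psi p z 1 = 0" using pp[OF wA, of "m - 1"] by simp
  thus False using psi_1[OF z(2)] by simp
 qed
 have "?u ^ CARD('a) = (?u ^ (CARD('a) ^ r0)) ^ CARD('a)" using fix_r[of r0] by simp
 also have "... = ?u ^ (CARD('a) ^ Suc r0)" by (simp add: mult.commute flip: power_mult)
 also have "... = ?u" using fix_r[of "Suc r0"] by simp
 finally have uq: "?u ^ CARD('a) = ?u" .
 define P where "P = (monom 1 CARD('a) - monom 1 1 :: 'a fls alg_closure poly)"
 have q1: "CARD('a) > 1" by (rule finite_field_card_gt_1)
 have P0: "P ~= 0"
 proof
  assume "P = 0"
  hence "coeff P CARD('a) = 0" by simp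
  thus False using q1 by (simp add: P_def)
 qed
 have degP: "degree P <= CARD('a)" unfolding P_def using q1 by (intro degree_diff_le degree_monom_le[THEN order_trans]) auto
 have rootP: "poly P w = 0 \<longleftrightarrow> w ^ CARD('a) = w" for w by (simp add: P_def poly_monom)
 let ?C = "range (%c :: 'a. to_ac (fls_const c) :: 'a fls alg_closure)"
 have sub: "?C <= {w. poly P w = 0}"
  by (auto simp: rootP finite_field_power_card simp flip: to_ac_power fls_const_power)
 have "card ?C = CARD('a)" by (rule card_image) (auto simp: inj_def dest: arg_cong[where f = "%f. fls_nth f 0"])
 moreover have "card {w. poly P w = 0} <= CARD('a)" using card_poly_roots_bound[OF P0] degP by simp
 ultimately have "?C = {w. poly P w = 0}" using sub poly_roots_finite[OF P0] by (intro card_seteq) auto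
 hence "?u : ?C" using uq rootP by blast
 then obtain c where "?u = to_ac (fls_const c)" by blast
 hence "e = emb c" using e by (auto simp: Dl_def emb_def fun_eq_iff) (metis (full_types))
 thus "e : range emb" by blast
next
 fix e assume "e : range emb"
 then obtain c where c: "e = emb c" by blast
 have "emb c * 1 : RR" "emb c * 1 : Dl" using ad.ss_scale[OF RR_ss ad.R_1] ad.ss_scale[OF Dl_ss ad.Dl_1] by auto
 thus "e : S Int Dl" using S c by (auto simp: ad.order_def)
qed

lemma max_order_exists: "EX S. ad.max_order S"
 by (rule ad.max_order_exists) (rule constants)

end

text \<open>Multiplication by a nonzero element permutes the nonzero elements of \<open>A\<close>,
  so all of \<open>A\<close> consists of roots of X^(q^m) - X, and the cardinalities agree.\<close>

lemma finite_subring_kf: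
 fixes A :: "'a::{finite,field} alg_closure set"
 assumes A: "finite A" "card A = CARD('a) ^ m" and m: "m > 0" and z: "0 : A"
  and mult: "!!a b. a : A ==> b : A ==> a * b : A"
 shows "A = kf m"
proof -
 have fixed: "w ^ (CARD('a) ^ m) = w" if w: "w : A" "w ~= 0" for w
 proof -
  let ?B = "A - {0}"
  have inj: "inj_on (%x. w * x) ?B" using w by (auto simp: inj_on_def)
  have sub: "(%x. w * x) ` ?B <= ?B" using w mult by auto
  have im: "(%x. w * x) ` ?B = ?B" using A(1) by (intro card_subset_eq sub) (auto simp: card_image[OF inj])
  have "(PROD x:?B. x) = (PROD x:?B. w * x)" using prod.reindex[OF inj, of "%x. x"] im by simp
  also have "... = w ^ card ?B * (PROD x:?B. x)" by (simp add: prod.distrib)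
  finally have "w ^ card ?B = 1" using A(1) by simp
  moreover have "card A = Suc (card ?B)" using card.remove[OF A(1) z] .
  ultimately show ?thesis unfolding A(2)[symmetric] by simp
 qed
 have "A <= kf m"
 proof
  fix x assume "x : A"
  thus "x : kf m" using fixed[of x] by (cases "x = 0") (simp_all add: kf_def)
 qed
 thus ?thesis using card_kf[OF m, where 'a = 'a] A(2) by (intro card_subset_eq) auto
qed

lemma kf_subset_dvd:
 assumes "m > 0" "kf m <= (kf r :: 'a::{finite,field} alg_closure set)" shows "m dvd r"
proof (rule ccontr)
 assume nd: "~ m dvd r"
 hence k: "r mod m > 0" "r mod m < m" using assms(1) by (auto simp: mod_greater_zero_iff_not_dvd)
 have "x : kf (r mod m)" if "x : kf m" for x :: "'a alg_closure"
 proof -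
  have "x : kf (m * (r div m) + r mod m)" using assms(2) that by auto
  thus ?thesis using kf_add_iff[OF kf_mult[OF that]] by blast
 qed
 hence "card (kf m :: 'a alg_closure set) <= card (kf (r mod m) :: 'a alg_closure set)" using card_kf(2)[OF k(1), where 'a = 'a] by (intro card_mono) auto
 thus False using card_kf(1)[OF k(1), where 'a = 'a] card_kf(1)[OF assms(1), where 'a = 'a] k(2) finite_field_card_gt_1[where 'a = 'a] by simp
qed

lemma sum_fun_apply: "(SUM i:I. f i) x = (SUM i:I. f i x :: 'b::comm_monoid_add)"
 by (induction I rule: infinite_finite_induct) simp_all

lemma (in adele) finite_between:
 assumes "lattice J" "lattice J'" shows "finite {I. subspace I & J <= I & I <= J'}"
proof (cases "J <= J'")
 case True
 let ?S = "{I. subspace I & J <= I & I <= J'}"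
 have "finite (quo J' J)" using lattice_fin[OF assms True] by (simp add: fin_def)
 moreover have "(%I. quo I J) ` ?S <= Pow (quo J' J)" by (auto simp: quo_def)
 moreover have "inj_on (%I. quo I J) ?S"
 proof (rule inj_onI)
  have "I = \<Union>(quo I J)" if "I : ?S" for I
   using that ss_0[OF lat_ss[OF assms(1)]] ss_add[of I] by (force simp: quo_def)
  thus "I = I'" if "I : ?S" "I' : ?S" "quo I J = quo I' J" for I I' using that by metis
 qed
 ultimately show ?thesis by (meson finite_Pow_iff finite_imageD finite_subset)
qed (auto intro: finite_subset[of _ "{}"])

lemma (in fq_ring) combination_in_subspace:
 assumes "subspace A" "subspace B" "B <= A" "fin A B" "!!i. i <= dm A B ==> b i : A"
 shows "EX c. (EX i<=dm A B. c i ~= 0) & (SUM i<=dm A B. emb (c i) * b i) : B"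
proof -
 let ?n = "dm A B"
 let ?D = "{..?n} \<rightarrow>\<^sub>E (UNIV :: 'a set)"
 let ?v = "%c. SUM i<=?n. emb (c i) * b i"
 have vA: "?v c : A" for c by (rule ss_sum[OF assms(1)]) (use ss_scale[OF assms(1)] assms(5) in auto)
 let ?f = "%c. (%b. ?v c + b) ` B"
 have "?f ` ?D <= quo A B" using vA by (auto simp: quo_def)
 hence "card (?f ` ?D) <= idx A B" unfolding idx_def using assms(4) by (intro card_mono) (auto simp: fin_def)
 also have "... = q ^ ?n" by (rule idx_dm[OF assms(1-4)])
 also have "... < card ?D" using q_gt_1 by (simp add: card_PiE q_def)
 finally have lt: "card (?f ` ?D) < card ?D" .
 have "~ inj_on ?f ?D"
 proof
  assume i: "inj_on ?f ?D"
  show False using lt unfolding card_image[OF i] by simp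
 qed
 then obtain c c' where c: "c : ?D" "c' : ?D" "c ~= c'" "?f c = ?f c'" by (auto simp: inj_on_def)
 have "?v c - ?v c' : B" using c(4) coset_eq_iff[OF assms(2)] by blast
 moreover have "?v c - ?v c' = ?v (%i. c i - c' i)" by (simp add: emb_diff left_diff_distrib sum_subtractf)
 moreover have "EX i<=?n. c i ~= c' i" using c(1-3) by (metis PiE_ext atMost_iff)
 ultimately show ?thesis by (intro exI[of _ "%i. c i - c' i"]) auto
qed

section \<open>The maximal order of the function field\<close>

locale curve_order = plane_curve +
 fixes Om :: "(bool => 'a fls alg_closure) set"
 assumes max_Om: "ad.max_order Om"
begin

sublocale ad: dedekind emb "CARD('a)" EE RR Dl Dn tau om Om
 by unfold_locales (rule max_Om)

lemma R0_pair: "w : R0 ==> pair w 0 : Om" and Ri_pair: "w : Ri ==> pair 0 w : Om"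
proof -
 have z: "0 : R0" "0 : Ri" using FF_0 by (simp_all add: R0_iff Ri_iff)
 show "w : R0 ==> pair w 0 : Om" "w : Ri ==> pair 0 w : Om" using ad.Om_R z by (auto simp: RR_def)
qed

lemma Om_1: "1 : Om"
 using ad.Om_R ad.R_1 by blast

lemma cc_Om: "cc p n : Om"
 using ad.Om_R cc_RR by blast

lemma sum_px: fixes c :: "nat => 'a" shows "(SUM i<=n. to_ac (fls_const (c i)) * to_ac (px (monom 1 i))) = to_ac (px (SUM i<=n. monom (c i) i))"
proof -
 have "to_ac (fls_const (c i)) * to_ac (px (monom 1 i)) = (to_ac (px (monom (c i) i)) :: 'a fls alg_closure)" for i
 proof -
  have "to_ac (fls_const (c i)) * to_ac (px (monom 1 i)) = (to_ac (px ([:c i:] * monom 1 i)) :: 'a fls alg_closure)"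
   by (simp add: px_const px.h_mult del: mult_pCons_left)
  also have "[:c i:] * monom 1 i = monom (c i) i" by (simp add: smult_monom)
  finally show ?thesis .
 qed
 thus ?thesis by (simp add: px.h_sum to_ac.h_sum)
qed

text \<open>All these ideals contain one fixed element: the n + 1 powers of x up to x^n are
  dependent modulo \<open>I\<close>, and so are those of 1/x at infinity. Only finitely many
  subspaces lie between the ideal of that element and \<open>Om\<close>.\<close>

lemma fin_ideals: "finite {I. ad.fr I & I <= Om & ad.dm Om I = n}"
proof -
 let ?P = "{p :: 'a poly. degree p <= n & p ~= 0}"
 have finP: "finite ?P" by (rule finite_subset[OF _ finite_degree_le]) auto
 \<comment> \<open>A common multiple of all polynomials that can arise from a dependence among the
   powers of x up to x^n.\<close>
 define pp where "pp = (PROD p:?P. p)"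
 have pp0: "pp ~= 0" unfolding pp_def using finP by simp
 let ?c = "cc pp n"
 have cDn: "?c : Dn" using pp0 by (auto simp: Dn_def)
 have "ad.smul ?c Om <= I" if I: "ad.fr I" "I <= Om" "ad.dm Om I = n" for I
 proof -
  note ss = ad.fr_ss[OF I(1)]
  note fin = ad.lattice_fin[OF ad.fr_lat[OF I(1)] ad.Om_lat I(2)]
  have "EX c. (EX i<=n. c i ~= 0) & (SUM i<=n. emb (c i) * pair (to_ac (px (monom 1 i))) 0) : I"
   using ad.combination_in_subspace[OF ad.Om_ss ss I(2) fin, of "%i. pair (to_ac (px (monom 1 i))) 0"] R0_pair[OF px_R0] I(3) by simp
  then obtain c where c: "EX i<=n. c i ~= 0" "(SUM i<=n. emb (c i) * pair (to_ac (px (monom 1 i))) 0) : I" by blast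
  let ?p = "SUM i<=n. monom (c i) i"
  have "(SUM i<=n. emb (c i) * pair (to_ac (px (monom 1 i))) 0) = pair (to_ac (px ?p)) 0"
  proof
   fix b show "(SUM i<=n. emb (c i) * pair (to_ac (px (monom 1 i))) 0) b = pair (to_ac (px ?p)) 0 b"
    by (cases b) (simp_all add: sum_fun_apply emb_def sum_px)
  qed
  hence pI: "pair (to_ac (px ?p)) 0 : I" using c(2) by simp
  have pP: "?p : ?P"
  proof -
   obtain i where "i <= n" "c i ~= 0" using c(1) by blast
   hence "coeff ?p i ~= 0" by (simp add: coeff_sum)
   hence "?p ~= 0" by auto
   moreover have "degree ?p <= n" by (intro degree_sum_le) (auto intro: degree_monom_le[THEN order_trans])
   ultimately show ?thesis by blast
  qed
  hence "?p dvd pp" unfolding pp_def using finP by (intro dvd_prodI) auto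
  then obtain k where k: "pp = ?p * k" by auto
  have "pair (to_ac (px k)) 0 * pair (to_ac (px ?p)) 0 : I" using ad.fr_mult[OF I(1) R0_pair[OF px_R0] pI] .
  moreover have "pair (to_ac (px k)) 0 * pair (to_ac (px ?p)) 0 = pair (to_ac (px pp)) 0" unfolding k by (simp add: fun_eq_iff px.h_mult)
  ultimately have ppI: "pair (to_ac (px pp)) 0 : I" by simp
  have "EX c. (EX i<=n. c i ~= 0) & (SUM i<=n. emb (c i) * pair 0 (to_ac (Tn (int i)))) : I"
   using ad.combination_in_subspace[OF ad.Om_ss ss I(2) fin, of "%i. pair 0 (to_ac (Tn (int i)))"] Ri_pair[OF Tn_Ri] I(3) by simp
  then obtain c where c: "EX i<=n. c i ~= 0" "(SUM i<=n. emb (c i) * pair 0 (to_ac (Tn (int i)))) : I" by blast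
  let ?s' = "SUM i<=n. fls_const (c i) * Tn (int i)"
  define s where "s = ?s'"
  have sn: "fls_nth s k = (if 0 <= k & k <= int n then c (nat k) else 0)" for k
  proof -
   have "fls_nth s k = (SUM i<=n. if i = nat k & 0 <= k then c i else 0)"
    unfolding s_def fls_nth_sum by (intro sum.cong) (auto simp: Tn_nth1)
   thus ?thesis by auto
  qed
  have "(SUM i<=n. emb (c i) * pair 0 (to_ac (Tn (int i)))) = pair 0 (to_ac s)"
  proof
   fix b show "(SUM i<=n. emb (c i) * pair 0 (to_ac (Tn (int i)))) b = pair 0 (to_ac s) b"
    by (cases b) (simp_all add: sum_fun_apply emb_def to_ac.h_sum s_def)
  qed
  hence sI: "pair 0 (to_ac s) : I" using c(2) by simp
  \<comment> \<open>At infinity a combination of powers of 1/x is its lowest power times a unit of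
    the local ring, so \<open>I\<close> contains that power and hence the n-th.\<close>
  define i0 where "i0 = (LEAST i. c i ~= 0)"
  have i0: "i0 <= n" "c i0 ~= 0" "!!i. i < i0 ==> c i = 0"
  proof -
   obtain i where i: "i <= n" "c i ~= 0" using c(1) by blast
   show "c i0 ~= 0" unfolding i0_def using i(2) by (rule LeastI)
   show "i0 <= n" using Least_le[of "%i. c i ~= 0", OF i(2)] i(1) unfolding i0_def by linarith
   show "c j = 0" if "j < i0" for j using not_less_Least[of j "%i. c i ~= 0"] that unfolding i0_def by blast
  qed
  define u where "u = Tn (- int i0) * s"
  have sr: "s : ratf" unfolding s_def by (intro ratf_simps(7) ratf_simps(4)) simp_all
  have ui: "u : inft" unfolding inft_def using ratf_simps(4)[OF Tn_ratf sr] by (auto simp: Tn_nth sn i0(3) u_def)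
  have u0: "fls_nth u 0 ~= 0" using i0 by (simp add: Tn_nth sn u_def)
  hence un: "u ~= 0" by auto
  have "to_ac (Tn (int (n - i0)) * inverse u) : Ri"
   by (rule Ri_closed(4), rule subr_simps(4)[OF subr_inft _ inft_unit[OF ui u0]]) (auto simp: inft_def Tn_nth1)
  hence "pair 0 (to_ac (Tn (int (n - i0)) * inverse u)) * pair 0 (to_ac s) : I" using ad.fr_mult[OF I(1) Ri_pair sI] by blast
  moreover have "Tn (int (n - i0)) * inverse u * s = Tn (int n)"
  proof -
   have "Tn (int i0) * u = Tn (int i0) * Tn (- int i0) * s" by (simp only: u_def mult.assoc)
   hence "s = Tn (int i0) * u" by simp
   hence "Tn (int (n - i0)) * inverse u * s = Tn (int (n - i0)) * Tn (int i0) * (inverse u * u)" by simp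
   also have "... = Tn (int (n - i0)) * Tn (int i0)" using un by simp
   also have "... = Tn (int n)" using i0(1) by (simp flip: Tn_add)
   finally show ?thesis .
  qed
  hence "pair 0 (to_ac (Tn (int (n - i0)) * inverse u)) * pair 0 (to_ac s) = pair 0 (to_ac (Tn (int n)))"
   by (simp add: fun_eq_iff flip: to_ac_mult)
  ultimately have TI: "pair 0 (to_ac (Tn (int n))) : I" by simp
  have "?c = pair (to_ac (px pp)) 0 + pair 0 (to_ac (Tn (int n)))" by (simp add: cc_def fun_eq_iff)
  hence "?c : I" using ad.ss_add[OF ss ppI TI] by simp
  thus ?thesis using ad.fr_mult[OF I(1)] by (auto simp: ad.smul_def mult.commute)
 qed
 hence "{I. ad.fr I & I <= Om & ad.dm Om I = n} <= {I. ad.subspace I & ad.smul ?c Om <= I & I <= Om}" using ad.fr_ss by blast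
 thus ?thesis using ad.finite_between[OF ad.fr_lat[OF ad.Dn_ideal(1)[OF cDn]] ad.Om_lat] by (rule finite_subset)
qed

sublocale ad: zeta emb "CARD('a)" EE RR Dl Dn tau om Om
proof
 show "Om Int Dl = range emb" using constants max_Om by (simp add: ad.max_order_def)
qed (rule fin_ideals)

text \<open>Passing from the plane model to \<open>Om\<close> raises the Euler characteristic while
  \<open>h0\<close> stays 1, so the genus is at most the arithmetic genus.\<close>

lemma genus_le: "2 * ad.g <= (d - 1) * (d - 2)"
proof -
 have r: "ad.chi Om = ad.chi RR + int (ad.dm Om RR)" by (rule ad.chi_step[OF ad.lattice_R ad.Om_lat ad.Om_R])
 have "I0 0 = {(0, 0)}" using d_pos by (auto simp: I0_def)
 hence "ad.h0 RR = 1" using sections_RN(2)[of 0] by (simp add: ad.h0_def RN_0)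
 moreover have "ad.h1 RR = card (II 0)" using cosections_RN(2)[of 0] by (simp add: ad.h1_def RN_0)
 ultimately have "ad.chi RR = 1 - int (card (II 0))" by (simp add: ad.chi_def)
 hence "ad.g <= card (II 0)" using r ad.chi_Om by simp
 thus ?thesis using card_II_0 by linarith
qed

text \<open>Multiplication by the unit \<open>cc p n\<close> of \<open>EE\<close> preserves the
  codimension of \<open>RR\<close> in \<open>Om\<close>; comparing the two towers from
  \<open>Om\<close> down to its multiple of \<open>RR\<close> transfers the bound from
  \<open>RR\<close> to \<open>Om\<close>.\<close>

lemma dm_cc_Om: assumes "p ~= 0" shows "ad.dm Om (ad.smul (cc p n) Om) <= d * (degree p + n)"
proof -
 have c: "cc p n : Dn" using assms by (auto simp: Dn_def)
 note f = ad.Dn_ideal[OF c]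
 have l: "ad.lattice (ad.smul (cc p n) RR)" by (rule ad.lattice_cR[OF c])
 have 1: "ad.smul (cc p n) RR <= ad.smul (cc p n) Om" using ad.Om_R by (rule ad.smul_mono)
 have 2: "ad.smul (cc p n) RR <= RR" using cc_RR by (rule ad.smul_R_R)
 note s = ad.lat_ss[OF l] ad.fr_ss[OF f(1)] ad.Om_ss RR_ss
 note fin = ad.lattice_fin[OF l ad.Om_lat order_trans[OF 1 f(2)]]
 have "ad.dm Om (ad.smul (cc p n) Om) + ad.dm (ad.smul (cc p n) Om) (ad.smul (cc p n) RR) = ad.dm Om RR + ad.dm RR (ad.smul (cc p n) RR)"
  using ad.dm_tower[OF s(1,2) 1 f(2) s(3) fin] ad.dm_tower[OF s(1,4) 2 ad.Om_R s(3) fin] by simp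
 moreover have "ad.dm (ad.smul (cc p n) Om) (ad.smul (cc p n) RR) = ad.dm Om RR"
 proof -
  have inj: "x = 0" if "cc p n * x = 0" for x
  proof -
   obtain v where "cc p n * v = 1" using ad.Dn_inv[OF c] by blast
   hence "x = v * (cc p n * x)" by (metis mult.assoc mult.commute mult_1)
   thus ?thesis using that by simp
  qed
  show ?thesis unfolding ad.dm_def using ad.idx_smul(1)[OF RR_ss inj ad.Om_ss ad.Om_R] by simp
 qed
 ultimately show ?thesis using dm_cc(2)[OF assms, of n] by simp
qed

lemma primes_over:
 assumes "ad.fr I" "I <= Om"
 shows "finite {P. ad.maxi P & I <= P}" "(\<Sum>P | ad.maxi P & I <= P. ad.dm Om P) <= ad.dm Om I"
proof -
 let ?f = "%P. (P, 1::nat)"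
 have sub: "?f ` {P. ad.maxi P & I <= P} <= ad.pj I"
  using ad.pr_Om ad.maxi_fr by (auto simp: ad.pj_def ad.pw_Suc)
 have inj: "inj_on ?f {P. ad.maxi P & I <= P}" by (auto simp: inj_on_def)
 note pj = ad.sum_pj[OF assms]
 show "finite {P. ad.maxi P & I <= P}" using finite_subset[OF sub] pj finite_imageD[OF _ inj] by blast
 have "(\<Sum>P | ad.maxi P & I <= P. ad.dm Om P) = (SUM t:?f ` {P. ad.maxi P & I <= P}. ad.dm Om (fst t))"
  unfolding sum.reindex[OF inj] by simp
 also have "... <= (SUM t:ad.pj I. ad.dm Om (fst t))" using pj sub by (intro sum_mono2) auto
 finally show "(\<Sum>P | ad.maxi P & I <= P. ad.dm Om P) <= ad.dm Om I" using pj by simp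
qed

lemma smul_Om_le_iff: "ad.fr P ==> ad.smul c Om <= P \<longleftrightarrow> c : P" if "P <= Om" for P c
 using Om_1 ad.fr_mult[of P] by (auto simp: ad.smul_def mult.commute)

end

lemma coeff_X: "coeff [:0, 1::'b::comm_ring_1:] b = (if b = 1 then 1 else 0)"
 by (auto simp: coeff_pCons split: nat.split)

text \<open>Reduction modulo Y^Q - Y leaves Y-degree below Q. At each x in \<open>kf e\<close> the
  remainder then has too many zeros in Y, so its coefficients vanish on \<open>kf e\<close> and are
  divisible by X^Q - X.\<close>

lemma vanishing_ideal_kf:
 fixes g :: "'a::{finite,field} poly poly"
 assumes e: "e > 0" and van: "!!x y. x : kf e ==> y : kf e ==> ev2 (lift g) x y = 0"
 shows "EX A B. g = A * [:monom 1 (CARD('a) ^ e) - [:0, 1:]:] + B * (monom 1 (CARD('a) ^ e) - [:0, 1:])"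
proof -
 let ?Q = "CARD('a) ^ e"
 have Q: "?Q > 1" using finite_field_card_gt_1[where 'a = 'a] e by (rule one_less_power)
 note k = card_kf[OF e, where 'a = 'a]
 let ?hY = "monom 1 ?Q - [:0, 1:] :: 'a poly poly"
 let ?hX = "monom 1 ?Q - [:0, 1:] :: 'a poly"
 have dY: "degree ?hY = ?Q" using Q by (intro antisym degree_le le_degree) (use e in \<open>auto simp: coeff_X\<close>)
 have dX: "degree ?hX = ?Q" using Q by (intro antisym degree_le le_degree) (use e in \<open>auto simp: coeff_X\<close>)
 have lY: "lead_coeff ?hY = 1" unfolding dY using Q e by (auto simp: coeff_X)
 have tY: "tdle ?hY ?Q" unfolding tdle_def using Q by (auto simp: coeff_X)
 obtain s where "tdle g s" using tdle_exists by blast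
 then obtain r where r: "ALL b>=?Q. coeff r b = 0" "?hY dvd (g - r)" using red_exists[OF dY lY tY] by blast
 obtain B where B: "g - r = ?hY * B" using r(2) by auto
 have van_r: "ev2 (lift r) x y = 0" if "x : kf e" "y : kf e" for x y
 proof -
  have "lift g - lift r = lift ?hY * lift B" unfolding B[symmetric] mac.mp_diff[symmetric] mac.mp_mult[symmetric] ..
  moreover have "ev2 (lift ?hY) x y = y ^ ?Q - y"
   by (simp add: mac.mp_diff mac.mp_pCons map_poly_monom)
  ultimately have "ev2 (lift g - lift r) x y = 0" using that(2) by (simp add: kf_def)
  thus ?thesis using van[OF that] by simp
 qed
 have "?hX dvd coeff r b" for b
 proof -
  let ?c = "coeff r b mod ?hX"
  have c0: "poly (map_poly to_ac (coeff r b)) x = 0" if x: "x : kf e" for x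
  proof -
   let ?p = "map_poly (%c. poly c x) (lift r)"
   have "?p = 0"
   proof (rule ccontr)
    assume n: "?p ~= 0"
    have "degree ?p < ?Q" using r(1) Q by (intro degree_lessI) (auto simp: coeff_map_poly)
    moreover have "kf e <= {y. poly ?p y = 0}" using van_r[OF x] by (auto simp: ev2_def)
    hence "?Q <= card {y. poly ?p y = 0}" using k card_mono[OF poly_roots_finite[OF n]] by metis
    ultimately show False using card_poly_roots_bound[OF n] by linarith
   qed
   hence "coeff ?p b = 0" by simp
   thus ?thesis by (simp add: coeff_map_poly)
  qed
  have "?c = 0"
  proof (rule ccontr)
   assume n: "?c ~= 0"
   let ?d = "map_poly to_ac ?c :: 'a alg_closure poly"
   have n': "?d ~= 0" using n by (simp add: map_poly_eq_0_iff)
   have "?hX ~= 0" using dX Q by (metis degree_0 not_one_less_zero)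
   hence "degree ?c < ?Q" using degree_mod_less'[of ?hX "coeff r b"] n dX by metis
   moreover have "degree ?d = degree ?c" by (rule degree_map_poly) simp
   moreover have "kf e <= {x. poly ?d x = 0}"
   proof
    fix x :: "'a alg_closure" assume x: "x : kf e"
    have "map_poly to_ac (coeff r b) = map_poly to_ac (?hX * (coeff r b div ?hX)) + ?d"
     unfolding to_ac.mp_add[symmetric] by simp
    hence "poly (map_poly to_ac (coeff r b)) x = poly (map_poly to_ac ?hX) x * poly (map_poly to_ac (coeff r b div ?hX)) x + poly ?d x"
     by (simp add: to_ac.mp_mult)
    moreover have "poly (map_poly to_ac ?hX) x = x ^ ?Q - x"
     by (simp add: to_ac.mp_diff to_ac.mp_pCons map_poly_monom poly_monom)
    ultimately show "x : {x. poly ?d x = 0}" using c0[OF x] x by (simp add: kf_def)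
   qed
   hence "?Q <= card {x. poly ?d x = 0}" using k card_mono[OF poly_roots_finite[OF n']] by metis
   ultimately show False using card_poly_roots_bound[OF n'] by linarith
  qed
  thus ?thesis by (simp add: dvd_eq_mod_eq_0)
 qed
 hence "[:?hX:] dvd r" by (simp add: const_poly_dvd_iff)
 then obtain A where "r = [:?hX:] * A" by auto
 hence "g = A * [:?hX:] + B * ?hY" using B by (simp add: algebra_simps)
 thus ?thesis by blast
qed

section \<open>Residue fields of maximal ideals\<close>

context dedekind
begin

interpretation emb: crhom emb
 by unfold_locales (simp_all add: emb_add emb_mult)

interpretation frE: crhom "%x::'e. x ^ (CARD('a) ^ m)" for m
 by (rule crhom_frob[OF emb.crhom_axioms])

lemma one_Om: "1 : Om"
 using Om_R R_1 by blast

lemma Om_power: "u : Om ==> u ^ k : Om"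
 by (induction k) (auto simp: one_Om Om_mult)

lemma maxi_ss: "maxi P ==> subspace P" and maxi_mult: "maxi P ==> a : Om ==> b : P ==> a * b : P"
 and maxi_1: "maxi P ==> 1 ~: P" and maxi_power: "maxi P ==> b : P ==> k > 0 ==> b ^ k : P"
proof -
 assume P: "maxi P"
 show "subspace P" by (rule fr_ss[OF maxi_fr[OF P]])
 show m: "a : Om ==> b : P ==> a * b : P" for a b by (rule fr_mult[OF maxi_fr[OF P]])
 show "1 ~: P" by (rule one_notin[OF maxi_fr[OF P] maxi_Om[OF P] maxi_ne[OF P]])
 show "b : P ==> k > 0 ==> b ^ k : P"
  using m[OF Om_power, of b b "k - 1"] maxi_Om[OF P] by (cases k) (auto simp: mult.commute)
qed

lemma maxi_prime:
 assumes P: "maxi P" and a: "a : Om" and b: "b : Om" and ab: "a * b : P" shows "a : P \<or> b : P"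
proof (rule ccontr)
 assume n: "~ ?thesis"
 let ?I = "{x : Om. x * b : P}"
 have ss: "subspace ?I"
  using ss_0[OF Om_ss] ss_0[OF maxi_ss[OF P]] ss_add[OF Om_ss] ss_add[OF maxi_ss[OF P]] ss_scale[OF Om_ss] ss_scale[OF maxi_ss[OF P]]
  by (intro subspaceI) (auto simp: distrib_right mult.assoc)
 have sub: "P <= ?I" using maxi_Om[OF P] maxi_mult[OF P b] by (auto simp: mult.commute)
 have "lattice ?I" using lattice_between[OF fr_lat[OF maxi_fr[OF P]] Om_lat ss sub] by blast
 moreover have "ALL c:Om. ALL i:?I. c * i : ?I" using Om_mult maxi_mult[OF P] by (auto simp: mult.assoc)
 ultimately have "fr ?I" by (simp add: fr_def)
 hence "?I = P \<or> ?I = Om" using maxi_max[OF P _ sub] by blast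
 thus False
 proof
  assume "?I = Om"
  hence "1 * b : P" using one_Om by blast
  thus False using n by simp
 qed (use n a ab in blast)
qed

lemma maxi_power_notin: assumes "maxi P" "u : Om" "u ~: P" shows "u ^ i ~: P"
proof (induction i)
 case (Suc i)
 thus ?case using maxi_prime[OF assms(1,2) Om_power[OF assms(2)], of i] assms(3) by auto
qed (simp add: maxi_1[OF assms(1)])

text \<open>Facts about the finite field of residues modulo \<open>P\<close> are phrased as
  membership in \<open>P\<close>. This one yields that residues of units have finite order and that
  a power of Frobenius fixes a given residue.\<close>

lemma maxi_pigeonhole:
 assumes P: "maxi P" and f: "!!i::nat. f i : Om" shows "EX i j. i < j & f i - f j : P"
proof -
 let ?c = "%i. (%b. f i + b) ` P"
 have "finite (quo Om P)" using lattice_fin[OF fr_lat[OF maxi_fr[OF P]] Om_lat maxi_Om[OF P]] by (simp add: fin_def)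
 moreover have "range ?c <= quo Om P" using f by (auto simp: quo_def)
 ultimately have "finite (range ?c)" by (rule finite_subset[rotated])
 hence "~ inj ?c" using finite_imageD by blast
 then obtain i j where "i ~= j" "?c i = ?c j" by (auto simp: inj_def)
 hence "f i - f j : P" "f j - f i : P" using coset_eq_iff[OF maxi_ss[OF P]] by (blast, metis)
 thus ?thesis using \<open>i \<noteq> j\<close> by (metis linorder_neqE_nat)
qed

lemma maxi_unit_power:
 assumes P: "maxi P" and u: "u : Om" "u ~: P" shows "EX k>0. 1 - u ^ k : P"
proof -
 obtain i j where ij: "i < j" "u ^ i - u ^ j : P" using maxi_pigeonhole[OF P, of "%i. u ^ i"] Om_power[OF u(1)] by blast
 note np = maxi_power_notin[OF P u]
 have "u ^ j = u ^ i * u ^ (j - i)" using ij(1) by (simp flip: power_add)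
 hence "u ^ i * (1 - u ^ (j - i)) : P" using ij(2) by (simp add: right_diff_distrib)
 hence "1 - u ^ (j - i) : P" using maxi_prime[OF P Om_power[OF u(1)]] ss_diff[OF Om_ss one_Om Om_power[OF u(1)]] np by blast
 thus ?thesis using ij(1) by (intro exI[of _ "j - i"]) simp
qed

lemma maxi_frob:
 assumes P: "maxi P" and u: "u : Om" shows "EX e>0. ALL k>0. u ^ (CARD('a) ^ (e * k)) - u : P"
proof -
 obtain i j where ij: "i < j" "u ^ (CARD('a) ^ i) - u ^ (CARD('a) ^ j) : P"
  using maxi_pigeonhole[OF P, of "%i. u ^ (CARD('a) ^ i)"] Om_power[OF u] by blast
 let ?e = "j - i"
 have "(u ^ (CARD('a) ^ ?e)) ^ (CARD('a) ^ i) = u ^ (CARD('a) ^ j)" using ij(1) by (simp flip: power_mult power_add)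
 hence "(u - u ^ (CARD('a) ^ ?e)) ^ (CARD('a) ^ i) : P" using ij(2) by (simp only: frE.h_diff)
 moreover note np = maxi_power_notin[OF P]
 ultimately have "u - u ^ (CARD('a) ^ ?e) : P" using ss_diff[OF Om_ss u Om_power[OF u]] by blast
 hence 1: "u ^ (CARD('a) ^ ?e) - u : P" using ss_neg[OF maxi_ss[OF P]] by fastforce
 have "u ^ (CARD('a) ^ (?e * Suc k)) - u : P" for k
 proof (induction k)
  case (Suc k)
  let ?w = "u ^ (CARD('a) ^ (?e * Suc k))"
  have "?w ^ (CARD('a) ^ ?e) = u ^ (CARD('a) ^ (?e * Suc (Suc k)))" by (simp add: algebra_simps flip: power_mult power_add)
  hence "u ^ (CARD('a) ^ (?e * Suc (Suc k))) - u = (?w - u) ^ (CARD('a) ^ ?e) + (u ^ (CARD('a) ^ ?e) - u)" by (simp only: frE.h_diff) simp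
  moreover have "(?w - u) ^ (CARD('a) ^ ?e) : P" using maxi_power[OF P Suc] by simp
  ultimately show ?case using ss_add[OF maxi_ss[OF P] _ 1] by metis
 qed (use 1 in simp)
 from this[of "_ - 1"] have "ALL k>0. u ^ (CARD('a) ^ (?e * k)) - u : P" by (metis Suc_diff_1)
 thus ?thesis using ij(1) by (intro exI[of _ "?e"]) simp
qed

end

section \<open>Maximal ideals as Frobenius orbits of points\<close>

context curve_order
begin

interpretation rho: crhom rho by (rule crhom_rho)

lemma crhom_emb: "crhom emb"
 by unfold_locales (simp_all add: ad.emb_add ad.emb_mult)

abbreviation rr :: "'a poly poly => bool => 'a fls alg_closure" where "rr g == pair (rho g) 0"

lemma rr_Om: "rr g : Om"
 using R0_pair R0_rho by blast

text \<open>If \<open>rr 1\<close> lies in \<open>P\<close>, then \<open>P\<close> belongs to the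
  chart at infinity. If 1/x were not in \<open>P\<close>, some 1 - x^(-k) would be, up to the
  idempotent; but that is a unit at infinity.\<close>

lemma infinite_prime:
 assumes P: "ad.maxi P" and r: "rr 1 : P" shows "pair 0 (to_ac (Tn 1)) : P"
proof (rule ccontr)
 let ?u = "pair 0 (to_ac (Tn 1)) :: bool => 'a fls alg_closure"
 assume n: "?u ~: P"
 have u: "?u : Om" using Ri_pair[OF Tn_Ri[of 1]] by simp
 obtain k where k: "k > 0" "1 - ?u ^ k : P" using ad.maxi_unit_power[OF P u n] by blast
 let ?f = "1 - Tn (int k) :: 'a fls"
 have "Tn (int k) : (inft :: 'a fls set)" by (auto simp: inft_def Tn_nth1)
 hence fi: "?f : inft" by (rule subr_simps(3)[OF subr_inft subr_simps(1)[OF subr_inft]])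
 have f0: "fls_nth ?f 0 ~= 0" using k(1) by (simp add: Tn_nth1)
 hence fn: "?f ~= 0" by auto
 have "to_ac (inverse ?f) : Ri" by (rule Ri_closed(4)[OF inft_unit[OF fi f0]])
 hence "pair 0 (to_ac (inverse ?f)) * (1 - ?u ^ k) : P" using ad.maxi_mult[OF P Ri_pair k(2)] by blast
 moreover have "pair 0 (to_ac (inverse ?f)) * (1 - ?u ^ k) = pair 0 (1 :: 'a fls alg_closure)"
 proof
  fix b
  have pw: "(?u ^ k) False = to_ac (Tn (int k))"
  proof -
   have "(?u ^ j) False = to_ac (Tn (int j))" for j
    by (induction j) (simp_all add: Tn_add)
   thus ?thesis .
  qed
  have "to_ac (inverse ?f) * (1 - to_ac (Tn (int k))) = (to_ac (inverse ?f * ?f) :: 'a fls alg_closure)"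
   by (simp only: to_ac.h_mult to_ac.h_diff to_ac_1)
  also have "... = 1" using fn by simp
  finally show "(pair 0 (to_ac (inverse ?f)) * (1 - ?u ^ k)) b = pair 0 (1 :: 'a fls alg_closure) b" using pw by (cases b) simp_all
 qed
 ultimately have "pair 0 1 : P" by simp
 hence "rr 1 + pair 0 1 : P" using ad.ss_add[OF ad.maxi_ss[OF P] r] by blast
 moreover have "rr 1 + pair 0 1 = 1" by auto
 ultimately show False using ad.maxi_1[OF P] by simp
qed

text \<open>The idempotent \<open>rr 1\<close> annihilates the component at infinity, and
  \<open>P\<close> is prime.\<close>

lemma finite_prime: assumes P: "ad.maxi P" and r: "rr 1 ~: P" shows "pair 0 w : Om ==> pair 0 w : P"
proof -
 assume w: "pair 0 w : Om"
 have "rr 1 * pair 0 w = 0" by auto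
 thus ?thesis using ad.maxi_prime[OF P rr_Om[of 1] w] r ad.ss_0[OF ad.maxi_ss[OF P]] by metis
qed

lemma rr_simps: "rr (f + g) = rr f + rr g" "rr (f - g) = rr f - rr g" "rr (f * g) = rr f * rr g" "k > 0 ==> rr (f ^ k) = rr f ^ k"
proof -
 show m: "rr (f * g) = rr f * rr g" for f g by (simp add: fun_eq_iff rho.h_mult)
 show "k > 0 ==> rr (f ^ k) = rr f ^ k"
 proof (induction k)
  case (Suc k)
  thus ?case using m[of f "f ^ k"] by (cases "k = 0") (simp only: power_0 power_Suc mult_1_right, simp only: power_Suc)
 qed simp
qed (simp_all add: fun_eq_iff rho.h_add rho.h_diff)

text \<open>\<open>cc p n\<close> carries \<open>Om\<close> into the plane model, so elements of
  \<open>Om\<close> have values at affine points where \<open>p\<close> does not vanish, singular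
  ones included.\<close>

context
 fixes p n assumes p0: "p ~= 0" and n0: "n > 0" and clear: "ad.smul (cc p n) Om <= RR"
begin

lemma Om_dom: "u : Om ==> u True : dom p"
 using ad.smul_memI[of u Om "cc p n"] clear by (auto simp: dom_def RR_def cc_def)

definition ker :: "'a alg_closure \<times> 'a alg_closure => (bool => 'a fls alg_closure) set" where
 "ker z = {u : Om. psi p z (u True) = 0}"

context
 fixes z assumes z: "z : cpts p"
begin

lemma ps_add: "u : Om ==> v : Om ==> psi p z ((u + v) True) = psi p z (u True) + psi p z (v True)"
 and ps_mult: "u : Om ==> v : Om ==> psi p z ((u * v) True) = psi p z (u True) * psi p z (v True)"
 using psi_simps(1,2)[OF z Om_dom] Om_dom Om_dom[of "u * v"] ad.Om_mult by auto

lemma ps_diff: "u : Om ==> v : Om ==> psi p z ((u - v) True) = psi p z (u True) - psi p z (v True)"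
 using ps_add[of "u - v" v] ad.ss_diff[OF ad.Om_ss, of u v] by simp

lemma ps_const: "psi p z (emb c True) = to_ac c"
 using psi_const[OF z] by (simp add: emb_def)

lemma emb_Om: "emb c : Om"
 using ad.ss_scale[OF ad.Om_ss Om_1, of c] by simp

lemma ps_scale: "u : Om ==> psi p z ((emb c * u) True) = to_ac c * psi p z (u True)"
 using ps_mult[OF emb_Om] ps_const by metis

lemma ps_rr: "psi p z (rr g True) = ev2 (lift g) (fst z) (snd z)"
 using psi_rho[OF z] by simp

lemma ps_1: "psi p z (1 True) = 1"
 using psi_1[OF z] by simp

lemma ps_cc: "psi p z (cc s k True) = acp s (fst z)"
 using psi_rho[OF z, of "[:s:]"] by (simp add: cc_def rho_const mac.mp_pCons)

lemma ker_ss: "ad.subspace (ker z)"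
proof (rule ad.subspaceI)
 have "psi p z ((1 - 1) True) = 0" using ps_diff[OF Om_1 Om_1] by simp
 thus "0 : ker z" using ad.ss_0[OF ad.Om_ss] by (simp add: ker_def)
 show "x + y : ker z" if "x : ker z" "y : ker z" for x y using that ad.ss_add[OF ad.Om_ss] ps_add by (auto simp: ker_def)
 show "emb c * x : ker z" if "x : ker z" for c x using that ad.ss_scale[OF ad.Om_ss] ps_scale[of x c] by (auto simp: ker_def)
qed

lemma ker_mult: "a : Om ==> u : ker z ==> a * u : ker z"
 using ad.Om_mult ps_mult[of a u] by (auto simp: ker_def)

lemma ker_fr: "ad.fr (ker z)"
proof -
 obtain s :: "'a poly" where s: "s ~= 0" "acp s (fst z) = 0" by (rule alg_closure_algebraic)
 have c: "cc s 1 : Dn" using s(1) by (auto simp: Dn_def)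
 have "cc s 1 : ker z" using ps_cc s(2) cc_Om by (simp add: ker_def)
 hence "ad.smul (cc s 1) Om <= ker z" using ker_mult by (auto simp: ad.smul_def mult.commute)
 hence "ad.lattice (ker z)"
  using ad.lattice_between[OF ad.fr_lat[OF ad.Dn_ideal(1)[OF c]] ad.Om_lat ker_ss] by (auto simp: ker_def)
 thus ?thesis using ker_mult by (simp add: ad.fr_def)
qed

lemma ker_Om: "ker z <= Om"
 by (auto simp: ker_def)

lemma idx_ker:
 assumes "ad.subspace S" "ker z <= S" "S <= Om"
 shows "finite ((%u. psi p z (u True)) ` S)" "card ((%u. psi p z (u True)) ` S) = CARD('a) ^ ad.dm S (ker z)"
proof -
 have c: "psi p z (u True) = psi p z (v True) \<longleftrightarrow> u - v : ker z" if "u : S" "v : S" for u v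
 proof -
  have "u : Om" "v : Om" using that assms(3) by blast+
  thus ?thesis using ps_diff[of u v] ad.ss_diff[OF ad.Om_ss, of u v] unfolding ker_def mem_Collect_eq by (metis eq_iff_diff_eq_0)
 qed
 note fin = ad.lattice_fin[OF ad.fr_lat[OF ker_fr] ad.Om_lat ker_Om]
 have fin': "ad.fin S (ker z)" using ad.fin_tower(1)[OF ker_ss assms(1,2,3) ad.Om_ss] fin by blast
 note v = ad.idx_via[OF ker_ss, of S "%u. psi p z (u True)"]
 show "finite ((%u. psi p z (u True)) ` S)" using v(2) c fin' by blast
 show "card ((%u. psi p z (u True)) ` S) = CARD('a) ^ ad.dm S (ker z)"
  using v(1) c ad.idx_dm[OF assms(1) ker_ss assms(2) fin'] by metis
qed

lemma one_notin_ker: "1 ~: ker z"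
 using ps_1 by (simp add: ker_def)

lemma dm_ker_pos: "ad.dm Om (ker z) > 0"
 using ad.dm_fr_0[OF ker_fr ad.fr_Om ker_Om] one_notin_ker Om_1 by (metis gr0I)

lemma image_subring:
 assumes "ad.subspace S" "ker z <= S" "S <= Om" "!!a b. a : S ==> b : S ==> a * b : S" "1 : S"
 shows "(%u. psi p z (u True)) ` S = kf (ad.dm S (ker z))" "ad.dm S (ker z) > 0"
proof -
 show pos: "ad.dm S (ker z) > 0"
 proof (rule ccontr)
  assume "~ ?thesis"
  hence c: "card ((%u. psi p z (u True)) ` S) = 1" using idx_ker(2)[OF assms(1-3)] by simp
  have "psi p z (0 True) = 0" using ad.ss_0[OF ker_ss] by (simp add: ker_def)
  hence "{0, 1} <= (%u. psi p z (u True)) ` S" using ad.ss_0[OF assms(1)] assms(5) ps_1 by (metis (no_types, lifting) empty_subsetI image_eqI insert_subset)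
  hence "card {0, 1 :: 'a alg_closure} <= 1" using c idx_ker(1)[OF assms(1-3)] by (metis card_mono)
  thus False by simp
 qed
 show "(%u. psi p z (u True)) ` S = kf (ad.dm S (ker z))"
 proof (rule finite_subring_kf[OF idx_ker[OF assms(1-3)] pos])
  have "psi p z (0 True) = 0" using ad.ss_0[OF ker_ss] by (simp add: ker_def)
  thus "0 : (%u. psi p z (u True)) ` S" using ad.ss_0[OF assms(1)] by (metis image_eqI)
  fix a b assume "a : (%u. psi p z (u True)) ` S" "b : (%u. psi p z (u True)) ` S"
  then obtain u v where uv: "u : S" "v : S" "a = psi p z (u True)" "b = psi p z (v True)" by blast
  have "a * b = psi p z ((u * v) True)" unfolding uv(3,4) by (rule ps_mult[symmetric]) (use uv assms(3) in blast)+
  thus "a * b : (%u. psi p z (u True)) ` S" using assms(4)[OF uv(1,2)] by blast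
 qed
qed

lemma image_Om: "(%u. psi p z (u True)) ` Om = kf (ad.dm Om (ker z))"
 by (rule image_subring(1)[OF ad.Om_ss ker_Om order_refl ad.Om_mult Om_1])

lemma ker_maxi: "ad.maxi (ker z)"
 unfolding ad.maxi_def
proof (intro conjI allI impI)
 show "ker z ~= Om" using one_notin_ker Om_1 by blast
 fix I assume I: "ad.fr I" "ker z <= I" "I <= Om"
 show "I = ker z \<or> I = Om"
 proof (cases "I = ker z")
  case False
  then obtain x where x: "x : I" "x : Om" "x ~: ker z" using I by blast
  hence "psi p z (x True) ~= 0" "psi p z (x True) : kf (ad.dm Om (ker z))" using image_Om by (auto simp: ker_def)
  hence "inverse (psi p z (x True)) : (%u. psi p z (u True)) ` Om" unfolding image_Om unfolding kf_def by (simp add: power_inverse)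
  then obtain y where y: "y : Om" "psi p z (y True) = inverse (psi p z (x True))" by (rule imageE) (rule that, simp_all)
  have "psi p z ((1 - y * x) True) = 0"
   using ps_diff[OF Om_1 ad.Om_mult[OF y(1) x(2)]] ps_mult[OF y(1) x(2)] ps_1 y(2) \<open>psi p z (x True) \<noteq> 0\<close> by simp
  hence "1 - y * x : I" using I(2) ad.ss_diff[OF ad.Om_ss Om_1 ad.Om_mult[OF y(1) x(2)]] by (auto simp: ker_def)
  hence "(1 - y * x) + y * x : I" using ad.ss_add[OF ad.fr_ss[OF I(1)]] ad.fr_mult[OF I(1) y(1) x(1)] by blast
  hence "I = Om" using ad.one_notin[OF I(1,3)] by auto
  thus ?thesis by simp
 qed simp
qed (rule ker_fr ker_Om)+

lemma cc_notin_ker: "cc p n ~: ker z"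
 using ps_cc z by (auto simp: ker_def cpts_def)

text \<open>The values of \<open>Om\<close> at \<open>z\<close> fill a finite field of degree
  \<open>dm Om (ker z)\<close>, which contains both coordinates of \<open>z\<close>.\<close>

lemma pts_iff: "z : pts r \<longleftrightarrow> ad.dm Om (ker z) dvd r"
proof
 assume "z : pts r"
 hence "(%u. psi p z (u True)) ` Om <= kf r" using psi_kf[OF z _ Om_dom] by auto
 thus "ad.dm Om (ker z) dvd r" using kf_subset_dvd[OF dm_ker_pos] image_Om by metis
next
 assume d: "ad.dm Om (ker z) dvd r"
 have "psi p z (rr g True) : kf (ad.dm Om (ker z))" for g unfolding image_Om[symmetric] using rr_Om by (rule imageI)
 hence "ev2 (lift g) (fst z) (snd z) : kf (ad.dm Om (ker z))" for g by (simp only: ps_rr)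
 hence "ev2 (lift g) (fst z) (snd z) : kf r" for g using d kf_mult by (auto simp: dvd_def)
 from this[of "[:[:0, 1:]:]"] this[of "[:0, 1:]"] have "fst z : kf r" "snd z : kf r"
  by (simp_all add: mac.mp_pCons to_ac.mp_pCons)
 thus "z : pts r" using z by (auto simp: pts_def cpts_def)
qed

lemma ps_poly: "u : Om ==> poly (map_poly emb G) u : Om & psi p z (poly (map_poly emb G) u True) = acp G (psi p z (u True))"
proof (induction G)
 case 0
 have "poly (map_poly emb 0) u = 0" unfolding map_poly_0 by (rule poly_0)
 moreover have "psi p z (0 True) = 0" using ad.ss_0[OF ker_ss] unfolding ker_def by blast
 ultimately show ?case using ad.ss_0[OF ad.Om_ss] by (metis map_poly_0 poly_0)
next
 case (pCons a G)
 have e: "poly (map_poly emb (pCons a G)) u = emb a + u * poly (map_poly emb G) u" by (simp add: crhom.mp_pCons[OF crhom_emb])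
 have m: "u * poly (map_poly emb G) u : Om" using pCons ad.Om_mult by blast
 have "emb a + u * poly (map_poly emb G) u : Om" using ad.ss_add[OF ad.Om_ss emb_Om m] .
 moreover have "psi p z ((emb a + u * poly (map_poly emb G) u) True) = acp (pCons a G) (psi p z (u True))"
  using ps_add[OF emb_Om m] ps_mult[of u "poly (map_poly emb G) u"] ps_const pCons by (simp add: to_ac.mp_pCons)
 ultimately show ?case unfolding e by blast
qed

end

lemma ker_frobpt: assumes "z : cpts p" shows "ker (frobpt i z) = ker z"
 using assms Om_dom ker_def by (auto simp: psi_frobpt)

text \<open>Choose \<open>u\<close> whose value t at \<open>z\<close> generates the residue field.
  Its minimal polynomial evaluated at \<open>u\<close> lies in the common kernel, so
  \<open>z'\<close> takes a conjugate of t at \<open>u\<close>. After twisting \<open>z\<close> by a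
  power of Frobenius the two evaluations agree at \<open>u\<close>, and therefore
  everywhere.\<close>

lemma ker_eq_conjugate:
 assumes z: "z : cpts p" "z' : cpts p" and k: "ker z' = ker z"
 shows "EX i<ad.dm Om (ker z). z' = frobpt i z"
proof -
 let ?m = "ad.dm Om (ker z)"
 obtain t :: "'a alg_closure" where t: "t : kf ?m" "!!j. 0 < j ==> j < ?m ==> t ~: kf j" using kf_generator[OF dm_ker_pos[OF z(1)]] by blast
 obtain u where u: "u : Om" "psi p z (u True) = t" using t(1) unfolding image_Om[OF z(1), symmetric] by blast
 obtain G :: "'a poly" where G: "map_poly to_ac G = (PROD i<?m. [:- (t ^ (CARD('a) ^ i)), 1:])"
  using min_poly_exists[OF dm_ker_pos[OF z(1)] t] by blast
 have "acp G t = 0" unfolding G using dm_ker_pos[OF z(1)] by (auto simp: poly_prod intro!: bexI[of _ 0])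
 hence "poly (map_poly emb G) u : ker z" using ps_poly[OF z(1) u(1)] u(2) by (simp add: ker_def)
 hence "acp G (psi p z' (u True)) = 0" using ps_poly[OF z(2) u(1), of G] unfolding k[symmetric] by (simp add: ker_def)
 then obtain i where i: "i < ?m" "psi p z' (u True) = t ^ (CARD('a) ^ i)" unfolding G by (auto simp: poly_prod)
 let ?y = "frobpt i z"
 have y: "?y : cpts p" by (rule frobpt_cpts[OF z(1)])
 \<comment> \<open>The ring of agreement contains the kernel, and its image is a finite field
   containing a generator of the residue field, so it is all of \<open>Om\<close>.\<close>
 let ?S = "{w : Om. psi p z' (w True) = psi p ?y (w True)}"
 have ss: "ad.subspace ?S"
  using ad.ss_0[OF ad.Om_ss] ad.ss_add[OF ad.Om_ss] ad.ss_scale[OF ad.Om_ss] ps_add[OF z(2)] ps_add[OF y] ps_scale[OF z(2)] ps_scale[OF y]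
   ad.ss_0[OF ker_ss[OF z(2)]] ad.ss_0[OF ker_ss[OF y]]
  by (intro ad.subspaceI) (simp_all add: ker_def)
 have kS: "ker z' <= ?S"
 proof
  fix w assume w: "w : ker z'"
  hence "w : ker ?y" using ker_frobpt[OF z(1), of i] k by simp
  thus "w : ?S" using w by (simp add: ker_def)
 qed
 have mS: "a * b : ?S" if "a : ?S" "b : ?S" for a b using that ad.Om_mult ps_mult[OF z(2)] ps_mult[OF y] by simp
 have oS: "1 : ?S" using ps_1[OF z(2)] ps_1[OF y] Om_1 by simp
 have SO: "?S <= Om" by blast
 have "u : ?S" using u i(2) psi_frobpt[OF z(1) Om_dom[OF u(1)]] by simp
 let ?k = "ad.dm ?S (ker z')"
 note im = image_subring[OF z(2) ss kS SO mS oS]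
 have im1: "(%u. psi p z' (u True)) ` ?S = kf ?k" by (rule im(1))
 have "psi p z' (u True) : (%u. psi p z' (u True)) ` ?S" using \<open>u \<in> ?S\<close> by (rule imageI)
 hence "t ^ (CARD('a) ^ i) : kf ?k" unfolding im1 i(2) .
 hence "(t ^ (CARD('a) ^ i)) ^ (CARD('a) ^ ?k) = t ^ (CARD('a) ^ i)" by (simp add: kf_def)
 hence "(t ^ (CARD('a) ^ ?k)) ^ (CARD('a) ^ i) = t ^ (CARD('a) ^ i)" by (simp only: mult.commute flip: power_mult)
 hence "t ^ (CARD('a) ^ ?k) = t" by (simp only: frob_inj)
 hence "~ ?k < ?m" using t(2)[of ?k] im(2) by (auto simp: kf_def)
 moreover have "?m = ad.dm Om ?S + ?k" unfolding k[symmetric]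
  by (rule ad.dm_tower[OF ker_ss[OF z(2)] ss kS SO ad.Om_ss ad.lattice_fin[OF ad.fr_lat[OF ker_fr[OF z(2)]] ad.Om_lat ker_Om[OF z(2)]]])
 ultimately have "ad.dm Om ?S = 0" by simp
 moreover have "ad.fin Om ?S" using ad.fin_tower(1)[OF ker_ss[OF z(2)] ss kS SO ad.Om_ss]
   ad.lattice_fin[OF ad.fr_lat[OF ker_fr[OF z(2)]] ad.Om_lat ker_Om[OF z(2)]] by blast
 ultimately have SO': "?S = Om" using ad.dm_eq_0D[OF ad.Om_ss ss SO] by simp
 have "psi p z' (rr g True) = psi p ?y (rr g True)" for g using SO' rr_Om by blast
 hence "ev2 (lift g) (fst z') (snd z') = ev2 (lift g) (fst ?y) (snd ?y)" for g by (simp only: ps_rr[OF z(2)] ps_rr[OF y])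
 from this[of "[:[:0, 1:]:]"] this[of "[:0, 1:]"] have "fst z' = fst ?y" "snd z' = snd ?y" by (simp_all add: mac.mp_pCons to_ac.mp_pCons)
 thus ?thesis using i(1) by (auto simp: prod_eq_iff)
qed

lemma card_fiber:
 assumes z: "z : cpts p" shows "card {z' : cpts p. ker z' = ker z} = ad.dm Om (ker z)"
proof -
 let ?m = "ad.dm Om (ker z)"
 have "{z' : cpts p. ker z' = ker z} = (%i. frobpt i z) ` {..<?m}"
 proof (intro equalityI subsetI)
  fix z' assume z': "z' : {z' : cpts p. ker z' = ker z}"
  thus "z' : (%i. frobpt i z) ` {..<?m}" using ker_eq_conjugate[OF z, of z'] by blast
 next
  fix z' assume "z' : (%i. frobpt i z) ` {..<?m}"
  thus "z' : {z' : cpts p. ker z' = ker z}" using ker_frobpt[OF z] frobpt_cpts[OF z] by blast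
 qed
 moreover have "inj_on (%i. frobpt i z) {..<?m}"
 proof (rule linorder_inj_onI)
  fix i j assume ij: "i < j" "i : {..<?m}" "j : {..<?m}"
  show "frobpt i z ~= frobpt j z"
  proof
   assume e: "frobpt i z = frobpt j z"
   hence "z : pts (j - i)" using z frob_cycle[OF ij(1)] by (auto simp: frobpt_def pts_def cpts_def)
   hence "?m dvd j - i" by (simp add: pts_iff[OF z])
   thus False using ij by (auto dest: dvd_imp_le)
  qed
 qed auto
 ultimately show ?thesis by (simp add: card_image)
qed

text \<open>A Nullstellensatz over a finite field. The polynomials with \<open>rr g\<close> in
  \<open>P\<close> form an ideal \<open>Q\<close> that contains X^N - X and Y^N - Y for a suitable N
  = q^e, so it suffices to find a common zero in \<open>kf e\<close>. Since n > 0, a prime at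
  infinity would contain \<open>cc p n\<close> and is excluded.\<close>

lemma ker_exists:
 assumes P: "ad.maxi P" and c: "cc p n ~: P" shows "EX z:cpts p. ker z = P"
proof -
 note ss = ad.maxi_ss[OF P]
 have dec: "cc p n = rr [:p:] + pair 0 (to_ac (Tn (int n)))" by (auto simp: cc_def rho_const)
 have r1: "rr 1 ~: P"
 proof
  assume r: "rr 1 : P"
  have "pair 0 (to_ac (Tn 1)) ^ n = (pair 0 (to_ac (Tn (int n))) :: bool => 'a fls alg_closure)"
  proof -
   have "(pair 0 (to_ac (Tn 1)) ^ Suc j) = (pair 0 (to_ac (Tn (int (Suc j)))) :: bool => 'a fls alg_closure)" for j
   proof (induction j)
    case (Suc j)
    have "int (Suc (Suc j)) = 1 + int (Suc j)" by simp
    hence "Tn (int (Suc (Suc j))) = (Tn 1 * Tn (int (Suc j)) :: 'a fls)" by (simp only: Tn_add)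
    hence "(pair 0 (to_ac (Tn (int (Suc (Suc j))))) :: bool => 'a fls alg_closure) = pair 0 (to_ac (Tn 1)) * pair 0 (to_ac (Tn (int (Suc j))))"
     by (simp add: fun_eq_iff)
    thus ?case unfolding power_Suc[of _ "Suc j"] Suc ..
   qed simp
   from this[of "n - 1"] show ?thesis using n0 by simp
  qed
  hence "pair 0 (to_ac (Tn (int n))) : P" using ad.maxi_power[OF P infinite_prime[OF P r] n0] by metis
  moreover have "rr [:p:] : P" using ad.maxi_mult[OF P rr_Om r, of "[:p:]"] rr_simps(3)[of "[:p:]" 1] by (metis mult_1_right)
  ultimately have "cc p n : P" unfolding dec using ad.ss_add[OF ss] by blast
  thus False using c by blast
 qed
 have pP: "rr [:p:] ~: P"
 proof
  assume "rr [:p:] : P"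
  hence "cc p n : P" unfolding dec using ad.ss_add[OF ss] finite_prime[OF P r1] Ri_pair[OF Tn_Ri] by blast
  thus False using c by blast
 qed
 define Q where "Q = {g. rr g : P}"
 have Q_add: "f + g : Q" if "f : Q" "g : Q" for f g using that ad.ss_add[OF ss] by (simp only: Q_def rr_simps mem_Collect_eq)
 have Q_mult: "f * g : Q" if "g : Q" for f g using that ad.maxi_mult[OF P rr_Om] by (simp only: Q_def rr_simps mem_Collect_eq)
 have Q_1: "1 ~: Q" using r1 by (simp add: Q_def)
 have Q_unit: "EX k>0. 1 - g ^ k : Q" if gQ: "g ~: Q" for g
 proof -
  obtain k where k: "k > 0" "1 - rr g ^ k : P" using ad.maxi_unit_power[OF P rr_Om, of g] gQ unfolding Q_def by blast
  have "rr 1 * (1 - rr g ^ k) : P" by (rule ad.maxi_mult[OF P rr_Om k(2)])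
  moreover have "rr 1 * (1 - rr g ^ k) = rr (1 - g ^ k)"
  proof -
   have "rr 1 * (1 - rr g ^ k) = rr 1 - rr (1 * g ^ k)" unfolding right_diff_distrib rr_simps(3) rr_simps(4)[OF k(1)] by simp
   thus ?thesis by (simp only: rr_simps mult_1)
  qed
  ultimately show ?thesis using k(1) unfolding Q_def by auto
 qed
 have Q_frob: "EX e>0. ALL k>0. g ^ (CARD('a) ^ (e * k)) - g : Q" for g
 proof -
  obtain e where e: "e > 0" "!!k. k > 0 ==> rr g ^ (CARD('a) ^ (e * k)) - rr g : P" using ad.maxi_frob[OF P rr_Om] by blast
  have "rr (g ^ (CARD('a) ^ (e * k)) - g) = rr g ^ (CARD('a) ^ (e * k)) - rr g" for k
   unfolding rr_simps(2) by (subst rr_simps(4)) simp_all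
  thus ?thesis using e unfolding Q_def by auto
 qed
 obtain e1 where e1: "e1 > 0" "!!k. k > 0 ==> [:[:0, 1:]:] ^ (CARD('a) ^ (e1 * k)) - [:[:0, 1:]:] : Q" using Q_frob by blast
 obtain e2 where e2: "e2 > 0" "!!k. k > 0 ==> [:0, 1:] ^ (CARD('a) ^ (e2 * k)) - [:0, 1:] : Q" using Q_frob by blast
 define e where "e = e1 * e2"
 have e0: "e > 0" using e1(1) e2(1) by (simp add: e_def)
 let ?N = "CARD('a) ^ e"
 have X: "[:monom 1 ?N - [:0, 1:]:] : Q"
  using e1 e2 e_def by (simp add: poly_const_pow monom_altdef)
 have Y: "monom 1 ?N - [:0, 1:] : Q"
  using e2(2)[OF e1(1)] by (simp add: e_def mult.commute monom_altdef)
 have "EX z:kf e \<times> kf e. ALL g:Q. ev2 (lift g) (fst z) (snd z) = 0"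
 proof (rule ccontr)
  assume "~ ?thesis"
  hence ex: "ALL z:kf e \<times> kf e. EX g. g : Q & ev2 (lift g) (fst z) (snd z) ~= 0" by blast
  define f where "f z = (SOME g. g : Q & ev2 (lift g) (fst z) (snd z) ~= 0)" for z
  have f: "f z : Q & ev2 (lift (f z)) (fst z) (snd z) ~= 0" if "z : kf e \<times> kf e" for z
   unfolding f_def by (rule someI_ex) (use ex that in blast)
  let ?Z = "kf e \<times> kf e :: ('a alg_closure \<times> 'a alg_closure) set"
  have finZ: "finite ?Z" using card_kf(2)[OF e0, where 'a = 'a] by simp
  have N1: "?N > 1" using finite_field_card_gt_1[where 'a = 'a] e0 by (rule one_less_power)
  \<comment> \<open>Each \<open>f z\<close> lies in \<open>Q\<close> and is nonzero at
    \<open>z\<close>, so its power of exponent N - 1 has value 1 there. The product is congruent to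
    1 modulo \<open>Q\<close> yet vanishes on the whole grid, which puts it into
    \<open>Q\<close>.\<close>
  let ?F = "PROD z:?Z. 1 - f z ^ (?N - 1)"
  have "1 - (PROD z:A. 1 - f z ^ (?N - 1)) : Q" if "finite A" "A <= ?Z" for A
   using that
  proof (induction A rule: finite_induct)
   case empty
   have "rr 0 = 0" by auto
   thus ?case using ad.ss_0[OF ss] by (simp add: Q_def)
  next
   case (insert z A)
   let ?G = "PROD z:A. 1 - f z ^ (?N - 1)"
   have "f z ^ (?N - 1) = f z ^ (?N - 2) * f z" using N1 by (metis Suc_1 Suc_diff_Suc power_Suc2)
   hence "f z ^ (?N - 1) : Q" using Q_mult f insert by auto
   moreover have "(1 - f z ^ (?N - 1)) * (1 - ?G) : Q" using Q_mult insert by blast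
   moreover have "1 - (1 - f z ^ (?N - 1)) * ?G = f z ^ (?N - 1) + (1 - f z ^ (?N - 1)) * (1 - ?G)" by (simp add: algebra_simps)
   ultimately show ?case using Q_add insert(1,2) by simp
  qed
  from this[OF finZ order_refl] have "1 - ?F : Q" .
  moreover have "ev2 (lift ?F) x y = 0" if "x : kf e" "y : kf e" for x y
  proof -
   have xy: "(x, y) : ?Z" using that by simp
   let ?v = "ev2 (lift (f (x, y))) x y"
   have "?v ^ ?N = ?v" using ev2_lift_frob[of "f (x, y)" x e y] that by (simp add: kf_def)
   moreover have "?N > 0" using N1 by linarith
   from power_minus_mult[OF this, of ?v] have "?v ^ ?N = ?v * ?v ^ (?N - 1)" by (simp only: mult.commute)
   ultimately have "?v ^ (?N - 1) = 1" using f[OF xy] by simp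
   hence "ev2 (lift (1 - f (x, y) ^ (?N - 1))) x y = 0" by (simp add: mac.mp_diff mac.mp_power)
   moreover have "ev2 (lift ?F) x y = (PROD z:?Z. ev2 (lift (1 - f z ^ (?N - 1))) x y)" by (simp only: mac.mp_prod ev2_prod)
   ultimately show ?thesis using finZ xy by auto
  qed
  then obtain A B where "?F = A * [:monom 1 ?N - [:0, 1:]:] + B * (monom 1 ?N - [:0, 1:])" using vanishing_ideal_kf[OF e0] by blast
  hence "?F : Q" using Q_add Q_mult X Y by metis
  ultimately have "(1 - ?F) + ?F : Q" by (rule Q_add)
  thus False using Q_1 by simp
 qed
 then obtain z where z: "!!g. g : Q ==> ev2 (lift g) (fst z) (snd z) = 0" by blast
 \<comment> \<open>Outside \<open>Q\<close> some power of \<open>g\<close> is congruent to 1 modulo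
   \<open>Q\<close>. This ensures in particular that \<open>p\<close> does not vanish at
   \<open>z\<close>.\<close>
 have nz: "ev2 (lift g) (fst z) (snd z) ~= 0" if gQ: "g ~: Q" for g
 proof
  assume g0: "ev2 (lift g) (fst z) (snd z) = 0"
  obtain k where k: "k > 0" "1 - g ^ k : Q" using Q_unit[OF gQ] by blast
  thus False using z[OF k(2)] g0 by (simp add: mac.mp_diff mac.mp_power zero_power)
 qed
 have "h : Q"
 proof -
  have "rr h = 0" using rho_dvd[of h] by auto
  thus ?thesis using ad.ss_0[OF ss] by (simp add: Q_def)
 qed
 moreover have "[:p:] ~: Q" using pP by (simp add: Q_def)
 ultimately have zc: "z : cpts p" using z[of h] nz[of "[:p:]"] by (auto simp: cpts_def mac.mp_pCons)
 have "P <= ker z"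
 proof
  fix u assume u: "u : P"
  have uO: "u : Om" using ad.maxi_Om[OF P] u by blast
  obtain g where g: "to_ac (px p) * u True = rho g" using Om_dom[OF uO] R0_rho by (auto simp: dom_def)
  have "rr [:p:] * u : P" by (rule ad.maxi_mult[OF P rr_Om u])
  moreover have "rr [:p:] * u = rr g" using g by (auto simp: rho_const)
  ultimately have "g : Q" by (simp add: Q_def)
  hence "evR z (rho g) = 0" using evR_rho[of z g] z zc by (auto simp: cpts_def)
  thus "u : ker z" using uO by (simp add: ker_def psi_def g)
 qed
 hence "ker z = P" using ad.maxi_max[OF P ker_fr[OF zc] _ ker_Om[OF zc]] one_notin_ker[OF zc] Om_1 by blast
 thus ?thesis using zc by blast
qed

lemma npts_good:
 assumes r: "r > 0"
 shows "card (pts r Int cpts p) = (\<Sum>P | ad.maxi P & ad.dm Om P dvd r & cc p n ~: P. ad.dm Om P)"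
proof -
 let ?G = "pts r Int cpts p"
 let ?S = "{P. ad.maxi P & ad.dm Om P dvd r & cc p n ~: P}"
 have finG: "finite ?G" using finite_pts(1)[OF r] by simp
 have im: "ker ` ?G = ?S"
 proof (intro equalityI subsetI)
  fix P assume "P : ?S"
  then obtain z where "z : cpts p" "ker z = P" "ad.dm Om P dvd r" using ker_exists by blast
  moreover have "z : pts r" using calculation pts_iff[of z r] by simp
  ultimately show "P : ker ` ?G" by blast
 qed (auto simp: ker_maxi cc_notin_ker pts_iff)
 have "card ?G = (SUM P:ker ` ?G. card {z : ?G. ker z = P})"
  using sum.image_gen[OF finG, of "%_. 1::nat" ker] by simp
 also have "... = (SUM P:?S. ad.dm Om P)" unfolding im
 proof (rule sum.cong[OF refl])
  fix P assume P: "P : ?S"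
  then obtain z where z: "z : cpts p" "ker z = P" using ker_exists by blast
  have "{z' : ?G. ker z' = P} = {z' : cpts p. ker z' = ker z}" using P z pts_iff by auto
  thus "card {z' : ?G. ker z' = P} = ad.dm Om P" using card_fiber[OF z(1)] z(2) by simp
 qed
 finally show ?thesis .
qed

end

end

section \<open>Comparison of places with points, and places of degree one\<close>

context curve_order
begin

interpretation rho: crhom rho by (rule crhom_rho)

lemma cc_in_Dn: "s ~= 0 ==> cc s k : Dn"
 by (auto simp: Dn_def)

text \<open>Places and points correspond away from \<open>p\<close> and infinity. The exceptional
  places divide one fixed ideal and the exceptional points are zeros of \<open>p\<close>, so both
  are bounded independently of \<open>r\<close>.\<close>

lemma npts_estimate: "EX C. ALL r>=1. \<bar>real (ad.npts r) - real CARD('a) ^ r\<bar> <= C * sqrt (real CARD('a)) ^ r"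
proof -
 obtain c where c: "c : Dn" "ad.smul c Om <= RR" using ad.Om_lat unfolding ad.lattice_def by blast
 obtain p n' where p: "p ~= 0" "c = cc p n'" using c(1) unfolding Dn_def by blast
 \<comment> \<open>The exponent is raised by one so that it is positive, and \<open>cc p n\<close>
   then lies in every prime at infinity.\<close>
 define n where "n = Suc n'"
 have n0: "n > 0" by (simp add: n_def)
 have "ad.smul (cc p n) Om = ad.smul (cc 1 1) (ad.smul (cc p n') Om)" by (simp add: ad.smul_smul cc_mult n_def)
 hence cl: "ad.smul (cc p n) Om <= RR"
  using ad.smul_mono[OF c(2), of "cc 1 1"] ad.smul_R_R[OF cc_RR, of 1 1] unfolding p(2) by simp
 note f = ad.Dn_ideal[OF cc_in_Dn[OF p(1), of n]]
 let ?B = "{(x, y). ev2 H x y = 0 & acp p x = 0}"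
 let ?b = "card ?B + ad.dm Om (ad.smul (cc p n) Om)"
 obtain C where C: "!!r. r >= 1 ==> \<bar>real (card (pts r)) - real CARD('a) ^ r\<bar> <= C * sqrt (real CARD('a)) ^ r" using card_pts_estimate by blast
 have "\<bar>real (ad.npts r) - real CARD('a) ^ r\<bar> <= (C + ?b) * sqrt (real CARD('a)) ^ r" if r: "r >= 1" for r
 proof -
  have r0: "r > 0" using r by simp
  let ?good = "{P. ad.maxi P & ad.dm Om P dvd r & cc p n ~: P}"
  let ?bad = "{P. ad.maxi P & ad.dm Om P dvd r & cc p n : P}"
  have fin: "finite (ad.primes_dvd r)" by (rule ad.finite_primes_dvd[OF r0])
  have u: "ad.primes_dvd r = ?good Un ?bad" "?good Int ?bad = {}" by (auto simp: ad.primes_dvd_def)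
  have N: "ad.npts r = card (pts r Int cpts p) + (SUM P:?bad. ad.dm Om P)"
   unfolding ad.npts_def npts_good[OF p(1) n0 cl r0] u(1) using fin u by (intro sum.union_disjoint) auto
  have sub: "ad.smul (cc p n) Om <= P" if "ad.maxi P" "cc p n : P" for P
   using smul_Om_le_iff[OF ad.maxi_Om[OF that(1)] ad.maxi_fr[OF that(1)]] that(2) by blast
  have "(SUM P:?bad. ad.dm Om P) <= (\<Sum>P | ad.maxi P & ad.smul (cc p n) Om <= P. ad.dm Om P)"
   using primes_over(1)[OF f] sub by (intro sum_mono2) auto
  also have "... <= ad.dm Om (ad.smul (cc p n) Om)" by (rule primes_over(2)[OF f])
  finally have B1: "(SUM P:?bad. ad.dm Om P) <= ad.dm Om (ad.smul (cc p n) Om)" .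
  have "pts r <= (pts r Int cpts p) Un ?B" by (auto simp: pts_def cpts_def)
  hence "card (pts r) <= card ((pts r Int cpts p) Un ?B)"
   using finite_pts(1)[OF r0] finite_bad_pts[OF p(1)] by (intro card_mono) auto
  also have "... <= card (pts r Int cpts p) + card ?B" by (rule card_Un_le)
  finally have B2: "card (pts r) <= card (pts r Int cpts p) + card ?B" .
  have B3: "card (pts r Int cpts p) <= card (pts r)" using finite_pts(1)[OF r0] by (intro card_mono) auto
  have "\<bar>real (ad.npts r) - real (card (pts r))\<bar> <= ?b" using N B1 B2 B3 by linarith
  moreover have "1 <= sqrt (real CARD('a)) ^ r" using finite_field_card_gt_1[where 'a = 'a] by (intro one_le_power) simp
  hence "real ?b <= real ?b * sqrt (real CARD('a)) ^ r" using mult_left_mono[of 1 "sqrt (real CARD('a)) ^ r" "real ?b"] by simp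
  ultimately show ?thesis using C[OF r] unfolding distrib_right by linarith
 qed
 thus ?thesis by blast
qed

lemma degree_one_decomposition:
 assumes P: "ad.maxi P" "ad.dm Om P = 1" and u: "u : Om" shows "EX c. u - emb c : P"
proof -
 let ?S = "ad.adj P 1"
 have ss: "ad.subspace P" "ad.subspace ?S" using ad.maxi_ss[OF P(1)] ad.ss_adj by blast+
 have sub: "P <= ?S" "?S <= Om" using ad.adj_upper[of P] ad.adj_least[OF ad.Om_ss ad.maxi_Om[OF P(1)] Om_1] by blast+
 note fin = ad.lattice_fin[OF ad.fr_lat[OF ad.maxi_fr[OF P(1)]] ad.Om_lat ad.maxi_Om[OF P(1)]]
 have "ad.dm Om P = ad.dm Om ?S + ad.dm ?S P" by (rule ad.dm_tower[OF ss sub ad.Om_ss fin])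
 moreover have "ad.dm ?S P = 1" by (rule ad.dm_adj[OF ss(1) ad.maxi_1[OF P(1)]])
 ultimately have "ad.dm Om ?S = 0" using P(2) by simp
 moreover have "ad.fin Om ?S" using ad.fin_tower(1)[OF ss sub ad.Om_ss] fin by blast
 ultimately have "Om = ?S" by (rule ad.dm_eq_0D[OF ad.Om_ss ss(2) sub(2), rotated])
 hence "u : ?S" using u by blast
 then obtain s c where "s : P" "u = s + emb c * 1" unfolding ad.adj_def by blast
 thus ?thesis by (intro exI[of _ c]) simp
qed

lemma rr_point:
 assumes P: "ad.maxi P" and a: "rr [:[:0, 1:] - [:a:]:] : P" and b: "rr [:- [:b:], 1:] : P"
 shows "rr (g - [:[:poly (poly g [:b:]) a:]:]) : P"
proof -
 obtain k where k: "g - [:poly g [:b:]:] = [:- [:b:], 1:] * k"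
  using poly_eq_0_iff_dvd[of "g - [:poly g [:b:]:]" "[:b:]"] by auto
 obtain l where l: "poly g [:b:] - [:poly (poly g [:b:]) a:] = [:- a, 1:] * l"
  using poly_eq_0_iff_dvd[of "poly g [:b:] - [:poly (poly g [:b:]) a:]" a] by auto
 have "[:[:- a, 1:] * l:] = [:[:- a, 1:]:] * [:l:]" by simp
 hence e: "g - [:[:poly (poly g [:b:]) a:]:] = k * [:- [:b:], 1:] + [:l:] * [:[:0, 1:] - [:a:]:]"
 proof -
  have "g - [:[:poly (poly g [:b:]) a:]:] = (g - [:poly g [:b:]:]) + [:poly g [:b:] - [:poly (poly g [:b:]) a:]:]" by simp
  also have "... = [:- [:b:], 1:] * k + [:[:- a, 1:]:] * [:l:]" unfolding k l by simp
  finally show ?thesis by simp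
 qed
 have "rr k * rr [:- [:b:], 1:] : P" "rr [:l:] * rr [:[:0, 1:] - [:a:]:] : P"
  using ad.maxi_mult[OF P rr_Om] a b by blast+
 thus ?thesis unfolding e rr_simps using ad.ss_add[OF ad.maxi_ss[OF P]] by blast
qed

text \<open>At infinity the prime contains \<open>cc 1 1\<close>. Elsewhere the residues of x and y
  are constants a and b in F_q, giving a rational zero of \<open>h\<close>; it lies on the diagonal,
  so x - y is in the prime.\<close>

lemma degree_one_primes:
 assumes diag: "!!a b. poly (poly h [:b:]) a = 0 ==> a = b"
  and P: "ad.maxi P" "ad.dm Om P = 1"
 shows "cc 1 1 : P \<or> rr [:[:0, 1:], - 1:] + pair 0 1 : P"
proof (cases "rr 1 : P")
 case True
 have "cc 1 1 = rr 1 + pair 0 (to_ac (Tn 1))" by (auto simp: cc_def)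
 thus ?thesis using ad.ss_add[OF ad.maxi_ss[OF P(1)] True infinite_prime[OF P(1) True]] by simp
next
 case False
 have rconst: "rr [:[:c:]:] = rr 1 * emb c" for c
  by (auto simp: emb_def to_ac_const_rho)
 have pt: "EX c. rr (g - [:[:c:]:]) : P" for g
 proof -
  obtain c where c: "rr g - emb c : P" using degree_one_decomposition[OF P rr_Om] by blast
  have "rr 1 * (rr g - emb c) : P" by (rule ad.maxi_mult[OF P(1) rr_Om c])
  moreover have "rr 1 * (rr g - emb c) = rr (g - [:[:c:]:])" unfolding rr_simps(2) rconst by auto
  ultimately show ?thesis by auto
 qed
 obtain a b where ab: "rr ([:[:0, 1:]:] - [:[:a:]:]) : P" "rr ([:0, 1:] - [:[:b:]:]) : P" using pt by blast
 have a': "rr [:[:0, 1:] - [:a:]:] : P" "rr [:- [:b:], 1:] : P" using ab by simp_all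
 have "poly (poly h [:b:]) a = 0"
 proof (rule ccontr)
  let ?c = "poly (poly h [:b:]) a"
  assume n: "?c ~= 0"
  have "rr (h - [:[:?c:]:]) : P" by (rule rr_point[OF P(1) a'])
  moreover have "rr h = 0" using rho_dvd[of h] by auto
  ultimately have "- rr [:[:?c:]:] : P" by (simp only: rr_simps diff_0)
  hence "rr [:[:- inverse ?c:]:] * - rr [:[:?c:]:] : P" by (rule ad.maxi_mult[OF P(1) rr_Om])
  moreover have "rr [:[:- inverse ?c:]:] * - rr [:[:?c:]:] = rr 1"
  proof -
   have "[:[:- inverse ?c:]:] * [:[:?c:]:] = (- 1 :: 'a poly poly)" using n by (simp add: one_pCons)
   hence "rr [:[:- inverse ?c:]:] * rr [:[:?c:]:] = rr (- 1)" by (simp only: rr_simps(3)[symmetric])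
   moreover have "rr (- 1) = - rr 1" by (auto simp: rho.h_minus)
   ultimately show ?thesis by simp
  qed
  ultimately show False using False by metis
 qed
 hence [simp]: "a = b" by (rule diag)
 have "[:[:0, 1:], - 1:] = [:[:0, 1:] - [:a:]:] - [:- [:b:], 1:]" by simp
 hence "rr [:[:0, 1:], - 1:] = rr [:[:0, 1:] - [:a:]:] - rr [:- [:b:], 1:]" by (simp only: rr_simps(2))
 hence "rr [:[:0, 1:], - 1:] : P" using ad.ss_diff[OF ad.maxi_ss[OF P(1)] a'] by metis
 moreover have "pair 0 1 : P" using finite_prime[OF P(1) False] Ri_pair[OF Ri_closed(5)] by blast
 ultimately show ?thesis using ad.ss_add[OF ad.maxi_ss[OF P(1)]] by blast
qed

text \<open>The function x - y has its zeros counted by its poles. The element \<open>D\<close> has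
  components x - y and 1, while \<open>?V\<close> has components 1 and (x - y)/x; their product is
  \<open>cc 1 1\<close> times the function x - y, which has degree zero by the product formula. Both
  factors being integral, the codimension of \<open>D\<close> is at most that of
  \<open>cc 1 1\<close>, hence at most \<open>d\<close>.\<close>

lemma dm_diagonal:
 assumes nd: "~ h dvd [:[:0, 1:], - 1:]"
 defines "D == rr [:[:0, 1:], - 1:] + pair 0 1"
 shows "ad.fr (ad.smul D Om)" "ad.smul D Om <= Om" "ad.dm Om (ad.smul D Om) <= d"
proof -
 let ?w = "rho [:[:0, 1:], - 1:]"
 let ?v = "to_ac (Tn 1) * ?w"
 have w0: "?w ~= 0" using nd rho_0_iff by blast
 have wF: "?w : FF" "inverse ?w : FF" using rho_FF FF_inverse by blast+
 have D: "D = pair ?w 1" by (auto simp: D_def)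
 have DE: "D : EE" "pair (inverse ?w) 1 : EE" "D * pair (inverse ?w) 1 = 1"
  using wF FF_1 w0 by (auto simp: D EE_def)
 show f: "ad.fr (ad.smul D Om)" by (rule ad.fr_smul[OF ad.fr_Om DE])
 have DO: "D : Om" unfolding D_def using ad.ss_add[OF ad.Om_ss rr_Om Ri_pair[OF Ri_closed(5)]] .
 show sub: "ad.smul D Om <= Om" using ad.Om_mult[OF DO] by (auto simp: ad.smul_def)
 have vRi: "?v : Ri"
 proof -
  have "?w = ply (map_poly px [:[:0, 1:], - 1:])" by (simp add: rho_def)
  also have "map_poly px [:[:0, 1:], - 1:] = [:fls_X_inv, - 1:]" by (simp add: px.mp_pCons px_X px.h_minus)
  finally have "?v = ply (smult (Tn 1) [:fls_X_inv, - 1:])" by (simp only: ply_smult)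
  also have "... : Ri" unfolding Ri_def
  proof (rule gr_AA[OF adm_inft])
   have X: "fls_X_inv : (ratf :: 'a fls set)" using ratf_px[of "[:0, 1:]"] by (simp only: px_X)
   have "coeff (smult (Tn 1) [:fls_X_inv, - 1:]) j : tS inft (Tn 1) j" for j
   proof -
    consider "j = 0" | "j = 1" | "j >= 2" by linarith
    thus ?thesis
    proof cases
     case 1
     thus ?thesis using ratf_simps(4)[OF Tn_ratf X] by (simp add: tS_inft Tn_nth)
    next
     case 2
     thus ?thesis using ratf_simps(5)[OF Tn_ratf] by (simp add: tS_inft Tn_nth1)
    next
     case 3
     then obtain j' where "j = Suc (Suc j')" by (metis One_nat_def Suc_1 Suc_le_D Suc_le_mono)
     thus ?thesis using ratf_simps(2) by (simp add: tS_inft)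
    qed
   qed
   thus "gr inft (Tn 1) (smult (Tn 1) [:fls_X_inv, - 1:])" by (simp add: gr_def)
  qed
  finally show ?thesis .
 qed
 let ?z = "(%_. inverse ?w) :: bool => 'a fls alg_closure"
 let ?z' = "(%_. ?w) :: bool => 'a fls alg_closure"
 have zD: "?z : Dl" "?z' : Dl" "?z * ?z' = 1" using wF w0 by (auto simp: Dl_def)
 let ?V = "pair 1 ?v"
 have Tn0: "to_ac (Tn 1) ~= (0 :: 'a fls alg_closure)" by simp
 have V: "?V = cc 1 1 * ?z' * pair (inverse ?w) 1" using w0 by (auto simp: cc_def)
 have VO: "?V : Om" using ad.ss_add[OF ad.Om_ss rr_Om[of 1] Ri_pair[OF vRi]]
 proof -
  have "rr 1 + pair 0 ?v = ?V" by auto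
  thus ?thesis using ad.ss_add[OF ad.Om_ss rr_Om[of 1] Ri_pair[OF vRi]] by simp
 qed
 have vE: "?V : EE" "pair 1 (inverse ?v) : EE" "?V * pair 1 (inverse ?v) = 1"
 proof -
  have "?v : FF" using Ri_FF[OF vRi] .
  moreover have "?v ~= 0" using w0 by simp
  ultimately show "?V : EE" "pair 1 (inverse ?v) : EE" "?V * pair 1 (inverse ?v) = 1"
   using FF_1 FF_inverse[of ?v] by (auto simp: EE_def simp del: inverse_mult_distrib)
 qed
 have c1: "cc 1 1 : Dn" by (rule cc_in_Dn) simp
 have fV: "ad.fr (ad.smul ?V Om)" by (rule ad.fr_smul[OF ad.fr_Om vE])
 have VleOm: "ad.smul ?V Om <= Om" using ad.Om_mult[OF VO] by (auto simp: ad.smul_def)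
 have "ad.dg (ad.smul D (ad.smul ?V Om)) = ad.dg (ad.smul D Om) + ad.dg (ad.smul ?V Om)"
  by (rule ad.dg_smul[OF DE fV])
 moreover have "ad.smul D (ad.smul ?V Om) = ad.smul ?z' (ad.smul (cc 1 1) Om)"
 proof -
  have "D * ?V = ?z' * cc 1 1" by (auto simp: D cc_def)
  thus ?thesis by (simp only: ad.smul_smul)
 qed
 moreover have "ad.dg (ad.smul ?z' (ad.smul (cc 1 1) Om)) = ad.dg (ad.smul (cc 1 1) Om)"
  by (rule ad.dg_smul_Dl[OF zD(2,1) _ ad.Dn_ideal(1)[OF c1]]) (use zD(3) in \<open>simp add: mult.commute\<close>)
 moreover have "ad.dg (ad.smul (cc 1 1) Om) = - int (ad.dm Om (ad.smul (cc 1 1) Om))"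
  by (rule ad.dg_ideal[OF ad.Dn_ideal[OF c1]])
 moreover have "ad.dg (ad.smul ?V Om) = - int (ad.dm Om (ad.smul ?V Om))" by (rule ad.dg_ideal[OF fV VleOm])
 moreover have "ad.dg (ad.smul D Om) = - int (ad.dm Om (ad.smul D Om))" by (rule ad.dg_ideal[OF f sub])
 moreover have "ad.dm Om (ad.smul (cc 1 1) Om) <= d" using dm_cc_Om[of 1 1] by simp
 ultimately show "ad.dm Om (ad.smul D Om) <= d" by simp
qed

lemma npts_1_le:
 assumes diag: "!!a b. poly (poly h [:b:]) a = 0 ==> a = b" and nd: "~ h dvd [:[:0, 1:], - 1:]"
 shows "ad.npts 1 <= 2 * d"
proof -
 let ?D = "rr [:[:0, 1:], - 1:] + pair 0 1"
 let ?A = "{P. ad.maxi P & ad.smul (cc 1 1) Om <= P}"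
 let ?B = "{P. ad.maxi P & ad.smul ?D Om <= P}"
 have c1: "cc 1 1 : Dn" by (rule cc_in_Dn) simp
 note fA = ad.Dn_ideal[OF c1] and fB = dm_diagonal(1,2)[OF nd]
 note A = primes_over[OF fA] and B = primes_over[OF fB]
 have sub: "ad.primes_dvd 1 <= ?A Un ?B"
 proof
  fix P assume "P : ad.primes_dvd 1"
  hence P: "ad.maxi P" "ad.dm Om P = 1" by (auto simp: ad.primes_dvd_def)
  show "P : ?A Un ?B" using degree_one_primes[OF diag P] smul_Om_le_iff[OF ad.maxi_Om[OF P(1)] ad.maxi_fr[OF P(1)]] P(1) by blast
 qed
 have "ad.npts 1 <= (SUM P:?A Un ?B. ad.dm Om P)" unfolding ad.npts_def using A(1) B(1) by (intro sum_mono2 sub) auto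
 also have "... <= (SUM P:?A. ad.dm Om P) + (SUM P:?B. ad.dm Om P)" using sum.union_inter[OF A(1) B(1), of "ad.dm Om"] by linarith
 also have "... <= d + d" using A(2) B(2) dm_cc_Om[of 1 1] dm_diagonal(3)[OF nd] by simp
 finally show ?thesis by simp
qed

lemma curve_bound:
 assumes diag: "!!a b. poly (poly h [:b:]) a = 0 ==> a = b" and nd: "~ h dvd [:[:0, 1:], - 1:]"
 shows "real CARD('a) + 1 <= real ((d - 1) * (d - 2)) * (of_int \<lfloor>2 * sqrt (real CARD('a))\<rfloor> / 2) + 2 * real d"
proof -
 obtain C where C: "!!r. r >= 1 ==> \<bar>real (ad.npts r) - real CARD('a) ^ r\<bar> <= C * sqrt (real CARD('a)) ^ r" using npts_estimate by blast
 let ?m = "of_int \<lfloor>2 * sqrt (real CARD('a))\<rfloor> :: real"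
 have m: "?m >= 0" by simp
 have "real CARD('a) + 1 - real ad.g * ?m <= real (ad.npts 1)" by (rule ad.hasse_weil_serre[OF C])
 moreover have "real (ad.npts 1) <= 2 * real d" using npts_1_le[OF diag nd] by linarith
 moreover have "real (2 * ad.g) <= real ((d - 1) * (d - 2))" using genus_le by (simp only: of_nat_le_iff)
 hence "real (2 * ad.g) * (?m / 2) <= real ((d - 1) * (d - 2)) * (?m / 2)" by (rule mult_right_mono) simp
 moreover have "real (2 * ad.g) * (?m / 2) = real ad.g * ?m" by simp
 ultimately show ?thesis by linarith
qed

end

theorem (in plane_curve) plane_curve_bound:
 assumes "!!a b. poly (poly h [:b:]) a = 0 ==> a = b" and "~ h dvd [:[:0, 1:], - 1:]"
 shows "real CARD('a) + 1 <= real ((d - 1) * (d - 2)) * (of_int \<lfloor>2 * sqrt (real CARD('a))\<rfloor> / 2) + 2 * real d"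
proof -
 obtain Om where "ad.max_order Om" using max_order_exists by blast
 then interpret curve_order h d Om by unfold_locales
 show ?thesis by (rule curve_bound[OF assms])
qed

section \<open>Factors of f(X) - f(Y)\<close>

text \<open>For the order by total degree and then by Y-degree, the leading monomial of a product is
  the product of the leading monomials.\<close>

lemma coeff_mult_extremal:
 fixes u v :: "'b::idom poly poly"
 assumes u: "!!i j. coeff (coeff u j) i ~= 0 ==> i + j < a0 + b0 \<or> i + j = a0 + b0 & j <= b0"
  and v: "!!i j. coeff (coeff v j) i ~= 0 ==> i + j < a1 + b1 \<or> i + j = a1 + b1 & j <= b1"
 shows "coeff (coeff (u * v) (b0 + b1)) (a0 + a1) = coeff (coeff u b0) a0 * coeff (coeff v b1) a1"
proof -
 let ?f = "%j i. coeff (coeff u j) i * coeff (coeff v (b0 + b1 - j)) (a0 + a1 - i)"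
 have z: "?f j i = 0" if "j <= b0 + b1" "i <= a0 + a1" "(j, i) ~= (b0, a0)" for j i
 proof (rule ccontr)
  assume "?f j i ~= 0"
  hence "coeff (coeff u j) i ~= 0" "coeff (coeff v (b0 + b1 - j)) (a0 + a1 - i) ~= 0" by auto
  from u[OF this(1)] v[OF this(2)] show False using that by auto
 qed
 have "coeff (coeff (u * v) (b0 + b1)) (a0 + a1) = (SUM j<=b0 + b1. SUM i<=a0 + a1. ?f j i)"
  by (simp add: coeff_mult coeff_sum)
 also have "... = (SUM j<=b0 + b1. if j = b0 then ?f b0 a0 else 0)"
 proof (rule sum.cong[OF refl])
  fix j assume j: "j : {..b0 + b1}"
  have "(SUM i<=a0 + a1. ?f j i) = (SUM i<=a0 + a1. if i = a0 & j = b0 then ?f b0 a0 else 0)"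
   using z j by (intro sum.cong) auto
  thus "(SUM i<=a0 + a1. ?f j i) = (if j = b0 then ?f b0 a0 else 0)" by simp
 qed
 also have "... = coeff (coeff u b0) a0 * coeff (coeff v b1) a1" by simp
 finally show ?thesis .
qed

lemma extremal_exists:
 fixes u :: "'b::idom poly poly"
 assumes "u ~= 0"
 obtains a b where "coeff (coeff u b) a ~= 0" "!!i j. coeff (coeff u j) i ~= 0 ==> i + j < a + b \<or> i + j = a + b & j <= b"
proof -
 obtain s where s: "tdle u s" using tdle_exists by blast
 let ?S = "{(i, j). coeff (coeff u j) i ~= 0}"
 have sub: "?S <= {..s} \<times> {..s}"
 proof clarify
  fix i j assume "coeff (coeff u j) i ~= 0"
  hence "i + j <= s" using tdleD[OF s] by (meson not_less)
  thus "i : {..s} & j : {..s}" by simp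
 qed
 have fin: "finite ?S" by (rule finite_subset[OF sub]) simp
 have "coeff u (degree u) ~= 0" using assms by simp
 hence "coeff (coeff u (degree u)) (degree (coeff u (degree u))) ~= 0" by simp
 hence ne: "?S ~= {}" by blast
 \<comment> \<open>This weight encodes the lexicographic order of (i + j, j), as j is at most
   \<open>s\<close>.\<close>
 define w where "w = (%(i, j). (i + j) * Suc s + j)"
 have "Max (w ` ?S) : w ` ?S" using fin ne by (intro Max_in) auto
 then obtain a b where ab: "(a, b) : ?S" "w (a, b) = Max (w ` ?S)" by auto
 have "i + j < a + b \<or> i + j = a + b & j <= b" if "coeff (coeff u j) i ~= 0" for i j
 proof -
  have "(i, j) : ?S" using that by simp
  hence "w (i, j) <= w (a, b)" unfolding ab(2) using fin by (intro Max_ge imageI) auto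
  hence le: "(i + j) * Suc s + j <= (a + b) * Suc s + b" by (simp add: w_def)
  have bs: "b <= s" using ab(1) sub by blast
  have "~ a + b < i + j"
  proof
   assume "a + b < i + j"
   hence "Suc (a + b) * Suc s <= (i + j) * Suc s" by (intro mult_le_mono1) simp
   hence "(a + b) * Suc s + Suc s <= (i + j) * Suc s" by simp
   thus False using le bs by linarith
  qed
  thus ?thesis using le by (cases "i + j = a + b") auto
 qed
 thus thesis using that ab(1) by blast
qed

text \<open>Leading coefficients in Y multiply to a constant, so both are constant, and the total
  degree of \<open>v\<close> is at least its Y-degree. Total degrees add up, which leaves at most
  \<open>degree u\<close> for \<open>u\<close>.\<close>

lemma tdle_factor:
 fixes u v :: "'b::idom poly poly"
 assumes w: "tdle (u * v) n" "degree (u * v) = n" and c: "lead_coeff (u * v) = [:c:]" "c ~= 0"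
 shows "tdle u (degree u)" "degree (lead_coeff u) = 0"
proof -
 have nz: "u ~= 0" "v ~= 0" using c by auto
 obtain a0 b0 where a: "coeff (coeff u b0) a0 ~= 0" "!!i j. coeff (coeff u j) i ~= 0 ==> i + j < a0 + b0 \<or> i + j = a0 + b0 & j <= b0"
  using extremal_exists[OF nz(1)] by metis
 obtain a1 b1 where b: "coeff (coeff v b1) a1 ~= 0" "!!i j. coeff (coeff v j) i ~= 0 ==> i + j < a1 + b1 \<or> i + j = a1 + b1 & j <= b1"
  using extremal_exists[OF nz(2)] by metis
 have "coeff (coeff (u * v) (b0 + b1)) (a0 + a1) ~= 0" using coeff_mult_extremal[of u a0 b0 v a1 b1] a b by simp
 hence le: "(a0 + a1) + (b0 + b1) <= n" using tdleD[OF w(1)] by (meson not_less)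
 have dn: "degree u + degree v = n" using w(2) degree_mult_eq[OF nz] by simp
 have lc: "lead_coeff u * lead_coeff v = [:c:]" using c(1) by (simp add: lead_coeff_mult)
 hence "degree (lead_coeff u) + degree (lead_coeff v) = 0" using nz degree_mult_eq[of "lead_coeff u" "lead_coeff v"] by simp
 thus d0: "degree (lead_coeff u) = 0" by simp
 have d0': "degree (lead_coeff v) = 0" using \<open>degree (lead_coeff u) + degree (lead_coeff v) = 0\<close> by simp
 have "coeff (lead_coeff v) 0 ~= 0" using d0' nz by (metis leading_coeff_0_iff)
 hence "degree v <= a1 + b1" using b(2)[of "degree v" 0] by auto
 hence "a0 + b0 <= degree u" using le dn by linarith
 thus "tdle u (degree u)" unfolding tdle_def
 proof (intro allI impI)
  fix i j assume "degree u < i + j"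
  thus "coeff (coeff u j) i = 0" using a(2)[of j i] \<open>a0 + b0 \<le> degree u\<close> by (metis leD less_imp_le less_le_trans)
 qed
qed

lemma monic_dvd_eq:
 fixes u v :: "'b::idom poly"
 assumes "u dvd v" "lead_coeff u = 1" "lead_coeff v = 1" "degree v <= degree u" shows "u = v"
proof -
 obtain r where r: "v = u * r" using assms(1) by auto
 have nz: "u ~= 0" "r ~= 0" using assms(2,3) r by auto
 have "degree r = 0" using assms(4) degree_mult_eq[OF nz] unfolding r by simp
 moreover have "lead_coeff r = 1" using assms(2,3) unfolding r by (simp add: lead_coeff_mult)
 ultimately have "r = 1" by (metis degree_0_id one_pCons)
 thus ?thesis using r by simp
qed

section \<open>The polynomial f(X) - f(Y) and its prime factors\<close>

definition diffp :: "'b::comm_ring_1 poly => 'b poly poly" where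
 "diffp p = [:p:] - map_poly (%c. [:c:]) p"

lemma crhom_const: "crhom (%c::'b::comm_ring_1. [:c:])"
 by unfold_locales (simp_all add: one_pCons)

lemma coeff_diffp: "coeff (diffp p) j = (if j = 0 then p - [:coeff p 0:] else - [:coeff p j:])"
 by (cases j) (simp_all add: diffp_def coeff_map_poly)

lemma ev2_diffp: "ev2 (diffp p) x y = poly p x - poly p y"
proof -
 have "map_poly (%c. poly c x) (map_poly (%c. [:c:]) p) = p" by (simp add: map_poly_map_poly o_def)
 thus ?thesis by (simp add: diffp_def) (simp add: ev2_def)
qed

lemma diffp_props:
 fixes p :: "'b::idom poly"
 assumes "degree p = n" "n > 0"
 shows "degree (diffp p) = n" "lead_coeff (diffp p) = [:- lead_coeff p:]" "tdle (diffp p) n"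
proof -
 have nz: "coeff p n ~= 0" using assms by auto
 show d: "degree (diffp p) = n"
  using assms nz by (intro antisym degree_le le_degree) (auto simp: coeff_diffp coeff_eq_0)
 show "lead_coeff (diffp p) = [:- lead_coeff p:]" unfolding d using assms by (simp add: coeff_diffp)
 show "tdle (diffp p) n" unfolding tdle_def
  using assms by (auto simp: coeff_diffp coeff_eq_0 coeff_pCons split: nat.split)
qed

lemma pderiv_diffp: "pderiv (diffp p) = - map_poly (%c. [:c:]) (pderiv (p :: 'b::idom poly))"
 unfolding diffp_def pderiv_diff map_poly_pderiv[OF crhom_const] by simp

lemma map_poly_const_eval: "poly (poly (map_poly (%c. [:c:]) p) [:y:]) x = poly (p :: 'b::comm_ring_1 poly) y"
 using crhom.mp_eval[OF crhom_const, of p y] by simp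

lemma ev2_poly: "ev2 g x y = poly (poly g [:y:]) x"
proof (induction g)
 case (pCons c g)
 thus ?case by simp
qed simp

abbreviation "diag == [:[:0, - 1:], 1:]"

lemma diag_dvd: "diag dvd g \<longleftrightarrow> poly g [:0, 1::'b::idom:] = 0"
 using poly_eq_0_iff_dvd[of g "[:0, 1:]"] by simp

lemma prime_diag: "prime_elem (diag :: 'b::field poly poly)"
proof (rule prime_elemI)
 show "~ is_unit (diag :: 'b poly poly)" by (auto simp: is_unit_poly_iff)
 show "(diag :: 'b poly poly) dvd a \<or> diag dvd b" if "diag dvd a * b" for a b
  using that unfolding diag_dvd by simp
qed simp

lemma monic_prime_factor:
 fixes w u :: "'b::field poly poly"
 assumes w: "tdle w n" "degree w = n" "lead_coeff w = [:c:]" "c ~= 0" and u: "u dvd w" "prime_elem u"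
 shows "EX v. prime_elem v & u dvd v & v dvd w & lead_coeff v = 1 & tdle v (degree v) & degree v > 0"
proof -
 obtain k where k: "w = u * k" using u(1) by auto
 note f = tdle_factor[OF w(1-4)[unfolded k]]
 obtain e where e: "lead_coeff u = [:e:]" using f(2) by (metis degree_eq_zeroE)
 have e0: "e ~= 0" using e u(2) by auto
 have unit: "is_unit [:[:inverse e:]:]" using e0 by (simp add: is_unit_const_poly_iff dvd_field_iff)
 let ?v = "[:[:inverse e:]:] * u"
 have "prime_elem ?v" using u(2) prime_elem_mult_unit_left[OF unit] by blast
 moreover have "lead_coeff ?v = 1" using e e0 by simp
 moreover have "degree ?v = degree u" using e0 by simp
 moreover have "tdle ?v (degree u)" using tdle_smult[OF f(1), of "inverse e"] by simp
 moreover have "?v dvd w" using u(1) mult_unit_dvd_iff'[OF unit] by blast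
 moreover have "degree u > 0"
 proof (rule ccontr)
  assume "~ degree u > 0"
  hence "u = [:[:e:]:]" using e by (metis degree_0_id gr0I)
  hence "is_unit u" using e0 by (simp add: is_unit_const_poly_iff dvd_field_iff)
  thus False using u(2) by auto
 qed
 ultimately show ?thesis by (intro exI[of _ ?v]) (simp del: mult_pCons_left)
qed

section \<open>Frobenius conjugates of factors\<close>

definition sg :: "nat => 'a::{finite,field} alg_closure poly poly => 'a alg_closure poly poly" where
 "sg m = map_poly (map_poly (%x. x ^ (CARD('a) ^ m)))"

lemma coeff_sg: "coeff (coeff (sg m g) b) a = coeff (coeff g b) a ^ (CARD('a) ^ m)" for g :: "'a::{finite,field} alg_closure poly poly"
 by (simp add: sg_def coeff_map_poly)

lemma ev2_sg: "ev2 (sg m g) (x ^ (CARD('a) ^ m)) (y ^ (CARD('a) ^ m)) = ev2 g x y ^ (CARD('a) ^ m)" for g :: "'a::{finite,field} alg_closure poly poly"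
proof (induction g)
 case (pCons c g)
 have "sg m (pCons c g) = pCons (map_poly (%x. x ^ (CARD('a) ^ m)) c) (sg m g)"
  by (simp add: sg_def map_poly_pCons)
 thus ?case using pCons by (simp add: frob.mp_eval frob.h_add power_mult_distrib)
qed (simp add: sg_def)

lemma sg_props:
 fixes g :: "'a::{finite,field} alg_closure poly poly"
 assumes "lead_coeff g = 1" shows "degree (sg m g) = degree g" "lead_coeff (sg m g) = 1"
proof -
 show d: "degree (sg m g) = degree g" unfolding sg_def
 proof (rule map_poly_degree_eq)
  show "map_poly (%x. x ^ (CARD('a) ^ m)) (lead_coeff g) ~= 0" unfolding assms by simp
 qed
 show "lead_coeff (sg m g) = 1" unfolding d using assms by (simp add: sg_def coeff_map_poly)
qed

lemma sg_fixed:
 fixes g :: "'a::{finite,field} alg_closure poly poly"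
 assumes "sg 1 g = g" shows "EX h. g = lift h"
proof -
 have "EX p. coeff g b = map_poly to_ac p" for b
 proof (rule frob_fixed_poly)
  show "map_poly (%x. x ^ CARD('a)) (coeff g b) = coeff g b"
   using arg_cong[OF assms, of "%g. coeff g b"] by (simp add: sg_def coeff_map_poly)
 qed
 then obtain p where p: "!!b. coeff g b = map_poly to_ac (p b)" by metis
 have "g = lift (SUM b<=degree g. monom (p b) b)"
 proof (rule poly_eqI)
  fix b
  have "map_poly to_ac (p b) = (0 :: 'a alg_closure poly) ==> p b = 0" by (simp add: map_poly_eq_0_iff)
  thus "coeff g b = coeff (lift (SUM b<=degree g. monom (p b) b)) b"
   using p[of b] coeff_eq_0[of g b] by (cases "b <= degree g") (auto simp: coeff_map_poly coeff_sum)
 qed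
 thus ?thesis by blast
qed

text \<open>With \<open>g\<close> the minimal polynomial of a generator t of \<open>kf m\<close>,
  evaluation at t embeds the residues into \<open>kf m\<close> and turns composition with
  \<open>f\<close> modulo \<open>g\<close> into application of \<open>f\<close>. Injectivity carries
  over, and the set of residues is finite.\<close>

lemma perm_poly_extI:
 fixes f :: "'a::{finite,field} poly"
 assumes m: "m > 0" and inj: "inj_on (poly (map_poly to_ac f)) (kf m)"
 shows "perm_poly_ext f m"
proof -
 obtain t :: "'a alg_closure" where t: "t : kf m" "!!j. 0 < j ==> j < m ==> t ~: kf j" using kf_generator[OF m] by blast
 obtain g :: "'a poly" where g: "degree g = m" "lead_coeff g = 1" "map_poly to_ac g = (PROD i<m. [:- (t ^ (CARD('a) ^ i)), 1:])"
  using min_poly_exists[OF m t] by blast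
 have gt: "poly (map_poly to_ac g) t = 0" unfolding g(3) using m by (auto simp: poly_prod intro!: bexI[of _ 0])
 have small: "p = 0" if "degree p < m" "poly (map_poly to_ac p) t = 0" for p :: "'a poly"
  using min_poly_dvd[of m t p] t(2) that by fastforce
 have irr: "irreducible g"
 proof (rule irreducibleI)
  show "g ~= 0" using g(1) m by auto
  show "~ is_unit g" using g(1) m by (auto simp: is_unit_poly_iff)
  fix a b assume ab: "g = a * b"
  have nz: "a ~= 0" "b ~= 0" using ab g(2) by auto
  have d: "degree a + degree b = m" using g(1) degree_mult_eq[OF nz] ab by simp
  have "poly (map_poly to_ac a) t = 0 \<or> poly (map_poly to_ac b) t = 0" using gt unfolding ab by (simp add: to_ac.mp_mult)
  hence "~ degree a < m \<or> ~ degree b < m" using small nz by blast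
  hence "degree a = 0 \<or> degree b = 0" using d by linarith
  thus "is_unit a \<or> is_unit b" using nz by (auto simp: is_unit_iff_degree)
 qed
 have kfp: "poly (map_poly to_ac p) t : kf m" for p :: "'a poly"
 proof -
  have "ev2 (lift [:p:]) t 0 ^ (CARD('a) ^ m) = ev2 (lift [:p:]) t 0"
   using ev2_lift_frob[of "[:p:]" t m 0] t(1) by (simp add: kf_def)
  thus ?thesis by (simp add: kf_def mac.mp_pCons)
 qed
 have g0: "g ~= 0" using g(1) m by auto
 have ev: "poly (map_poly to_ac (pcompose f p mod g)) t = poly (map_poly to_ac f) (poly (map_poly to_ac p) t)" for p
 proof -
  have "pcompose f p = g * (pcompose f p div g) + pcompose f p mod g" by simp
  hence "map_poly to_ac (pcompose f p) = map_poly to_ac g * map_poly to_ac (pcompose f p div g) + map_poly to_ac (pcompose f p mod g)"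
   by (metis to_ac.mp_add to_ac.mp_mult)
  hence "poly (map_poly to_ac (pcompose f p mod g)) t = poly (map_poly to_ac (pcompose f p)) t" using gt by simp
  also have "... = poly (map_poly to_ac f) (poly (map_poly to_ac p) t)" by (simp add: to_ac.mp_pcompose poly_pcompose)
  finally show ?thesis .
 qed
 let ?D = "{p :: 'a poly. degree p < m}"
 let ?F = "%p. pcompose f p mod g"
 have fin: "finite ?D" by (rule finite_subset[OF _ finite_degree_le[of m]]) auto
 have injF: "inj_on ?F ?D"
 proof (rule inj_onI)
  fix p p' assume p: "p : ?D" "p' : ?D" "?F p = ?F p'"
  have "poly (map_poly to_ac f) (poly (map_poly to_ac p) t) = poly (map_poly to_ac f) (poly (map_poly to_ac p') t)"
   using ev[of p] ev[of p'] p(3) by simp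
  hence "poly (map_poly to_ac p) t = poly (map_poly to_ac p') t" using inj_onD[OF inj _ kfp kfp] by blast
  hence "poly (map_poly to_ac (p - p')) t = 0" by (simp add: to_ac.mp_diff)
  moreover have "degree (p - p') < m" using p by (intro degree_diff_less) auto
  ultimately show "p = p'" using small[of "p - p'"] by simp
 qed
 have "degree (?F p) < m" for p using degree_mod_less[OF g0, of "pcompose f p"] g(1) m by auto
 hence "?F ` ?D <= ?D" by blast
 hence "bij_betw ?F ?D ?D" using injF fin by (simp add: bij_betw_def endo_inj_surj)
 thus ?thesis unfolding perm_poly_ext_def using irr g by blast
qed

text \<open>
 If no conjugation-invariant factor other than the diagonal occurs, all off-diagonal solutions over
 extension fields lie in finitely many points, which are avoided by infinitely many extensions.
\<close>

lemma injective_or_curve: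
 fixes f :: "'a::{finite,field} poly"
 assumes pp: "inj (poly f)" and deg: "degree f = n" "n > 0" and sep: "pderiv f ~= 0"
 shows "infinite {m. m > 0 & inj_on (poly (map_poly to_ac f)) (kf m)} \<or>
  (EX (h :: 'a poly poly) d. plane_curve h d & d < n & (ALL a b. poly (poly h [:b:]) a = 0 --> a = b) & ~ h dvd [:[:0, 1:], - 1:])"
proof -
 let ?f = "map_poly to_ac f :: 'a alg_closure poly"
 let ?W = "diffp ?f"
 have degF: "degree ?f = n" using deg by (simp add: degree_map_poly)
 note W = diffp_props[OF degF deg(2)]
 have c0: "- lead_coeff ?f ~= 0" using degF deg(2) by auto
 have Wnz: "?W ~= 0" using W(1) deg(2) by auto
 let ?M = "{v. prime_elem v & v dvd ?W & lead_coeff v = 1 & tdle v (degree v) & degree v > 0}"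
 show ?thesis
 proof (cases "EX v:?M. v ~= diag & sg 1 v = v")
  case True
  then obtain v where v: "prime_elem v" "v dvd ?W" "lead_coeff v = 1" "tdle v (degree v)" "degree v > 0" "v ~= diag" "sg 1 v = v" by blast
  obtain h where h: "v = lift h" using sg_fixed[OF v(7)] by blast
  obtain k where k: "?W = v * k" using v(2) by auto
  have knz: "k ~= 0" using Wnz k by auto
  have vnz: "v ~= 0" using v(1) by auto
  have ndv: "~ diag dvd v"
  proof
   assume dv: "diag dvd v"
   then obtain r where r: "v = diag * r" by auto
   have "~ v dvd r"
   proof
    assume "v dvd r"
    moreover have "r ~= 0" using r vnz by auto
    ultimately have "degree v <= degree r" by (rule dvd_imp_degree_le)
    moreover have "degree v = 1 + degree r" unfolding r using \<open>r \<noteq> 0\<close> by (subst degree_mult_eq) auto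
    ultimately show False by simp
   qed
   hence "v dvd diag" using prime_elem_dvd_multD[OF v(1), of diag r] r by simp
   hence "v = diag" using v(3,5) by (intro monic_dvd_eq) auto
   thus False using v(6) by simp
  qed
  have "diag dvd ?W"
  proof -
   have "poly ?W [:0, 1:] = 0"
   proof (rule ccontr)
    assume "poly ?W [:0, 1:] ~= 0"
    moreover have "poly (poly ?W [:0, 1:]) x = 0" for x
    proof -
     have "poly (poly g [:0, 1:]) x = ev2 g x x" for g :: "'a alg_closure poly poly"
      by (induction g) simp_all
     thus ?thesis by (simp add: ev2_diffp)
    qed
    ultimately show False using infinite_alg_closure poly_roots_finite by (metis (mono_tags, lifting) UNIV_eq_I mem_Collect_eq)
   qed
   thus ?thesis by (simp add: diag_dvd)
  qed
  \<comment> \<open>The diagonal divides f(X) - f(Y) but not \<open>v\<close>, so it divides the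
    cofactor; this is why the degree of the curve is strictly less than \<open>n\<close>.\<close>
  hence "diag dvd k" using prime_elem_dvd_multD[OF prime_diag, of v k] ndv k by simp
  hence "degree (diag :: 'a alg_closure poly poly) <= degree k" by (rule dvd_imp_degree_le[OF _ knz])
  hence dk: "degree k >= 1" by simp
  have dn: "degree v < n" using W(1) dk degree_mult_eq[OF vnz knz] unfolding k by simp
  have hs: "degree h = degree v" "lead_coeff h = 1" "tdle h (degree v)"
  proof -
   show dh: "degree h = degree v" by (simp add: h degree_lift)
   show "lead_coeff h = 1"
   proof -
    have "lift [:lead_coeff h:] = lift 1" using v(3) dh by (simp add: h coeff_map_poly mac.mp_pCons)
    thus ?thesis unfolding lift_eq_iff by (simp add: one_pCons)
   qed
   show "tdle h (degree v)" using v(4) by (simp add: h tdle_lift)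
  qed
  \<comment> \<open>Otherwise every zero (x, y) of \<open>v\<close> would have y a critical point of
    \<open>f\<close>, so that f(x) would be one of finitely many critical values for every
    x.\<close>
  have "pderiv h ~= 0"
  proof
   assume "pderiv h = 0"
   hence pv: "pderiv v = 0" using lift_pderiv[of h] by (simp add: h)
   have root: "poly (pderiv ?f) y = 0" if "ev2 v x y = 0" for x y
   proof -
    have "pderiv ?W = v * pderiv k" unfolding k by (simp add: pderiv_mult pv)
    hence "ev2 (pderiv ?W) x y = 0" using that by simp
    moreover have "ev2 (pderiv ?W) x y = - poly (pderiv ?f) y" unfolding pderiv_diffp by (simp add: ev2_poly map_poly_const_eval)
    ultimately show ?thesis by simp
   qed
   have pf: "pderiv ?f ~= 0"
   proof -
    have "pderiv ?f = map_poly to_ac (pderiv f)" using map_poly_pderiv[OF crhom_to_ac] by metis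
    thus ?thesis using sep by (simp add: map_poly_eq_0_iff)
   qed
   let ?R = "{y. poly (pderiv ?f) y = 0}"
   have finR: "finite ?R" by (rule poly_roots_finite[OF pf])
   have "EX y:?R. poly ?f x = poly ?f y" for x
   proof -
    have lc: "coeff (map_poly (%c. poly c x) v) (degree v) = 1" using v(3) by (simp add: coeff_map_poly)
    hence "degree (map_poly (%c. poly c x) v) >= degree v" by (intro le_degree) simp
    then obtain y where y: "poly (map_poly (%c. poly c x) v) y = 0" using alg_closed_exists_root v(5) by (metis less_le_trans)
    hence e: "ev2 v x y = 0" by (simp add: ev2_def)
    have "ev2 ?W x y = 0" unfolding k using e by simp
    thus ?thesis using root[OF e] by (auto simp: ev2_diffp)
   qed
   hence "UNIV <= (UN y:?R. {x. poly (?f - [:poly ?f y:]) x = 0})" by auto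
   moreover have "finite (UN y:?R. {x. poly (?f - [:poly ?f y:]) x = 0})"
   proof (intro finite_UN_I finR poly_roots_finite)
    fix y show "?f - [:poly ?f y:] ~= 0"
    proof
     assume "?f - [:poly ?f y:] = 0"
     hence "degree ?f = degree [:poly ?f y:]" by simp
     thus False using degF deg(2) by simp
    qed
   qed
   ultimately show False using infinite_alg_closure by (metis finite_subset)
  qed
  hence pc: "plane_curve h (degree v)"
   using v(1,5) hs by unfold_locales (simp_all add: h)
  have offdiag: "a = b" if "poly (poly h [:b:]) a = 0" for a b
  proof -
   have "ev2 v (to_ac a) (to_ac b) = to_ac (poly (poly h [:b:]) a)"
   proof -
    have "ev2 (lift g) (to_ac a) (to_ac b) = to_ac (poly (poly g [:b:]) a)" for g :: "'a poly poly"
    proof (induction g)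
     case (pCons c g)
     thus ?case by (simp add: mac.mp_pCons to_ac.mp_eval)
    qed simp
    thus ?thesis by (simp add: h)
   qed
   hence "ev2 ?W (to_ac a) (to_ac b) = 0" unfolding k using that by simp
   hence "poly f a = poly f b" by (simp add: ev2_diffp to_ac.mp_eval)
   thus ?thesis using pp by (simp add: inj_def)
  qed
  have nd: "~ h dvd [:[:0, 1:], - 1:]"
  proof
   assume "h dvd [:[:0, 1:], - 1:]"
   then obtain r where "[:[:0, 1:], - 1:] = h * r" by auto
   hence "lift [:[:0, 1:], - 1:] = v * lift r" by (metis h mac.mp_mult)
   hence "v dvd - lift [:[:0, 1:], - 1:]" by (metis dvd_minus_iff dvd_triv_left)
   moreover have "- lift [:[:0, 1:], - 1:] = diag" by (simp add: mac.mp_pCons to_ac.mp_pCons mac.h_minus)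
   ultimately have "v dvd diag" by metis
   hence "v = diag" using v(3,5) by (intro monic_dvd_eq) auto
   thus False using v(6) by simp
  qed
  have "ALL a b. poly (poly h [:b:]) a = 0 --> a = b" using offdiag by blast
  hence "plane_curve h (degree v) & degree v < n & (ALL a b. poly (poly h [:b:]) a = 0 --> a = b) & ~ h dvd [:[:0, 1:], - 1:]"
   using pc dn nd by simp
  thus ?thesis by blast
 next
  case False
  obtain A where A: "!!v. v \<in># A ==> prime v" "normalize (prod_mset A) = normalize ?W"
   using prime_factorization_exists'[OF Wnz] by blast
  have dvdA: "prod_mset A dvd ?W" "?W dvd prod_mset A" using A(2) by (metis associatedD1, metis associatedD2)
  have ex: "EX v. v : ?M & u dvd v" if u: "u \<in># A" for u
  proof -
   have "prime_elem u" using A(1)[OF u] by simp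
   moreover have "u dvd ?W" using u dvdA(1) by (meson dvd_prod_mset dvd_trans)
   ultimately show ?thesis using monic_prime_factor[OF W(3,1,2) c0] by blast
  qed
  define mon where "mon u = (SOME v. v : ?M & u dvd v)" for u
  have mon: "mon u : ?M & u dvd mon u" if "u \<in># A" for u
   unfolding mon_def by (rule someI_ex[OF ex[OF that]])
  define N where "N = {v : mon ` set_mset A. v ~= diag}"
  have finN: "finite N" by (simp add: N_def)
  have NM: "v : ?M" "v ~= diag" "sg 1 v ~= v" if v: "v : N" for v
  proof -
   obtain u where u: "u \<in># A" "v = mon u" using v by (auto simp: N_def)
   show M: "v : ?M" using mon[OF u(1)] u(2) by simp
   show d: "v ~= diag" using v by (simp add: N_def)
   show "sg 1 v ~= v" using False M d by blast
  qed
  have zero: "EX v:N. ev2 v x y = 0" if "x ~= y" "poly ?f x = poly ?f y" for x y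
  proof -
   have "ev2 ?W x y = 0" using that(2) by (simp add: ev2_diffp)
   hence "ev2 (prod_mset A) x y = 0" using dvdA(2) ev2_dvd by blast
   moreover have "ev2 (prod_mset B) x y = (\<Prod>v\<in>#B. ev2 v x y)" for B by (induction B) simp_all
   ultimately obtain u where u: "u \<in># A" "ev2 u x y = 0" by auto
   hence "ev2 (mon u) x y = 0" using mon ev2_dvd by blast
   moreover have "mon u ~= diag" using calculation that(1) by auto
   ultimately show ?thesis using u(1) by (auto simp: N_def)
  qed
  \<comment> \<open>Each factor in \<open>N\<close> differs from its conjugate, and both are monic
    of the same degree with \<open>v\<close> prime, so they meet in finitely many points.\<close>
  define Z where "Z = (UN v:N. {(x, y). ev2 v x y = 0 & ev2 (sg 1 v) x y = 0})"
  have finZ: "finite Z" unfolding Z_def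
  proof (intro finite_UN_I finN finite_common_zeros)
   fix v assume v: "v : N"
   show "prime_elem v" "0 < degree v" "lead_coeff v = 1" using NM(1)[OF v] by auto
   show "~ v dvd sg 1 v"
   proof
    assume "v dvd sg 1 v"
    hence "v = sg 1 v" using NM(1)[OF v] sg_props[of v 1] by (intro monic_dvd_eq) auto
    thus False using NM(3)[OF v] by simp
   qed
  qed
  obtain t where t: "t > 0" "fst ` Z Un snd ` Z <= kf t" using kf_common[of "fst ` Z Un snd ` Z"] finZ by auto
  define Cs where "Cs = (UN v:N. UN b<=degree v. (%a. coeff (coeff v b) a) ` {..degree (coeff v b)})"
  have "finite Cs" unfolding Cs_def using finN by auto
  then obtain s where s: "s > 0" "Cs <= kf s" using kf_common[of Cs] by blast
  have coefs: "coeff (coeff v b) a : kf s" if v: "v : N" for v a b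
  proof (cases "b <= degree v & a <= degree (coeff v b)")
   case True
   hence "coeff (coeff v b) a : Cs" using v unfolding Cs_def by blast
   thus ?thesis using s(2) by blast
  next
   case F: False
   hence "coeff (coeff v b) a = 0" by (auto simp: coeff_eq_0)
   thus ?thesis by simp
  qed
  \<comment> \<open>Modulo s this exponent is 1, so on the coefficients of the factors the Frobenius
    power acts as Frobenius itself; modulo t it is 1 as well, so points of \<open>Z\<close> over
    this field are already rational over F_q, where \<open>f\<close> is injective.\<close>
  have inj: "inj_on (poly ?f) (kf (s * t * j + 1))" for j
  proof (rule inj_onI, rule ccontr)
   let ?m = "s * t * j + 1"
   fix x y assume xy: "x : kf ?m" "y : kf ?m" "poly ?f x = poly ?f y" "x ~= y"
   obtain v where v: "v : N" "ev2 v x y = 0" using zero xy by blast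
   have "sg ?m v = sg 1 v"
   proof (intro poly_eqI)
    fix b a
    have "coeff (coeff v b) a : kf (s * (t * j))" by (rule kf_mult[OF coefs[OF v(1)]])
    hence e: "coeff (coeff v b) a ^ (CARD('a) ^ (s * t * j)) = coeff (coeff v b) a" by (simp add: kf_def mult.assoc)
    have "coeff (coeff v b) a ^ (CARD('a) ^ ?m) = (coeff (coeff v b) a ^ (CARD('a) ^ (s * t * j))) ^ CARD('a)"
     by (simp add: mult.commute flip: power_mult)
    thus "coeff (coeff (sg ?m v) b) a = coeff (coeff (sg 1 v) b) a" unfolding coeff_sg e by simp
   qed
   moreover have "ev2 (sg ?m v) x y = ev2 v x y ^ (CARD('a) ^ ?m)" using ev2_sg[of ?m v x y] xy(1,2) by (simp add: kf_def)
   ultimately have "ev2 (sg 1 v) x y = 0" using v(2) by simp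
   hence "(x, y) : Z" using v unfolding Z_def by blast
   hence "x : kf t" "y : kf t" using t(2) by force+
   hence "x : kf (t * (s * j))" "y : kf (t * (s * j))" by (auto intro: kf_mult)
   hence "x : kf 1" "y : kf 1" using kf_add_iff[of x "t * (s * j)" 1] kf_add_iff[of y "t * (s * j)" 1] xy(1,2) by (simp_all add: mult_ac)
   then obtain a b where "x = to_ac a" "y = to_ac b" unfolding kf_1 by blast
   hence "poly f a = poly f b" "a ~= b" using xy(3,4) by (auto simp: to_ac.mp_eval)
   thus False using pp by (simp add: inj_def)
  qed
  have "range (%j. s * t * j + 1) <= {m. m > 0 & inj_on (poly ?f) (kf m)}"
   using inj by auto
  moreover have "infinite (range (%j. s * t * j + 1))"
   using s(1) t(1) by (intro range_inj_infinite) (auto simp: inj_def)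
  ultimately show ?thesis using infinite_super by blast
 qed
qed

text \<open>A vanishing derivative leaves only exponents divisible by the characteristic p, and
  every coefficient has a p-th root because the field is finite.\<close>

lemma pth_root:
 fixes f :: "'a::{finite,field} poly"
 assumes "pderiv f = 0" defines "p == CHAR('a)" shows "prime p" "EX g. f = g ^ p & degree f = p * degree g"
proof -
 have "CHAR('a) > 0"
 proof -
  have "of_nat CARD('a) = (0 :: 'a)" using finite_field_binomial_0[of 1, where 'a = 'a] finite_field_card_gt_1[where 'a = 'a] by simp
  thus ?thesis using finite_field_card_gt_1[where 'a = 'a] by (metis CHAR_pos_iff less_trans zero_less_one)
 qed
 thus pr: "prime p" unfolding p_def by (rule prime_CHAR_semidom)
 have p0: "p > 0" using pr by (rule prime_gt_0_nat)
 have fr: "(x + y) ^ p = x ^ p + y ^ p" for x y :: 'a using freshmans_dream[of p x y] pr by (simp add: p_def)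
 have inj: "inj (%x::'a. x ^ p)"
 proof (rule injI)
  fix x y :: 'a assume e: "x ^ p = y ^ p"
  have "((x - y) + y) ^ p = (x - y) ^ p + y ^ p" by (rule fr)
  hence "(x - y) ^ p = 0" using e by simp
  thus "x = y" by simp
 qed
 hence "surj (%x::'a. x ^ p)" using finite_UNIV_inj_surj[of "%x::'a. x ^ p"] by simp
 then obtain rt where rt: "!!x. (rt x :: 'a) ^ p = x" by (metis surjD)
 have z: "coeff f i = 0" if i: "~ p dvd i" for i
 proof -
  obtain k where k: "i = Suc k" using i by (cases i) auto
  have "coeff (pderiv f) k = 0" using assms(1) by simp
  hence "of_nat i * coeff f i = 0" unfolding k by (simp only: coeff_pderiv)
  moreover have "of_nat i ~= (0 :: 'a)" using i by (simp add: of_nat_eq_0_iff_char_dvd p_def)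
  ultimately show ?thesis by simp
 qed
 define N where "N = degree f div p"
 define g where "g = (SUM i<=N. monom (rt (coeff f (p * i))) i)"
 have dpN: "degree f = p * N"
 proof (cases "f = 0")
  case False
  have "p dvd degree f" using z[of "degree f"] False by auto
  thus ?thesis by (simp add: N_def)
 qed (simp add: N_def)
 have "g ^ p = (SUM i<=N. monom (rt (coeff f (p * i))) i ^ p)"
  unfolding g_def by (rule freshmans_dream_sum) (use pr in \<open>simp_all add: p_def\<close>)
 also have "... = (SUM i<=N. monom (coeff f (p * i)) (p * i))" by (simp add: monom_power rt mult.commute)
 also have "... = (SUM j:(%i. p * i) ` {..N}. monom (coeff f j) j)"
  using p0 by (subst sum.reindex) (auto simp: inj_on_def)
 also have "... = (SUM j<=p * N. monom (coeff f j) j)"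
 proof (rule sum.mono_neutral_left)
  show "ALL i:{..p * N} - (%i. p * i) ` {..N}. monom (coeff f i) i = 0"
  proof
   fix i assume i: "i : {..p * N} - (%i. p * i) ` {..N}"
   have "~ p dvd i"
   proof
    assume "p dvd i"
    then obtain k where "i = p * k" by auto
    thus False using i by auto
   qed
   thus "monom (coeff f i) i = 0" using z by simp
  qed
 qed (use p0 in auto)
 also have "... = f" using poly_as_sum_of_monoms[of f] by (simp add: dpN)
 finally have fg: "f = g ^ p" by simp
 have "degree f = p * degree g" unfolding fg by (cases "g = 0") (use p0 in \<open>simp_all add: degree_power_eq zero_power\<close>)
 thus "EX g. f = g ^ p & degree f = p * degree g" using fg by blast
qed

text \<open>If the derivative vanishes, f is a p-th power of some g. Taking p-th powers is
  injective, so injectivity of f on F_q passes to g and injectivity of g on an extension passes back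
  to f; a curve found for g has even smaller degree.\<close>

lemma injective_or_curve':
 fixes f :: "'a::{finite,field} poly"
 assumes "inj (poly f)" "degree f = n" "n > 0"
 shows "infinite {m. m > 0 & inj_on (poly (map_poly to_ac f)) (kf m)} \<or>
  (EX (h :: 'a poly poly) d. plane_curve h d & d < n & (ALL a b. poly (poly h [:b:]) a = 0 --> a = b) & ~ h dvd [:[:0, 1:], - 1:])"
 using assms
proof (induction n arbitrary: f rule: less_induct)
 case (less n)
 show ?case
 proof (cases "pderiv f = 0")
  case True
  let ?p = "CHAR('a)"
  note pr = pth_root(1)[OF True]
  obtain g where g: "f = g ^ ?p" "degree f = ?p * degree g" using pth_root(2)[OF True] by blast
  have p1: "?p > 1" using pr prime_gt_1_nat by blast
  have dg: "degree g < n" "degree g > 0" using g(2) less.prems p1 by auto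
  have injg: "inj (poly g)" using less.prems(1) unfolding g(1) by (auto simp: inj_def)
  have sub: "inj_on (poly (map_poly to_ac f)) (kf m)" if i: "inj_on (poly (map_poly to_ac g)) (kf m)" for m
  proof (rule inj_onI)
   fix x y assume xy: "x : kf m" "y : kf m" "poly (map_poly to_ac f) x = poly (map_poly to_ac f) y"
   let ?a = "poly (map_poly to_ac g) x" and ?b = "poly (map_poly to_ac g) y"
   have "?a ^ ?p = ?b ^ ?p" using xy(3) unfolding g(1) by (simp add: to_ac.mp_power)
   moreover have "((?a - ?b) + ?b) ^ ?p = (?a - ?b) ^ ?p + ?b ^ ?p"
    by (rule freshmans_dream) (use pr in simp_all)
   ultimately have "(?a - ?b) ^ ?p = 0" by simp
   hence "?a = ?b" by simp
   thus "x = y" using i xy(1,2) by (auto dest: inj_onD)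
  qed
  from less.IH[OF dg(1) injg refl dg(2)] show ?thesis
  proof
   assume "infinite {m. m > 0 & inj_on (poly (map_poly to_ac g)) (kf m)}"
   moreover have "{m. m > 0 & inj_on (poly (map_poly to_ac g)) (kf m)} <= {m. m > 0 & inj_on (poly (map_poly to_ac f)) (kf m)}"
    using sub by blast
   ultimately show ?thesis using infinite_super by blast
  qed (use dg(1) less_trans in blast)
 next
  case False
  thus ?thesis using injective_or_curve less.prems by blast
 qed
qed

text \<open>The hypothesis makes s = sqrt q satisfy s^2 <= A s + (B - 1), and completing the square
  bounds s by the larger root of the quadratic.\<close>

lemma quadratic_sqrt_bound:
 fixes q A B m :: real
 assumes q: "q >= 0" and A: "A >= 0" and m: "m <= 2 * sqrt q" and h: "q + 1 <= A * (m / 2) + B"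
 shows "q <= ((A + sqrt (A ^ 2 + 4 * (B - 1))) / 2) ^ 2"
proof -
 let ?s = "sqrt q"
 have s: "?s ^ 2 = q" "?s >= 0" using q by simp_all
 have "A * (m / 2) <= A * ?s" using m A by (intro mult_left_mono) auto
 hence 1: "?s ^ 2 <= A * ?s + (B - 1)" using h s by simp
 have "(2 * ?s - A) ^ 2 = 4 * (?s ^ 2 - A * ?s) + A ^ 2" by (simp add: power2_eq_square algebra_simps)
 also have "... <= A ^ 2 + 4 * (B - 1)" using 1 by simp
 finally have "\<bar>2 * ?s - A\<bar> <= sqrt (A ^ 2 + 4 * (B - 1))" by (simp add: real_le_rsqrt)
 hence "?s <= (A + sqrt (A ^ 2 + 4 * (B - 1))) / 2" by simp
 hence "?s ^ 2 <= ((A + sqrt (A ^ 2 + 4 * (B - 1))) / 2) ^ 2" using s(2) by (rule power_mono)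
 thus ?thesis using s(1) by simp
qed

theorem theorem4p1:
  fixes f :: "'a::{finite,field} poly" and n :: nat
  assumes "n > 0" and "degree f = n" and "non_exceptional_pp f"
  shows "real (CARD('a)) + 1 \<le> (real n - 2) * (real n - 3) * (of_int \<lfloor>2 * sqrt (real (CARD('a)))\<rfloor> / 2) + 2 * (real n - 1)
         \<and> real (CARD('a)) \<le> of_int \<lfloor>(((real n - 2) * (real n - 3) + sqrt ((real n - 2)^2 * (real n - 3)^2 + 8 * real n - 12)) / 2)^2\<rfloor>"
proof -
 let ?q = "real CARD('a)"
 let ?m = "of_int \<lfloor>2 * sqrt ?q\<rfloor> :: real"
 let ?A = "(real n - 2) * (real n - 3)"
 have pp: "inj (poly f)" using assms(3) by (simp add: non_exceptional_pp_def perm_poly_def bij_def)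
 have "~ infinite {m. m > 0 & perm_poly_ext f m}" using assms(3) by (auto simp: non_exceptional_pp_def exceptional_def)
 moreover have "{m. m > 0 & inj_on (poly (map_poly to_ac f)) (kf m)} <= {m. m > 0 & perm_poly_ext f m}" using perm_poly_extI by blast
 ultimately have "~ infinite {m. m > 0 & inj_on (poly (map_poly to_ac f)) (kf m)}" using finite_subset by blast
 then obtain h :: "'a poly poly" and d where h: "plane_curve h d" "d < n" "!!a b. poly (poly h [:b:]) a = 0 ==> a = b" "~ h dvd [:[:0, 1:], - 1:]"
  using injective_or_curve'[OF pp assms(2,1)] by blast
 have b: "?q + 1 <= real ((d - 1) * (d - 2)) * (?m / 2) + 2 * real d" by (rule plane_curve.plane_curve_bound[OF h(1,3,4)])
 have n2: "n >= 2" using h(2) plane_curve.d_pos[OF h(1)] by linarith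
 \<comment> \<open>The product is 0 for n = 2 and has two nonnegative factors from n = 3 on.\<close>
 have A0: "?A >= 0"
 proof (cases "n = 2")
  case False
  thus ?thesis using n2 by simp
 qed simp
 \<comment> \<open>For d <= 2 the truncated product is 0; otherwise d <= n - 1 compares the factors
   one by one.\<close>
 have "real ((d - 1) * (d - 2)) <= ?A"
 proof (cases "d <= 2")
  case True
  hence "(d - 1) * (d - 2) = 0" by auto
  hence "real ((d - 1) * (d - 2)) = 0" by simp
  thus ?thesis using A0 by linarith
 next
  case False
  have "real ((d - 1) * (d - 2)) = (real d - 1) * (real d - 2)" using False by simp
  also have "... <= (real n - 2) * (real n - 3)" using False h(2) by (intro mult_mono) auto
  finally show ?thesis .
 qed
 hence "real ((d - 1) * (d - 2)) * (?m / 2) <= ?A * (?m / 2)" by (rule mult_right_mono) simp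
 moreover have "real d <= real n - 1" using h(2) by linarith
 hence "2 * real d <= 2 * (real n - 1)" by simp
 ultimately have 1: "?q + 1 <= ?A * (?m / 2) + 2 * (real n - 1)" by (rule order_trans[OF b add_mono])
 have "?q <= ((?A + sqrt (?A ^ 2 + 4 * (2 * (real n - 1) - 1))) / 2) ^ 2"
  by (rule quadratic_sqrt_bound[OF _ A0 _ 1]) simp_all
 \<comment> \<open>The constant 8 n - 12 is 4 (B - 1) with B = 2 (n - 1). The floor in the
   conclusion costs nothing because q is an integer.\<close>
 also have "?A ^ 2 + 4 * (2 * (real n - 1) - 1) = (real n - 2)^2 * (real n - 3)^2 + 8 * real n - 12"
  by (simp add: power_mult_distrib)
 finally have "int CARD('a) <= \<lfloor>((?A + sqrt ((real n - 2)^2 * (real n - 3)^2 + 8 * real n - 12)) / 2) ^ 2\<rfloor>"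
  by (simp add: le_floor_iff)
 hence "?q <= of_int \<lfloor>((?A + sqrt ((real n - 2)^2 * (real n - 3)^2 + 8 * real n - 12)) / 2) ^ 2\<rfloor>" by linarith
 thus ?thesis using 1 by blast
qed

end
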